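(* Let $\widehat H_{dd}=\{\sigma\in\widetilde H^{-1}\otimes\mathbb S:\operatorname{div}\sigma\in\widetilde H^{-1}\otimes\mathbb V,\ \operatorname{div}\operatorname{div}\sigma\in\widetilde H^{-1}\}$ with norm $\|\sigma\|_{dd}$. There exist continuous linear operators $S^{dd}_0:\widehat H_{dd}\to\mathring H^1\otimes\mathbb S$, $S^{dd}_1:\widehat H_{dd}\to\mathring H^1\otimes\mathbb T$, $S^{dd}_2:\widehat H_{dd}\to\mathring H^1\otimes\mathbb S$ such that every $\sigma\in\widehat H_{dd}$ satisfies \[ \sigma=S^{dd}_0\sigma+\operatorname{sym}\operatorname{curl}S^{dd}_1\sigma+\operatorname{inc}S^{dd}_2\sigma . \] Consequently $\widehat H_{dd}=\widetilde H_{dd}$.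
   Context: $\Omega\subset\mathbb R^3$ is bounded, open, connected and simply connected, with Lipschitz boundary, and $\partial\Omega$ is connected. $\mathbb V=\mathbb R^3$, $\mathbb S$ and $\mathbb T$ are the symmetric and trace-free $3\times3$ real matrices, $\operatorname{sym}\tau=\frac12(\tau+\tau^\top)$; div and curl of matrix fields act row-wise; $\operatorname{inc}g=\operatorname{curl}((\operatorname{curl}g)^\top)$; derivatives are distributional on $\mathbb R^3$. $\mathring H^1$ is the closure of $\mathcal D(\Omega)$ (smooth functions compactly supported in $\Omega$) in $H^1(\Omega)$. $\widetilde H^{-1}=\{u\in H^{-1}(\mathbb R^3):\operatorname{supp}u\subset\overline\Omega\}$ with the $H^{-1}(\mathbb R^3)$ norm (componentwise). $\|\sigma\|_{dd}^2=\|\sigma\|_{\widetilde H^{-1}}^2+\|\operatorname{div}\sigma\|_{\widetilde H^{-1}}^2+\|\operatorname{div}\operatorname{div}\sigma\|_{\widetilde H^{-1}}^2$, and $\widetilde H_{dd}$ is the closure of $\mathcal D(\Omega)\otimes\mathbb S$ (extended by zero) in this norm. *)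

theory Defs
  imports "HOL-Analysis.Analysis"
begin

type_synonym pt = "real^3"
type_synonym fn = "pt \<Rightarrow> real"
(* a distribution on R^3, acting on (smooth compactly supported) test functions *)
type_synonym distr = "fn \<Rightarrow> real"

definition lipschitz_boundary :: "pt set \<Rightarrow> bool" where
  "lipschitz_boundary \<Omega> \<longleftrightarrow>
     (\<forall>x\<in>frontier \<Omega>. \<exists>r>0. \<exists>Q::real^3^3. \<exists>\<gamma>::real\<times>real \<Rightarrow> real. \<exists>L.
        orthogonal_matrix Q \<and> L-lipschitz_on UNIV \<gamma> \<and>
        (\<forall>y\<in>ball x r. y \<in> \<Omega> \<longleftrightarrow> (Q *v y) $ 3 < \<gamma> ((Q *v y) $ 1, (Q *v y) $ 2)))"

definition pd :: "3 \<Rightarrow> fn \<Rightarrow> fn" where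
  "pd i f = (\<lambda>x. frechet_derivative f (at x) (axis i 1))"

definition dpart :: "3 list \<Rightarrow> fn \<Rightarrow> fn" where
  "dpart ks f = fold pd ks f"

definition smooth_fn :: "fn \<Rightarrow> bool" where
  "smooth_fn f \<longleftrightarrow> (\<forall>ks. dpart ks f differentiable_on UNIV)"

definition tsupp :: "fn \<Rightarrow> pt set" where
  "tsupp f = closure {x. f x \<noteq> 0}"

definition test :: "fn \<Rightarrow> bool" where
  "test f \<longleftrightarrow> smooth_fn f \<and> compact (tsupp f)"

(* D(Omega), extended by zero *)
definition test_on :: "pt set \<Rightarrow> fn \<Rightarrow> bool" where
  "test_on \<Omega> f \<longleftrightarrow> test f \<and> tsupp f \<subseteq> \<Omega>"

definition L2 :: "fn \<Rightarrow> bool" where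
  "L2 u \<longleftrightarrow> u \<in> borel_measurable lborel \<and> integrable lborel (\<lambda>x. (u x)\<^sup>2)"

definition l2sq :: "fn \<Rightarrow> real" where
  "l2sq u = integral\<^sup>L lborel (\<lambda>x. (u x)\<^sup>2)"

definition h1t :: "fn \<Rightarrow> real" where
  "h1t \<phi> = sqrt (l2sq \<phi> + (\<Sum>i\<in>UNIV. l2sq (pd i \<phi>)))"

definition weak_pd :: "3 \<Rightarrow> fn \<Rightarrow> fn \<Rightarrow> bool" where
  "weak_pd i u g \<longleftrightarrow> (\<forall>\<phi>. test \<phi> \<longrightarrow>
      integral\<^sup>L lborel (\<lambda>x. u x * pd i \<phi> x) = - integral\<^sup>L lborel (\<lambda>x. g x * \<phi> x))"

definition H1 :: "fn \<Rightarrow> bool" where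
  "H1 u \<longleftrightarrow> L2 u \<and> (\<forall>i. \<exists>g. L2 g \<and> weak_pd i u g)"

definition wgrad :: "3 \<Rightarrow> fn \<Rightarrow> fn" where
  "wgrad i u = (SOME g. L2 g \<and> weak_pd i u g)"

definition h1norm :: "fn \<Rightarrow> real" where
  "h1norm u = sqrt (l2sq u + (\<Sum>i\<in>UNIV. l2sq (wgrad i u)))"

(* \<mathring>H^1(Omega): closure of D(Omega) in H^1, functions extended by zero to R^3 *)
definition H01 :: "pt set \<Rightarrow> fn \<Rightarrow> bool" where
  "H01 \<Omega> u \<longleftrightarrow> H1 u \<and>
     (\<exists>\<phi>::nat \<Rightarrow> fn. (\<forall>n. test_on \<Omega> (\<phi> n)) \<and>
        (\<lambda>n. h1norm (\<lambda>x. u x - \<phi> n x)) \<longlonglongrightarrow> 0)"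

definition hm1_le :: "distr \<Rightarrow> real \<Rightarrow> bool" where
  "hm1_le u C \<longleftrightarrow> (\<forall>\<phi>. test \<phi> \<longrightarrow> \<bar>u \<phi>\<bar> \<le> C * h1t \<phi>)"

definition Hm1 :: "distr \<Rightarrow> bool" where
  "Hm1 u \<longleftrightarrow>
     (\<forall>\<phi> \<psi> a b. test \<phi> \<longrightarrow> test \<psi> \<longrightarrow>
        u (\<lambda>x. a * \<phi> x + b * \<psi> x) = a * u \<phi> + b * u \<psi>) \<and>
     (\<exists>C. hm1_le u C)"

definition hm1norm :: "distr \<Rightarrow> real" where
  "hm1norm u = Inf {C. 0 \<le> C \<and> hm1_le u C}"

definition supp_in :: "distr \<Rightarrow> pt set \<Rightarrow> bool" where
  "supp_in u F \<longleftrightarrow> (\<forall>\<phi>. test \<phi> \<longrightarrow> tsupp \<phi> \<inter> F = {} \<longrightarrow> u \<phi> = 0)"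

definition Htm1 :: "pt set \<Rightarrow> distr \<Rightarrow> bool" where
  "Htm1 \<Omega> u \<longleftrightarrow> Hm1 u \<and> supp_in u (closure \<Omega>)"

definition fdist :: "fn \<Rightarrow> distr" where
  "fdist u = (\<lambda>\<phi>. integral\<^sup>L lborel (\<lambda>x. u x * \<phi> x))"

definition dderiv :: "3 \<Rightarrow> distr \<Rightarrow> distr" where
  "dderiv k u = (\<lambda>\<phi>. - u (pd k \<phi>))"

definition ddiv :: "(3 \<Rightarrow> 3 \<Rightarrow> distr) \<Rightarrow> 3 \<Rightarrow> distr" where
  "ddiv \<sigma> i = (\<lambda>\<phi>. \<Sum>j\<in>UNIV. dderiv j (\<sigma> i j) \<phi>)"

definition ddivdiv :: "(3 \<Rightarrow> 3 \<Rightarrow> distr) \<Rightarrow> distr" where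
  "ddivdiv \<sigma> = (\<lambda>\<phi>. \<Sum>i\<in>UNIV. dderiv i (ddiv \<sigma> i) \<phi>)"

definition levi :: "3 \<Rightarrow> 3 \<Rightarrow> 3 \<Rightarrow> real" where
  "levi i j k =
     (if (i, j, k) \<in> {(1, 2, 3), (2, 3, 1), (3, 1, 2)} then 1
      else if (i, j, k) \<in> {(1, 3, 2), (3, 2, 1), (2, 1, 3)} then -1 else 0)"

definition dcurl :: "(3 \<Rightarrow> 3 \<Rightarrow> distr) \<Rightarrow> 3 \<Rightarrow> 3 \<Rightarrow> distr" where
  "dcurl T i j = (\<lambda>\<phi>. \<Sum>k\<in>UNIV. \<Sum>l\<in>UNIV. levi j k l * dderiv k (T i l) \<phi>)"

definition dtrans :: "(3 \<Rightarrow> 3 \<Rightarrow> distr) \<Rightarrow> 3 \<Rightarrow> 3 \<Rightarrow> distr" where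
  "dtrans T i j = T j i"

definition dsym :: "(3 \<Rightarrow> 3 \<Rightarrow> distr) \<Rightarrow> 3 \<Rightarrow> 3 \<Rightarrow> distr" where
  "dsym T i j = (\<lambda>\<phi>. (T i j \<phi> + T j i \<phi>) / 2)"

definition dinc :: "(3 \<Rightarrow> 3 \<Rightarrow> distr) \<Rightarrow> 3 \<Rightarrow> 3 \<Rightarrow> distr" where
  "dinc g = dcurl (dtrans (dcurl g))"

definition matdist :: "(3 \<Rightarrow> 3 \<Rightarrow> fn) \<Rightarrow> 3 \<Rightarrow> 3 \<Rightarrow> distr" where
  "matdist F i j = fdist (F i j)"

definition Hhat_dd :: "pt set \<Rightarrow> (3 \<Rightarrow> 3 \<Rightarrow> distr) \<Rightarrow> bool" where
  "Hhat_dd \<Omega> \<sigma> \<longleftrightarrow>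
     (\<forall>i j \<phi>. test \<phi> \<longrightarrow> \<sigma> i j \<phi> = \<sigma> j i \<phi>) \<and>
     (\<forall>i j. Htm1 \<Omega> (\<sigma> i j)) \<and> (\<forall>i. Htm1 \<Omega> (ddiv \<sigma> i)) \<and> Htm1 \<Omega> (ddivdiv \<sigma>)"

definition dd_norm :: "(3 \<Rightarrow> 3 \<Rightarrow> distr) \<Rightarrow> real" where
  "dd_norm \<sigma> = sqrt ((\<Sum>i\<in>UNIV. \<Sum>j\<in>UNIV. (hm1norm (\<sigma> i j))\<^sup>2)
                     + (\<Sum>i\<in>UNIV. (hm1norm (ddiv \<sigma> i))\<^sup>2) + (hm1norm (ddivdiv \<sigma>))\<^sup>2)"

(* ||tau||_dd \<le> eps, written without presupposing finiteness of the norms *)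
definition dd_within :: "(3 \<Rightarrow> 3 \<Rightarrow> distr) \<Rightarrow> real \<Rightarrow> bool" where
  "dd_within \<tau> \<epsilon> \<longleftrightarrow> (\<exists>a b c. (\<forall>i j. 0 \<le> a i j \<and> hm1_le (\<tau> i j) (a i j)) \<and>
       (\<forall>i. 0 \<le> b i \<and> hm1_le (ddiv \<tau> i) (b i)) \<and> 0 \<le> c \<and> hm1_le (ddivdiv \<tau>) c \<and>
       (\<Sum>i\<in>UNIV. \<Sum>j\<in>UNIV. (a i j)\<^sup>2) + (\<Sum>i\<in>UNIV. (b i)\<^sup>2) + c\<^sup>2 \<le> \<epsilon>\<^sup>2)"

definition test_sym_on :: "pt set \<Rightarrow> (3 \<Rightarrow> 3 \<Rightarrow> fn) \<Rightarrow> bool" where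
  "test_sym_on \<Omega> \<Phi> \<longleftrightarrow> (\<forall>i j. test_on \<Omega> (\<Phi> i j) \<and> \<Phi> i j = \<Phi> j i)"

(* closure of D(Omega) \<otimes> S in the dd-norm, realised inside distributions on R^3 *)
definition Htilde_dd :: "pt set \<Rightarrow> (3 \<Rightarrow> 3 \<Rightarrow> distr) \<Rightarrow> bool" where
  "Htilde_dd \<Omega> \<sigma> \<longleftrightarrow> (\<forall>\<epsilon>>0. \<exists>\<Phi>. test_sym_on \<Omega> \<Phi> \<and>
       dd_within (\<lambda>i j \<phi>. \<sigma> i j \<phi> - matdist \<Phi> i j \<phi>) \<epsilon>)"

definition mlin :: "real \<Rightarrow> (3 \<Rightarrow> 3 \<Rightarrow> distr) \<Rightarrow> real \<Rightarrow> (3 \<Rightarrow> 3 \<Rightarrow> distr) \<Rightarrow> 3 \<Rightarrow> 3 \<Rightarrow> distr" where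
  "mlin a \<sigma> b \<tau> = (\<lambda>i j \<phi>. a * \<sigma> i j \<phi> + b * \<tau> i j \<phi>)"

definition bdd_lin_op :: "pt set \<Rightarrow> ((3 \<Rightarrow> 3 \<Rightarrow> real) \<Rightarrow> bool)
      \<Rightarrow> ((3 \<Rightarrow> 3 \<Rightarrow> distr) \<Rightarrow> 3 \<Rightarrow> 3 \<Rightarrow> fn) \<Rightarrow> bool" where
  "bdd_lin_op \<Omega> P S \<longleftrightarrow>
     (\<forall>\<sigma>. Hhat_dd \<Omega> \<sigma> \<longrightarrow> (\<forall>i j. H01 \<Omega> (S \<sigma> i j)) \<and>
          (AE x in lborel. P (\<lambda>i j. S \<sigma> i j x))) \<and>
     (\<forall>\<sigma> \<tau> a b. Hhat_dd \<Omega> \<sigma> \<longrightarrow> Hhat_dd \<Omega> \<tau> \<longrightarrow> (\<forall>i j.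
          AE x in lborel. S (mlin a \<sigma> b \<tau>) i j x = a * S \<sigma> i j x + b * S \<tau> i j x)) \<and>
     (\<exists>C. \<forall>\<sigma>. Hhat_dd \<Omega> \<sigma> \<longrightarrow> (\<forall>i j. h1norm (S \<sigma> i j) \<le> C * dd_norm \<sigma>))"

definition is_sym :: "(3 \<Rightarrow> 3 \<Rightarrow> real) \<Rightarrow> bool" where
  "is_sym M \<longleftrightarrow> (\<forall>i j. M i j = M j i)"

definition is_tracefree :: "(3 \<Rightarrow> 3 \<Rightarrow> real) \<Rightarrow> bool" where
  "is_tracefree M \<longleftrightarrow> (\<Sum>i\<in>UNIV. M i i) = 0"

end

theory Submission
  imports Defs
begin

text \<open>
  Near a boundary point a Lipschitz domain is mapped into itself by all small translations in an open cone spanned by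
  three directions \<open>d\<^sub>1, d\<^sub>2, d\<^sub>3\<close>, so convolution with kernels supported in that cone turns distributions
  supported in \<open>closure \<Omega>\<close> into functions supported in \<open>\<Omega>\<close>. There is such a kernel \<open>\<theta>\<close> of integral one with
  \<open>8 \<theta>(2 x) - \<theta>(x) = \<Sum>a. \<partial>\<^sub>a\<^sup>2 \<eta>\<^sub>a\<close>, where \<open>\<partial>\<^sub>a\<close> is the derivative in direction \<open>d\<^sub>a\<close> and
  \<open>\<eta>\<^sub>a\<close> is a test function supported in the cone. Telescoping the mollifications \<open>\<theta>\<^sub>k * \<theta>\<^sub>k * u\<close>,
  where \<open>\<theta>\<^sub>k(x) = 8\<^sup>k \<theta>(2\<^sup>k x)\<close>, gives
  \<open>u = \<theta> * \<theta> * u + \<Sum>a. \<partial>\<^sub>a\<^sup>2 T\<^sub>a u\<close>, and almost orthogonality of the dyadic pieces shows that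
  \<open>T\<^sub>a\<close> maps \<open>H\<^sup>-\<^sup>1\<close> into \<open>H\<^sup>1\<^sub>0\<close>. These operators commute with derivatives. Applied to the entries of a symmetric
  matrix field \<open>\<sigma>\<close>, the algebraic identity
  \<open>\<partial>\<^sub>v\<^sup>2 \<sigma> = v v\<^sup>T div div \<sigma> + 2 sym curl (v (div \<sigma> \<times> v)\<^sup>T) + inc (v \<times> \<sigma> \<times> v)\<close>
  turns this representation into the decomposition. Multiplication by smooth cutoff functions preserves the
  space, so the local decompositions add up to a global one. The mollifications
  themselves converge in the norm of the space, which yields density of test fields.
\<close>

section \<open>Smooth functions and test functions\<close>

text \<open>The operators \<open>T a\<close> have to gain two orders of smoothness, and this is why
  \<open>\<theta>\<close> is convolved twice. The difference of two consecutive squares factors into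
  a kernel \<open>\<Theta>\<close>, the sum of both mollifiers, and a kernel that is a sum of second
  derivatives of the \<open>\<eta> a\<close>. Once these derivatives are pulled out, each factor
  gains one order: convolution with \<open>\<Theta>\<close> maps H^-1 into square summable sequences
  in L2 (\<open>square_function\<close>), and convolution with \<open>\<eta> a\<close> sums such
  sequences back into H^1 (\<open>h1t_dyadic_sum\<close>). The two estimates are dual to each other,
  and neither asks for vanishing moments, since the derivative in the H^1 norm already supplies the
  cancellation. This matters because a kernel living in an open cone cannot be even; its shape is
  dictated by the support condition. Second derivatives, rather than first ones, are extracted
  because the algebraic identity trades them against div div. That trade forces the operators to
  commute with derivatives, so cutoffs must be applied before them and not after.\<close>

lemma pd_eqI: "(f has_derivative f') (at x) \<Longrightarrow> pd i f x = f' (axis i 1)"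
  by (metis frechet_derivative_at pd_def)

lemma dpart_Cons: "dpart (k # ks) f = dpart ks (pd k f)"
  by (simp add: dpart_def)

lemma smooth_fn_differentiable: "smooth_fn f \<Longrightarrow> f differentiable (at x)"
  unfolding smooth_fn_def by (drule spec[of _ "[]"]) (simp add: dpart_def differentiable_on_def)

lemma smooth_fn_pd: "smooth_fn f \<Longrightarrow> smooth_fn (pd i f)"
  unfolding smooth_fn_def by (metis dpart_Cons)

text \<open>Smoothness is the greatest class of differentiable functions closed under
  \<open>pd\<close>, so exhibiting any such class replaces an induction over lists of
  derivatives.\<close>

lemma smooth_fn_coinduct:
  assumes "P f" and d: "\<And>f x. P f \<Longrightarrow> f differentiable (at x)" and p: "\<And>f i. P f \<Longrightarrow> P (pd i f)"
  shows "smooth_fn f"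
proof -
  have "dpart ks f differentiable_on UNIV" if "P f" for ks f
    using that
  proof (induction ks arbitrary: f)
    case Nil
    then show ?case using d by (simp add: dpart_def differentiable_on_def)
  next
    case (Cons k ks)
    then show ?case using p by (simp add: dpart_Cons)
  qed
  then show ?thesis using assms(1) by (simp add: smooth_fn_def)
qed

lemma has_derivative_pd:
  assumes "f differentiable (at x)"
  shows "(f has_derivative (\<lambda>h. \<Sum>i\<in>UNIV. h $ i * pd i f x)) (at x)"
proof -
  let ?D = "frechet_derivative f (at x)"
  have D: "(f has_derivative ?D) (at x)" using assms frechet_derivative_works by blast
  interpret bounded_linear ?D using D has_derivative_bounded_linear by blast
  have "?D h = (\<Sum>i\<in>UNIV. h $ i * pd i f x)" for h
  proof -
    have "?D h = ?D (\<Sum>i\<in>UNIV. (h $ i) *\<^sub>R axis i 1)"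
      using basis_expansion[of h] by (simp add: scalar_mult_eq_scaleR)
    also have "\<dots> = (\<Sum>i\<in>UNIV. h $ i * pd i f x)"
      by (simp add: sum scaleR pd_def)
    finally show ?thesis .
  qed
  then show ?thesis using D by presburger
qed

lemma pd_add_at:
  assumes "f differentiable (at x)" "g differentiable (at x)"
  shows "pd i (\<lambda>x. f x + g x) x = pd i f x + pd i g x"
  by (rule trans, rule pd_eqI, rule has_derivative_add[OF has_derivative_pd[OF assms(1)] has_derivative_pd[OF assms(2)]])
     (simp add: axis_def if_distrib[where f="\<lambda>x. x * _"] cong: if_cong)

lemma pd_mult_at:
  assumes "f differentiable (at x)" "g differentiable (at x)"
  shows "pd i (\<lambda>x. f x * g x) x = pd i f x * g x + f x * pd i g x"
  by (rule trans, rule pd_eqI, rule has_derivative_mult[OF has_derivative_pd[OF assms(1)] has_derivative_pd[OF assms(2)]])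
     (simp add: axis_def if_distrib[where f="\<lambda>x. x * _"] cong: if_cong)

lemma pd_const: "pd i (\<lambda>x. c) = (\<lambda>x. 0)"
  by (rule ext, rule pd_eqI[where f'="\<lambda>h. 0"]) simp

lemma smooth_fn_const: "smooth_fn (\<lambda>x. c)"
  by (rule smooth_fn_coinduct[where P="\<lambda>f. \<exists>c. f = (\<lambda>x. c)"]) (auto simp: pd_const)

text \<open>A derivative of a product is only a sum of products, so the coinduction invariant has to be the whole
  generated algebra.\<close>
inductive smooth_alg :: "fn \<Rightarrow> bool" where
  base: "smooth_fn f \<Longrightarrow> smooth_alg f"
| add: "smooth_alg f \<Longrightarrow> smooth_alg g \<Longrightarrow> smooth_alg (\<lambda>x. f x + g x)"
| mult: "smooth_alg f \<Longrightarrow> smooth_alg g \<Longrightarrow> smooth_alg (\<lambda>x. f x * g x)"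

lemma smooth_alg_imp: "smooth_alg f \<Longrightarrow> smooth_fn f"
proof (rule smooth_fn_coinduct[where P=smooth_alg])
  show d: "f differentiable (at x)" if "smooth_alg f" for f x
    using that by induction (auto simp: smooth_fn_differentiable)
  show "smooth_alg (pd i f)" if "smooth_alg f" for f i
    using that
  proof induction
    case (base f)
    then show ?case by (simp add: smooth_alg.base smooth_fn_pd)
  next
    case (add f g)
    then have "pd i (\<lambda>x. f x + g x) = (\<lambda>x. pd i f x + pd i g x)"
      by (intro ext pd_add_at d)
    then show ?case using add smooth_alg.add by simp
  next
    case (mult f g)
    then have "pd i (\<lambda>x. f x * g x) = (\<lambda>x. pd i f x * g x + f x * pd i g x)"
      by (intro ext pd_mult_at d)
    then show ?case using mult smooth_alg.add smooth_alg.mult by simp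
  qed
qed

lemma smooth_fn_add: "smooth_fn f \<Longrightarrow> smooth_fn g \<Longrightarrow> smooth_fn (\<lambda>x. f x + g x)"
  by (rule smooth_alg_imp[OF smooth_alg.add[OF smooth_alg.base smooth_alg.base]])

lemma smooth_fn_mult: "smooth_fn f \<Longrightarrow> smooth_fn g \<Longrightarrow> smooth_fn (\<lambda>x. f x * g x)"
  by (rule smooth_alg_imp[OF smooth_alg.mult[OF smooth_alg.base smooth_alg.base]])

lemma smooth_fn_cmult: "smooth_fn f \<Longrightarrow> smooth_fn (\<lambda>x. c * f x)"
  by (rule smooth_fn_mult[OF smooth_fn_const])

lemma smooth_fn_diff: "smooth_fn f \<Longrightarrow> smooth_fn g \<Longrightarrow> smooth_fn (\<lambda>x. f x - g x)"
  using smooth_fn_add[OF _ smooth_fn_cmult[of g "-1"]] by simp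

lemma pd_add: "smooth_fn f \<Longrightarrow> smooth_fn g \<Longrightarrow> pd i (\<lambda>x. f x + g x) = (\<lambda>x. pd i f x + pd i g x)"
  by (intro ext pd_add_at smooth_fn_differentiable)

lemma pd_mult: "smooth_fn f \<Longrightarrow> smooth_fn g \<Longrightarrow> pd i (\<lambda>x. f x * g x) = (\<lambda>x. pd i f x * g x + f x * pd i g x)"
  by (intro ext pd_mult_at smooth_fn_differentiable)

lemma pd_cmult: "smooth_fn f \<Longrightarrow> pd i (\<lambda>x. c * f x) = (\<lambda>x. c * pd i f x)"
  by (simp add: pd_mult smooth_fn_const pd_const)

lemma pd_diff: "smooth_fn f \<Longrightarrow> smooth_fn g \<Longrightarrow> pd i (\<lambda>x. f x - g x) = (\<lambda>x. pd i f x - pd i g x)"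
  using pd_add[OF _ smooth_fn_cmult[of g "-1"]] pd_cmult[of g i "-1"] by simp

lemma smooth_fn_sum: "finite A \<Longrightarrow> (\<And>a. a \<in> A \<Longrightarrow> smooth_fn (f a)) \<Longrightarrow> smooth_fn (\<lambda>x. \<Sum>a\<in>A. f a x)"
  by (induction A rule: finite_induct) (auto simp: smooth_fn_const smooth_fn_add)

lemma pd_sum: "finite A \<Longrightarrow> (\<And>a. a \<in> A \<Longrightarrow> smooth_fn (f a)) \<Longrightarrow> pd i (\<lambda>x. \<Sum>a\<in>A. f a x) = (\<lambda>x. \<Sum>a\<in>A. pd i (f a) x)"
  by (induction A rule: finite_induct) (auto simp: pd_const pd_add smooth_fn_sum)

lemma pd_affine:
  assumes "smooth_fn f"
  shows "pd i (\<lambda>x. f (c *\<^sub>R x + v)) = (\<lambda>x. c * pd i f (c *\<^sub>R x + v))"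
proof
  fix x
  have "((\<lambda>x. c *\<^sub>R x + v) has_derivative (\<lambda>h. c *\<^sub>R h)) (at x)"
    by (auto intro!: derivative_eq_intros)
  from has_derivative_compose[OF this has_derivative_pd[OF smooth_fn_differentiable[OF assms]]]
  have "((\<lambda>x. f (c *\<^sub>R x + v)) has_derivative (\<lambda>h. \<Sum>i\<in>UNIV. (c *\<^sub>R h) $ i * pd i f (c *\<^sub>R x + v))) (at x)" .
  from pd_eqI[OF this, of i]
  show "pd i (\<lambda>x. f (c *\<^sub>R x + v)) x = c * pd i f (c *\<^sub>R x + v)"
    by (simp add: axis_def if_distrib[where f="\<lambda>x. x * _"] if_distrib[where f="\<lambda>x. _ * x"] cong: if_cong)
qed

lemma smooth_fn_affine:
  assumes "smooth_fn f"
  shows "smooth_fn (\<lambda>x. f (c *\<^sub>R x + v))"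
\<comment> \<open>The scalar \<open>k\<close> in the invariant absorbs the factor \<open>c\<close>
  that every differentiation produces.\<close>
proof (rule smooth_fn_coinduct[where P="\<lambda>h. \<exists>f k. smooth_fn f \<and> h = (\<lambda>x. k * f (c *\<^sub>R x + v))"])
  show "\<exists>g k. smooth_fn g \<and> (\<lambda>x. f (c *\<^sub>R x + v)) = (\<lambda>x. k * g (c *\<^sub>R x + v))"
    using assms by (intro exI[of _ f] exI[of _ 1]) auto
next
  fix h and x assume "\<exists>f k. smooth_fn f \<and> h = (\<lambda>x. k * f (c *\<^sub>R x + v))"
  then obtain f k where f: "smooth_fn f" and h: "h = (\<lambda>x. k * f (c *\<^sub>R x + v))" by blast
  have "((\<lambda>x. c *\<^sub>R x + v) has_derivative (\<lambda>h. c *\<^sub>R h)) (at x)"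
    by (auto intro!: derivative_eq_intros)
  from has_derivative_compose[OF this has_derivative_pd[OF smooth_fn_differentiable[OF f]]]
  show "h differentiable (at x)" unfolding h
    by (intro differentiable_mult differentiable_const) (auto simp: differentiable_def)
next
  fix h and i assume "\<exists>f k. smooth_fn f \<and> h = (\<lambda>x. k * f (c *\<^sub>R x + v))"
  then obtain f k where f: "smooth_fn f" and h: "h = (\<lambda>x. k * f (c *\<^sub>R x + v))" by blast
  have "smooth_fn (\<lambda>x. c * pd i f x)" by (rule smooth_fn_cmult[OF smooth_fn_pd[OF f]])
  have d: "(\<lambda>x. f (c *\<^sub>R x + v)) differentiable (at x)" for x
  proof -
    have "((\<lambda>x. c *\<^sub>R x + v) has_derivative (\<lambda>h. c *\<^sub>R h)) (at x)"
      by (auto intro!: derivative_eq_intros)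
    from has_derivative_compose[OF this has_derivative_pd[OF smooth_fn_differentiable[OF f]]]
    show ?thesis by (auto simp: differentiable_def)
  qed
  have "pd i h = (\<lambda>x. k * pd i (\<lambda>x. f (c *\<^sub>R x + v)) x)"
    unfolding h using d by (intro ext) (simp add: pd_mult_at pd_const)
  also have "\<dots> = (\<lambda>x. (k * c) * pd i f (c *\<^sub>R x + v))"
    by (simp add: pd_affine[OF f] mult.assoc)
  finally show "\<exists>f k. smooth_fn f \<and> pd i h = (\<lambda>x. k * f (c *\<^sub>R x + v))"
    using smooth_fn_pd[OF f] by blast
qed

text \<open>Functions of one linear coordinate are the bridge from the calculus of one variable to
  R^3: kernels and cutoffs are products of them. The sequence \<open>D\<close> carries all
  derivatives, so differentiation moves along it and picks up a factor \<open>l $ i\<close>.\<close>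

lemma smooth_fn_ridge:
  fixes D :: "nat \<Rightarrow> real \<Rightarrow> real"
  assumes D: "\<And>n x. (D n has_real_derivative D (Suc n) x) (at x)"
  shows "smooth_fn (\<lambda>x. D n (l \<bullet> x))" and "pd i (\<lambda>x. D n (l \<bullet> x)) = (\<lambda>x. l $ i * D (Suc n) (l \<bullet> x))"
proof -
  have der: "((\<lambda>x. D n (l \<bullet> x)) has_derivative (\<lambda>h. (l \<bullet> h) * D (Suc n) (l \<bullet> x))) (at x)" for n and x :: pt
  proof -
    have "((\<lambda>x. l \<bullet> x) has_derivative (\<lambda>h. l \<bullet> h)) (at x)" by (auto intro!: derivative_eq_intros)
    from has_derivative_compose[OF this D[unfolded has_field_derivative_def, of n "l \<bullet> x"]]
    show ?thesis by (simp add: mult.commute)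
  qed
  show pd: "pd i (\<lambda>x. D n (l \<bullet> x)) = (\<lambda>x. l $ i * D (Suc n) (l \<bullet> x))" for n i
    using pd_eqI[OF der] by (simp add: inner_axis fun_eq_iff)
  have dm: "(\<lambda>x. k * D n (l \<bullet> x)) differentiable (at x)" for k n and x :: pt
    using der by (intro differentiable_mult differentiable_const) (auto simp: differentiable_def)
  have p: "pd i (\<lambda>x. k * D n (l \<bullet> x)) = (\<lambda>x. (k * l $ i) * D (Suc n) (l \<bullet> x))" for k n i
  proof
    fix x
    have "pd i (\<lambda>x. k * D n (l \<bullet> x)) x = k * pd i (\<lambda>x. D n (l \<bullet> x)) x"
      using dm[of 1] by (subst pd_mult_at) (auto simp: pd_const)
    then show "pd i (\<lambda>x. k * D n (l \<bullet> x)) x = (k * l $ i) * D (Suc n) (l \<bullet> x)"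
      by (simp add: pd)
  qed
  show "smooth_fn (\<lambda>x. D n (l \<bullet> x))"
  proof (rule smooth_fn_coinduct[where P="\<lambda>f. \<exists>k n. f = (\<lambda>x. k * D n (l \<bullet> x))"])
    show "\<exists>k m. (\<lambda>x. D n (l \<bullet> x)) = (\<lambda>x. k * D m (l \<bullet> x))"
      by (intro exI[of _ 1] exI[of _ n]) simp
  next
    fix f and x :: pt assume "\<exists>k n. f = (\<lambda>x. k * D n (l \<bullet> x))"
    then obtain k n where "f = (\<lambda>x. k * D n (l \<bullet> x))" by blast
    then show "f differentiable (at x)" using dm[of k n x] by simp
  next
    fix f i assume "\<exists>k n. f = (\<lambda>x. k * D n (l \<bullet> x))"
    then obtain k n where "f = (\<lambda>x. k * D n (l \<bullet> x))" by blast
    then show "\<exists>k n. pd i f = (\<lambda>x. k * D n (l \<bullet> x))" using p[of i k n] by metis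
  qed
qed

section \<open>Supports and test functions\<close>

lemma tsupp_subset: "closed S \<Longrightarrow> (\<And>x. f x \<noteq> 0 \<Longrightarrow> x \<in> S) \<Longrightarrow> tsupp f \<subseteq> S"
  unfolding tsupp_def by (rule closure_minimal) auto

lemma tsupp_nonzero: "f x \<noteq> 0 \<Longrightarrow> x \<in> tsupp f"
  unfolding tsupp_def by (rule subsetD[OF closure_subset]) simp

lemma closed_tsupp: "closed (tsupp f)"
  by (simp add: tsupp_def)

lemma compact_tsupp_subset: "compact S \<Longrightarrow> (\<And>x. f x \<noteq> 0 \<Longrightarrow> x \<in> S) \<Longrightarrow> compact (tsupp f)"
  using tsupp_subset[of S f] compact_Int_closed[OF _ closed_tsupp, of S f]
  by (simp add: Int_absorb1 compact_imp_closed)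

lemma pd_nonzero_tsupp: "pd i f x \<noteq> 0 \<Longrightarrow> x \<in> tsupp f"
proof (rule ccontr)
  assume n: "x \<notin> tsupp f" and p: "pd i f x \<noteq> 0"
  have "(f has_derivative (\<lambda>h. 0)) (at x)"
    by (rule has_derivative_transform_within_open[where f="\<lambda>_. 0" and s="- tsupp f"])
       (use n closed_tsupp tsupp_nonzero[of f] in auto)
  from pd_eqI[OF this] p show False by simp
qed

lemma tsupp_pd: "tsupp (pd i f) \<subseteq> tsupp f"
  by (intro tsupp_subset closed_tsupp pd_nonzero_tsupp)

lemma testI: "smooth_fn f \<Longrightarrow> compact S \<Longrightarrow> (\<And>x. f x \<noteq> 0 \<Longrightarrow> x \<in> S) \<Longrightarrow> test f"
  unfolding test_def using compact_tsupp_subset by blast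

lemma test_smooth: "test f \<Longrightarrow> smooth_fn f" and test_compact: "test f \<Longrightarrow> compact (tsupp f)"
  by (auto simp: test_def)

lemma test_zero: "test (\<lambda>x. 0)"
  by (rule testI[where S="{}"]) (auto simp: smooth_fn_const)

lemma test_add: "test f \<Longrightarrow> test g \<Longrightarrow> test (\<lambda>x. f x + g x)"
  by (rule testI[where S="tsupp f \<union> tsupp g"])
     (use tsupp_nonzero[of f] tsupp_nonzero[of g] in \<open>force simp: test_smooth smooth_fn_add test_compact compact_Un\<close>)+

lemma test_mult: "smooth_fn f \<Longrightarrow> test g \<Longrightarrow> test (\<lambda>x. f x * g x)"
  by (rule testI[where S="tsupp g"])
     (auto simp: test_smooth smooth_fn_mult test_compact intro!: tsupp_nonzero)

lemma test_cmult: "test g \<Longrightarrow> test (\<lambda>x. c * g x)"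
  by (rule test_mult[OF smooth_fn_const])

lemma test_diff: "test f \<Longrightarrow> test g \<Longrightarrow> test (\<lambda>x. f x - g x)"
  using test_add[OF _ test_cmult[of g "-1"]] by simp

lemma test_sum: "finite A \<Longrightarrow> (\<And>a. a \<in> A \<Longrightarrow> test (f a)) \<Longrightarrow> test (\<lambda>x. \<Sum>a\<in>A. f a x)"
  by (induction A rule: finite_induct) (auto simp: test_zero test_add)

lemma test_pd: "test f \<Longrightarrow> test (pd i f)"
  by (rule testI[where S="tsupp f"]) (auto simp: test_smooth smooth_fn_pd test_compact pd_nonzero_tsupp)

lemma test_affine:
  assumes "test f" "c \<noteq> 0"
  shows "test (\<lambda>x. f (c *\<^sub>R x + v))"
proof (rule testI[where S="(\<lambda>y. (1/c) *\<^sub>R (y - v)) ` tsupp f"])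
  show "compact ((\<lambda>y. (1/c) *\<^sub>R (y - v)) ` tsupp f)"
    using assms by (intro compact_continuous_image continuous_intros test_compact)
  fix x assume "f (c *\<^sub>R x + v) \<noteq> 0"
  then have "c *\<^sub>R x + v \<in> tsupp f" by (rule tsupp_nonzero)
  moreover have "x = (1/c) *\<^sub>R ((c *\<^sub>R x + v) - v)" using assms by simp
  ultimately show "x \<in> (\<lambda>y. (1/c) *\<^sub>R (y - v)) ` tsupp f" by blast
qed (use assms in \<open>auto intro: smooth_fn_affine test_smooth\<close>)

lemma test_refl: "test f \<Longrightarrow> test (\<lambda>y. f (x - y))"
  using test_affine[of f "-1" x] by (simp add: algebra_simps)

lemma pd_refl: "smooth_fn f \<Longrightarrow> pd i (\<lambda>y. f (x - y)) = (\<lambda>y. - pd i f (x - y))"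
  using pd_affine[of f i "-1" x] by (simp add: algebra_simps)

lemma test_continuous: "test f \<Longrightarrow> continuous_on UNIV f"
  by (simp add: continuous_at_imp_continuous_on differentiable_imp_continuous_within smooth_fn_differentiable test_smooth)

lemma test_bounded: assumes "test f" obtains B where "B \<ge> 0" "\<And>x. \<bar>f x\<bar> \<le> B"
proof -
  have "bounded (f ` tsupp f)"
    using assms continuous_on_subset[OF test_continuous] by (intro compact_imp_bounded compact_continuous_image test_compact) auto
  then obtain B where B: "\<And>x. x \<in> tsupp f \<Longrightarrow> \<bar>f x\<bar> \<le> B"
    by (auto simp: bounded_iff)
  have "\<bar>f x\<bar> \<le> max B 0" for x
    using B[of x] tsupp_nonzero[of f x] by (cases "f x = 0") auto
  then show thesis using that[of "max B 0"] by simp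
qed

section \<open>The \<open>L\<^sup>2\<close> and \<open>H\<^sup>1\<close> norms of test functions\<close>

lemma L2_borel: "L2 f \<Longrightarrow> f \<in> borel_measurable lborel" and L2_sq: "L2 f \<Longrightarrow> integrable lborel (\<lambda>x. (f x)\<^sup>2)"
  by (auto simp: L2_def)

lemma L2_mult_integrable:
  assumes "L2 f" "L2 g" shows "integrable lborel (\<lambda>x. f x * g x)"
proof (rule Bochner_Integration.integrable_bound[where f="\<lambda>x. (f x)\<^sup>2 + (g x)\<^sup>2"])
  show "integrable lborel (\<lambda>x. (f x)\<^sup>2 + (g x)\<^sup>2)" using assms by (auto simp: L2_def)
  show "(\<lambda>x. f x * g x) \<in> borel_measurable lborel" using assms by (auto simp: L2_def)
  have "\<bar>a * b\<bar> \<le> a\<^sup>2 + b\<^sup>2" for a b :: real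
  proof -
    have "2 * (\<bar>a\<bar> * \<bar>b\<bar>) \<le> a\<^sup>2 + b\<^sup>2" using sum_squares_bound[of "\<bar>a\<bar>" "\<bar>b\<bar>"] by (simp add: mult.assoc)
    moreover have "0 \<le> \<bar>a\<bar> * \<bar>b\<bar>" by simp
    ultimately show ?thesis unfolding abs_mult by linarith
  qed
  then show "AE x in lborel. norm (f x * g x) \<le> norm ((f x)\<^sup>2 + (g x)\<^sup>2)" by auto
qed

lemma L2_lincomb:
  assumes "L2 f" "L2 g" shows "L2 (\<lambda>x. a * f x + b * g x)"
proof -
  have eq: "(a * f x + b * g x)\<^sup>2 = a\<^sup>2 * (f x)\<^sup>2 + b\<^sup>2 * (g x)\<^sup>2 + (2 * a * b) * (f x * g x)" for x
    by (simp add: power2_eq_square algebra_simps)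
  show ?thesis
    using assms L2_mult_integrable[OF assms] unfolding L2_def eq by auto
qed

lemma L2_add: "L2 f \<Longrightarrow> L2 g \<Longrightarrow> L2 (\<lambda>x. f x + g x)" using L2_lincomb[of f g 1 1] by simp
lemma L2_diff: "L2 f \<Longrightarrow> L2 g \<Longrightarrow> L2 (\<lambda>x. f x - g x)" using L2_lincomb[of f g 1 "-1"] by simp
lemma L2_cmult: "L2 f \<Longrightarrow> L2 (\<lambda>x. c * f x)" using L2_lincomb[of f f c 0] by simp
lemma L2_zero: "L2 (\<lambda>x. 0)" by (simp add: L2_def)
lemma L2_sum: "finite A \<Longrightarrow> (\<And>a. a \<in> A \<Longrightarrow> L2 (f a)) \<Longrightarrow> L2 (\<lambda>x. \<Sum>a\<in>A. f a x)"
  by (induction A rule: finite_induct) (auto simp: L2_zero L2_add)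
lemma L2_abs: "L2 f \<Longrightarrow> L2 (\<lambda>x. \<bar>f x\<bar>)" by (auto simp: L2_def)

lemma l2sq_nonneg: "0 \<le> l2sq f" by (simp add: l2sq_def)

lemma l2sq_lincomb:
  assumes "L2 f" "L2 g"
  shows "l2sq (\<lambda>x. a * f x + b * g x) = a\<^sup>2 * l2sq f + 2 * a * b * (\<integral>x. f x * g x \<partial>lborel) + b\<^sup>2 * l2sq g"
proof -
  have eq: "(a * f x + b * g x)\<^sup>2 = a\<^sup>2 * (f x)\<^sup>2 + b\<^sup>2 * (g x)\<^sup>2 + (2 * a * b) * (f x * g x)" for x
    by (simp add: power2_eq_square algebra_simps)
  show ?thesis
    using assms L2_mult_integrable[OF assms] unfolding l2sq_def eq L2_def by simp
qed

definition n2 :: "fn \<Rightarrow> real" where "n2 f = sqrt (l2sq f)"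

lemma n2_nonneg: "0 \<le> n2 f" by (simp add: n2_def l2sq_nonneg)
lemma n2_sq: "(n2 f)\<^sup>2 = l2sq f" by (simp add: n2_def l2sq_nonneg)

lemma L2_Cauchy_Schwarz:
  assumes "L2 f" "L2 g" shows "\<bar>\<integral>x. f x * g x \<partial>lborel\<bar> \<le> n2 f * n2 g"
proof -
  define I A B where "I = (\<integral>x. f x * g x \<partial>lborel)" and "A = l2sq f" and "B = l2sq g"
  have q: "0 \<le> a\<^sup>2 * A + 2 * a * b * I + b\<^sup>2 * B" for a b
    using l2sq_nonneg l2sq_lincomb[OF assms] unfolding I_def A_def B_def by metis
  have AB: "0 \<le> A" "0 \<le> B" by (simp_all add: A_def B_def l2sq_nonneg)
  have "I\<^sup>2 \<le> A * B"
  proof (cases "B = 0")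
    case True
    have "I = 0"
    proof (rule ccontr)
      assume "I \<noteq> 0"
      \<comment> \<open>With \<open>B = 0\<close> the quadratic form is affine in \<open>b\<close>;
        this \<open>b\<close> makes it equal to -1.\<close>
      have "0 \<le> A + 2 * (- (A + 1) / (2 * I)) * I" using q[of 1 "- (A + 1) / (2 * I)"] True by simp
      also have "\<dots> = -1" using \<open>I \<noteq> 0\<close> by (simp add: field_simps)
      finally show False by simp
    qed
    then show ?thesis using True by simp
  next
    case False
    have "0 \<le> B * (A * B - I\<^sup>2)" using q[of B "- I"] by (simp add: power2_eq_square algebra_simps)
    then show ?thesis using False AB by (simp add: zero_le_mult_iff)
  qed
  then have "sqrt (I\<^sup>2) \<le> sqrt (A * B)" by (rule real_sqrt_le_mono)
  then show ?thesis by (simp add: n2_def I_def A_def B_def real_sqrt_mult)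
qed

lemma n2_triangle:
  assumes "L2 f" "L2 g" shows "n2 (\<lambda>x. f x + g x) \<le> n2 f + n2 g"
proof (rule power2_le_imp_le)
  have "(n2 (\<lambda>x. f x + g x))\<^sup>2 = l2sq f + 2 * (\<integral>x. f x * g x \<partial>lborel) + l2sq g"
    using l2sq_lincomb[OF assms, of 1 1] by (simp add: n2_sq)
  also have "\<dots> \<le> (n2 f + n2 g)\<^sup>2"
    using L2_Cauchy_Schwarz[OF assms] by (simp add: power2_sum n2_sq)
  finally show "(n2 (\<lambda>x. f x + g x))\<^sup>2 \<le> (n2 f + n2 g)\<^sup>2" .
qed (simp add: n2_nonneg)

lemma n2_cmult: "n2 (\<lambda>x. c * f x) = \<bar>c\<bar> * n2 f"
  by (simp add: n2_def l2sq_def power_mult_distrib real_sqrt_mult)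

lemma n2_zero: "n2 (\<lambda>x. 0) = 0" by (simp add: n2_def l2sq_def)

lemma n2_sum: "finite A \<Longrightarrow> (\<And>a. a \<in> A \<Longrightarrow> L2 (f a)) \<Longrightarrow> n2 (\<lambda>x. \<Sum>a\<in>A. f a x) \<le> (\<Sum>a\<in>A. n2 (f a))"
proof (induction A rule: finite_induct)
  case (insert a A)
  have "n2 (\<lambda>x. f a x + (\<Sum>a\<in>A. f a x)) \<le> n2 (f a) + n2 (\<lambda>x. \<Sum>a\<in>A. f a x)"
    using insert by (intro n2_triangle L2_sum) auto
  then show ?case using insert by simp
qed (simp add: n2_zero)

lemma n2_cong_AE: "L2 f \<Longrightarrow> g \<in> borel_measurable lborel \<Longrightarrow> AE x in lborel. f x = g x \<Longrightarrow> L2 g \<and> n2 g = n2 f"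
proof -
  assume a: "L2 f" "g \<in> borel_measurable lborel" "AE x in lborel. f x = g x"
  have "AE x in lborel. (f x)\<^sup>2 = (g x)\<^sup>2" using a(3) by auto
  moreover have [measurable]: "f \<in> borel_measurable lborel" "g \<in> borel_measurable lborel" using a by (auto simp: L2_def)
  ultimately have "integrable lborel (\<lambda>x. (f x)\<^sup>2) \<longleftrightarrow> integrable lborel (\<lambda>x. (g x)\<^sup>2)" "l2sq f = l2sq g"
    unfolding l2sq_def by (intro integrable_cong_AE integral_cong_AE; measurable)+
  then show "L2 g \<and> n2 g = n2 f" using a unfolding L2_def n2_def by presburger
qed

lemma cc_integrable:
  fixes f :: fn
  assumes "continuous_on UNIV f" "compact K" "\<And>x. f x \<noteq> 0 \<Longrightarrow> x \<in> K"
  shows "integrable lborel f"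
proof -
  have "integrable lborel (\<lambda>x. indicator K x *\<^sub>R f x)"
    by (rule borel_integrable_compact[OF assms(2) continuous_on_subset[OF assms(1) subset_UNIV]])
  moreover have "(\<lambda>x. indicator K x *\<^sub>R f x) = f"
    using assms(3) by (auto simp: indicator_def fun_eq_iff)
  ultimately show ?thesis by simp
qed

lemma test_integrable: "test f \<Longrightarrow> integrable lborel f"
  by (rule cc_integrable[OF test_continuous test_compact tsupp_nonzero])

lemma test_borel: "test f \<Longrightarrow> f \<in> borel_measurable borel"
  by (rule borel_measurable_continuous_onI[OF test_continuous])

lemma test_L2: "test f \<Longrightarrow> L2 f"
  unfolding L2_def power2_eq_square
  using test_borel[of f] test_integrable[OF test_mult[OF test_smooth], of f f] by simp

lemma lborel_integral_affine:
  fixes f :: fn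
  assumes [measurable]: "f \<in> borel_measurable borel" and c: "c \<noteq> (0::real)"
  shows "(\<integral>x. f (c *\<^sub>R x + t) \<partial>lborel) = (\<integral>x. f x \<partial>lborel) / \<bar>c\<bar> ^ 3"
proof -
  have DIM: "DIM(pt) = 3" by simp
  have "(\<integral>x. f x \<partial>lborel) = (\<integral>x. f x \<partial>density (distr lborel borel (\<lambda>x. t + c *\<^sub>R x)) (\<lambda>_. ennreal (\<bar>c\<bar> ^ 3)))"
    using lborel_affine[OF c, of t] unfolding DIM by simp
  also have "\<dots> = \<bar>c\<bar> ^ 3 * (\<integral>x. f (c *\<^sub>R x + t) \<partial>lborel)"
    by (subst integral_density) (auto simp: integral_distr add.commute eval_nat_numeral)
  finally show ?thesis using c by (simp add: field_simps)
qed

lemma lborel_integral_refl: "f \<in> borel_measurable borel \<Longrightarrow> (\<integral>y. f (x - y) \<partial>lborel) = (\<integral>y. (f::fn) y \<partial>lborel)"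
  using lborel_integral_affine[of f "-1" x] by (simp add: algebra_simps)

lemma lborel_integral_shift: "f \<in> borel_measurable borel \<Longrightarrow> (\<integral>y. f (y + x) \<partial>lborel) = (\<integral>y. (f::fn) y \<partial>lborel)"
  using lborel_integral_affine[of f 1 x] by simp

lemma n2_refl: "test f \<Longrightarrow> n2 (\<lambda>y. f (x - y)) = n2 f"
  unfolding n2_def l2sq_def using lborel_integral_refl[of "\<lambda>y. (f y)\<^sup>2" x] borel_measurable_power[OF test_borel, of f 2] by simp

lemma h1t_sq: "(h1t f)\<^sup>2 = (n2 f)\<^sup>2 + (\<Sum>i\<in>UNIV. (n2 (pd i f))\<^sup>2)"
  by (simp add: h1t_def n2_sq l2sq_nonneg sum_nonneg)

lemma h1t_nonneg: "0 \<le> h1t f"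
  by (simp add: h1t_def l2sq_nonneg sum_nonneg)

text \<open>Seen as the Euclidean norm of a vector of L2 norms, \<open>h1t\<close> inherits its
  triangle inequality from R x R^3, by monotonicity in the entries
  (\<open>h1t_le_norm\<close>).\<close>

lemma h1t_norm: "h1t f = norm (n2 f, (\<chi> i. n2 (pd i f)) :: real^3)"
  by (rule power2_eq_imp_eq) (simp_all add: h1t_sq h1t_nonneg norm_Pair norm_vec_def L2_set_def sum_nonneg)

lemma h1t_le_norm:
  assumes "n2 f \<le> a" "\<And>i. n2 (pd i f) \<le> b $ i"
  shows "h1t f \<le> norm (a, b :: real^3)"
proof (rule power2_le_imp_le)
  have "(n2 f)\<^sup>2 \<le> a\<^sup>2" using assms n2_nonneg by (intro power_mono) auto
  moreover have "(n2 (pd i f))\<^sup>2 \<le> (b $ i)\<^sup>2" for i using assms n2_nonneg by (intro power_mono) auto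
  ultimately show "(h1t f)\<^sup>2 \<le> (norm (a, b))\<^sup>2"
    by (simp add: h1t_sq norm_Pair norm_vec_def L2_set_def sum_nonneg sum_mono add_mono)
qed simp

lemma h1t_triangle:
  assumes "test f" "test g" shows "h1t (\<lambda>x. f x + g x) \<le> h1t f + h1t g"
proof -
  have "h1t (\<lambda>x. f x + g x) \<le> norm ((n2 f, (\<chi> i. n2 (pd i f)) :: real^3) + (n2 g, \<chi> i. n2 (pd i g)))"
    unfolding add_Pair using assms
    by (intro h1t_le_norm) (auto simp: pd_add test_smooth intro!: n2_triangle test_L2 test_pd)
  also have "\<dots> \<le> h1t f + h1t g" unfolding h1t_norm by (rule norm_triangle_ineq)
  finally show ?thesis .
qed

lemma h1t_cmult: assumes "test f" shows "h1t (\<lambda>x. c * f x) = \<bar>c\<bar> * h1t f"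
proof (rule power2_eq_imp_eq)
  show "(h1t (\<lambda>x. c * f x))\<^sup>2 = (\<bar>c\<bar> * h1t f)\<^sup>2"
    using assms by (simp add: h1t_sq n2_cmult pd_cmult test_smooth power_mult_distrib sum_distrib_left algebra_simps)
qed (simp_all add: h1t_nonneg)

lemma h1t_zero: "h1t (\<lambda>x. 0) = 0"
  using h1t_cmult[OF test_zero, of 0] by simp

lemma h1t_sum: "finite A \<Longrightarrow> (\<And>a. a \<in> A \<Longrightarrow> test (f a)) \<Longrightarrow> h1t (\<lambda>x. \<Sum>a\<in>A. f a x) \<le> (\<Sum>a\<in>A. h1t (f a))"
proof (induction A rule: finite_induct)
  case (insert a A)
  have "h1t (\<lambda>x. f a x + (\<Sum>a\<in>A. f a x)) \<le> h1t (f a) + h1t (\<lambda>x. \<Sum>a\<in>A. f a x)"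
    using insert by (intro h1t_triangle test_sum) auto
  then show ?case using insert by simp
qed (simp add: h1t_zero)

lemma n2_le_h1t: "n2 f \<le> h1t f"
  by (rule power2_le_imp_le) (simp_all add: h1t_sq h1t_nonneg sum_nonneg)

lemma n2_pd_le_h1t: "n2 (pd i f) \<le> h1t f"
proof (rule power2_le_imp_le)
  have "(n2 (pd i f))\<^sup>2 \<le> (\<Sum>i\<in>UNIV. (n2 (pd i f))\<^sup>2)"
    by (rule member_le_sum) auto
  then show "(n2 (pd i f))\<^sup>2 \<le> (h1t f)\<^sup>2" unfolding h1t_sq using zero_le_power2[of "n2 f"] by linarith
qed (simp add: h1t_nonneg)

lemma h1t_le_sum: "h1t f \<le> n2 f + (\<Sum>i\<in>UNIV. n2 (pd i f))"
proof -
  have "h1t f \<le> norm (n2 f, 0::real^3) + norm (0::real, (\<chi> i. n2 (pd i f)) :: real^3)"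
    unfolding h1t_norm using norm_triangle_ineq[of "(n2 f, 0::real^3)" "(0, \<chi> i. n2 (pd i f))"] by simp
  also have "\<dots> \<le> n2 f + (\<Sum>i\<in>UNIV. n2 (pd i f))"
    using norm_le_l1_cart[of "(\<chi> i. n2 (pd i f)) :: real^3"] by (simp add: norm_Pair n2_nonneg)
  finally show ?thesis .
qed

lemma h1t_refl: "test f \<Longrightarrow> h1t (\<lambda>y. f (x - y)) = h1t f"
proof (rule power2_eq_imp_eq)
  assume f: "test f"
  have "n2 (pd i (\<lambda>y. f (x - y))) = n2 (pd i f)" for i
    using n2_refl[OF test_pd[OF f], of i x] n2_cmult[of "-1" "\<lambda>y. pd i f (x - y)"] by (simp add: pd_refl[OF test_smooth[OF f]])
  then show "(h1t (\<lambda>y. f (x - y)))\<^sup>2 = (h1t f)\<^sup>2" by (simp add: h1t_sq n2_refl f)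
qed (simp_all add: h1t_nonneg)

lemma n2_le_bound:
  assumes "L2 f" "\<And>x. \<bar>f x\<bar> \<le> B" "\<And>x. f x \<noteq> 0 \<Longrightarrow> x \<in> K" "compact K" "0 \<le> B"
  shows "n2 f \<le> B * sqrt (measure lborel K)"
proof -
  have fin: "emeasure lborel K < \<infinity>" by (rule emeasure_bounded_finite[OF compact_imp_bounded[OF assms(4)]])
  have K: "K \<in> sets lborel" using assms(4) by (simp add: borel_compact)
  have "l2sq f \<le> (\<integral>x. B\<^sup>2 * indicator K x \<partial>lborel)"
    unfolding l2sq_def
  proof (rule integral_mono)
    show "integrable lborel (\<lambda>x. B\<^sup>2 * indicator K x)" using K fin by simp
    show "(f x)\<^sup>2 \<le> B\<^sup>2 * indicator K x" for x
      using assms(2)[of x] assms(3)[of x] assms(5) by (auto simp: indicator_def abs_le_square_iff[symmetric])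
  qed (use assms(1) in \<open>simp add: L2_def\<close>)
  also have "\<dots> = B\<^sup>2 * measure lborel K" using K by simp
  finally have "sqrt (l2sq f) \<le> sqrt (B\<^sup>2 * measure lborel K)" by simp
  then show ?thesis using assms(5) by (simp add: n2_def real_sqrt_mult)
qed

section \<open>Taylor expansion and integration by parts\<close>

lemma smooth_fn_line_MVT:
  assumes "smooth_fn f" "0 < t"
  obtains s where "0 < s" "s < t" "f (x + axis i t) - f x = t * pd i f (x + axis i s)"
proof -
  have ax: "axis i s = s *\<^sub>R (axis i 1 :: pt)" for i s by (simp add: vec_eq_iff axis_def)
  have d: "((\<lambda>s. f (x + axis i s)) has_real_derivative pd i f (x + axis i s)) (at s)" for s
  proof -
    have "((\<lambda>s. x + s *\<^sub>R axis i 1) has_derivative (\<lambda>h. h *\<^sub>R axis i 1)) (at s)"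
      by (auto intro!: derivative_eq_intros)
    then have "((\<lambda>s. x + axis i s) has_derivative (\<lambda>h. axis i h)) (at s)"
      unfolding ax[symmetric] .
    from has_derivative_compose[OF this has_derivative_pd[OF smooth_fn_differentiable[OF assms(1)]]]
    have "((\<lambda>s. f (x + axis i s)) has_derivative (\<lambda>h. \<Sum>j\<in>UNIV. axis i h $ j * pd j f (x + axis i s))) (at s)" .
    moreover have "(\<Sum>j\<in>UNIV. axis i h $ j * pd j f (x + axis i s)) = pd i f (x + axis i s) * h" for h
      by (simp add: axis_def if_distrib[where f="\<lambda>x. x * _"] cong: if_cong)
    ultimately show ?thesis by (simp add: has_field_derivative_def mult_commute_abs)
  qed
  obtain s where "0 < s" "s < t" "f (x + axis i t) - f (x + axis i 0) = (t - 0) * pd i f (x + axis i s)"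
    using MVT2[OF assms(2), of "\<lambda>s. f (x + axis i s)" "\<lambda>s. pd i f (x + axis i s)"] d by blast
  moreover have "axis i (0::real) = (0 :: pt)" by (simp add: axis_def vec_eq_iff)
  ultimately show thesis using that by simp
qed

lemma norm_axis_real: "norm (axis i t :: pt) = \<bar>t\<bar>"
  by (simp add: norm_vec_def L2_set_def axis_def if_distrib[where f="\<lambda>x. x\<^sup>2"] cong: if_cong)

lemma smooth_fn_continuous: "smooth_fn f \<Longrightarrow> isCont f x"
  by (simp add: differentiable_imp_continuous_within smooth_fn_differentiable)

lemma smooth_fn_shift: "smooth_fn f \<Longrightarrow> smooth_fn (\<lambda>x. f (x + v))"
  using smooth_fn_affine[of f 1 v] by simp

lemma pd_shift: "smooth_fn f \<Longrightarrow> pd i (\<lambda>x. f (x + v)) = (\<lambda>x. pd i f (x + v))"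
  using pd_affine[of f i 1 v] by simp

text \<open>The mixed second difference of \<open>f\<close> over a square of side \<open>t\<close>
  is symmetric in the two directions. Two applications of the mean value theorem equate it with
  \<open>t * t\<close> times either mixed derivative at some point within \<open>2 * t\<close> of
  \<open>x\<close>; continuity then lets \<open>t\<close> tend to 0.\<close>

lemma pd_commute:
  assumes f: "smooth_fn f" shows "pd i (pd j f) = pd j (pd i f)"
proof
  fix x
  have key: "\<exists>y. norm (y - x) \<le> 2 * t \<and>
      f (x + axis i t + axis j t) - f (x + axis i t) - f (x + axis j t) + f x = t * (t * pd j (pd i f) y)"
    if t: "0 < t" for t i j
  proof -
    have k: "smooth_fn (\<lambda>y. f (y + axis j t) - f y)" by (rule smooth_fn_diff[OF smooth_fn_shift[OF f] f])
    have e: "pd i (\<lambda>y. f (y + axis j t) - f y) = (\<lambda>y. pd i f (y + axis j t) - pd i f y)"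
      by (simp only: pd_diff[OF smooth_fn_shift[OF f] f] pd_shift[OF f])
    obtain s where s: "0 < s" "s < t" "f (x + axis i t + axis j t) - f (x + axis i t) - (f (x + axis j t) - f x)
        = t * (pd i f (x + axis i s + axis j t) - pd i f (x + axis i s))"
      using smooth_fn_line_MVT[OF k t, where x=x and i=i] unfolding e by blast
    obtain r where r: "0 < r" "r < t" "pd i f (x + axis i s + axis j t) - pd i f (x + axis i s) = t * pd j (pd i f) (x + axis i s + axis j r)"
      by (rule smooth_fn_line_MVT[OF smooth_fn_pd[OF f] t, where x="x + axis i s" and i=j])
    have "norm (x + axis i s + axis j r - x) \<le> norm (axis i s :: pt) + norm (axis j r :: pt)"
      by (simp add: norm_triangle_ineq)
    also have "\<dots> \<le> 2 * t" using s r by (simp add: norm_axis_real)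
    finally show ?thesis using s r by (intro exI[of _ "x + axis i s + axis j r"]) simp
  qed
  let ?t = "\<lambda>n. 1 / (real n + 1)"
  have "\<exists>y z. norm (y - x) \<le> 2 * ?t n \<and> norm (z - x) \<le> 2 * ?t n \<and> pd j (pd i f) y = pd i (pd j f) z" for n
  proof -
    have t: "0 < ?t n" by simp
    obtain y where y: "norm (y - x) \<le> 2 * ?t n"
      "f (x + axis i (?t n) + axis j (?t n)) - f (x + axis i (?t n)) - f (x + axis j (?t n)) + f x = ?t n * (?t n * pd j (pd i f) y)"
      using key[OF t, of i j] by blast
    obtain z where z: "norm (z - x) \<le> 2 * ?t n"
      "f (x + axis j (?t n) + axis i (?t n)) - f (x + axis j (?t n)) - f (x + axis i (?t n)) + f x = ?t n * (?t n * pd i (pd j f) z)"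
      using key[OF t, of j i] by blast
    have c: "x + axis i (?t n) + axis j (?t n) = x + axis j (?t n) + axis i (?t n)" by (simp only: ac_simps)
    have "?t n * (?t n * pd j (pd i f) y) = ?t n * (?t n * pd i (pd j f) z)" using y(2) z(2) unfolding c by linarith
    then have "pd j (pd i f) y = pd i (pd j f) z" using t by simp
    then show ?thesis using y z by blast
  qed
  then obtain Y Z where YZ: "\<And>n. norm (Y n - x) \<le> 2 * ?t n" "\<And>n. norm (Z n - x) \<le> 2 * ?t n"
     "\<And>n. pd j (pd i f) (Y n) = pd i (pd j f) (Z n)" by metis
  have t0: "(\<lambda>n. 2 * ?t n) \<longlonglongrightarrow> 0"
    using tendsto_mult[OF tendsto_const[of 2] LIMSEQ_inverse_real_of_nat] by (simp add: inverse_eq_divide add.commute)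
  have "(\<lambda>n. Y n - x) \<longlonglongrightarrow> 0" "(\<lambda>n. Z n - x) \<longlonglongrightarrow> 0"
    using YZ by (auto intro!: Lim_null_comparison[OF _ t0] always_eventually)
  then have l: "Y \<longlonglongrightarrow> x" "Z \<longlonglongrightarrow> x" by (simp_all add: LIM_zero_iff)
  have "(\<lambda>n. pd j (pd i f) (Y n)) \<longlonglongrightarrow> pd j (pd i f) x" "(\<lambda>n. pd i (pd j f) (Z n)) \<longlonglongrightarrow> pd i (pd j f) x"
    using l by (auto intro!: isCont_tendsto_compose[of _ "pd _ (pd _ f)"] smooth_fn_continuous smooth_fn_pd f)
  then show "pd i (pd j f) x = pd j (pd i f) x" using YZ(3) LIMSEQ_unique by simp
qed

lemma test_Lipschitz:
  assumes g: "test g" obtains M where "M \<ge> 0" "\<And>x y. \<bar>g x - g y\<bar> \<le> M * norm (x - y)"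
proof -
  have "\<forall>i. \<exists>B. B \<ge> 0 \<and> (\<forall>x. \<bar>pd i g x\<bar> \<le> B)" using test_bounded[OF test_pd[OF g]] by metis
  then obtain B where B: "\<And>i. B i \<ge> 0" "\<And>i x. \<bar>pd i g x\<bar> \<le> B i" by metis
  have o: "onorm (\<lambda>h::pt. \<Sum>i\<in>UNIV. h $ i * pd i g x) \<le> (\<Sum>i\<in>UNIV. B i)" for x
  proof (rule onorm_le)
    fix h :: pt
    have "\<bar>\<Sum>i\<in>UNIV. h $ i * pd i g x\<bar> \<le> (\<Sum>i\<in>UNIV. \<bar>h $ i * pd i g x\<bar>)" by (rule sum_abs)
    also have "\<dots> \<le> (\<Sum>i\<in>UNIV. norm h * B i)"
      unfolding abs_mult by (intro sum_mono mult_mono component_le_norm_cart B) auto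
    finally show "norm (\<Sum>i\<in>UNIV. h $ i * pd i g x) \<le> (\<Sum>i\<in>UNIV. B i) * norm h"
      by (simp add: sum_distrib_left mult.commute)
  qed
  show thesis
  proof (rule that)
    show "0 \<le> (\<Sum>i\<in>UNIV. B i)" by (simp add: B sum_nonneg)
    show "\<bar>g x - g y\<bar> \<le> (\<Sum>i\<in>UNIV. B i) * norm (x - y)" for x y
      using differentiable_bound[OF convex_UNIV, of g "\<lambda>x h. \<Sum>i\<in>UNIV. h $ i * pd i g x" "\<Sum>i\<in>UNIV. B i" x y]
        has_derivative_pd[OF smooth_fn_differentiable[OF test_smooth[OF g]]] o by simp
  qed
qed

text \<open>An element of H^-1 is controlled by \<open>h1t\<close> only, so differentiating
  \<open>u (\<lambda>y. g (x - y))\<close> in \<open>x\<close> needs a remainder that is quadratic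
  in \<open>h\<close> in that norm, not just pointwise. The bounds below lead there.\<close>

definition taylor_rem :: "fn \<Rightarrow> pt \<Rightarrow> fn" where
  "taylor_rem g h x = g (x + h) - g x - (\<Sum>i\<in>UNIV. h $ i * pd i g x)"

lemma test_shift: "test g \<Longrightarrow> test (\<lambda>x. g (x + v))"
  using test_affine[of g 1 v] by simp

lemma test_taylor_rem: "test g \<Longrightarrow> test (taylor_rem g h)"
  unfolding taylor_rem_def by (intro test_diff test_shift test_sum test_cmult test_pd) auto

text \<open>Symmetry of second derivatives makes the remainder commute with \<open>pd\<close>; hence
  L2 bounds valid for every test function upgrade to \<open>h1t\<close> bounds by applying them to
  \<open>pd i g\<close>.\<close>

lemma pd_taylor_rem: "test g \<Longrightarrow> pd j (taylor_rem g h) = taylor_rem (pd j g) h"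
proof -
  assume g: "test g"
  have s: "smooth_fn g" using g by (rule test_smooth)
  have s': "smooth_fn (\<lambda>x. \<Sum>i\<in>UNIV. h $ i * pd i g x)"
    by (intro smooth_fn_sum smooth_fn_cmult smooth_fn_pd s) auto
  have "pd j (\<lambda>x. \<Sum>i\<in>UNIV. h $ i * pd i g x) = (\<lambda>x. \<Sum>i\<in>UNIV. h $ i * pd i (pd j g) x)"
    using pd_sum[of UNIV "\<lambda>i x. h $ i * pd i g x" j] s
    by (simp add: smooth_fn_cmult smooth_fn_pd pd_cmult pd_commute[of g j])
  then show ?thesis unfolding taylor_rem_def
    by (simp add: pd_diff pd_shift s s' smooth_fn_diff smooth_fn_shift)
qed

text \<open>The gradient is Lipschitz because the second derivatives are bounded, and the linearised
  mean value inequality on the ball of radius \<open>norm h\<close> turns this into a quadratic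
  bound.\<close>

lemma taylor_rem_bound:
  assumes g: "test g" obtains M where "M \<ge> 0" "\<And>x h. \<bar>taylor_rem g h x\<bar> \<le> M * (norm h)\<^sup>2"
proof -
  have "\<forall>i. \<exists>B. B \<ge> 0 \<and> (\<forall>x y. \<bar>pd i g x - pd i g y\<bar> \<le> B * norm (x - y))" using test_Lipschitz[OF test_pd[OF g]] by metis
  then obtain B where B: "\<And>i. B i \<ge> 0" "\<And>i x y. \<bar>pd i g x - pd i g y\<bar> \<le> B i * norm (x - y)" by metis
  define M where "M = (\<Sum>i\<in>UNIV. B i)"
  let ?D = "\<lambda>x h. \<Sum>i\<in>UNIV. (h::pt) $ i * pd i g x"
  show thesis
  proof (rule that)
    show "0 \<le> M" by (simp add: M_def B sum_nonneg)
    fix x h :: pt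
    have o: "onorm (?D y - ?D x) \<le> M * norm h" if y: "y \<in> cball x (norm h)" for y
    proof (rule onorm_le)
      fix k :: pt
      have yx: "norm (y - x) \<le> norm h" using y by (simp add: dist_norm norm_minus_commute)
      have "\<bar>(?D y - ?D x) k\<bar> = \<bar>\<Sum>i\<in>UNIV. k $ i * (pd i g y - pd i g x)\<bar>"
        by (simp add: sum_subtractf algebra_simps)
      also have "\<dots> \<le> (\<Sum>i\<in>UNIV. \<bar>k $ i * (pd i g y - pd i g x)\<bar>)" by (rule sum_abs)
      also have "\<dots> \<le> (\<Sum>i\<in>UNIV. norm k * (B i * norm h))"
        unfolding abs_mult
        by (intro sum_mono mult_mono component_le_norm_cart order_trans[OF B(2)] mult_left_mono B yx) auto
      also have "\<dots> = M * norm h * norm k" by (simp add: M_def sum_distrib_left sum_distrib_right mult_ac)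
      finally show "norm ((?D y - ?D x) k) \<le> M * norm h * norm k" by simp
    qed
    have "norm (g (x + h) - g x - ?D x (x + h - x)) \<le> norm (x + h - x) * (M * norm h)"
    proof (rule differentiable_bound_linearization[where S="cball x (norm h)"])
      show "x + t *\<^sub>R (x + h - x) \<in> cball x (norm h)" if "t \<in> {0..1}" for t
        using that by (auto simp: dist_norm mult_left_le_one_le)
      show "(g has_derivative ?D y) (at y within cball x (norm h))" for y
        using has_derivative_at_withinI[OF has_derivative_pd[OF smooth_fn_differentiable[OF test_smooth[OF g]]]] .
    qed (use o in auto)
    then show "\<bar>taylor_rem g h x\<bar> \<le> M * (norm h)\<^sup>2" by (simp add: taylor_rem_def power2_eq_square mult_ac)
  qed
qed

text \<open>For steps of length at most 1 the remainder lives in one compact set independent of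
  \<open>h\<close>, so sup bounds become L2 bounds with uniform constants.\<close>

lemma taylor_rem_nonzero:
  assumes "taylor_rem g h x \<noteq> 0" "norm h \<le> 1"
  shows "x \<in> {a + b | a b. a \<in> tsupp g \<and> b \<in> cball 0 1}"
proof -
  have "x + h \<in> tsupp g \<or> x \<in> tsupp g"
  proof (rule ccontr)
    assume n: "\<not> (x + h \<in> tsupp g \<or> x \<in> tsupp g)"
    then have "pd i g x = 0" for i using pd_nonzero_tsupp by blast
    moreover have "g x = 0" "g (x + h) = 0" using n tsupp_nonzero[of g] by blast+
    ultimately have "taylor_rem g h x = 0" by (simp add: taylor_rem_def)
    then show False using assms by simp
  qed
  moreover have "x = (x + h) + (- h)" "x = x + 0" by simp_all
  moreover have "- h \<in> cball 0 1" "(0::pt) \<in> cball 0 1" using assms by auto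
  ultimately show ?thesis by blast
qed

lemma taylor_rem_n2:
  assumes g: "test g" obtains C where "C \<ge> 0" "\<And>h. norm h \<le> 1 \<Longrightarrow> n2 (taylor_rem g h) \<le> C * (norm h)\<^sup>2"
proof -
  obtain M where M: "M \<ge> 0" "\<And>x h. \<bar>taylor_rem g h x\<bar> \<le> M * (norm h)\<^sup>2" using taylor_rem_bound[OF g] by metis
  let ?K = "{a + b | a b. a \<in> tsupp g \<and> b \<in> cball (0::pt) 1}"
  have K: "compact ?K" by (intro compact_sums test_compact g compact_cball)
  show thesis
  proof (rule that[of "M * sqrt (measure lborel ?K)"])
    fix h :: pt assume "norm h \<le> 1"
    then have "n2 (taylor_rem g h) \<le> (M * (norm h)\<^sup>2) * sqrt (measure lborel ?K)"
      using M K taylor_rem_nonzero by (intro n2_le_bound test_L2 test_taylor_rem g) auto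
    then show "n2 (taylor_rem g h) \<le> M * sqrt (measure lborel ?K) * (norm h)\<^sup>2" by (simp add: mult_ac)
  qed (use M in simp)
qed

lemma taylor_rem_h1t:
  assumes g: "test g" obtains C where "C \<ge> 0" "\<And>h. norm h \<le> 1 \<Longrightarrow> h1t (taylor_rem g h) \<le> C * (norm h)\<^sup>2"
proof -
  obtain C where C: "C \<ge> 0" "\<And>h. norm h \<le> 1 \<Longrightarrow> n2 (taylor_rem g h) \<le> C * (norm h)\<^sup>2" using taylor_rem_n2[OF g] by metis
  have "\<forall>i. \<exists>D. D \<ge> 0 \<and> (\<forall>h. norm h \<le> 1 \<longrightarrow> n2 (taylor_rem (pd i g) h) \<le> D * (norm h)\<^sup>2)" using taylor_rem_n2[OF test_pd[OF g]] by metis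
  then obtain D where D: "\<And>i. D i \<ge> 0" "\<And>i h. norm h \<le> 1 \<Longrightarrow> n2 (taylor_rem (pd i g) h) \<le> D i * (norm h)\<^sup>2" by metis
  show thesis
  proof (rule that[of "C + (\<Sum>i\<in>UNIV. D i)"])
    fix h :: pt assume h: "norm h \<le> 1"
    have "h1t (taylor_rem g h) \<le> C * (norm h)\<^sup>2 + (\<Sum>i\<in>UNIV. D i * (norm h)\<^sup>2)"
      using C(2)[OF h] D(2)[OF h] by (intro order_trans[OF h1t_le_sum] add_mono sum_mono) (auto simp: pd_taylor_rem g)
    then show "h1t (taylor_rem g h) \<le> (C + (\<Sum>i\<in>UNIV. D i)) * (norm h)\<^sup>2" by (simp add: distrib_right sum_distrib_right)
  qed (simp add: C D sum_nonneg)
qed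

lemma eq_zero_if_le_square:
  fixes a C :: real assumes "\<And>t. 0 < t \<Longrightarrow> t \<le> 1 \<Longrightarrow> t * \<bar>a\<bar> \<le> C * t\<^sup>2" shows "a = 0"
proof (rule ccontr)
  assume a: "a \<noteq> 0"
  \<comment> \<open>With this \<open>t\<close> the bound \<open>(\<bar>C\<bar> + 1) * t\<close> is
    at most half of \<open>\<bar>a\<bar>\<close>.\<close>
  define t where "t = min 1 (\<bar>a\<bar> / (2 * (\<bar>C\<bar> + 1)))"
  have t: "0 < t" "t \<le> 1" "t \<le> \<bar>a\<bar> / (2 * (\<bar>C\<bar> + 1))" using a by (auto simp: t_def)
  have "t * \<bar>a\<bar> \<le> t * (C * t)" using assms[OF t(1,2)] by (simp add: power2_eq_square mult_ac)
  then have "\<bar>a\<bar> \<le> C * t" using t(1) by simp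
  also have "\<dots> \<le> (\<bar>C\<bar> + 1) * t" using t by (intro mult_right_mono) auto
  also have "\<dots> \<le> (\<bar>C\<bar> + 1) * (\<bar>a\<bar> / (2 * (\<bar>C\<bar> + 1)))" using t by (intro mult_left_mono) auto
  also have "\<dots> = \<bar>a\<bar> / 2" by (simp add: field_simps)
  finally show False using a by simp
qed

lemma axis_sum: "(\<Sum>j\<in>UNIV. axis i t $ j * F j) = t * (F i :: real)" for i :: 3
  by (simp add: axis_def if_distrib[where f="\<lambda>x. x * _"] cong: if_cong)

text \<open>Translation invariance cancels the zeroth-order terms in the integral of
  \<open>taylor_rem g (axis i t)\<close> and leaves \<open>t\<close> times the integral in question,
  while the remainder itself is of order \<open>t^2\<close> on a fixed compact set.\<close>

lemma integral_pd: assumes g: "test g" shows "(\<integral>x. pd i g x \<partial>lborel) = 0"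
proof -
  obtain M where M: "M \<ge> 0" "\<And>x h. \<bar>taylor_rem g h x\<bar> \<le> M * (norm h)\<^sup>2" using taylor_rem_bound[OF g] by metis
  let ?K = "{a + b | a b. a \<in> tsupp g \<and> b \<in> cball (0::pt) 1}"
  have K: "compact ?K" by (intro compact_sums test_compact g compact_cball)
  have fin: "emeasure lborel ?K < \<infinity>" by (rule emeasure_bounded_finite[OF compact_imp_bounded[OF K]])
  have Ks: "?K \<in> sets lborel" using K by (simp add: borel_compact)
  have ig: "integrable lborel (pd i g)" "integrable lborel g" "integrable lborel (\<lambda>x. g (x + h))" for h
    using g by (auto intro!: test_integrable test_pd test_shift)
  show ?thesis
  proof (rule eq_zero_if_le_square)
    fix t :: real assume t: "0 < t" "t \<le> 1"
    let ?h = "axis i t :: pt"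
    have n: "norm ?h = t" using t by (simp add: norm_axis_real)
    have r: "taylor_rem g ?h = (\<lambda>x. g (x + ?h) - g x - t * pd i g x)"
      by (simp add: taylor_rem_def axis_sum fun_eq_iff)
    have "(\<integral>x. taylor_rem g ?h x \<partial>lborel) = (\<integral>x. g (x + ?h) \<partial>lborel) - (\<integral>x. g x \<partial>lborel) - t * (\<integral>x. pd i g x \<partial>lborel)"
      unfolding r using ig by simp
    also have "\<dots> = - t * (\<integral>x. pd i g x \<partial>lborel)"
      using lborel_integral_shift[OF test_borel[OF g], of ?h] by simp
    finally have "t * \<bar>\<integral>x. pd i g x \<partial>lborel\<bar> = \<bar>\<integral>x. taylor_rem g ?h x \<partial>lborel\<bar>" using t by (simp add: abs_mult)
    also have "\<dots> \<le> (\<integral>x. M * t\<^sup>2 * indicator ?K x \<partial>lborel)"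
    proof (rule order_trans[OF integral_abs_bound], rule integral_mono)
      show "integrable lborel (\<lambda>x. \<bar>taylor_rem g ?h x\<bar>)" using test_integrable[OF test_taylor_rem[OF g]] by simp
      show "integrable lborel (\<lambda>x. M * t\<^sup>2 * indicator ?K x)" using Ks fin by simp
      show "\<bar>taylor_rem g ?h x\<bar> \<le> M * t\<^sup>2 * indicator ?K x" for x
        using M(2)[of ?h x] taylor_rem_nonzero[of g ?h x] n t by (cases "taylor_rem g ?h x = 0") (auto simp: M(1) indicator_def)
    qed
    also have "\<dots> = (M * measure lborel ?K) * t\<^sup>2" using Ks by simp
    finally show "t * \<bar>\<integral>x. pd i g x \<partial>lborel\<bar> \<le> (M * measure lborel ?K) * t\<^sup>2" .
  qed
qed

lemma integral_by_parts:
  assumes "test f" "smooth_fn g"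
  shows "(\<integral>x. f x * pd i g x \<partial>lborel) = - (\<integral>x. pd i f x * g x \<partial>lborel)"
proof -
  have t: "test (\<lambda>x. g x * f x)" "test (\<lambda>x. pd i g x * f x)" "test (\<lambda>x. g x * pd i f x)"
    using assms by (auto intro!: test_mult test_pd smooth_fn_pd)
  have "0 = (\<integral>x. pd i (\<lambda>x. g x * f x) x \<partial>lborel)" using integral_pd[OF t(1)] by simp
  also have "\<dots> = (\<integral>x. pd i g x * f x \<partial>lborel) + (\<integral>x. g x * pd i f x \<partial>lborel)"
    using t by (simp add: pd_mult assms test_smooth test_integrable)
  finally show ?thesis by (simp add: mult.commute)
qed

section \<open>Convolution of distributions in \<open>H\<^sup>-\<^sup>1\<close> with test functions\<close>

lemma Hm1_lin: "Hm1 u \<Longrightarrow> test \<phi> \<Longrightarrow> test \<psi> \<Longrightarrow> u (\<lambda>x. a * \<phi> x + b * \<psi> x) = a * u \<phi> + b * u \<psi>"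
  by (simp add: Hm1_def)

lemma Hm1_zero: "Hm1 u \<Longrightarrow> u (\<lambda>x. 0) = 0"
  using Hm1_lin[of u "\<lambda>x. 0" "\<lambda>x. 0" 0 0] by (simp add: test_zero)
lemma Hm1_add: "Hm1 u \<Longrightarrow> test \<phi> \<Longrightarrow> test \<psi> \<Longrightarrow> u (\<lambda>x. \<phi> x + \<psi> x) = u \<phi> + u \<psi>"
  using Hm1_lin[of u \<phi> \<psi> 1 1] by simp
lemma Hm1_diff: "Hm1 u \<Longrightarrow> test \<phi> \<Longrightarrow> test \<psi> \<Longrightarrow> u (\<lambda>x. \<phi> x - \<psi> x) = u \<phi> - u \<psi>"
  using Hm1_lin[of u \<phi> \<psi> 1 "-1"] by simp
lemma Hm1_cmult: "Hm1 u \<Longrightarrow> test \<phi> \<Longrightarrow> u (\<lambda>x. c * \<phi> x) = c * u \<phi>"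
  using Hm1_lin[of u \<phi> \<phi> c 0] by simp
lemma Hm1_sum: "finite A \<Longrightarrow> Hm1 u \<Longrightarrow> (\<And>a. a \<in> A \<Longrightarrow> test (f a)) \<Longrightarrow> u (\<lambda>x. \<Sum>a\<in>A. f a x) = (\<Sum>a\<in>A. u (f a))"
proof (induction A rule: finite_induct)
  case (insert a A)
  have "u (\<lambda>x. f a x + (\<Sum>a\<in>A. f a x)) = u (f a) + u (\<lambda>x. \<Sum>a\<in>A. f a x)"
    using insert by (intro Hm1_add test_sum) auto
  then show ?case using insert by simp
qed (simp add: Hm1_zero)

lemma hm1_leD: "hm1_le u C \<Longrightarrow> test \<phi> \<Longrightarrow> \<bar>u \<phi>\<bar> \<le> C * h1t \<phi>"
  by (simp add: hm1_le_def)

lemma hm1_le_mono: "hm1_le u C \<Longrightarrow> C \<le> D \<Longrightarrow> hm1_le u D"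
  unfolding hm1_le_def by (meson h1t_nonneg mult_right_mono order_trans)

lemma Hm1_bound: assumes "Hm1 u" obtains C where "C \<ge> 0" "hm1_le u C"
proof -
  obtain C where "hm1_le u C" using assms by (auto simp: Hm1_def)
  then have "hm1_le u (max C 0)" by (rule hm1_le_mono) simp
  then show thesis using that[of "max C 0"] by simp
qed

text \<open>The convolution of a distribution with a test function, as a genuine function.\<close>

definition cv :: "distr \<Rightarrow> fn \<Rightarrow> fn" where "cv u g x = u (\<lambda>y. g (x - y))"

text \<open>Linearity identifies the first-order error with \<open>u\<close> applied to the
  reflected Taylor remainder; reflection preserves \<open>h1t\<close>, so the error is quadratic in
  \<open>h\<close>.\<close>

lemma cv_has_derivative:
  assumes u: "Hm1 u" and g: "test g"
  shows "(cv u g has_derivative (\<lambda>h. \<Sum>i\<in>UNIV. h $ i * cv u (pd i g) x)) (at x)"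
proof -
  let ?D = "\<lambda>h::pt. \<Sum>i\<in>UNIV. h $ i * cv u (pd i g) x"
  obtain C where C: "C \<ge> 0" "hm1_le u C" using Hm1_bound[OF u] .
  obtain D where D: "D \<ge> 0" "\<And>h. norm h \<le> 1 \<Longrightarrow> h1t (taylor_rem g h) \<le> D * (norm h)\<^sup>2" using taylor_rem_h1t[OF g] by metis
  have bl: "bounded_linear ?D"
    unfolding linear_conv_bounded_linear[symmetric]
    by (rule linearI) (simp_all add: algebra_simps sum.distrib sum_distrib_left)
  have rem: "cv u g (x + h) - cv u g x - ?D h = u (\<lambda>y. taylor_rem g h (x - y))" for h
  proof -
    have t: "test (\<lambda>y. g (x + h - y))" "test (\<lambda>y. g (x - y))" "\<And>i. test (\<lambda>y. pd i g (x - y))"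
      using g by (auto intro: test_refl test_pd)
    have ts: "test (\<lambda>y. \<Sum>i\<in>UNIV. h $ i * pd i g (x - y))" by (rule test_sum) (simp_all add: test_cmult t)
    have "(\<lambda>y. taylor_rem g h (x - y)) = (\<lambda>y. (g (x + h - y) - g (x - y)) - (\<Sum>i\<in>UNIV. h $ i * pd i g (x - y)))"
      by (simp add: taylor_rem_def fun_eq_iff algebra_simps)
    moreover have "u (\<lambda>y. \<Sum>i\<in>UNIV. h $ i * pd i g (x - y)) = (\<Sum>i\<in>UNIV. h $ i * u (\<lambda>y. pd i g (x - y)))"
      by (subst Hm1_sum[OF finite u]) (simp_all add: test_cmult t Hm1_cmult[OF u t(3)])
    ultimately have "u (\<lambda>y. taylor_rem g h (x - y)) = (u (\<lambda>y. g (x + h - y)) - u (\<lambda>y. g (x - y))) - (\<Sum>i\<in>UNIV. h $ i * u (\<lambda>y. pd i g (x - y)))"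
      by (simp add: Hm1_diff[OF u test_diff[OF t(1,2)] ts] Hm1_diff[OF u t(1,2)])
    then show ?thesis by (simp add: cv_def)
  qed
  have bd: "norm (cv u g (x + h) - cv u g x - ?D h) / norm h \<le> (C * D) * norm h" if h: "norm h \<le> 1" for h
  proof (cases "h = 0")
    case False
    have "\<bar>u (\<lambda>y. taylor_rem g h (x - y))\<bar> \<le> C * h1t (\<lambda>y. taylor_rem g h (x - y))"
      by (intro hm1_leD C test_refl test_taylor_rem g)
    also have "\<dots> \<le> C * (D * (norm h)\<^sup>2)"
      unfolding h1t_refl[OF test_taylor_rem[OF g]] using D(2)[OF h] C(1) by (rule mult_left_mono)
    finally show ?thesis unfolding rem using False by (simp add: divide_le_eq power2_eq_square mult_ac)
  qed simp
  have "((\<lambda>h. norm (cv u g (x + h) - cv u g x - ?D h) / norm h) \<longlongrightarrow> 0) (at 0)"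
  proof (rule tendsto_0_le[where K=1])
    show "((\<lambda>h::pt. (C * D) * norm h) \<longlongrightarrow> 0) (at 0)" by (auto intro!: tendsto_eq_intros)
    have "\<forall>\<^sub>F h in at 0. norm (h::pt) \<le> 1"
      unfolding eventually_at by (intro exI[of _ 1]) (auto simp: dist_norm)
    then show "\<forall>\<^sub>F h in at 0. norm (norm (cv u g (x + h) - cv u g x - ?D h) / norm h) \<le> norm ((C * D) * norm h) * 1"
      by eventually_elim (use bd C D in auto)
  qed
  then show ?thesis unfolding has_derivative_at using bl by blast
qed

lemma pd_cv: "Hm1 u \<Longrightarrow> test g \<Longrightarrow> pd i (cv u g) = cv u (pd i g)"
  using pd_eqI[OF cv_has_derivative] by (simp add: fun_eq_iff axis_sum)

lemma smooth_cv:
  assumes u: "Hm1 u" and g: "test g" shows "smooth_fn (cv u g)"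
proof (rule smooth_fn_coinduct[where P="\<lambda>f. \<exists>g. test g \<and> f = cv u g"])
  show "\<exists>h. test h \<and> cv u g = cv u h" using g by blast
  fix f assume "\<exists>g. test g \<and> f = cv u g"
  then obtain g where g: "test g" "f = cv u g" by blast
  show "f differentiable (at x)" for x using cv_has_derivative[OF u g(1)] g(2) by (auto simp: differentiable_def)
  show "\<exists>h. test h \<and> pd i f = cv u h" for i using pd_cv[OF u g(1)] test_pd[OF g(1)] g(2) by blast
qed

lemma cv_nonzero:
  assumes s: "supp_in u K" and g: "test g" and n: "cv u g x \<noteq> 0"
  shows "x \<in> {a + b | a b. a \<in> K \<and> b \<in> tsupp g}"
proof -
  have "\<not> tsupp (\<lambda>y. g (x - y)) \<inter> K = {}"
    using s n test_refl[OF g, of x] unfolding supp_in_def cv_def by blast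
  then obtain a where a: "a \<in> K" "a \<in> tsupp (\<lambda>y. g (x - y))" by blast
  have "closed ((\<lambda>y. x - y) -` tsupp g)"
    by (intro continuous_closed_vimage closed_tsupp) (auto intro!: continuous_intros)
  then have "tsupp (\<lambda>y. g (x - y)) \<subseteq> (\<lambda>y. x - y) -` tsupp g"
    by (rule tsupp_subset) (auto intro: tsupp_nonzero)
  then have "x - a \<in> tsupp g" using a by auto
  then show ?thesis using a(1) by (intro CollectI exI[of _ a] exI[of _ "x - a"]) auto
qed

lemma test_cv:
  assumes "Hm1 u" "supp_in u K" "compact K" "test g"
  shows "test (cv u g)" and "tsupp (cv u g) \<subseteq> {a + b | a b. a \<in> K \<and> b \<in> tsupp g}"
proof -
  have c: "compact {a + b | a b. a \<in> K \<and> b \<in> tsupp g}" using assms by (intro compact_sums test_compact)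
  show "test (cv u g)" by (rule testI[OF smooth_cv[OF assms(1,4)] c cv_nonzero[OF assms(2,4)]])
  show "tsupp (cv u g) \<subseteq> {a + b | a b. a \<in> K \<and> b \<in> tsupp g}"
    by (rule tsupp_subset[OF compact_imp_closed[OF c] cv_nonzero[OF assms(2,4)]])
qed

lemma hm1_le_fdist:
  assumes "L2 f" shows "hm1_le (fdist f) (n2 f)"
  unfolding hm1_le_def fdist_def
proof (intro allI impI)
  fix \<phi> assume "test \<phi>"
  then have "\<bar>\<integral>x. f x * \<phi> x \<partial>lborel\<bar> \<le> n2 f * n2 \<phi>" by (rule L2_Cauchy_Schwarz[OF assms test_L2])
  also have "\<dots> \<le> n2 f * h1t \<phi>" by (rule mult_left_mono[OF n2_le_h1t n2_nonneg])
  finally show "\<bar>\<integral>x. f x * \<phi> x \<partial>lborel\<bar> \<le> n2 f * h1t \<phi>" .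
qed

lemma Hm1_fdist: "L2 f \<Longrightarrow> Hm1 (fdist f)"
proof -
  assume f: "L2 f"
  have "fdist f (\<lambda>x. a * \<phi> x + b * \<psi> x) = a * fdist f \<phi> + b * fdist f \<psi>" if t: "test \<phi>" "test \<psi>" for \<phi> \<psi> a b
  proof -
    have "fdist f (\<lambda>x. a * \<phi> x + b * \<psi> x) = (\<integral>x. a * (f x * \<phi> x) + b * (f x * \<psi> x) \<partial>lborel)"
      by (simp add: fdist_def algebra_simps)
    also have "\<dots> = a * fdist f \<phi> + b * fdist f \<psi>"
      using L2_mult_integrable[OF f test_L2] t by (simp add: fdist_def)
    finally show ?thesis .
  qed
  then show ?thesis unfolding Hm1_def using hm1_le_fdist[OF f] by blast
qed

lemma supp_in_fdist: "supp_in (fdist f) (tsupp f)"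
  unfolding supp_in_def fdist_def
proof (intro allI impI)
  fix \<phi> assume "tsupp \<phi> \<inter> tsupp f = {}"
  then have "f x * \<phi> x = 0" for x using tsupp_nonzero[of f x] tsupp_nonzero[of \<phi> x] by auto
  then have z: "(\<lambda>x. f x * \<phi> x) = (\<lambda>x. 0)" by (rule ext)
  show "(\<integral>x. f x * \<phi> x \<partial>lborel) = 0" unfolding z by simp
qed

text \<open>Ordinary convolution (\<open>conv_eq\<close>), routed through \<open>cv\<close> so that
  smoothness, derivatives and supports need no second proof.\<close>

definition conv :: "fn \<Rightarrow> fn \<Rightarrow> fn" where "conv f = cv (fdist f)"
definition rfl :: "fn \<Rightarrow> fn" where "rfl g = (\<lambda>z. g (- z))"

lemma conv_eq: "conv f g x = (\<integral>y. f y * g (x - y) \<partial>lborel)"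
  by (simp add: conv_def cv_def fdist_def)

lemma test_rfl: "test g \<Longrightarrow> test (rfl g)"
  using test_refl[of g 0] by (simp add: rfl_def)
lemma pd_rfl: "test g \<Longrightarrow> pd i (rfl g) = (\<lambda>z. - rfl (pd i g) z)"
  using pd_refl[OF test_smooth, of g i 0] by (simp add: rfl_def)
lemma tsupp_rfl: "tsupp (rfl g) = uminus ` tsupp g"
proof -
  have "{x. rfl g x \<noteq> 0} = uminus ` {x. g x \<noteq> 0}"
    by (force simp: rfl_def image_iff intro: exI[of _ "- _"])
  then show ?thesis by (simp add: tsupp_def closure_injective_linear_image linear_uminus)
qed
lemma test_conv: "test f \<Longrightarrow> test g \<Longrightarrow> test (conv f g)"
  unfolding conv_def by (rule test_cv(1)[OF Hm1_fdist[OF test_L2] supp_in_fdist test_compact])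

lemma tsupp_conv: "test f \<Longrightarrow> test g \<Longrightarrow> tsupp (conv f g) \<subseteq> {a + b | a b. a \<in> tsupp f \<and> b \<in> tsupp g}"
  unfolding conv_def by (rule test_cv(2)[OF Hm1_fdist[OF test_L2] supp_in_fdist test_compact])

lemma conv_commute: assumes "test f" "test g" shows "conv f g = conv g f"
proof
  fix x
  have "(\<lambda>y. f y * g (x - y)) \<in> borel_measurable borel"
    by (rule test_borel[OF test_mult[OF test_smooth[OF assms(1)] test_refl[OF assms(2)]]])
  then show "conv f g x = conv g f x"
    unfolding conv_eq using lborel_integral_refl[of "\<lambda>y. f y * g (x - y)" x] by (simp add: mult.commute)
qed

lemma pd_conv: "test f \<Longrightarrow> test g \<Longrightarrow> pd i (conv f g) = conv f (pd i g)"
  unfolding conv_def by (rule pd_cv[OF Hm1_fdist[OF test_L2]])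

lemma pd_conv': "test f \<Longrightarrow> test g \<Longrightarrow> pd i (conv f g) = conv (pd i f) g"
  by (metis conv_commute pd_conv test_pd)

text \<open>Supplies the map \<open>q\<close> of the Riemann sums, which moves each covered point to
  a nearby centre. Inserting a ball overrides the previous map on that ball, so the level sets stay
  Borel.\<close>

lemma finite_measurable_selection:
  assumes "finite Z" "0 < (e::real)"
  shows "\<exists>q::pt \<Rightarrow> pt. (\<forall>z. {x. q x = z} \<in> sets borel) \<and> (\<forall>x\<in>(\<Union>z\<in>Z. ball z e). q x \<in> Z \<and> dist x (q x) \<le> e)"
  using assms(1)
proof (induction Z rule: finite_induct)
  case empty
  show ?case by (intro exI[of _ "\<lambda>_. 0"]) auto
next
  case (insert z Z)
  then obtain q where q: "\<And>w. {x. q x = w} \<in> sets borel" "\<And>x. x \<in> (\<Union>z\<in>Z. ball z e) \<Longrightarrow> q x \<in> Z \<and> dist x (q x) \<le> e" by blast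
  let ?q = "\<lambda>x. if x \<in> ball z e then z else q x"
  have "{x. ?q x = w} = (if w = z then ball z e else {}) \<union> ({x. q x = w} - ball z e)" for w by auto
  then have "{x. ?q x = w} \<in> sets borel" for w using q(1)[of w] by auto
  moreover have "?q x \<in> insert z Z \<and> dist x (?q x) \<le> e" if "x \<in> (\<Union>z\<in>insert z Z. ball z e)" for x
    using that q(2)[of x] by (auto simp: dist_commute)
  ultimately show ?case by (intro exI[of _ ?q]) blast
qed

text \<open>The difference of two translates is \<open>taylor_rem\<close> plus the linear term, both
  evaluated at \<open>z - y\<close>, and the substitution \<open>z - y\<close> is an isometry for
  \<open>h1t\<close>.\<close>

lemma h1t_translate_diff:
  assumes g: "test g" obtains L where "L \<ge> 0" "\<And>x z. dist x z \<le> 1 \<Longrightarrow> h1t (\<lambda>y. g (x - y) - g (z - y)) \<le> L * dist x z"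
proof -
  obtain D where D: "D \<ge> 0" "\<And>h. norm h \<le> 1 \<Longrightarrow> h1t (taylor_rem g h) \<le> D * (norm h)\<^sup>2" using taylor_rem_h1t[OF g] by metis
  let ?S = "\<Sum>i\<in>UNIV. h1t (pd i g)"
  show thesis
  proof (rule that[of "D + ?S"])
    show "0 \<le> D + ?S" using D by (simp add: h1t_nonneg sum_nonneg)
    fix x z :: pt assume d: "dist x z \<le> 1"
    let ?h = "x - z"
    have tc: "test (\<lambda>w. ?h $ i * pd i g w)" for i by (rule test_cmult[OF test_pd[OF g]])
    have ts: "test (\<lambda>w. \<Sum>i\<in>UNIV. ?h $ i * pd i g w)" by (rule test_sum[OF finite tc])
    have tr: "test (taylor_rem g ?h)" by (rule test_taylor_rem[OF g])
    have t: "test (\<lambda>w. taylor_rem g ?h w + (\<Sum>i\<in>UNIV. ?h $ i * pd i g w))" by (rule test_add[OF tr ts])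
    have eq: "(\<lambda>y. g (x - y) - g (z - y)) = (\<lambda>y. (\<lambda>w. taylor_rem g ?h w + (\<Sum>i\<in>UNIV. ?h $ i * pd i g w)) (z - y))"
      by (simp add: taylor_rem_def fun_eq_iff)
    have "h1t (\<lambda>y. g (x - y) - g (z - y)) = h1t (\<lambda>w. taylor_rem g ?h w + (\<Sum>i\<in>UNIV. ?h $ i * pd i g w))"
      unfolding eq by (rule h1t_refl[OF t])
    also have "\<dots> \<le> h1t (taylor_rem g ?h) + (\<Sum>i\<in>UNIV. h1t (\<lambda>w. ?h $ i * pd i g w))"
      by (rule order_trans[OF h1t_triangle[OF tr ts] add_left_mono[OF h1t_sum[OF finite tc]]])
    also have "\<dots> \<le> D * dist x z + (\<Sum>i\<in>UNIV. dist x z * h1t (pd i g))"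
    proof (intro add_mono sum_mono)
      have "h1t (taylor_rem g ?h) \<le> D * (norm ?h)\<^sup>2" using D(2) d by (simp add: dist_norm)
      also have "\<dots> \<le> D * dist x z"
        using d D(1) by (intro mult_left_mono) (auto simp: dist_norm power2_eq_square mult_left_le_one_le)
      finally show "h1t (taylor_rem g ?h) \<le> D * dist x z" .
      show "h1t (\<lambda>w. ?h $ i * pd i g w) \<le> dist x z * h1t (pd i g)" for i
        using component_le_norm_cart[of ?h i] by (simp add: h1t_cmult test_pd g dist_norm mult_right_mono h1t_nonneg)
    qed
    finally show "h1t (\<lambda>y. g (x - y) - g (z - y)) \<le> (D + ?S) * dist x z"
      by (simp add: algebra_simps sum_distrib_left)
  qed
qed

lemma eq_if_abs_diff_le: "(\<And>e. 0 < e \<Longrightarrow> e \<le> 1 \<Longrightarrow> \<bar>a - b\<bar> \<le> C * e) \<Longrightarrow> a = (b::real)"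
proof -
  assume *: "\<And>e. 0 < e \<Longrightarrow> e \<le> 1 \<Longrightarrow> \<bar>a - b\<bar> \<le> C * e"
  have "a - b = 0"
    by (rule eq_zero_if_le_square[where C=C]) (use *[THEN mult_left_mono] in \<open>force simp: power2_eq_square mult_ac\<close>)
  then show ?thesis by simp
qed

text \<open>The integral is compared with Riemann sums: for a measurable map \<open>q\<close> with finitely many values that moves points
  by at most \<open>e\<close>, linearity of \<open>u\<close> applies to \<open>\<Sum>z. c z * g (z - y)\<close>.\<close>
lemma fdist_cv:
  assumes u: "Hm1 u" and g: "test g" and f: "test \<phi>"
  shows "fdist (cv u g) \<phi> = u (conv \<phi> (rfl g))"
proof -
  obtain C where C: "C \<ge> 0" "hm1_le u C" using Hm1_bound[OF u] .
  obtain L where L: "L \<ge> 0" "\<And>x z. dist x z \<le> 1 \<Longrightarrow> h1t (\<lambda>y. g (x - y) - g (z - y)) \<le> L * dist x z"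
    using h1t_translate_diff[OF g] by metis
  obtain M where M: "M \<ge> 0" "\<And>x y. \<bar>g x - g y\<bar> \<le> M * norm (x - y)" using test_Lipschitz[OF g] by metis
  have "\<forall>i. \<exists>B. B \<ge> 0 \<and> (\<forall>x y. \<bar>pd i g x - pd i g y\<bar> \<le> B * norm (x - y))" using test_Lipschitz[OF test_pd[OF g]] by metis
  then obtain B where B: "\<And>i. B i \<ge> 0" "\<And>i x y. \<bar>pd i g x - pd i g y\<bar> \<le> B i * norm (x - y)" by metis
  define n where "n = (\<integral>x. \<bar>\<phi> x\<bar> \<partial>lborel)"
  have n0: "0 \<le> n" by (simp add: n_def)
  have if1: "integrable lborel \<phi>" by (rule test_integrable[OF f])
  let ?K2 = "{a + b | a b. a \<in> tsupp \<phi> \<and> b \<in> tsupp (rfl g)}"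
  let ?m = "sqrt (measure lborel ?K2)"
  have K2: "compact ?K2" by (intro compact_sums test_compact f test_rfl g)
  show ?thesis
  proof (rule eq_if_abs_diff_le)
    fix e :: real assume e: "0 < e" "e \<le> 1"
    obtain Z where Z: "finite Z" "Z \<subseteq> tsupp \<phi>" "tsupp \<phi> \<subseteq> (\<Union>z\<in>Z. ball z e)"
      using compactE_image[OF test_compact[OF f], of "tsupp \<phi>" "\<lambda>z. ball z e"] e by (auto simp: subset_eq) (metis dist_self)
    obtain q where q: "\<And>z. {x. q x = z} \<in> sets borel" "\<And>x. x \<in> (\<Union>z\<in>Z. ball z e) \<Longrightarrow> q x \<in> Z \<and> dist x (q x) \<le> e"
      using finite_measurable_selection[OF Z(1) e(1)] by metis
    have qK: "q x \<in> Z" "dist x (q x) \<le> e" if "\<phi> x \<noteq> 0" for x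
      using q(2)[of x] tsupp_nonzero[of \<phi> x] that Z(3) by blast+
    \<comment> \<open>The Riemann weight of the node \<open>z\<close>: the mass of
      \<open>\<phi>\<close> on the cell \<open>q x = z\<close>.\<close>
    define c where "c z = (\<integral>x. indicator {x. q x = z} x * \<phi> x \<partial>lborel)" for z
    have ii: "integrable lborel (\<lambda>x. indicator {x. q x = z} x * \<phi> x)" for z
      using integrable_mult_indicator[of "{x. q x = z}" lborel \<phi>] q(1)[of z] if1 by simp
    have pw: "(\<Sum>z\<in>Z. F z * (indicator {x. q x = z} x * \<phi> x)) = F (q x) * \<phi> x" for F :: fn and x
    proof (cases "\<phi> x = 0")
      case False
      have "(\<Sum>z\<in>Z. F z * (indicator {x. q x = z} x * \<phi> x)) = (\<Sum>z\<in>Z. if z = q x then F z * \<phi> x else 0)"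
        by (intro sum.cong) (auto simp: indicator_def)
      then show ?thesis using qK(1)[OF False] Z(1) by simp
    qed simp
    have iq: "integrable lborel (\<lambda>x. F (q x) * \<phi> x)" for F :: fn
      unfolding pw[symmetric] using ii by auto
    have cs: "(\<Sum>z\<in>Z. c z * F z) = (\<integral>x. F (q x) * \<phi> x \<partial>lborel)" for F :: fn
      unfolding pw[symmetric] c_def using ii by (simp add: mult.commute)
    \<comment> \<open>One error bound for two uses: \<open>F = cv u g\<close>, and
      \<open>F x = k (x - y)\<close> for fixed \<open>y\<close>, where \<open>k\<close> is
      \<open>g\<close> or one of its derivatives.\<close>
    have est: "\<bar>(\<integral>x. F x * \<phi> x \<partial>lborel) - (\<Sum>z\<in>Z. c z * F z)\<bar> \<le> N * e * n"
      if F: "integrable lborel (\<lambda>x. F x * \<phi> x)" "\<And>x. dist x (q x) \<le> e \<Longrightarrow> \<bar>F x - F (q x)\<bar> \<le> N * e" for F N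
    proof -
      have "\<bar>(\<integral>x. F x * \<phi> x \<partial>lborel) - (\<Sum>z\<in>Z. c z * F z)\<bar> = \<bar>\<integral>x. (F x * \<phi> x - F (q x) * \<phi> x) \<partial>lborel\<bar>"
        unfolding cs using F(1) iq[of F] by simp
      also have "\<dots> \<le> (\<integral>x. (N * e) * \<bar>\<phi> x\<bar> \<partial>lborel)"
      proof (rule order_trans[OF integral_abs_bound], rule integral_mono)
        show "integrable lborel (\<lambda>x. \<bar>F x * \<phi> x - F (q x) * \<phi> x\<bar>)" using F(1) iq[of F] by auto
        show "integrable lborel (\<lambda>x. (N * e) * \<bar>\<phi> x\<bar>)" using if1 by auto
        show "\<bar>F x * \<phi> x - F (q x) * \<phi> x\<bar> \<le> (N * e) * \<bar>\<phi> x\<bar>" for x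
        proof (cases "\<phi> x = 0")
          case False
          have "\<bar>F x * \<phi> x - F (q x) * \<phi> x\<bar> = \<bar>F x - F (q x)\<bar> * \<bar>\<phi> x\<bar>" by (simp add: abs_mult[symmetric] algebra_simps)
          then show ?thesis using F(2)[OF qK(2)[OF False]] by (simp add: mult_right_mono)
        qed simp
      qed
      finally show ?thesis by (simp add: n_def)
    qed
    have "\<bar>fdist (cv u g) \<phi> - (\<Sum>z\<in>Z. c z * cv u g z)\<bar> \<le> (C * L) * e * n"
      unfolding fdist_def
    proof (rule est)
      show "integrable lborel (\<lambda>x. cv u g x * \<phi> x)"
        by (rule test_integrable[OF test_mult[OF smooth_cv[OF u g] f]])
      fix x assume d: "dist x (q x) \<le> e"
      have "\<bar>cv u g x - cv u g (q x)\<bar> = \<bar>u (\<lambda>y. g (x - y) - g (q x - y))\<bar>"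
        unfolding cv_def by (simp add: Hm1_diff[OF u test_refl[OF g] test_refl[OF g]])
      also have "\<dots> \<le> C * h1t (\<lambda>y. g (x - y) - g (q x - y))"
        by (rule hm1_leD[OF C(2) test_diff[OF test_refl[OF g] test_refl[OF g]]])
      also have "\<dots> \<le> C * (L * e)"
        using L(2)[of x "q x"] d e L(1) by (intro mult_left_mono C(1)) (auto intro: order_trans mult_left_mono)
      finally show "\<bar>cv u g x - cv u g (q x)\<bar> \<le> C * L * e" by simp
    qed
    moreover have "\<bar>u (conv \<phi> (rfl g)) - (\<Sum>z\<in>Z. c z * cv u g z)\<bar> \<le> C * ((M + (\<Sum>i\<in>UNIV. B i)) * e * n * ?m)"
    proof -
      \<comment> \<open>Applying \<open>u\<close> to \<open>E g\<close> gives the error of the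
        Riemann sum for the right-hand side, so \<open>E g\<close> must be small in
        \<open>h1t\<close>. Since \<open>pd i (E g)\<close> is minus \<open>E (pd i g)\<close>, sup
        bounds for \<open>E g\<close> and \<open>E (pd i g)\<close> on the fixed compact set
        \<open>?K2\<close> suffice.\<close>
      define E where "E k y = conv \<phi> (rfl k) y - (\<Sum>z\<in>Z. c z * k (z - y))" for k y
      have tE: "test (\<lambda>y. \<Sum>z\<in>Z. c z * k (z - y))" "test (E k)" if "test k" for k
      proof -
        show 1: "test (\<lambda>y. \<Sum>z\<in>Z. c z * k (z - y))" by (rule test_sum[OF Z(1) test_cmult[OF test_refl[OF that]]])
        show "test (E k)" unfolding E_def by (rule test_diff[OF test_conv[OF f test_rfl[OF that]] 1])
      qed
      have bE: "\<bar>E k y\<bar> \<le> N * e * n" if "test k" "\<And>x y. \<bar>k x - k y\<bar> \<le> N * norm (x - y)" "N \<ge> 0" for k N y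
      proof -
        have "E k y = (\<integral>x. k (x - y) * \<phi> x \<partial>lborel) - (\<Sum>z\<in>Z. c z * k (z - y))"
          by (simp add: E_def conv_eq rfl_def mult.commute)
        moreover have "\<bar>\<dots>\<bar> \<le> N * e * n"
        proof (rule est)
          show "integrable lborel (\<lambda>x. k (x - y) * \<phi> x)"
            using test_integrable[OF test_mult[OF test_smooth[OF test_shift[OF that(1)]] f], of "-y"] by simp
          show "\<bar>k (x - y) - k (q x - y)\<bar> \<le> N * e" if "dist x (q x) \<le> e" for x
            using \<open>\<And>x y. \<bar>k x - k y\<bar> \<le> N * norm (x - y)\<close>[of "x - y" "q x - y"] mult_left_mono[OF that \<open>N \<ge> 0\<close>]
            by (simp add: dist_norm)
        qed
        ultimately show ?thesis by simp
      qed
      have nz: "y \<in> ?K2" if "E k y \<noteq> 0" "test k" "tsupp k \<subseteq> tsupp g" for k y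
      proof (cases "conv \<phi> (rfl k) y = 0")
        case False
        have "y \<in> {a + b | a b. a \<in> tsupp \<phi> \<and> b \<in> tsupp (rfl k)}"
          using tsupp_conv[OF f test_rfl[OF that(2)]] tsupp_nonzero[of "conv \<phi> (rfl k)", OF False] by blast
        moreover have "tsupp (rfl k) \<subseteq> tsupp (rfl g)"
        proof -
          show ?thesis unfolding tsupp_rfl using that(3) by blast
        qed
        ultimately show ?thesis by blast
      next
        case True
        have "\<exists>z\<in>Z. k (z - y) \<noteq> 0"
        proof (rule ccontr)
          assume "\<not> (\<exists>z\<in>Z. k (z - y) \<noteq> 0)"
          then have "(\<Sum>z\<in>Z. c z * k (z - y)) = 0" by (intro sum.neutral) auto
          then show False using True \<open>E k y \<noteq> 0\<close> by (simp add: E_def)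
        qed
        then obtain z where z: "z \<in> Z" "k (z - y) \<noteq> 0" by blast
        have "z - y \<in> tsupp g" using tsupp_nonzero[of k "z - y"] z(2) that(3) by blast
        have "y - z \<in> tsupp (rfl g)" unfolding tsupp_rfl using \<open>z - y \<in> tsupp g\<close> by (force simp: image_iff)
        then show ?thesis using z(1) Z(2) by (intro CollectI exI[of _ z] exI[of _ "y - z"]) auto
      qed
      have pE: "pd i (E g) = (\<lambda>y. - E (pd i g) y)" for i
      proof -
        have a: "pd i (conv \<phi> (rfl g)) = (\<lambda>y. - conv \<phi> (rfl (pd i g)) y)"
          by (simp add: pd_conv[OF f test_rfl[OF g]] pd_rfl[OF g] conv_eq fun_eq_iff)
        have b: "pd i (\<lambda>y. \<Sum>z\<in>Z. c z * g (z - y)) = (\<lambda>y. - (\<Sum>z\<in>Z. c z * pd i g (z - y)))"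
          using pd_sum[OF Z(1), of "\<lambda>z y. c z * g (z - y)" i] test_refl[OF g]
          by (simp add: pd_cmult test_smooth test_cmult pd_refl[OF test_smooth[OF g]] sum_negf)
        show ?thesis unfolding E_def
          by (simp add: pd_diff[OF test_smooth[OF test_conv[OF f test_rfl[OF g]]] test_smooth[OF tE(1)[OF g]]] a b fun_eq_iff)
      qed
      have "h1t (E g) \<le> n2 (E g) + (\<Sum>i\<in>UNIV. n2 (pd i (E g)))" by (rule h1t_le_sum)
      also have "\<dots> \<le> (M * e * n) * ?m + (\<Sum>i\<in>UNIV. (B i * e * n) * ?m)"
      proof (intro add_mono sum_mono)
        show "n2 (E g) \<le> (M * e * n) * ?m"
          using bE[OF g M(2) M(1)] nz[OF _ g subset_refl] K2 M(1) e n0 by (intro n2_le_bound test_L2 tE g) auto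
        fix i
        have "n2 (pd i (E g)) = n2 (E (pd i g))" using n2_cmult[of "-1" "E (pd i g)"] by (simp add: pE)
        also have "\<dots> \<le> (B i * e * n) * ?m"
          using bE[OF test_pd[OF g] B(2) B(1)] nz[OF _ test_pd[OF g] tsupp_pd] K2 B(1) e n0
          by (intro n2_le_bound test_L2 tE test_pd g) auto
        finally show "n2 (pd i (E g)) \<le> (B i * e * n) * ?m" .
      qed
      finally have hE: "h1t (E g) \<le> (M + (\<Sum>i\<in>UNIV. B i)) * e * n * ?m"
        by (simp add: distrib_right sum_distrib_right)
      have "u (conv \<phi> (rfl g)) - (\<Sum>z\<in>Z. c z * cv u g z) = u (E g)"
      proof -
        have "u (\<lambda>y. \<Sum>z\<in>Z. c z * g (z - y)) = (\<Sum>z\<in>Z. c z * cv u g z)"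
          unfolding cv_def using Hm1_sum[OF Z(1) u, of "\<lambda>z y. c z * g (z - y)"]
          by (simp add: test_cmult test_refl[OF g] Hm1_cmult[OF u])
        then show ?thesis unfolding E_def
          by (simp add: Hm1_diff[OF u test_conv[OF f test_rfl[OF g]] tE(1)[OF g]])
      qed
      also have "\<bar>u (E g)\<bar> \<le> C * h1t (E g)" by (rule hm1_leD[OF C(2) tE(2)[OF g]])
      also have "\<dots> \<le> C * ((M + (\<Sum>i\<in>UNIV. B i)) * e * n * ?m)" by (rule mult_left_mono[OF hE C(1)])
      finally show ?thesis .
    qed
    ultimately have "\<bar>fdist (cv u g) \<phi> - u (conv \<phi> (rfl g))\<bar> \<le> (C * L) * e * n + C * ((M + (\<Sum>i\<in>UNIV. B i)) * e * n * ?m)"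
      by linarith
    also have "\<dots> = ((C * L) * n + C * ((M + (\<Sum>i\<in>UNIV. B i)) * n * ?m)) * e" by (simp add: algebra_simps)
    finally show "\<bar>fdist (cv u g) \<phi> - u (conv \<phi> (rfl g))\<bar> \<le> ((C * L) * n + C * ((M + (\<Sum>i\<in>UNIV. B i)) * n * ?m)) * e" .
  qed
qed

section \<open>Dyadic kernels\<close>

definition n1 :: "fn \<Rightarrow> real" where "n1 g = (\<integral>x. \<bar>g x\<bar> \<partial>lborel)"

lemma n1_nonneg: "0 \<le> n1 g" by (simp add: n1_def)

lemma n2_rfl: "test f \<Longrightarrow> n2 (rfl f) = n2 f"
  using n2_refl[of f 0] by (simp add: rfl_def)

lemma conv_sup: assumes "test f" "test g" shows "\<bar>conv f g x\<bar> \<le> n2 f * n2 g"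
  unfolding conv_eq
  using L2_Cauchy_Schwarz[OF test_L2[OF assms(1)] test_L2[OF test_refl[OF assms(2), of x]]] n2_refl[OF assms(2), of x] by simp

lemma conv_adjoint: "test f \<Longrightarrow> test g \<Longrightarrow> test \<phi> \<Longrightarrow> fdist (conv f g) \<phi> = fdist f (conv \<phi> (rfl g))"
  unfolding conv_def[of f] by (rule fdist_cv[OF Hm1_fdist[OF test_L2]])

lemma fdist_self: "fdist f f = (n2 f)\<^sup>2"
  by (simp only: n2_sq) (simp add: fdist_def l2sq_def power2_eq_square)

text \<open>The square of the left norm is the pairing of \<open>g\<close> with
  \<open>conv (conv f g) (rfl f)\<close>, which is bounded pointwise by Cauchy-Schwarz
  (\<open>conv_sup\<close>); one factor of the norm then cancels.\<close>

lemma young: assumes f: "test f" and g: "test g" shows "n2 (conv f g) \<le> n1 g * n2 f"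
proof -
  let ?F = "conv f g"
  have F: "test ?F" by (rule test_conv[OF f g])
  have c: "test (conv ?F (rfl f))" by (rule test_conv[OF F test_rfl[OF f]])
  have "(n2 ?F)\<^sup>2 = fdist (conv g f) ?F" by (simp add: fdist_self conv_commute[OF f g, symmetric])
  also have "\<dots> = fdist g (conv ?F (rfl f))" by (rule conv_adjoint[OF g f F])
  also have "\<dots> \<le> \<bar>\<dots>\<bar>" by simp
  also have "\<dots> \<le> (\<integral>x. \<bar>g x\<bar> * (n2 ?F * n2 f) \<partial>lborel)"
    unfolding fdist_def
  proof (rule order_trans[OF integral_abs_bound], rule integral_mono)
    show "integrable lborel (\<lambda>x. \<bar>g x * conv ?F (rfl f) x\<bar>)"
      using test_integrable[OF test_mult[OF test_smooth[OF g] c]] by auto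
    show "integrable lborel (\<lambda>x. \<bar>g x\<bar> * (n2 ?F * n2 f))" using test_integrable[OF g] by auto
    show "\<bar>g x * conv ?F (rfl f) x\<bar> \<le> \<bar>g x\<bar> * (n2 ?F * n2 f)" for x
      using conv_sup[OF F test_rfl[OF f], of x] by (simp add: abs_mult n2_rfl[OF f] mult_left_mono)
  qed
  also have "\<dots> = n2 ?F * (n1 g * n2 f)" by (simp add: n1_def)
  finally have "n2 ?F * n2 ?F \<le> n2 ?F * (n1 g * n2 f)" by (simp add: power2_eq_square)
  then show ?thesis
    using n2_nonneg[of ?F] n2_nonneg[of f] n1_nonneg[of g] by (cases "n2 ?F = 0") (auto simp: mult_le_cancel_left)
qed

text \<open>Associativity is the adjoint relation tested on a reflected translate of
  \<open>b\<close>.\<close>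

lemma conv_assoc: assumes f: "test f" and a: "test a" and b: "test b"
  shows "conv (conv f a) b = conv f (conv a b)"
proof
  fix x
  have "conv (conv f a) b x = fdist (conv f a) (\<lambda>y. b (x - y))" by (simp add: conv_def cv_def)
  also have "\<dots> = fdist f (conv (\<lambda>y. b (x - y)) (rfl a))" by (rule conv_adjoint[OF f a test_refl[OF b]])
  also have "conv (\<lambda>y. b (x - y)) (rfl a) = (\<lambda>z. conv a b (x - z))"
  proof
    fix z
    have m: "(\<lambda>y. b (x - y) * a (y - z)) \<in> borel_measurable borel"
      using test_borel[OF test_mult[OF test_smooth[OF test_refl[OF b, of x]] test_shift[OF a, of "-z"]]] by simp
    have "conv (\<lambda>y. b (x - y)) (rfl a) z = (\<integral>y. b (x - y) * a (y - z) \<partial>lborel)"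
      by (simp add: conv_eq rfl_def)
    also have "\<dots> = (\<integral>y. b (x - (y + z)) * a (y + z - z) \<partial>lborel)"
      by (rule lborel_integral_shift[OF m, symmetric])
    also have "\<dots> = conv a b (x - z)" by (simp add: conv_eq algebra_simps)
    finally show "conv (\<lambda>y. b (x - y)) (rfl a) z = conv a b (x - z)" .
  qed
  also have "fdist f (\<lambda>z. conv a b (x - z)) = conv f (conv a b) x" by (simp add: conv_def[of f] cv_def)
  finally show "conv (conv f a) b x = conv f (conv a b) x" .
qed

lemma conv_cmult_right: "conv f (\<lambda>x. c * g x) = (\<lambda>x. c * conv f g x)"
proof -
  have "(\<integral>y. f y * (c * g (x - y)) \<partial>lborel) = (\<integral>y. c * (f y * g (x - y)) \<partial>lborel)" for x
    by (simp add: mult_ac)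
  then show ?thesis by (simp add: fun_eq_iff conv_eq)
qed

lemma conv_cmult_left: "conv (\<lambda>x. c * f x) g = (\<lambda>x. c * conv f g x)"
  by (simp add: fun_eq_iff conv_eq mult.assoc)

lemma conv_integrable: "test f \<Longrightarrow> test g \<Longrightarrow> integrable lborel (\<lambda>y. f y * g (x - y))"
  by (rule test_integrable[OF test_mult[OF test_smooth test_refl]])

lemma conv_add_right: "test f \<Longrightarrow> test g \<Longrightarrow> test h \<Longrightarrow> conv f (\<lambda>x. g x + h x) = (\<lambda>x. conv f g x + conv f h x)"
  by (simp add: fun_eq_iff conv_eq distrib_left conv_integrable)

lemma conv_diff_right: "test f \<Longrightarrow> test g \<Longrightarrow> test h \<Longrightarrow> conv f (\<lambda>x. g x - h x) = (\<lambda>x. conv f g x - conv f h x)"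
  by (simp add: fun_eq_iff conv_eq right_diff_distrib conv_integrable)

lemma conv_diff_left: "test f \<Longrightarrow> test g \<Longrightarrow> test h \<Longrightarrow> conv (\<lambda>x. g x - h x) f = (\<lambda>x. conv g f x - conv h f x)"
  by (simp add: fun_eq_iff conv_eq left_diff_distrib conv_integrable)

text \<open>The factor \<open>8 ^ k\<close> keeps the integral and the L1 norm fixed in dimension
  three (\<open>integral_dil\<close>, \<open>n1_dil\<close>).\<close>

definition dil :: "nat \<Rightarrow> fn \<Rightarrow> fn" where "dil k g x = 8 ^ k * g (2 ^ k *\<^sub>R x)"

lemma test_dil: "test g \<Longrightarrow> test (dil k g)"
  unfolding dil_def using test_cmult[OF test_affine[of g "2^k" 0]] by simp

lemma pd_dil: "test g \<Longrightarrow> pd i (dil k g) = (\<lambda>x. 2 ^ k * dil k (pd i g) x)"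
  unfolding dil_def
  using pd_cmult[OF smooth_fn_affine[OF test_smooth[of g], of "2^k" 0], of i "8^k"] pd_affine[OF test_smooth[of g], of i "2^k" 0]
  by (simp add: mult.left_commute)

lemma rfl_dil: "rfl (dil k g) = dil k (rfl g)"
  by (simp add: rfl_def dil_def fun_eq_iff)

lemma n1_dil: assumes "test g" shows "n1 (dil k g) = n1 g"
proof -
  have "(\<integral>x. \<bar>g (2 ^ k *\<^sub>R x + 0)\<bar> \<partial>lborel) = (\<integral>x. \<bar>g x\<bar> \<partial>lborel) / \<bar>2 ^ k\<bar> ^ 3"
    using test_borel[OF assms] by (intro lborel_integral_affine[of "\<lambda>x. \<bar>g x\<bar>"]) auto
  moreover have "((2::real) ^ k) ^ 3 = (2 ^ 3) ^ k" by (simp only: power_mult[symmetric] mult.commute)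
  then have "(8::real) ^ k = (2 ^ k) ^ 3" by simp
  ultimately show ?thesis by (simp add: n1_def dil_def abs_mult)
qed

text \<open>One half to the power of the distance between \<open>k\<close> and \<open>l\<close>; the
  case split avoids truncated subtraction.\<close>

definition dyadic_weight :: "nat \<Rightarrow> nat \<Rightarrow> real" where "dyadic_weight k l = (if k \<le> l then (1/2) ^ (l - k) else (1/2) ^ (k - l))"

text \<open>The geometric series on either side of \<open>k\<close> are at most 2 each.\<close>

lemma dyadic_weight_sum: "(\<Sum>l\<in>{m..<n}. dyadic_weight k l) \<le> 4"
proof -
  have a: "(\<Sum>l\<in>{..k}. (1/2::real) ^ (k - l)) \<le> 2"
  proof (induction k)
    case (Suc k)
    have "(\<Sum>l\<in>{..Suc k}. (1/2::real) ^ (Suc k - l)) = 1 + (\<Sum>l\<in>{..k}. (1/2) * (1/2) ^ (k - l))"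
      by (simp add: Suc_diff_le)
    also have "\<dots> = 1 + (1/2) * (\<Sum>l\<in>{..k}. (1/2) ^ (k - l))" by (simp only: sum_distrib_left)
    finally show ?case using Suc by linarith
  qed simp
  have b: "(\<Sum>l\<in>{k..<N}. (1/2::real) ^ (l - k)) \<le> 2 - 2 * (1/2) ^ (N - k)" if "k \<le> N" for N
    using that by (induction N rule: dec_induct) (auto simp: Suc_diff_le)
  have "(\<Sum>l\<in>{m..<n}. dyadic_weight k l) \<le> (\<Sum>l\<in>{..k} \<union> {k..<max n k}. dyadic_weight k l)"
    by (intro sum_mono2) (auto simp: dyadic_weight_def)
  also have "\<dots> \<le> (\<Sum>l\<in>{..k}. dyadic_weight k l) + (\<Sum>l\<in>{k..<max n k}. dyadic_weight k l)"
    by (subst sum_Un) (auto simp: dyadic_weight_def intro!: sum_nonneg)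
  also have "(\<Sum>l\<in>{..k}. dyadic_weight k l) = (\<Sum>l\<in>{..k}. (1/2::real) ^ (k - l))"
    by (intro sum.cong) (auto simp: dyadic_weight_def)
  also have "(\<Sum>l\<in>{k..<max n k}. dyadic_weight k l) = (\<Sum>l\<in>{k..<max n k}. (1/2::real) ^ (l - k))"
    by (intro sum.cong) (auto simp: dyadic_weight_def)
  finally show ?thesis using a b[of "max n k"] by (smt (verit) max.cobounded2 zero_le_power zero_le_divide_1_iff)
qed

lemma dyadic_weight_commute: "dyadic_weight k l = dyadic_weight l k" by (auto simp: dyadic_weight_def)

text \<open>Almost orthogonality: for \<open>k \<le> l\<close> one derivative is moved from the finer to the coarser scale,
  which gains a factor \<open>2^(k - l)\<close>.\<close>
lemma almost_orthogonal:
  assumes \<Theta>: "test \<Theta>"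
  shows "\<exists>C\<ge>0. \<forall>w m n. (\<forall>k. test (w k)) \<longrightarrow>
       (n2 (\<lambda>x. \<Sum>k\<in>{m..<n}. conv (w k) (dil k (pd i \<Theta>)) x))\<^sup>2 \<le> C * (\<Sum>k\<in>{m..<n}. (n2 (w k))\<^sup>2)"
proof -
  let ?\<psi> = "pd i \<Theta>"
  define A where "A = n1 (pd i ?\<psi>) * n1 \<Theta>"
  have A: "0 \<le> A" by (simp add: A_def n1_nonneg)
  have \<psi>: "test ?\<psi>" "test (pd i ?\<psi>)" using \<Theta> by (simp_all add: test_pd)
  have le: "\<bar>\<integral>x. conv (w k) (dil k ?\<psi>) x * conv (w l) (dil l ?\<psi>) x \<partial>lborel\<bar> \<le> A * dyadic_weight k l * (n2 (w k) * n2 (w l))"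
    if w: "\<And>k. test (w k)" and kl: "k \<le> l" for w k l
  proof -
    let ?F = "conv (w k) (dil k ?\<psi>)" and ?G = "conv (w l) (dil l \<Theta>)"
    have F: "test ?F" by (rule test_conv[OF w test_dil[OF \<psi>(1)]])
    have G: "test ?G" by (rule test_conv[OF w test_dil[OF \<Theta>]])
    have pG: "pd i ?G = (\<lambda>x. 2 ^ l * conv (w l) (dil l ?\<psi>) x)"
      unfolding pd_conv[OF w test_dil[OF \<Theta>]] pd_dil[OF \<Theta>] conv_cmult_right ..
    have pF: "pd i ?F = (\<lambda>x. 2 ^ k * conv (w k) (dil k (pd i ?\<psi>)) x)"
      unfolding pd_conv[OF w test_dil[OF \<psi>(1)]] pd_dil[OF \<psi>(1)] conv_cmult_right ..
    have "2 ^ l * (\<integral>x. ?F x * conv (w l) (dil l ?\<psi>) x \<partial>lborel) = (\<integral>x. ?F x * pd i ?G x \<partial>lborel)"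
      unfolding pG by (simp add: mult.left_commute)
    also have "\<dots> = - (\<integral>x. pd i ?F x * ?G x \<partial>lborel)" by (rule integral_by_parts[OF F test_smooth[OF G]])
    finally have "\<bar>2 ^ l * (\<integral>x. ?F x * conv (w l) (dil l ?\<psi>) x \<partial>lborel)\<bar> = \<bar>\<integral>x. pd i ?F x * ?G x \<partial>lborel\<bar>"
      by (simp only: abs_minus_cancel)
    then have "2 ^ l * \<bar>\<integral>x. ?F x * conv (w l) (dil l ?\<psi>) x \<partial>lborel\<bar> = \<bar>\<integral>x. pd i ?F x * ?G x \<partial>lborel\<bar>"
      by (simp only: abs_mult) simp
    also have "\<dots> \<le> n2 (pd i ?F) * n2 ?G" by (rule L2_Cauchy_Schwarz[OF test_L2[OF test_pd[OF F]] test_L2[OF G]])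
    also have "\<dots> \<le> (2 ^ k * (n1 (pd i ?\<psi>) * n2 (w k))) * (n1 \<Theta> * n2 (w l))"
    proof (rule mult_mono)
      show "n2 (pd i ?F) \<le> 2 ^ k * (n1 (pd i ?\<psi>) * n2 (w k))"
        using young[OF w[of k] test_dil[OF \<psi>(2), of k]] by (simp add: pF n2_cmult n1_dil[OF \<psi>(2)])
      show "n2 ?G \<le> n1 \<Theta> * n2 (w l)"
        using young[OF w[of l] test_dil[OF \<Theta>, of l]] by (simp add: n1_dil[OF \<Theta>])
    qed (auto simp: n1_nonneg n2_nonneg)
    finally have "\<bar>\<integral>x. ?F x * conv (w l) (dil l ?\<psi>) x \<partial>lborel\<bar> \<le> (2 ^ k / 2 ^ l) * (A * (n2 (w k) * n2 (w l)))"
      by (simp add: A_def field_simps)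
    also have "2 ^ k / 2 ^ l = dyadic_weight k l"
      using kl by (simp add: dyadic_weight_def power_diff power_one_over field_simps)
    finally show ?thesis by (simp add: mult_ac)
  qed
  show ?thesis
  proof (intro exI[of _ "4 * A"] conjI allI impI)
    fix w :: "nat \<Rightarrow> fn" and m n :: nat
    assume "\<forall>k. test (w k)"
    then have w: "\<And>k. test (w k)" by blast
    let ?I = "{m..<n}"
    define F where "F k = conv (w k) (dil k ?\<psi>)" for k
    have F: "test (F k)" for k unfolding F_def by (rule test_conv[OF w test_dil[OF \<psi>(1)]])
    have ip: "integrable lborel (\<lambda>x. F k x * F l x)" for k l
      by (rule test_integrable[OF test_mult[OF test_smooth[OF F] F]])
    have b: "\<bar>\<integral>x. F k x * F l x \<partial>lborel\<bar> \<le> A * dyadic_weight k l * (((n2 (w k))\<^sup>2 + (n2 (w l))\<^sup>2) / 2)" for k l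
    proof -
      have "\<bar>\<integral>x. F k x * F l x \<partial>lborel\<bar> \<le> A * dyadic_weight k l * (n2 (w k) * n2 (w l))"
      proof (cases "k \<le> l")
        case True then show ?thesis unfolding F_def by (rule le[OF w])
      next
        case False
        then show ?thesis using le[OF w, of l k] unfolding F_def by (simp add: mult.commute dyadic_weight_commute[of l k])
      qed
      also have "\<dots> \<le> A * dyadic_weight k l * (((n2 (w k))\<^sup>2 + (n2 (w l))\<^sup>2) / 2)"
        using sum_squares_bound[of "n2 (w k)" "n2 (w l)"] A by (intro mult_left_mono) (auto simp: dyadic_weight_def)
      finally show ?thesis .
    qed
    \<comment> \<open>Schur's test: expand the square, split each product of norms by the
      arithmetic-geometric mean inequality, and bound the row sums of \<open>dyadic_weight\<close>
      by 4.\<close>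
    have "(n2 (\<lambda>x. \<Sum>k\<in>?I. F k x))\<^sup>2 = (\<integral>x. (\<Sum>k\<in>?I. \<Sum>l\<in>?I. F k x * F l x) \<partial>lborel)"
      by (simp only: n2_sq l2sq_def) (simp add: power2_eq_square sum_product)
    also have "\<dots> = (\<Sum>k\<in>?I. \<Sum>l\<in>?I. \<integral>x. F k x * F l x \<partial>lborel)"
      using ip by simp
    also have "\<dots> \<le> (\<Sum>k\<in>?I. \<Sum>l\<in>?I. A * dyadic_weight k l * (((n2 (w k))\<^sup>2 + (n2 (w l))\<^sup>2) / 2))"
      by (intro sum_mono order_trans[OF abs_ge_self b])
    also have "\<dots> = A / 2 * ((\<Sum>k\<in>?I. \<Sum>l\<in>?I. dyadic_weight k l * (n2 (w k))\<^sup>2) + (\<Sum>k\<in>?I. \<Sum>l\<in>?I. dyadic_weight k l * (n2 (w l))\<^sup>2))"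
      by (simp add: sum_distrib_left sum.distrib distrib_left add_divide_distrib mult_ac)
    also have "(\<Sum>k\<in>?I. \<Sum>l\<in>?I. dyadic_weight k l * (n2 (w l))\<^sup>2) = (\<Sum>k\<in>?I. \<Sum>l\<in>?I. dyadic_weight k l * (n2 (w k))\<^sup>2)"
      by (subst sum.swap) (simp add: dyadic_weight_commute)
    also have "A / 2 * ((\<Sum>k\<in>?I. \<Sum>l\<in>?I. dyadic_weight k l * (n2 (w k))\<^sup>2) + (\<Sum>k\<in>?I. \<Sum>l\<in>?I. dyadic_weight k l * (n2 (w k))\<^sup>2))
       = A * (\<Sum>k\<in>?I. (\<Sum>l\<in>?I. dyadic_weight k l) * (n2 (w k))\<^sup>2)" by (simp add: sum_distrib_right)
    also have "\<dots> \<le> A * (\<Sum>k\<in>?I. 4 * (n2 (w k))\<^sup>2)"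
      by (intro mult_left_mono sum_mono mult_right_mono dyadic_weight_sum A) auto
    finally show "(n2 (\<lambda>x. \<Sum>k\<in>?I. conv (w k) (dil k ?\<psi>) x))\<^sup>2 \<le> 4 * A * (\<Sum>k\<in>?I. (n2 (w k))\<^sup>2)"
      by (simp add: F_def sum_distrib_left mult_ac)
  qed (use A in simp)
qed

text \<open>A derivative of \<open>(1/2) ^ k * conv (w k) (dil k \<Theta>)\<close> is exactly
  \<open>conv (w k) (dil k (pd i \<Theta>))\<close>, so the pieces of the gradient are almost
  orthogonal with no moment condition on \<open>\<Theta>\<close>. The function itself is controlled
  by Young's inequality and the square summable weights \<open>(1/2) ^ k\<close>.\<close>

lemma h1t_dyadic_sum:
  assumes \<Theta>: "test \<Theta>"
  shows "\<exists>C\<ge>0. \<forall>w m n. (\<forall>k. test (w k)) \<longrightarrow>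
       h1t (\<lambda>x. \<Sum>k\<in>{m..<n}. (1/2) ^ k * conv (w k) (dil k \<Theta>) x) \<le> C * sqrt (\<Sum>k\<in>{m..<n}. (n2 (w k))\<^sup>2)"
proof -
  have "\<forall>i. \<exists>C\<ge>0. \<forall>w m n. (\<forall>k. test (w k)) \<longrightarrow>
       (n2 (\<lambda>x. \<Sum>k\<in>{m..<n}. conv (w k) (dil k (pd i \<Theta>)) x))\<^sup>2 \<le> C * (\<Sum>k\<in>{m..<n}. (n2 (w k))\<^sup>2)"
    by (intro allI almost_orthogonal[OF \<Theta>])
  from choice[OF this] obtain C where C: "\<And>i. C i \<ge> 0" "\<And>i w m n. (\<forall>k. test (w k)) \<Longrightarrow>
       (n2 (\<lambda>x. \<Sum>k\<in>{m..<n}. conv (w k) (dil k (pd i \<Theta>)) x))\<^sup>2 \<le> C i * (\<Sum>k\<in>{m..<n}. (n2 (w k))\<^sup>2)" by blast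
  show ?thesis
  proof (intro exI[of _ "n1 \<Theta> * 2 + (\<Sum>i\<in>UNIV. sqrt (C i))"] conjI allI impI)
    show "0 \<le> n1 \<Theta> * 2 + (\<Sum>i\<in>UNIV. sqrt (C i))" by (simp add: n1_nonneg C sum_nonneg)
    fix w :: "nat \<Rightarrow> fn" and m n :: nat
    assume "\<forall>k. test (w k)"
    then have w: "\<And>k. test (w k)" by blast
    let ?I = "{m..<n}"
    define S where "S = (\<Sum>k\<in>?I. (n2 (w k))\<^sup>2)"
    have t: "test (conv (w k) (dil k \<Theta>))" for k by (rule test_conv[OF w test_dil[OF \<Theta>]])
    have tk: "test (\<lambda>x. (1/2) ^ k * conv (w k) (dil k \<Theta>) x)" for k by (rule test_cmult[OF t])
    let ?G = "\<lambda>x. \<Sum>k\<in>?I. (1/2) ^ k * conv (w k) (dil k \<Theta>) x"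
    have "n2 ?G \<le> (\<Sum>k\<in>?I. n2 (\<lambda>x. (1/2) ^ k * conv (w k) (dil k \<Theta>) x))"
      by (rule n2_sum) (auto intro: test_L2 tk)
    also have "\<dots> \<le> (\<Sum>k\<in>?I. n1 \<Theta> * ((1/2) ^ k * n2 (w k)))"
    proof (rule sum_mono)
      fix k
      have "n2 (\<lambda>x. (1/2) ^ k * conv (w k) (dil k \<Theta>) x) = (1/2) ^ k * n2 (conv (w k) (dil k \<Theta>))"
        by (subst n2_cmult) simp
      also have "\<dots> \<le> (1/2) ^ k * (n1 \<Theta> * n2 (w k))"
        using young[OF w test_dil[OF \<Theta>], of k k] by (intro mult_left_mono) (simp_all add: n1_dil[OF \<Theta>])
      finally show "n2 (\<lambda>x. (1/2) ^ k * conv (w k) (dil k \<Theta>) x) \<le> n1 \<Theta> * ((1/2) ^ k * n2 (w k))"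
        by (simp only: mult.left_commute)
    qed
    also have "\<dots> = n1 \<Theta> * (\<Sum>k\<in>?I. (1/2) ^ k * n2 (w k))" by (simp add: sum_distrib_left)
    also have "\<dots> \<le> n1 \<Theta> * (2 * sqrt S)"
    proof (intro mult_left_mono n1_nonneg)
      have "(\<Sum>k\<in>?I. (1/2) ^ k * n2 (w k))\<^sup>2 \<le> (\<Sum>k\<in>?I. ((1/2) ^ k)\<^sup>2) * S"
        unfolding S_def by (rule Cauchy_Schwarz_ineq_sum)
      also have "\<dots> \<le> 4 * S"
      proof (rule mult_right_mono)
        have "(\<Sum>k\<in>?I. ((1/2::real) ^ k)\<^sup>2) \<le> (\<Sum>k\<in>?I. dyadic_weight 0 k)"
          by (intro sum_mono) (simp add: dyadic_weight_def power2_eq_square mult_left_le power_le_one)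
        then show "(\<Sum>k\<in>?I. ((1/2::real) ^ k)\<^sup>2) \<le> 4" using dyadic_weight_sum[where k=0 and m=m and n=n] by linarith
      qed (simp add: S_def sum_nonneg)
      finally have "sqrt ((\<Sum>k\<in>?I. (1/2) ^ k * n2 (w k))\<^sup>2) \<le> sqrt (4 * S)" by (rule real_sqrt_le_mono)
      then show "(\<Sum>k\<in>?I. (1/2) ^ k * n2 (w k)) \<le> 2 * sqrt S"
        by (simp add: real_sqrt_mult)
    qed
    finally have a: "n2 ?G \<le> n1 \<Theta> * 2 * sqrt S" by simp
    have b: "n2 (pd i ?G) \<le> sqrt (C i) * sqrt S" for i
    proof -
      have "pd i ?G = (\<lambda>x. \<Sum>k\<in>?I. conv (w k) (dil k (pd i \<Theta>)) x)"
      proof -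
        have "pd i (\<lambda>x. (1/2) ^ k * conv (w k) (dil k \<Theta>) x) = (\<lambda>x. conv (w k) (dil k (pd i \<Theta>)) x)" for k
          unfolding pd_cmult[OF test_smooth[OF t]] pd_conv[OF w test_dil[OF \<Theta>]] pd_dil[OF \<Theta>] conv_cmult_right
          by (simp add: power_one_over)
        then show ?thesis by (subst pd_sum[OF _ test_smooth[OF tk]]) (simp_all only: finite_atLeastLessThan)
      qed
      then have "(n2 (pd i ?G))\<^sup>2 \<le> C i * S" using C(2)[of w i m n] w by (simp add: S_def)
      then have "sqrt ((n2 (pd i ?G))\<^sup>2) \<le> sqrt (C i * S)" by (rule real_sqrt_le_mono)
      then show ?thesis by (simp add: real_sqrt_mult n2_nonneg)
    qed
    have "h1t ?G \<le> n1 \<Theta> * 2 * sqrt S + (\<Sum>i\<in>UNIV. sqrt (C i) * sqrt S)"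
      by (intro order_trans[OF h1t_le_sum] add_mono sum_mono a b)
    then show "h1t ?G \<le> (n1 \<Theta> * 2 + (\<Sum>i\<in>UNIV. sqrt (C i))) * sqrt (\<Sum>k\<in>?I. (n2 (w k))\<^sup>2)"
      by (simp add: S_def[symmetric] distrib_right sum_distrib_right)
  qed
qed

text \<open>The dual of \<open>h1t_dyadic_sum\<close>. By the adjoint relation the sum of squares
  \<open>S\<close> equals \<open>u\<close> applied to a dyadic sum built from the pieces
  \<open>F k\<close> themselves, whose \<open>h1t\<close> is at most \<open>C * sqrt S\<close>; one
  factor \<open>sqrt S\<close> cancels. The constant is uniform in \<open>u\<close>,
  \<open>K\<close> and the range of scales.\<close>

lemma square_function:
  assumes \<Theta>: "test \<Theta>"
  shows "\<exists>C\<ge>0. \<forall>u K c m n. Hm1 u \<longrightarrow> supp_in u K \<longrightarrow> compact K \<longrightarrow> 0 \<le> c \<longrightarrow> hm1_le u c \<longrightarrow>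
       sqrt (\<Sum>k\<in>{m..<n}. (n2 (\<lambda>x. (1/2) ^ k * cv u (dil k \<Theta>) x))\<^sup>2) \<le> C * c"
proof -
  obtain C where C: "C \<ge> 0"
    "\<And>w m n. (\<forall>k. test (w k)) \<Longrightarrow>
       h1t (\<lambda>x. \<Sum>k\<in>{m..<n}. (1/2) ^ k * conv (w k) (dil k (rfl \<Theta>)) x) \<le> C * sqrt (\<Sum>k\<in>{m..<n}. (n2 (w k))\<^sup>2)"
    using h1t_dyadic_sum[OF test_rfl[OF \<Theta>]] by blast
  show ?thesis
  proof (intro exI[of _ C] conjI allI impI)
    show "0 \<le> C" by (rule C(1))
    fix u K c and m n :: nat
    assume u: "Hm1 u" "supp_in u K" "compact K" and c: "0 \<le> c" "hm1_le u c"
    let ?I = "{m..<n}"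
    define F where "F k = (\<lambda>x. (1/2) ^ k * cv u (dil k \<Theta>) x)" for k
    have F: "test (F k)" for k unfolding F_def by (rule test_cmult[OF test_cv(1)[OF u test_dil[OF \<Theta>]]])
    define S where "S = (\<Sum>k\<in>?I. (n2 (F k))\<^sup>2)"
    have S0: "0 \<le> S" by (simp add: S_def sum_nonneg)
    have G: "test (conv (F k) (dil k (rfl \<Theta>)))" for k by (rule test_conv[OF F test_dil[OF test_rfl[OF \<Theta>]]])
    have "(n2 (F k))\<^sup>2 = u (\<lambda>x. (1/2) ^ k * conv (F k) (dil k (rfl \<Theta>)) x)" for k
    proof -
      have "(n2 (F k))\<^sup>2 = (1/2) ^ k * fdist (cv u (dil k \<Theta>)) (F k)"
        unfolding fdist_self[symmetric] unfolding fdist_def by (subst F_def) (simp only: mult.assoc integral_mult_right_zero)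
      also have "\<dots> = (1/2) ^ k * u (conv (F k) (dil k (rfl \<Theta>)))"
        by (simp only: fdist_cv[OF u(1) test_dil[OF \<Theta>] F] rfl_dil)
      finally show ?thesis by (simp only: Hm1_cmult[OF u(1) G])
    qed
    then have "S = u (\<lambda>x. \<Sum>k\<in>?I. (1/2) ^ k * conv (F k) (dil k (rfl \<Theta>)) x)"
      unfolding S_def by (subst Hm1_sum[OF _ u(1) test_cmult[OF G]]) (simp_all only: finite_atLeastLessThan)
    also have "\<dots> \<le> c * h1t (\<lambda>x. \<Sum>k\<in>?I. (1/2) ^ k * conv (F k) (dil k (rfl \<Theta>)) x)"
      by (rule order_trans[OF abs_ge_self hm1_leD[OF c(2) test_sum[OF _ test_cmult[OF G]]]]) simp
    also have "\<dots> \<le> c * (C * sqrt S)" unfolding S_def by (rule mult_left_mono[OF C(2) c(1)]) (simp add: F)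
    finally have "sqrt S * sqrt S \<le> sqrt S * (C * c)" using S0 by (simp add: mult_ac)
    then have "sqrt S \<le> C * c" using S0 c(1) C(1) unfolding mult_le_cancel_left by (cases "S = 0") auto
    then show "sqrt (\<Sum>k\<in>?I. (n2 (\<lambda>x. (1/2) ^ k * cv u (dil k \<Theta>) x))\<^sup>2) \<le> C * c" by (simp add: S_def F_def)
  qed
qed

section \<open>Smooth functions of one variable\<close>

text \<open>Asks for the whole tower of derivatives at once, the form in which
  \<open>smooth_fn_ridge\<close> consumes it.\<close>

definition smooth1 :: "(real \<Rightarrow> real) \<Rightarrow> bool" where
  "smooth1 f \<longleftrightarrow> (\<exists>D. D 0 = f \<and> (\<forall>n x. (D n has_real_derivative D (Suc n) x) (at x)))"

lemma smooth1_coinduct: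
  assumes f: "P f" and step: "\<And>f. P f \<Longrightarrow> \<exists>f'. (\<forall>x. (f has_real_derivative f' x) (at x)) \<and> P f'"
  shows "smooth1 f"
proof -
  define d where "d f = (SOME f'. (\<forall>x. (f has_real_derivative f' x) (at x)) \<and> P f')" for f :: "real \<Rightarrow> real"
  have d: "(\<forall>x. (f has_real_derivative d f x) (at x)) \<and> P (d f)" if "P f" for f
    unfolding d_def using step[OF that] by (rule someI_ex)
  define D where "D n = (d ^^ n) f" for n
  have "P (D n)" for n unfolding D_def by (induction n) (auto simp: f d)
  then have "(D n has_real_derivative D (Suc n) x) (at x)" for n x using d[of "D n"] by (simp add: D_def)
  then show ?thesis unfolding smooth1_def by (intro exI[of _ D]) (simp add: D_def)
qed

lemma smooth1_derivE:
  assumes "smooth1 f" obtains f' where "\<And>x. (f has_real_derivative f' x) (at x)" "smooth1 f'"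
proof -
  obtain D where D: "D 0 = f" "\<And>n x. (D n has_real_derivative D (Suc n) x) (at x)"
    using assms by (auto simp: smooth1_def)
  have "smooth1 (D (Suc 0))" unfolding smooth1_def by (intro exI[of _ "\<lambda>n. D (Suc n)"]) (simp add: D)
  then show thesis using that[of "D (Suc 0)"] D by metis
qed

lemma smooth1I: "(\<And>x. (f has_real_derivative f' x) (at x)) \<Longrightarrow> smooth1 f' \<Longrightarrow> smooth1 f"
  by (rule smooth1_coinduct[where P="\<lambda>g. smooth1 g \<or> g = f"]) (auto elim: smooth1_derivE)

lemma smooth1_const: "smooth1 (\<lambda>x. c)"
  by (rule smooth1_coinduct[where P="\<lambda>f. \<exists>c. f = (\<lambda>x. c)"]) (auto intro!: exI[of _ "\<lambda>x. 0"])

lemma smooth1_id: "smooth1 (\<lambda>x. x)"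
  by (rule smooth1I[OF DERIV_ident smooth1_const])

inductive smooth1_alg :: "(real \<Rightarrow> real) \<Rightarrow> bool" where
  base: "smooth1 f \<Longrightarrow> smooth1_alg f"
| add: "smooth1_alg f \<Longrightarrow> smooth1_alg g \<Longrightarrow> smooth1_alg (\<lambda>x. f x + g x)"
| mult: "smooth1_alg f \<Longrightarrow> smooth1_alg g \<Longrightarrow> smooth1_alg (\<lambda>x. f x * g x)"

lemma smooth1_alg_imp: assumes "smooth1_alg f" shows "smooth1 f"
proof (rule smooth1_coinduct[where P=smooth1_alg, OF assms])
  fix f assume "smooth1_alg f"
  then show "\<exists>f'. (\<forall>x. (f has_real_derivative f' x) (at x)) \<and> smooth1_alg f'"
  proof induction
    case (base f)
    then show ?case using smooth1_derivE smooth1_alg.base by metis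
  next
    case (add f g)
    then obtain f' g' where *: "\<forall>x. (f has_real_derivative f' x) (at x)" "smooth1_alg f'" "\<forall>x. (g has_real_derivative g' x) (at x)" "smooth1_alg g'" by blast
    then have "\<forall>x. ((\<lambda>x. f x + g x) has_real_derivative f' x + g' x) (at x)" by (auto intro: DERIV_add)
    then show ?case using smooth1_alg.add[OF *(2,4)] by (intro exI[of _ "\<lambda>x. f' x + g' x"] conjI)
  next
    case (mult f g)
    then obtain f' g' where *: "\<forall>x. (f has_real_derivative f' x) (at x)" "smooth1_alg f'" "\<forall>x. (g has_real_derivative g' x) (at x)" "smooth1_alg g'" by blast
    have "\<forall>x. ((\<lambda>x. f x * g x) has_real_derivative f' x * g x + g' x * f x) (at x)"
      using * by (auto intro: DERIV_mult)
    moreover have "smooth1_alg (\<lambda>x. f' x * g x + g' x * f x)"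
      by (rule smooth1_alg.add[OF smooth1_alg.mult[OF *(2) mult(2)] smooth1_alg.mult[OF *(4) mult(1)]])
    ultimately show ?case by (intro exI[of _ "\<lambda>x. f' x * g x + g' x * f x"] conjI)
  qed
qed

lemma smooth1_add: "smooth1 f \<Longrightarrow> smooth1 g \<Longrightarrow> smooth1 (\<lambda>x. f x + g x)"
  by (rule smooth1_alg_imp[OF smooth1_alg.add[OF smooth1_alg.base smooth1_alg.base]])

lemma smooth1_mult: "smooth1 f \<Longrightarrow> smooth1 g \<Longrightarrow> smooth1 (\<lambda>x. f x * g x)"
  by (rule smooth1_alg_imp[OF smooth1_alg.mult[OF smooth1_alg.base smooth1_alg.base]])

lemma smooth1_affine: assumes "smooth1 f" shows "smooth1 (\<lambda>x. f (a + c * x))"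
proof (rule smooth1_coinduct[where P="\<lambda>g. \<exists>f k. smooth1 f \<and> g = (\<lambda>x. k * f (a + c * x))"])
  show "\<exists>g k. smooth1 g \<and> (\<lambda>x. f (a + c * x)) = (\<lambda>x. k * g (a + c * x))"
    using assms by (intro exI[of _ f] exI[of _ 1]) simp
  fix g assume "\<exists>f k. smooth1 f \<and> g = (\<lambda>x. k * f (a + c * x))"
  then obtain f k where f: "smooth1 f" "g = (\<lambda>x. k * f (a + c * x))" by blast
  obtain f' where f': "\<And>x. (f has_real_derivative f' x) (at x)" "smooth1 f'" using smooth1_derivE[OF f(1)] by blast
  have "(g has_real_derivative (k * c) * f' (a + c * x)) (at x)" for x
    unfolding f(2) by (auto intro!: derivative_eq_intros DERIV_chain'[OF _ f'(1)])
  then show "\<exists>g'. (\<forall>x. (g has_real_derivative g' x) (at x)) \<and> (\<exists>f k. smooth1 f \<and> g' = (\<lambda>x. k * f (a + c * x)))"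
    using f'(2) by (intro exI[of _ "\<lambda>x. (k * c) * f' (a + c * x)"] conjI allI exI[of _ f'] exI[of _ "k * c"]) auto
qed

text \<open>The classical flat function \<open>exp (- (1/x))\<close> with a polynomial in
  \<open>1/x\<close> in front. The polynomial makes the family closed under differentiation, which
  replaces \<open>p\<close> by \<open>y^2 * (p - p')\<close> in the variable
  \<open>y = 1/x\<close>.\<close>

definition flat :: "real poly \<Rightarrow> real \<Rightarrow> real" where
  "flat p x = (if x > 0 then poly p (1/x) * exp (- (1/x)) else 0)"

lemma poly_exp_tendsto_0: "((\<lambda>y. poly p y * exp (- y)) \<longlongrightarrow> (0::real)) at_top"
proof -
  have "((\<lambda>y. \<Sum>i\<le>degree p. coeff p i * (y ^ i / exp y)) \<longlongrightarrow> (\<Sum>i\<le>degree p. coeff p i * 0)) at_top"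
    by (intro tendsto_sum tendsto_mult tendsto_const tendsto_power_div_exp_0)
  moreover have "(\<lambda>y. \<Sum>i\<le>degree p. coeff p i * (y ^ i / exp y)) = (\<lambda>y. poly p y * exp (- y))"
    by (simp only: poly_altdef sum_distrib_right exp_minus divide_inverse mult.assoc)
  ultimately show ?thesis by simp
qed

lemma flat_deriv: "(flat p has_real_derivative flat ([:0, 0, 1:] * (p - pderiv p)) x) (at x)"
proof -
  let ?q = "[:0, 0, 1:] * (p - pderiv p)"
  consider "x > 0" | "x < 0" | "x = 0" by linarith
  then show ?thesis
  proof cases
    case 1
    have "((\<lambda>x. poly p (1/x) * exp (- (1/x))) has_real_derivative poly ?q (1/x) * exp (- (1/x))) (at x)"
      using 1 by (auto intro!: derivative_eq_intros DERIV_chain'[OF _ poly_DERIV] simp: field_simps power2_eq_square)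
    then have "((\<lambda>x. poly p (1/x) * exp (- (1/x))) has_real_derivative flat ?q x) (at x)" using 1 by (simp add: flat_def)
    then show ?thesis
      by (rule has_field_derivative_transform_within_open[where S="{0<..}"]) (use 1 in \<open>auto simp: flat_def\<close>)
  next
    case 2
    have "((\<lambda>x. 0) has_real_derivative flat ?q x) (at x)" using 2 by (simp add: flat_def)
    then show ?thesis
      by (rule has_field_derivative_transform_within_open[where S="{..<0}"]) (use 2 in \<open>auto simp: flat_def\<close>)
  next
    case 3
    have r: "((\<lambda>h. flat p h / h) \<longlongrightarrow> 0) (at_right 0)"
    proof -
      have "filterlim (\<lambda>h::real. 1/h) at_top (at_right 0)"
        using filterlim_inverse_at_top_right by (simp add: inverse_eq_divide)
      \<comment> \<open>\<open>flat p h / h\<close> has the same form with \<open>p\<close>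
        multiplied by its variable, which is \<open>pCons 0 p\<close>.\<close>
      from filterlim_compose[OF poly_exp_tendsto_0[of "pCons 0 p"] this]
      have "((\<lambda>h. poly (pCons 0 p) (1/h) * exp (- (1/h))) \<longlongrightarrow> 0) (at_right 0)" by simp
      moreover have "\<forall>\<^sub>F h in at_right 0. poly (pCons 0 p) (1/h) * exp (- (1/h)) = flat p h / h"
        unfolding eventually_at_right_field by (intro exI[of _ 1]) (simp add: flat_def)
      ultimately show ?thesis by (rule Lim_transform_eventually)
    qed
    have l: "((\<lambda>h. flat p h / h) \<longlongrightarrow> 0) (at_left 0)"
    proof -
      have "\<forall>\<^sub>F h in at_left 0. 0 = flat p h / (h::real)"
        unfolding eventually_at_left_field by (intro exI[of _ "-1"]) (simp add: flat_def)
      from Lim_transform_eventually[OF tendsto_const this] show ?thesis .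
    qed
    have "((\<lambda>h. flat p h / h) \<longlongrightarrow> 0) (at 0)" using l r by (simp add: filterlim_at_split)
    moreover have "flat p 0 = 0" "flat ?q 0 = 0" by (simp_all add: flat_def)
    ultimately show ?thesis unfolding 3 DERIV_def by simp
  qed
qed

lemma smooth1_flat: "smooth1 (flat p)"
  by (rule smooth1_coinduct[where P="\<lambda>f. \<exists>p. f = flat p"]) (use flat_deriv in blast)+

text \<open>The antiderivative of a bump living between \<open>a\<close> and \<open>b\<close>,
  rescaled to run from 0 to 1; the bump is the product of \<open>flat 1\<close> seen from both
  ends.\<close>

lemma smooth_step_exists:
  fixes a b :: real assumes ab: "a < b"
  obtains P where "smooth1 P" "\<And>x. x \<le> a \<Longrightarrow> P x = 0" "\<And>x. x \<ge> b \<Longrightarrow> P x = 1" "mono P"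
proof -
  define r where "r = (\<lambda>x. flat 1 (- a + 1 * x) * flat 1 (b + (-1) * x))"
  have r: "smooth1 r" unfolding r_def by (rule smooth1_mult[OF smooth1_affine[OF smooth1_flat] smooth1_affine[OF smooth1_flat]])
  have r0: "r x \<ge> 0" "x \<le> a \<Longrightarrow> r x = 0" "x \<ge> b \<Longrightarrow> r x = 0" "a < x \<Longrightarrow> x < b \<Longrightarrow> r x > 0" for x
    by (auto simp: r_def flat_def)
  obtain r' where r': "\<And>x. (r has_real_derivative r' x) (at x)" using smooth1_derivE[OF r] by blast
  have "\<exists>F. \<forall>x::real. -\<infinity> < ereal x \<longrightarrow> ereal x < \<infinity> \<longrightarrow> (F has_vector_derivative r x) (at x)"
    by (rule einterval_antiderivative) (use r' DERIV_isCont in auto)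
  then obtain F where "\<And>x. (F has_vector_derivative r x) (at x)" by auto
  then have F: "\<And>x. (F has_real_derivative r x) (at x)" by (simp add: has_real_derivative_iff_has_vector_derivative)
  have mono: "F x \<le> F y" if "x \<le> y" for x y
    by (rule DERIV_nonneg_imp_nondecreasing[OF that]) (use F r0 in blast)
  have left: "F x = F a" if "x \<le> a" for x
  proof (cases "x = a")
    case False
    then have xa: "x < a" using that by simp
    obtain z where "x < z" "z < a" "F a - F x = (a - x) * r z" using MVT2[OF xa, of F r] F by blast
    then show ?thesis using r0(2)[of z] by simp
  qed simp
  have right: "F x = F b" if "x \<ge> b" for x
  proof (cases "x = b")
    case False
    then have bx: "b < x" using that by simp
    obtain z where "b < z" "z < x" "F x - F b = (x - b) * r z" using MVT2[OF bx, of F r] F by blast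
    then show ?thesis using r0(3)[of z] by simp
  qed simp
  have pos: "F a < F b"
  proof -
    obtain z where "a < z" "z < b" "F b - F a = (b - a) * r z" using MVT2[OF ab, of F r] F by auto
    then show ?thesis using r0(4)[of z] ab by (smt (verit) mult_pos_pos)
  qed
  define P where "P = (\<lambda>x. (F x + - F a) * (1 / (F b - F a)))"
  show thesis
  proof (rule that[of P])
    have sF: "smooth1 F" by (rule smooth1I[OF F r])
    have sFa: "smooth1 (\<lambda>x. F x + - F a)" using smooth1_add[OF sF smooth1_const[of "- F a"]] .
    show "smooth1 P" unfolding P_def using smooth1_mult[OF sFa smooth1_const[of "1 / (F b - F a)"]] .
    show "x \<le> a \<Longrightarrow> P x = 0" for x using left[of x] by (simp add: P_def)
    show "x \<ge> b \<Longrightarrow> P x = 1" for x using right[of x] pos by (simp add: P_def)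
    show "mono P"
    proof (rule monoI)
      fix x y :: real assume "x \<le> y"
      then show "P x \<le> P y" unfolding P_def using mono[of x y] pos by (intro mult_right_mono) auto
    qed
  qed
qed

lemma smooth_fn_ridge1: "smooth1 p \<Longrightarrow> smooth_fn (\<lambda>x. p (l \<bullet> x))"
proof -
  assume "smooth1 p"
  then obtain D where D: "D 0 = p" "\<And>n x. (D n has_real_derivative D (Suc n) x) (at x)"
    by (auto simp: smooth1_def)
  show ?thesis using smooth_fn_ridge(1)[of D 0 l] D by simp
qed

lemma pd_ridge1:
  assumes "smooth1 p" "\<And>x. (p has_real_derivative p' x) (at x)"
  shows "pd i (\<lambda>x. p (l \<bullet> x)) = (\<lambda>x. l $ i * p' (l \<bullet> x))"
proof -
  obtain D where D: "D 0 = p" "\<And>n x. (D n has_real_derivative D (Suc n) x) (at x)"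
    using assms(1) by (auto simp: smooth1_def)
  have "D (Suc 0) = p'" using DERIV_unique[OF D(2)[of 0, unfolded D(1)] assms(2)] by auto
  then show ?thesis using smooth_fn_ridge(2)[of D i 0 l] D by simp
qed

section \<open>Dyadic potentials and weak derivatives\<close>

text \<open>The term of scale \<open>k\<close> in \<open>T\<close>. The weight
  \<open>(1/4) ^ k\<close> cancels the \<open>4 ^ k\<close> that two derivatives of
  \<open>dil k \<eta>\<close> produce (\<open>dd_dd_dil\<close>).\<close>

definition Tk :: "fn \<Rightarrow> fn \<Rightarrow> nat \<Rightarrow> distr \<Rightarrow> fn" where
  "Tk \<Theta> \<eta> k u = (\<lambda>x. (1/4) ^ k * conv (cv u (dil k \<Theta>)) (dil k \<eta>) x)"

text \<open>The transpose of \<open>Tk\<close> (\<open>Tk_adjoint\<close>). It moves all identities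
  to the side of test functions, where everything is smooth.\<close>

definition Gk :: "fn \<Rightarrow> fn \<Rightarrow> nat \<Rightarrow> fn \<Rightarrow> fn" where
  "Gk \<Theta> \<eta> k \<phi> = (\<lambda>x. (1/4) ^ k * conv (conv \<phi> (rfl (dil k \<eta>))) (rfl (dil k \<Theta>)) x)"

lemma test_Tk: "Hm1 u \<Longrightarrow> supp_in u K \<Longrightarrow> compact K \<Longrightarrow> test \<Theta> \<Longrightarrow> test \<eta> \<Longrightarrow> test (Tk \<Theta> \<eta> k u)"
  unfolding Tk_def by (rule test_cmult[OF test_conv[OF test_cv(1)[OF _ _ _ test_dil] test_dil]])

lemma test_Gk: "test \<phi> \<Longrightarrow> test \<Theta> \<Longrightarrow> test \<eta> \<Longrightarrow> test (Gk \<Theta> \<eta> k \<phi>)"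
  unfolding Gk_def by (rule test_cmult[OF test_conv[OF test_conv[OF _ test_rfl[OF test_dil]] test_rfl[OF test_dil]]])

lemma Tk_adjoint:
  assumes u: "Hm1 u" "supp_in u K" "compact K" and t: "test \<Theta>" "test \<eta>" "test \<phi>"
  shows "fdist (Tk \<Theta> \<eta> k u) \<phi> = u (Gk \<Theta> \<eta> k \<phi>)"
proof -
  let ?v = "cv u (dil k \<Theta>)" and ?\<psi> = "conv \<phi> (rfl (dil k \<eta>))"
  have v: "test ?v" by (rule test_cv(1)[OF u test_dil[OF t(1)]])
  have \<psi>: "test ?\<psi>" by (rule test_conv[OF t(3) test_rfl[OF test_dil[OF t(2)]]])
  have "fdist (Tk \<Theta> \<eta> k u) \<phi> = (1/4) ^ k * fdist (conv ?v (dil k \<eta>)) \<phi>"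
    unfolding fdist_def Tk_def by (simp only: mult.assoc integral_mult_right_zero)
  also have "fdist (conv ?v (dil k \<eta>)) \<phi> = u (conv ?\<psi> (rfl (dil k \<Theta>)))"
    using conv_adjoint[OF v test_dil[OF t(2)] t(3)] fdist_cv[OF u(1) test_dil[OF t(1)] \<psi>] by metis
  also have "(1/4) ^ k * \<dots> = u (Gk \<Theta> \<eta> k \<phi>)"
    unfolding Gk_def by (rule Hm1_cmult[OF u(1) test_conv[OF \<psi> test_rfl[OF test_dil[OF t(1)]]], symmetric])
  finally show ?thesis .
qed

lemma pd_Gk:
  assumes "test \<phi>" "test \<Theta>" "test \<eta>"
  shows "pd i (Gk \<Theta> \<eta> k \<phi>) = Gk \<Theta> \<eta> k (pd i \<phi>)"
proof -
  have t: "test (rfl (dil k \<eta>))" "test (rfl (dil k \<Theta>))" using assms by (simp_all add: test_rfl test_dil)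
  show ?thesis unfolding Gk_def
    pd_cmult[OF test_smooth[OF test_conv[OF test_conv[OF assms(1) t(1)] t(2)]]]
    pd_conv'[OF test_conv[OF assms(1) t(1)] t(2)] pd_conv'[OF assms(1) t(1)] ..
qed

lemma n2_conv_dil:
  "test f \<Longrightarrow> test g \<Longrightarrow> n2 (conv f (dil k g)) \<le> n1 g * n2 f"
  using young[OF _ test_dil, of f g k] by (simp add: n1_dil)

text \<open>\<open>square_function\<close> for \<open>\<Theta>\<close> followed by
  \<open>h1t_dyadic_sum\<close> for \<open>\<eta>\<close>, each taking one factor
  \<open>(1/2) ^ k\<close> of \<open>(1/4) ^ k\<close>. The three clauses serve different ends: the
  uniform bound gives continuity, the geometric L2 bound gives convergence almost everywhere, and
  the Cauchy tails, which follow from convergence of the sum of squares, give convergence in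
  H^1.\<close>

lemma Tk_bounds:
  assumes \<Theta>: "test \<Theta>" and \<eta>: "test \<eta>"
  shows "\<exists>M\<ge>0. \<forall>u K c. Hm1 u \<longrightarrow> supp_in u K \<longrightarrow> compact K \<longrightarrow> 0 \<le> c \<longrightarrow> hm1_le u c \<longrightarrow>
     (\<forall>m n. h1t (\<lambda>x. \<Sum>k\<in>{m..<n}. Tk \<Theta> \<eta> k u x) \<le> M * c) \<and>
     (\<forall>k. n2 (Tk \<Theta> \<eta> k u) \<le> M * c * (1/2) ^ k) \<and>
     (\<forall>e>0. \<exists>N. \<forall>m\<ge>N. \<forall>n. h1t (\<lambda>x. \<Sum>k\<in>{m..<n}. Tk \<Theta> \<eta> k u x) \<le> e)"
proof -
  obtain A where A: "A \<ge> 0" "\<And>w m n. (\<forall>k. test (w k)) \<Longrightarrow>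
       h1t (\<lambda>x. \<Sum>k\<in>{m..<n}. (1/2) ^ k * conv (w k) (dil k \<eta>) x) \<le> A * sqrt (\<Sum>k\<in>{m..<n}. (n2 (w k))\<^sup>2)"
    using h1t_dyadic_sum[OF \<eta>] by blast
  obtain B where B: "B \<ge> 0" "\<And>u K c m n. Hm1 u \<Longrightarrow> supp_in u K \<Longrightarrow> compact K \<Longrightarrow> 0 \<le> c \<Longrightarrow> hm1_le u c \<Longrightarrow>
       sqrt (\<Sum>k\<in>{m..<n}. (n2 (\<lambda>x. (1/2) ^ k * cv u (dil k \<Theta>) x))\<^sup>2) \<le> B * c"
    using square_function[OF \<Theta>] by blast
  define M where "M = A * B + n1 \<eta> * B"
  show ?thesis
  proof (intro exI[of _ M] conjI allI impI)
    show "0 \<le> M" using A B n1_nonneg[of \<eta>] by (simp add: M_def)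
    fix u K c
    assume u: "Hm1 u" "supp_in u K" "compact K" and c: "0 \<le> c" "hm1_le u c"
    define F where "F k = (\<lambda>x. (1/2) ^ k * cv u (dil k \<Theta>) x)" for k
    have F: "test (F k)" for k unfolding F_def by (rule test_cmult[OF test_cv(1)[OF u test_dil[OF \<Theta>]]])
    have T: "Tk \<Theta> \<eta> k u = (\<lambda>x. (1/2) ^ k * conv (F k) (dil k \<eta>) x)" for k
    proof -
      have "(1/4::real) ^ k = (1/2) ^ k * (1/2) ^ k" by (simp flip: power_mult_distrib)
      then show ?thesis unfolding Tk_def F_def conv_cmult_left by (simp only: mult.assoc)
    qed
    have S: "sqrt (\<Sum>k\<in>{m..<n}. (n2 (F k))\<^sup>2) \<le> B * c" for m n
      unfolding F_def by (rule B(2)[OF u c])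
    have h: "h1t (\<lambda>x. \<Sum>k\<in>{m..<n}. Tk \<Theta> \<eta> k u x) \<le> A * sqrt (\<Sum>k\<in>{m..<n}. (n2 (F k))\<^sup>2)" for m n
      unfolding T by (rule A(2)) (simp add: F)
    have nb: "0 \<le> n1 \<eta> * B * c" "0 \<le> A * B * c" using A B c n1_nonneg[of \<eta>] by auto
    show "h1t (\<lambda>x. \<Sum>k\<in>{m..<n}. Tk \<Theta> \<eta> k u x) \<le> M * c" for m n
    proof -
      have "h1t (\<lambda>x. \<Sum>k\<in>{m..<n}. Tk \<Theta> \<eta> k u x) \<le> A * (B * c)"
        by (rule order_trans[OF h mult_left_mono[OF S A(1)]])
      then show ?thesis using nb by (simp add: M_def distrib_right mult.assoc)
    qed
    show "n2 (Tk \<Theta> \<eta> k u) \<le> M * c * (1/2) ^ k" for k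
    proof -
      have "n2 (F k) \<le> B * c" using S[of k "Suc k"] by (simp add: n2_nonneg)
      then have "n1 \<eta> * n2 (F k) \<le> n1 \<eta> * (B * c)" by (rule mult_left_mono[OF _ n1_nonneg])
      then have "n2 (conv (F k) (dil k \<eta>)) \<le> n1 \<eta> * (B * c)" using n2_conv_dil[OF F \<eta>, of k k] by linarith
      also have "\<dots> \<le> M * c" using nb by (simp add: M_def distrib_right mult.assoc)
      finally have "(1/2) ^ k * n2 (conv (F k) (dil k \<eta>)) \<le> (1/2) ^ k * (M * c)" by (intro mult_left_mono) auto
      moreover have "n2 (Tk \<Theta> \<eta> k u) = (1/2) ^ k * n2 (conv (F k) (dil k \<eta>))" unfolding T by (subst n2_cmult) simp
      ultimately show ?thesis by (simp only: mult.commute)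
    qed
    fix e :: real assume e: "e > 0"
    have sm: "summable (\<lambda>k. (n2 (F k))\<^sup>2)"
    proof (rule summableI_nonneg_bounded)
      show "(\<Sum>k<n. (n2 (F k))\<^sup>2) \<le> (B * c)\<^sup>2" for n
      proof (rule sqrt_le_D)
        show "sqrt (\<Sum>k<n. (n2 (F k))\<^sup>2) \<le> B * c" using S[of 0 n] by (simp add: atLeast0LessThan)
      qed
    qed simp
    have "0 < (e / (A + 1))\<^sup>2" using e A(1) by simp
    then obtain N where N: "\<And>m n. m \<ge> N \<Longrightarrow> norm (\<Sum>k\<in>{m..<n}. (n2 (F k))\<^sup>2) < (e / (A + 1))\<^sup>2"
      using sm unfolding summable_Cauchy by blast
    show "\<exists>N. \<forall>m\<ge>N. \<forall>n. h1t (\<lambda>x. \<Sum>k\<in>{m..<n}. Tk \<Theta> \<eta> k u x) \<le> e"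
    proof (intro exI[of _ N] allI impI)
      fix m n assume "N \<le> m"
      then have "(\<Sum>k\<in>{m..<n}. (n2 (F k))\<^sup>2) \<le> (e / (A + 1))\<^sup>2" using N[of m n] by simp
      then have "sqrt (\<Sum>k\<in>{m..<n}. (n2 (F k))\<^sup>2) \<le> e / (A + 1)"
        using e A(1) by (simp add: real_le_lsqrt sum_nonneg)
      then have "A * sqrt (\<Sum>k\<in>{m..<n}. (n2 (F k))\<^sup>2) \<le> A * (e / (A + 1))" by (rule mult_left_mono[OF _ A(1)])
      also have "\<dots> \<le> e" using e A(1) by (simp add: field_simps)
      finally show "h1t (\<lambda>x. \<Sum>k\<in>{m..<n}. Tk \<Theta> \<eta> k u x) \<le> e" using h[of m n] by linarith
    qed
  qed
qed

text \<open>Monotone convergence for the squared partial sums of the absolute values, whose L2 norms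
  are bounded by the sum of the norms. The series converges absolutely off a null set, and the value
  of \<open>suminf\<close> on that set does not matter.\<close>

lemma L2_series:
  fixes h :: "nat \<Rightarrow> fn"
  assumes h: "\<And>k. L2 (h k)" and s: "summable (\<lambda>k. n2 (h k))"
  shows "AE x in lborel. summable (\<lambda>k. \<bar>h k x\<bar>)" "L2 (\<lambda>x. \<Sum>k. h k x)" "n2 (\<lambda>x. \<Sum>k. h k x) \<le> (\<Sum>k. n2 (h k))"
proof -
  have [measurable]: "h k \<in> borel_measurable lborel" for k using h[of k] by (rule L2_borel)
  define B where "B = (\<Sum>k. n2 (h k))"
  have B0: "0 \<le> B" unfolding B_def by (rule suminf_nonneg[OF s n2_nonneg])
  define s where "s N x = (\<Sum>k<N. \<bar>h k x\<bar>)" for N x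
  have sL: "L2 (s N)" for N unfolding s_def by (rule L2_sum) (simp_all add: L2_abs h)
  have sB: "n2 (s N) \<le> B" for N
  proof -
    have a: "n2 (\<lambda>x. \<bar>h k x\<bar>) = n2 (h k)" for k by (simp add: n2_def l2sq_def)
    have "n2 (s N) \<le> (\<Sum>k<N. n2 (h k))"
      unfolding s_def using n2_sum[of "{..<N}" "\<lambda>k x. \<bar>h k x\<bar>"] by (simp add: L2_abs h a)
    also have "\<dots> \<le> B" unfolding B_def by (rule sum_le_suminf[OF \<open>summable (\<lambda>k. n2 (h k))\<close>]) (simp_all add: n2_nonneg)
    finally show ?thesis .
  qed
  have s0: "0 \<le> s N x" for N x by (simp add: s_def sum_nonneg)
  have smono: "s M x \<le> s N x" if "M \<le> N" for M N x unfolding s_def using that by (intro sum_mono2) auto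
  let ?G = "\<lambda>x. SUP N. ennreal ((s N x)\<^sup>2)"
  have [measurable]: "s N \<in> borel_measurable lborel" for N by (rule L2_borel[OF sL])
  have "(\<integral>\<^sup>+x. ?G x \<partial>lborel) = (SUP N. \<integral>\<^sup>+x. ennreal ((s N x)\<^sup>2) \<partial>lborel)"
    by (rule nn_integral_monotone_convergence_SUP)
       (auto simp: incseq_def le_fun_def intro!: ennreal_leI power_mono smono s0)
  also have "\<dots> \<le> ennreal (B\<^sup>2)"
  proof (rule SUP_least)
    fix N
    have "(\<integral>\<^sup>+x. ennreal ((s N x)\<^sup>2) \<partial>lborel) = ennreal (l2sq (s N))"
      unfolding l2sq_def by (rule nn_integral_eq_integral[OF L2_sq[OF sL]]) simp
    also have "\<dots> \<le> ennreal (B\<^sup>2)"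
      using power_mono[OF sB n2_nonneg, of N 2] by (simp add: n2_sq ennreal_leI)
    finally show "(\<integral>\<^sup>+x. ennreal ((s N x)\<^sup>2) \<partial>lborel) \<le> ennreal (B\<^sup>2)" .
  qed
  finally have G: "(\<integral>\<^sup>+x. ?G x \<partial>lborel) \<le> ennreal (B\<^sup>2)" .
  then have "(\<integral>\<^sup>+x. ?G x \<partial>lborel) \<noteq> \<infinity>" by (metis ennreal_neq_top infinity_ennreal_def neq_top_trans)
  then have AE_fin: "AE x in lborel. ?G x \<noteq> \<infinity>" by (intro nn_integral_noteq_infinite) auto
  have pt: "summable (\<lambda>k. \<bar>h k x\<bar>) \<and> ennreal ((\<Sum>k. h k x)\<^sup>2) \<le> ?G x" if fin: "?G x \<noteq> \<infinity>" for x
  proof -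
    obtain r where r: "?G x = ennreal r" "0 \<le> r" using fin by (cases "?G x") auto
    have sr: "(s N x)\<^sup>2 \<le> r" for N
    proof -
      have "ennreal ((s N x)\<^sup>2) \<le> ennreal r" unfolding r(1)[symmetric] by (rule SUP_upper) simp
      then show ?thesis using r(2) by simp
    qed
    have "s N x \<le> sqrt r" for N using sr[of N] by (rule real_le_rsqrt)
    then have sm: "summable (\<lambda>k. \<bar>h k x\<bar>)"
      unfolding s_def by (intro summableI_nonneg_bounded[where x="sqrt r"]) auto
    have "\<bar>\<Sum>k. h k x\<bar> \<le> (\<Sum>k. \<bar>h k x\<bar>)" by (rule summable_rabs[OF sm])
    also have "\<dots> \<le> sqrt r" using \<open>\<And>N. s N x \<le> sqrt r\<close> unfolding s_def by (intro suminf_le_const sm)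
    finally have "\<bar>\<Sum>k. h k x\<bar>\<^sup>2 \<le> (sqrt r)\<^sup>2" by (intro power_mono) auto
    then have "(\<Sum>k. h k x)\<^sup>2 \<le> r" using r(2) by simp
    then show ?thesis using sm r by (simp add: ennreal_leI)
  qed
  show "AE x in lborel. summable (\<lambda>k. \<bar>h k x\<bar>)" using AE_fin by eventually_elim (use pt in blast)
  have f[measurable]: "(\<lambda>x. \<Sum>k. h k x) \<in> borel_measurable lborel" by measurable
  have "(\<integral>\<^sup>+x. ennreal ((\<Sum>k. h k x)\<^sup>2) \<partial>lborel) \<le> (\<integral>\<^sup>+x. ?G x \<partial>lborel)"
    by (rule nn_integral_mono_AE) (use AE_fin in \<open>eventually_elim, use pt in blast\<close>)
  also note G
  finally have le: "(\<integral>\<^sup>+x. ennreal ((\<Sum>k. h k x)\<^sup>2) \<partial>lborel) \<le> ennreal (B\<^sup>2)" .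
  have int: "integrable lborel (\<lambda>x. (\<Sum>k. h k x)\<^sup>2)"
    by (rule integrableI_nonneg) (use le in \<open>auto intro: le_less_trans\<close>)
  then show "L2 (\<lambda>x. \<Sum>k. h k x)" unfolding L2_def using f by blast
  have "ennreal (l2sq (\<lambda>x. \<Sum>k. h k x)) \<le> ennreal (B\<^sup>2)"
    unfolding l2sq_def using le nn_integral_eq_integral[OF int] by simp
  then have "l2sq (\<lambda>x. \<Sum>k. h k x) \<le> B\<^sup>2" by simp
  then have "sqrt (l2sq (\<lambda>x. \<Sum>k. h k x)) \<le> sqrt (B\<^sup>2)" by (rule real_sqrt_le_mono)
  then show "n2 (\<lambda>x. \<Sum>k. h k x) \<le> (\<Sum>k. n2 (h k))" using B0 by (simp add: n2_def B_def)
qed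

lemma L2_series_tail:
  fixes h :: "nat \<Rightarrow> fn"
  assumes h: "\<And>k. L2 (h k)" and s: "summable (\<lambda>k. n2 (h k))"
  shows "n2 (\<lambda>x. (\<Sum>k. h k x) - (\<Sum>k<N. h k x)) \<le> (\<Sum>k. n2 (h (k + N)))"
proof -
  have s': "summable (\<lambda>k. n2 (h (k + N)))" using summable_ignore_initial_segment[OF s, of N] .
  have L: "L2 (\<lambda>x. \<Sum>k. h (k + N) x)" using L2_series(2)[OF h s'] .
  have LN: "L2 (\<lambda>x. \<Sum>k<N. h k x)" by (rule L2_sum) (simp_all add: h)
  have "AE x in lborel. (\<Sum>k. h (k + N) x) = (\<Sum>k. h k x) - (\<Sum>k<N. h k x)"
    using L2_series(1)[OF h s]
  proof eventually_elim
    fix x assume "summable (\<lambda>k. \<bar>h k x\<bar>)"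
    then have "summable (\<lambda>k. h k x)" by (rule summable_rabs_cancel)
    then show "(\<Sum>k. h (k + N) x) = (\<Sum>k. h k x) - (\<Sum>k<N. h k x)" by (rule suminf_minus_initial_segment)
  qed
  then have "n2 (\<lambda>x. (\<Sum>k. h k x) - (\<Sum>k<N. h k x)) = n2 (\<lambda>x. \<Sum>k. h (k + N) x)"
    by (intro conjunct2[OF n2_cong_AE[OF L]] L2_borel[OF L2_diff[OF L2_series(2)[OF h s] LN]])
  also have "\<dots> \<le> (\<Sum>k. n2 (h (k + N)))" by (rule L2_series(3)[OF h s'])
  finally show ?thesis .
qed

text \<open>Completeness of L2, wanted for weak gradients, which arise as Cauchy sequences without a
  summability bound. A subsequence with increments below \<open>(1/2) ^ j\<close> telescopes to a
  series covered by \<open>L2_series\<close>.\<close>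

lemma Riesz_Fischer:
  fixes g :: "nat \<Rightarrow> fn"
  assumes g: "\<And>n. L2 (g n)" and C: "\<And>e. e > 0 \<Longrightarrow> \<exists>N. \<forall>m\<ge>N. \<forall>n\<ge>N. n2 (\<lambda>x. g m x - g n x) \<le> e"
  shows "\<exists>f. L2 f \<and> (\<lambda>n. n2 (\<lambda>x. f x - g n x)) \<longlonglongrightarrow> 0"
proof -
  have "\<forall>j. \<exists>N. \<forall>m\<ge>N. \<forall>n\<ge>N. n2 (\<lambda>x. g m x - g n x) \<le> (1/2) ^ j"
    using C by simp
  from choice[OF this] obtain r0 where r0: "\<And>j m n. m \<ge> r0 j \<Longrightarrow> n \<ge> r0 j \<Longrightarrow> n2 (\<lambda>x. g m x - g n x) \<le> (1/2) ^ j"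
    by blast
  \<comment> \<open>Summing the thresholds makes the indices nondecreasing while each stays above
    \<open>r0 j\<close>.\<close>
  define r where "r j = (\<Sum>i\<le>j. r0 i)" for j
  have rr: "r0 j \<le> r j" for j unfolding r_def by (rule member_le_sum) auto
  have rS: "r j \<le> r (Suc j)" for j by (simp add: r_def)
  define h where "h j = (\<lambda>x. g (r (Suc j)) x - g (r j) x)" for j
  have hL: "L2 (h j)" for j unfolding h_def by (rule L2_diff[OF g g])
  have hb: "n2 (h j) \<le> (1/2) ^ j" for j
    unfolding h_def using rr[of j] rS[of j] by (intro r0) auto
  have sg: "summable (\<lambda>j. (1/2::real) ^ j)" by (rule summable_geometric) simp
  have sh: "summable (\<lambda>j. n2 (h j))"
    by (rule summable_comparison_test'[OF sg, of 0]) (simp add: hb n2_nonneg)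
  define f where "f = (\<lambda>x. (\<Sum>j. h j x) + g (r 0) x)"
  have fL: "L2 f" unfolding f_def by (rule L2_add[OF L2_series(2)[OF hL sh] g])
  have fj: "n2 (\<lambda>x. f x - g (r j) x) \<le> 2 * (1/2) ^ j" for j
  proof -
    have "(\<Sum>i<j. h i x) = g (r j) x - g (r 0) x" for x
      unfolding h_def by (rule sum_lessThan_telescope)
    then have "(\<lambda>x. f x - g (r j) x) = (\<lambda>x. (\<Sum>k. h k x) - (\<Sum>k<j. h k x))" by (simp add: f_def fun_eq_iff)
    then have "n2 (\<lambda>x. f x - g (r j) x) \<le> (\<Sum>k. n2 (h (k + j)))" using L2_series_tail[OF hL sh, of j] by simp
    also have "\<dots> \<le> (\<Sum>k. (1/2) ^ j * (1/2) ^ k)"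
    proof (rule suminf_le)
      show "n2 (h (k + j)) \<le> (1/2) ^ j * (1/2) ^ k" for k using hb[of "k + j"] by (simp add: power_add mult.commute)
      show "summable (\<lambda>k. n2 (h (k + j)))" using summable_ignore_initial_segment[OF sh, of j] .
      show "summable (\<lambda>k. (1/2::real) ^ j * (1/2) ^ k)" by (rule summable_mult[OF sg])
    qed
    also have "\<dots> = 2 * (1/2) ^ j" by (subst suminf_mult[OF sg]) (simp add: suminf_geometric)
    finally show ?thesis .
  qed
  have "(\<lambda>n. n2 (\<lambda>x. f x - g n x)) \<longlonglongrightarrow> 0"
  proof (rule LIMSEQ_I)
    fix e :: real assume e: "0 < e"
    obtain j where j: "(1/2) ^ j < e / 4" using real_arch_pow_inv[of "e/4" "1/2"] e by auto
    show "\<exists>N. \<forall>n\<ge>N. norm (n2 (\<lambda>x. f x - g n x) - 0) < e"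
    proof (intro exI[of _ "r j"] allI impI)
      fix n assume n: "r j \<le> n"
      have "(\<lambda>x. f x - g n x) = (\<lambda>x. (f x - g (r j) x) + (g (r j) x - g n x))" by simp
      then have "n2 (\<lambda>x. f x - g n x) \<le> n2 (\<lambda>x. f x - g (r j) x) + n2 (\<lambda>x. g (r j) x - g n x)"
        using n2_triangle[OF L2_diff[OF fL g[of "r j"]] L2_diff[OF g[of "r j"] g[of n]]] by simp
      also have "\<dots> \<le> 2 * (1/2) ^ j + (1/2) ^ j" using n rr[of j] by (intro add_mono fj r0) auto
      also have "\<dots> < e" using j e by linarith
      finally show "norm (n2 (\<lambda>x. f x - g n x) - 0) < e" by (simp add: n2_nonneg)
    qed
  qed
  then show ?thesis using fL by blast
qed

section \<open>Uniqueness of weak derivatives and the norm of H^1\<close>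

lemma smooth_fn_prod: "finite A \<Longrightarrow> (\<And>a. a \<in> A \<Longrightarrow> smooth_fn (f a)) \<Longrightarrow> smooth_fn (\<lambda>x. \<Prod>a\<in>A. f a x)"
proof (induction A rule: finite_induct)
  case empty
  then show ?case using smooth_fn_const[of 1] by simp
next
  case (insert a A)
  have "smooth_fn (\<lambda>x. f a x * (\<Prod>a\<in>A. f a x))" by (rule smooth_fn_mult) (use insert in auto)
  then show ?case using insert by simp
qed

text \<open>The step \<open>P\<close> climbs between 1 and 2, so inside the slab between the two
  faces normal to axis \<open>i\<close> the factor \<open>G n i\<close> vanishes within distance
  \<open>1 / (n + 1)\<close> of them and is 1 from distance \<open>2 / (n + 1)\<close> on.\<close>

lemma test_box_approx:
  fixes a b :: pt
  obtains F :: "nat \<Rightarrow> fn" where "\<And>n. test (F n)" "\<And>n x. 0 \<le> F n x \<and> F n x \<le> indicator (cbox a b) x"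
    "\<And>x. (\<lambda>n. F n x) \<longlonglongrightarrow> indicator (box a b) x"
proof -
  obtain P where P: "smooth1 P" "\<And>x. x \<le> (1::real) \<Longrightarrow> P x = 0" "\<And>x. x \<ge> 2 \<Longrightarrow> P x = 1" "mono P"
    using smooth_step_exists[of 1 2] by auto
  have P01: "0 \<le> P x" "P x \<le> 1" for x
    using monoD[OF P(4), of 0 x] monoD[OF P(4), of x 2] P(2)[of 0] P(2)[of x] P(3)[of 2] P(3)[of x] by (cases "x \<le> 0"; cases "x \<ge> 2"; force)+
  define G where "G n i x = P ((- real (Suc n) * a $ i) + real (Suc n) * (axis i 1 \<bullet> x)) * P (real (Suc n) * b $ i + (- real (Suc n)) * (axis i 1 \<bullet> x))" for n i and x :: pt
  have G: "G n i x = P (real (Suc n) * (x $ i - a $ i)) * P (real (Suc n) * (b $ i - x $ i))" for n i x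
    unfolding G_def inner_axis' by (simp add: algebra_simps)
  have sG: "smooth_fn (G n i)" for n i
    unfolding G_def by (rule smooth_fn_mult[OF smooth_fn_ridge1[OF smooth1_affine[OF P(1)]] smooth_fn_ridge1[OF smooth1_affine[OF P(1)]]])
  have G01: "0 \<le> G n i x" "G n i x \<le> 1" for n i x unfolding G using P01 by (simp_all add: mult_le_one)
  have Gnz: "a $ i < x $ i \<and> x $ i < b $ i" if "G n i x \<noteq> 0" for n i x
  proof -
    have "\<not> real (Suc n) * (x $ i - a $ i) \<le> 1" "\<not> real (Suc n) * (b $ i - x $ i) \<le> 1"
      using that P(2) unfolding G by (metis mult_zero_left mult_zero_right)+
    then have "0 < real (Suc n) * (x $ i - a $ i)" "0 < real (Suc n) * (b $ i - x $ i)" by linarith+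
    then show ?thesis by (simp add: zero_less_mult_iff)
  qed
  define F where "F n = (\<lambda>x. \<Prod>i\<in>UNIV. G n i x)" for n
  have Fnz: "x \<in> box a b" if "F n x \<noteq> 0" for n x
    using that Gnz unfolding F_def mem_box_cart by (metis finite iso_tuple_UNIV_I prod_zero)
  show thesis
  proof (rule that[of F])
    show "test (F n)" for n
    proof (rule testI[where S="cbox a b"])
      show "smooth_fn (F n)" unfolding F_def by (rule smooth_fn_prod[OF finite sG])
      show "x \<in> cbox a b" if "F n x \<noteq> 0" for x using Fnz[OF that] box_subset_cbox by blast
    qed (rule compact_cbox)
    show "0 \<le> F n x \<and> F n x \<le> indicator (cbox a b) x" for n x
    proof -
      have "0 \<le> F n x" "F n x \<le> 1" unfolding F_def by (auto intro!: prod_nonneg prod_le_1 G01)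
      moreover have "x \<in> cbox a b" if "F n x \<noteq> 0" using Fnz[OF that] box_subset_cbox by blast
      ultimately show ?thesis by (cases "F n x = 0") (auto simp: indicator_def)
    qed
    show "(\<lambda>n. F n x) \<longlonglongrightarrow> indicator (box a b) x" for x
    proof (cases "x \<in> box a b")
      case True
      have "(\<lambda>n. G n i x) \<longlonglongrightarrow> 1" for i
      proof -
        have d: "0 < x $ i - a $ i" "0 < b $ i - x $ i" using True by (auto simp: mem_box_cart)
        have ev: "\<forall>\<^sub>F n in sequentially. 2 \<le> real (Suc n) * d" if "0 < d" for d
        proof -
          obtain N where N: "2 / d < real N" using reals_Archimedean2 by blast
          show ?thesis
          proof (rule eventually_sequentiallyI[of N])
            fix n assume "N \<le> n"
            then have "2 / d \<le> real (Suc n)" using N by linarith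
            then show "2 \<le> real (Suc n) * d" using that by (simp add: field_simps)
          qed
        qed
        have "\<forall>\<^sub>F n in sequentially. G n i x = 1"
          using ev[OF d(1)] ev[OF d(2)] by eventually_elim (simp add: G P(3))
        then show ?thesis by (rule tendsto_eventually)
      qed
      then have "(\<lambda>n. F n x) \<longlonglongrightarrow> (\<Prod>i\<in>(UNIV :: 3 set). 1)" unfolding F_def by (intro tendsto_prod)
      then show ?thesis using True by simp
    next
      case False
      then have "F n x = 0" for n using Fnz by blast
      then show ?thesis using False by simp
    qed
  qed
qed

lemma L2_indicator_cbox: "L2 (indicator (cbox a b :: pt set))"
proof -
  have "(\<lambda>x. (indicator (cbox a b) x :: real)\<^sup>2) = indicator (cbox a b)" by (auto simp: indicator_def)
  then show ?thesis unfolding L2_def using emeasure_bounded_finite[OF bounded_cbox, of a b] by (auto intro!: integrable_real_indicator)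
qed

lemma L2_indicator_box: "L2 (indicator (box a b :: pt set))"
proof -
  have "(\<lambda>x. (indicator (box a b) x :: real)\<^sup>2) = indicator (box a b)" by (auto simp: indicator_def)
  then show ?thesis unfolding L2_def using emeasure_bounded_finite[OF bounded_box, of a b] by (auto intro!: integrable_real_indicator)
qed

text \<open>Orthogonality passes from test functions to indicators of boxes by dominated
  convergence. The positive and negative parts of \<open>g\<close> are then densities of two
  measures that agree on a generator stable under intersection, hence coincide.\<close>

lemma L2_orthogonal_test_zero:
  assumes g: "L2 g" and o: "\<And>\<phi>. test \<phi> \<Longrightarrow> (\<integral>x. g x * \<phi> x \<partial>lborel) = 0"
  shows "AE x in lborel. g x = 0"
proof -
  have [measurable]: "g \<in> borel_measurable lborel" by (rule L2_borel[OF g])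
  have box0: "(\<integral>x. g x * indicator (box a b) x \<partial>lborel) = 0" for a b :: pt
  proof -
    obtain F where F: "\<And>n. test (F n)" "\<And>n x. 0 \<le> F n x \<and> F n x \<le> indicator (cbox a b) x"
      "\<And>x. (\<lambda>n. F n x) \<longlonglongrightarrow> indicator (box a b) x" using test_box_approx[of a b] by metis
    have "(\<lambda>n. \<integral>x. g x * F n x \<partial>lborel) \<longlonglongrightarrow> (\<integral>x. g x * indicator (box a b) x \<partial>lborel)"
    proof (rule integral_dominated_convergence[where w="\<lambda>x. \<bar>g x\<bar> * indicator (cbox a b) x"])
      show "integrable lborel (\<lambda>x. \<bar>g x\<bar> * indicator (cbox a b) x)"
        by (rule L2_mult_integrable[OF L2_abs[OF g] L2_indicator_cbox])
      show "AE x in lborel. (\<lambda>n. g x * F n x) \<longlonglongrightarrow> g x * indicator (box a b) x"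
        by (intro AE_I2 tendsto_mult tendsto_const F)
      show "AE x in lborel. norm (g x * F n x) \<le> \<bar>g x\<bar> * indicator (cbox a b) x" for n
        using F(2)[of n] by (intro AE_I2) (simp add: abs_mult mult_left_mono)
      show "(\<lambda>x. g x * F n x) \<in> borel_measurable lborel" for n using test_borel[OF F(1), of n] by simp
    qed measurable
    moreover have "(\<lambda>n. \<integral>x. g x * F n x \<partial>lborel) = (\<lambda>n. 0)" using o[OF F(1)] by simp
    ultimately show ?thesis by (simp add: LIMSEQ_const_iff)
  qed
  define gp gm where "gp x = max 0 (g x)" and "gm x = max 0 (- g x)" for x
  have [measurable]: "gp \<in> borel_measurable lborel" "gm \<in> borel_measurable lborel" unfolding gp_def[abs_def] gm_def[abs_def] by measurable
  have ip: "integrable lborel (\<lambda>x. gp x * indicator (box a b) x)" "integrable lborel (\<lambda>x. gm x * indicator (box a b) x)" for a b :: pt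
  proof -
    have i: "integrable lborel (\<lambda>x. g x * indicator (box a b) x)" by (rule L2_mult_integrable[OF g L2_indicator_box])
    show "integrable lborel (\<lambda>x. gp x * indicator (box a b) x)" "integrable lborel (\<lambda>x. gm x * indicator (box a b) x)"
      by (rule Bochner_Integration.integrable_bound[OF i]; auto simp: gp_def gm_def indicator_def)+
  qed
  have gp0: "0 \<le> gp x" "0 \<le> gm x" for x by (simp_all add: gp_def gm_def)
  have em: "emeasure (density lborel (\<lambda>x. ennreal (f x))) (box a b) = ennreal (\<integral>x. f x * indicator (box a b) x \<partial>lborel)"
    if "f \<in> borel_measurable lborel" "\<And>x. 0 \<le> f x" "integrable lborel (\<lambda>x. f x * indicator (box a b) x)" for f and a b :: pt
  proof -
    have "emeasure (density lborel (\<lambda>x. ennreal (f x))) (box a b) = (\<integral>\<^sup>+x. ennreal (f x) * indicator (box a b) x \<partial>lborel)"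
      using that by (intro emeasure_density) auto
    also have "\<dots> = (\<integral>\<^sup>+x. ennreal (f x * indicator (box a b) x) \<partial>lborel)"
      by (intro nn_integral_cong) (auto simp: indicator_def)
    also have "\<dots> = ennreal (\<integral>x. f x * indicator (box a b) x \<partial>lborel)"
      using that by (intro nn_integral_eq_integral) auto
    finally show ?thesis .
  qed
  have dens: "density lborel (\<lambda>x. ennreal (gp x)) = density lborel (\<lambda>x. ennreal (gm x))"
  proof -
    let ?E = "range (\<lambda>(a, b). box a b :: pt set)"
    show ?thesis
    proof (rule measure_eqI_generator_eq[where E="?E" and \<Omega>=UNIV and A="\<lambda>n::nat. box (- (real n *\<^sub>R One)) (real n *\<^sub>R One)"])
      show "Int_stable ?E" by (auto simp: Int_stable_def box_Int_box)
      show "sets (density lborel (\<lambda>x. ennreal (gp x))) = sigma_sets UNIV ?E"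
        "sets (density lborel (\<lambda>x. ennreal (gm x))) = sigma_sets UNIV ?E"
        by (simp_all add: borel_eq_box)
      show "range (\<lambda>n::nat. box (- (real n *\<^sub>R One)) (real n *\<^sub>R One)) \<subseteq> ?E" by auto
      show "(\<Union>n::nat. box (- (real n *\<^sub>R One)) (real n *\<^sub>R One)) = (UNIV :: pt set)" by (rule UN_box_eq_UNIV)
      show "emeasure (density lborel (\<lambda>x. ennreal (gp x))) (box (- (real n *\<^sub>R One)) (real n *\<^sub>R One)) \<noteq> \<infinity>" for n
        using em[of gp, OF _ gp0(1) ip(1)] by simp
      fix X assume "X \<in> ?E"
      then obtain a b where X: "X = box a b" by auto
      have "(\<integral>x. gp x * indicator (box a b) x \<partial>lborel) - (\<integral>x. gm x * indicator (box a b) x \<partial>lborel) = (\<integral>x. g x * indicator (box a b) x \<partial>lborel)"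
        unfolding Bochner_Integration.integral_diff[OF ip, symmetric]
        by (intro Bochner_Integration.integral_cong) (auto simp: gp_def gm_def indicator_def)
      then show "emeasure (density lborel (\<lambda>x. ennreal (gp x))) X = emeasure (density lborel (\<lambda>x. ennreal (gm x))) X"
        unfolding X box0 using em[of gp, OF _ gp0(1) ip(1)] em[of gm, OF _ gp0(2) ip(2)] by simp
    qed simp
  qed
  have "AE x in lborel. ennreal (gp x) = ennreal (gm x)"
    using dens by (subst (asm) sigma_finite_measure.density_unique_iff[OF sigma_finite_lborel]) auto
  then show ?thesis by eventually_elim (auto simp: gp_def gm_def max_def split: if_splits)
qed

lemma weak_pd_unique:
  assumes "L2 g" "L2 g'" "weak_pd i u g" "weak_pd i u g'" shows "AE x in lborel. g x = g' x"
proof -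
  have "AE x in lborel. g x - g' x = 0"
  proof (rule L2_orthogonal_test_zero[OF L2_diff[OF assms(1,2)]])
    fix \<phi> assume \<phi>: "test \<phi>"
    have "(\<integral>x. (g x - g' x) * \<phi> x \<partial>lborel) = (\<integral>x. g x * \<phi> x \<partial>lborel) - (\<integral>x. g' x * \<phi> x \<partial>lborel)"
      using L2_mult_integrable[OF assms(1) test_L2[OF \<phi>]] L2_mult_integrable[OF assms(2) test_L2[OF \<phi>]]
      by (simp add: left_diff_distrib)
    also have "\<dots> = 0" using assms(3,4) \<phi> unfolding weak_pd_def by (metis add.inverse_inverse diff_self)
    finally show "(\<integral>x. (g x - g' x) * \<phi> x \<partial>lborel) = 0" .
  qed
  then show ?thesis by eventually_elim simp
qed

lemma H1_wgrad: "H1 u \<Longrightarrow> L2 (wgrad i u) \<and> weak_pd i u (wgrad i u)"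
  unfolding H1_def wgrad_def by (metis (mono_tags, lifting) someI_ex)

lemma H1_L2: "H1 u \<Longrightarrow> L2 u" by (simp add: H1_def)

text \<open>\<open>h1norm\<close> goes through a chosen weak gradient; uniqueness of weak
  derivatives allows any convenient \<open>g\<close> in its place.\<close>

lemma h1norm_eq:
  assumes u: "L2 u" and g: "\<And>i. L2 (g i)" "\<And>i. weak_pd i u (g i)"
  shows "H1 u" "h1norm u = norm (n2 u, (\<chi> i. n2 (g i)) :: real^3)"
proof -
  show H: "H1 u" unfolding H1_def using assms by blast
  have w: "n2 (wgrad i u) = n2 (g i)" for i
  proof -
    have "AE x in lborel. g i x = wgrad i u x"
      using weak_pd_unique[OF g(1) _ g(2)] H1_wgrad[OF H] by blast
    then show ?thesis using n2_cong_AE[OF g(1)] L2_borel H1_wgrad[OF H] by metis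
  qed
  show "h1norm u = norm (n2 u, (\<chi> i. n2 (g i)) :: real^3)"
  proof (rule power2_eq_imp_eq)
    show "(h1norm u)\<^sup>2 = (norm (n2 u, (\<chi> i. n2 (g i)) :: real^3))\<^sup>2"
      by (simp add: h1norm_def norm_Pair norm_vec_def L2_set_def sum_nonneg l2sq_nonneg n2_sq[symmetric] w)
  qed (simp_all add: h1norm_def l2sq_nonneg sum_nonneg)
qed

lemma weak_pd_test: "test f \<Longrightarrow> weak_pd i f (pd i f)"
  unfolding weak_pd_def using integral_by_parts test_smooth by blast

lemma H1_test: assumes "test f" shows "H1 f"
  by (rule h1norm_eq(1)[OF test_L2[OF assms] test_L2[OF test_pd[OF assms]] weak_pd_test[OF assms]])

lemma h1norm_test: assumes "test f" shows "h1norm f = h1t f"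
  unfolding h1t_norm by (rule h1norm_eq(2)[OF test_L2[OF assms] test_L2[OF test_pd[OF assms]] weak_pd_test[OF assms]])

lemma weak_pd_lincomb:
  assumes L: "L2 u" "L2 v" "L2 g" "L2 h" and w: "weak_pd i u g" "weak_pd i v h"
  shows "weak_pd i (\<lambda>x. a * u x + b * v x) (\<lambda>x. a * g x + b * h x)"
  unfolding weak_pd_def
proof (intro allI impI)
  fix \<phi> assume \<phi>: "test \<phi>"
  have e: "(\<integral>x. (a * f x + b * k x) * \<psi> x \<partial>lborel) = a * (\<integral>x. f x * \<psi> x \<partial>lborel) + b * (\<integral>x. k x * \<psi> x \<partial>lborel)"
    if "L2 f" "L2 k" "test \<psi>" for f k \<psi>
    using L2_mult_integrable[OF that(1) test_L2[OF that(3)]] L2_mult_integrable[OF that(2) test_L2[OF that(3)]]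
    by (simp add: distrib_right mult.assoc)
  show "(\<integral>x. (a * u x + b * v x) * pd i \<phi> x \<partial>lborel) = - (\<integral>x. (a * g x + b * h x) * \<phi> x \<partial>lborel)"
    using w \<phi> unfolding weak_pd_def by (simp add: e[OF L(1,2) test_pd[OF \<phi>]] e[OF L(3,4) \<phi>])
qed

lemma H1_lincomb:
  assumes u: "H1 u" and v: "H1 v"
  shows "H1 (\<lambda>x. a * u x + b * v x)" "h1norm (\<lambda>x. a * u x + b * v x) \<le> \<bar>a\<bar> * h1norm u + \<bar>b\<bar> * h1norm v"
proof -
  note U = H1_wgrad[OF u] and V = H1_wgrad[OF v]
  note L = H1_L2[OF u] H1_L2[OF v]
  have w: "weak_pd i (\<lambda>x. a * u x + b * v x) (\<lambda>x. a * wgrad i u x + b * wgrad i v x)" for i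
    using weak_pd_lincomb[OF L] U V by blast
  have LL: "L2 (\<lambda>x. a * wgrad i u x + b * wgrad i v x)" for i using L2_lincomb U V by blast
  note E = h1norm_eq[where g="\<lambda>i x. a * wgrad i u x + b * wgrad i v x", OF L2_lincomb[OF L, of a b] LL w]
  show "H1 (\<lambda>x. a * u x + b * v x)" by (rule E(1))
  have tri: "n2 (\<lambda>x. a * f x + b * g x) \<le> \<bar>a\<bar> * n2 f + \<bar>b\<bar> * n2 g" if "L2 f" "L2 g" for f g
    using n2_triangle[OF L2_cmult[OF that(1), of a] L2_cmult[OF that(2), of b]] by (simp add: n2_cmult)
  let ?N = "\<lambda>u. (n2 u, (\<chi> i. n2 (wgrad i u)) :: real^3)"
  have "(norm (n2 (\<lambda>x. a * u x + b * v x), (\<chi> i. n2 (\<lambda>x. a * wgrad i u x + b * wgrad i v x)) :: real^3))\<^sup>2 \<le> (norm (\<bar>a\<bar> *\<^sub>R ?N u + \<bar>b\<bar> *\<^sub>R ?N v))\<^sup>2"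
    using U V by (simp add: norm_Pair norm_vec_def L2_set_def sum_nonneg)
       (intro add_mono sum_mono power_mono tri L n2_nonneg; simp)
  then have "h1norm (\<lambda>x. a * u x + b * v x) \<le> norm (\<bar>a\<bar> *\<^sub>R ?N u + \<bar>b\<bar> *\<^sub>R ?N v)"
    unfolding E(2) by (rule power2_le_imp_le) simp
  also have "\<dots> \<le> \<bar>a\<bar> * norm (?N u) + \<bar>b\<bar> * norm (?N v)"
    using norm_triangle_ineq[of "\<bar>a\<bar> *\<^sub>R ?N u" "\<bar>b\<bar> *\<^sub>R ?N v"] by (simp only: norm_scaleR abs_idempotent)
  finally show "h1norm (\<lambda>x. a * u x + b * v x) \<le> \<bar>a\<bar> * h1norm u + \<bar>b\<bar> * h1norm v"
    using h1norm_eq(2)[OF L(1), of "\<lambda>i. wgrad i u"] h1norm_eq(2)[OF L(2), of "\<lambda>i. wgrad i v"] U V by simp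
qed

lemma h1norm_nonneg: "0 \<le> h1norm u" by (simp add: h1norm_def l2sq_nonneg sum_nonneg)

section \<open>The closure of test functions on \<open>\<Omega>\<close> in H^1\<close>

lemma test_on_test: "test_on \<Omega> f \<Longrightarrow> test f" by (simp add: test_on_def)

lemma test_on_zero: "test_on \<Omega> (\<lambda>x. 0)"
  by (simp add: test_on_def test_zero tsupp_def)

lemma test_on_lincomb: assumes "test_on \<Omega> f" "test_on \<Omega> g" shows "test_on \<Omega> (\<lambda>x. a * f x + b * g x)"
proof -
  have t: "test f" "test g" using assms by (auto simp: test_on_def)
  have "tsupp (\<lambda>x. a * f x + b * g x) \<subseteq> tsupp f \<union> tsupp g"
  proof (rule tsupp_subset)
    fix x assume "a * f x + b * g x \<noteq> 0"
    then have "f x \<noteq> 0 \<or> g x \<noteq> 0" by auto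
    then show "x \<in> tsupp f \<union> tsupp g" using tsupp_nonzero[of f x] tsupp_nonzero[of g x] by blast
  qed (intro closed_Un closed_tsupp)
  then show ?thesis using assms test_add[OF test_cmult[OF t(1)] test_cmult[OF t(2)]] unfolding test_on_def by blast
qed

lemma test_on_sum: "finite A \<Longrightarrow> (\<And>a. a \<in> A \<Longrightarrow> test_on \<Omega> (f a)) \<Longrightarrow> test_on \<Omega> (\<lambda>x. \<Sum>a\<in>A. f a x)"
proof (induction A rule: finite_induct)
  case (insert a A)
  then show ?case using test_on_lincomb[of \<Omega> "f a" "\<lambda>x. \<Sum>a\<in>A. f a x" 1 1] by simp
qed (simp add: test_on_zero)

lemma H01_lincomb:
  assumes u: "H01 \<Omega> u" and v: "H01 \<Omega> v" shows "H01 \<Omega> (\<lambda>x. a * u x + b * v x)"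
proof -
  obtain f where f: "\<And>n. test_on \<Omega> (f n)" "(\<lambda>n. h1norm (\<lambda>x. u x - f n x)) \<longlonglongrightarrow> 0" using u by (auto simp: H01_def)
  obtain g where g: "\<And>n. test_on \<Omega> (g n)" "(\<lambda>n. h1norm (\<lambda>x. v x - g n x)) \<longlonglongrightarrow> 0" using v by (auto simp: H01_def)
  have uv: "H1 u" "H1 v" using u v by (auto simp: H01_def)
  have d: "H1 (\<lambda>x. u x - f n x)" "H1 (\<lambda>x. v x - g n x)" for n
    using H1_lincomb(1)[OF uv(1) H1_test[OF test_on_test[OF f(1)]], of 1 "-1"]
      H1_lincomb(1)[OF uv(2) H1_test[OF test_on_test[OF g(1)]], of 1 "-1"] by simp_all
  show ?thesis unfolding H01_def
  proof (intro conjI exI[of _ "\<lambda>n x. a * f n x + b * g n x"] allI)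
    show "H1 (\<lambda>x. a * u x + b * v x)" by (rule H1_lincomb(1)[OF uv])
    show "test_on \<Omega> (\<lambda>x. a * f n x + b * g n x)" for n by (rule test_on_lincomb[OF f(1) g(1)])
    have l: "(\<lambda>n. \<bar>a\<bar> * h1norm (\<lambda>x. u x - f n x) + \<bar>b\<bar> * h1norm (\<lambda>x. v x - g n x)) \<longlonglongrightarrow> 0"
      using tendsto_add[OF tendsto_mult[OF tendsto_const f(2)] tendsto_mult[OF tendsto_const g(2)], of "\<bar>a\<bar>" "\<bar>b\<bar>"] by simp
    show "(\<lambda>n. h1norm (\<lambda>x. a * u x + b * v x - (a * f n x + b * g n x))) \<longlonglongrightarrow> 0"
    proof (rule Lim_null_comparison[OF always_eventually l], rule allI)
      fix n
      have "(\<lambda>x. a * u x + b * v x - (a * f n x + b * g n x)) = (\<lambda>x. a * (u x - f n x) + b * (v x - g n x))"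
        by (simp add: algebra_simps)
      then show "norm (h1norm (\<lambda>x. a * u x + b * v x - (a * f n x + b * g n x))) \<le> \<bar>a\<bar> * h1norm (\<lambda>x. u x - f n x) + \<bar>b\<bar> * h1norm (\<lambda>x. v x - g n x)"
        using H1_lincomb(2)[OF d, of a n b n] by (simp add: h1norm_nonneg)
    qed
  qed
qed

lemma H01_test_on: "test_on \<Omega> f \<Longrightarrow> H01 \<Omega> f"
  unfolding H01_def
  by (intro conjI exI[of _ "\<lambda>n. f"]) (auto simp: H1_test test_on_test h1norm_test[OF test_zero] h1t_zero)

lemma fdist_lim:
  assumes "L2 u" "\<And>n. L2 (F n)" "(\<lambda>n. n2 (\<lambda>x. u x - F n x)) \<longlonglongrightarrow> 0" "test \<phi>"
  shows "(\<lambda>n. fdist (F n) \<phi>) \<longlonglongrightarrow> fdist u \<phi>"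
proof -
  have "(\<lambda>n. fdist (F n) \<phi> - fdist u \<phi>) \<longlonglongrightarrow> 0"
  proof (rule Lim_null_comparison)
    show "(\<lambda>n. n2 (\<lambda>x. u x - F n x) * n2 \<phi>) \<longlonglongrightarrow> 0"
      using tendsto_mult[OF assms(3) tendsto_const, of "n2 \<phi>"] by simp
    have "norm (fdist (F n) \<phi> - fdist u \<phi>) \<le> n2 (\<lambda>x. u x - F n x) * n2 \<phi>" for n
    proof -
      have "fdist u \<phi> - fdist (F n) \<phi> = (\<integral>x. (u x - F n x) * \<phi> x \<partial>lborel)"
        using L2_mult_integrable[OF assms(1) test_L2[OF assms(4)]] L2_mult_integrable[OF assms(2) test_L2[OF assms(4)], of n]
        by (simp add: fdist_def left_diff_distrib)
      then show ?thesis
        using L2_Cauchy_Schwarz[OF L2_diff[OF assms(1,2)] test_L2[OF assms(4)], of n] by simp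
    qed
    then show "\<forall>\<^sub>F n in sequentially. norm (fdist (F n) \<phi> - fdist u \<phi>) \<le> n2 (\<lambda>x. u x - F n x) * n2 \<phi>" by simp
  qed
  then show ?thesis by (simp add: LIM_zero_iff)
qed

text \<open>The function is the pointwise sum, available through the geometric L2 bound; this
  concrete form later makes the operators linear almost everywhere. Its weak gradient is the L2
  limit of the gradients of the partial sums (\<open>Riesz_Fischer\<close>), identified by passing
  to the limit in the integration by parts.\<close>

lemma H01_series:
  fixes f :: "nat \<Rightarrow> fn"
  assumes f: "\<And>k. test_on \<Omega> (f k)"
    and b: "\<And>k. n2 (f k) \<le> B * (1/2) ^ k"
    and M: "\<And>n. h1t (\<lambda>x. \<Sum>k\<in>{0..<n}. f k x) \<le> M"
    and C: "\<And>e. e > 0 \<Longrightarrow> \<exists>N. \<forall>m\<ge>N. \<forall>n. h1t (\<lambda>x. \<Sum>k\<in>{m..<n}. f k x) \<le> e"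
  shows "H01 \<Omega> (\<lambda>x. \<Sum>k. f k x)" "h1norm (\<lambda>x. \<Sum>k. f k x) \<le> M"
    "AE x in lborel. summable (\<lambda>k. f k x)"
    "test \<phi> \<Longrightarrow> (\<lambda>k. fdist (f k) \<phi>) sums fdist (\<lambda>x. \<Sum>k. f k x) \<phi>"
proof -
  have tf: "test (f k)" and fL: "L2 (f k)" for k using test_on_test[OF f] test_L2 by blast+
  have sg: "summable (\<lambda>j. (1/2::real) ^ j)" by (rule summable_geometric) simp
  have sn: "summable (\<lambda>k. n2 (f k))"
    by (rule summable_comparison_test'[OF summable_mult[OF sg, of B], of 0]) (use b n2_nonneg in simp)
  let ?u = "\<lambda>x. \<Sum>k. f k x"
  define F where "F n = (\<lambda>x. \<Sum>k<n. f k x)" for n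
  have tF: "test_on \<Omega> (F n)" "test (F n)" for n
    unfolding F_def by (rule test_on_sum[OF finite_lessThan f], rule test_sum[OF finite_lessThan tf])
  have FL: "L2 (F n)" for n by (rule test_L2[OF tF(2)])
  have uL: "L2 ?u" by (rule L2_series(2)[OF fL sn])
  show "AE x in lborel. summable (\<lambda>k. f k x)"
    using L2_series(1)[OF fL sn] by eventually_elim (rule summable_rabs_cancel)
  have u0: "(\<lambda>n. n2 (\<lambda>x. ?u x - F n x)) \<longlonglongrightarrow> 0"
  proof (rule Lim_null_comparison)
    have "(\<lambda>n. suminf (\<lambda>k. n2 (f k)) - (\<Sum>k<n. n2 (f k))) \<longlonglongrightarrow> suminf (\<lambda>k. n2 (f k)) - suminf (\<lambda>k. n2 (f k))"
      by (intro tendsto_diff tendsto_const summable_LIMSEQ sn)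
    then show "(\<lambda>n. \<Sum>k. n2 (f (k + n))) \<longlonglongrightarrow> 0"
      using suminf_minus_initial_segment[OF sn] by simp
    show "\<forall>\<^sub>F n in sequentially. norm (n2 (\<lambda>x. ?u x - F n x)) \<le> (\<Sum>k. n2 (f (k + n)))"
      using L2_series_tail[OF fL sn] unfolding F_def by (simp add: n2_nonneg)
  qed
  show "(\<lambda>k. fdist (f k) \<phi>) sums fdist ?u \<phi>" if \<phi>: "test \<phi>"
  proof -
    have "fdist (F n) \<phi> = (\<Sum>k<n. fdist (f k) \<phi>)" for n
      unfolding fdist_def F_def sum_distrib_right
      by (rule Bochner_Integration.integral_sum) (rule L2_mult_integrable[OF fL test_L2[OF \<phi>]])
    then show ?thesis unfolding sums_def using fdist_lim[OF uL FL u0 \<phi>] by simp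
  qed
  have diffF: "h1t (\<lambda>x. F m x - F n x) \<le> e"
    if N: "\<forall>m\<ge>N. \<forall>n. h1t (\<lambda>x. \<Sum>k\<in>{m..<n}. f k x) \<le> e" and mn: "m \<ge> N" "n \<ge> N" for N m n e
  proof -
    have le: "(\<lambda>x. F q x - F p x) = (\<lambda>x. \<Sum>k\<in>{p..<q}. f k x)" if "p \<le> q" for p q
    proof
      fix x show "F q x - F p x = (\<Sum>k\<in>{p..<q}. f k x)"
        unfolding F_def using sum_diff_nat_ivl[of 0 p q "\<lambda>k. f k x"] that by (simp add: atLeast0LessThan)
    qed
    show ?thesis
    proof (cases "n \<le> m")
      case True then show ?thesis using le[OF True] N mn by simp
    next
      case False
      then have nm: "m \<le> n" by simp
      have "h1t (\<lambda>x. F m x - F n x) = h1t (\<lambda>x. F n x - F m x)"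
        using h1t_cmult[OF test_diff[OF tF(2)[of n] tF(2)[of m]], of "-1"] by simp
      then show ?thesis using le[OF nm] N mn by simp
    qed
  qed
  have "\<forall>i. \<exists>g. L2 g \<and> (\<lambda>n. n2 (\<lambda>x. g x - pd i (F n) x)) \<longlonglongrightarrow> 0"
  proof (intro allI Riesz_Fischer)
    show "L2 (pd i (F n))" for i n by (rule test_L2[OF test_pd[OF tF(2)]])
    fix i and e :: real assume "e > 0"
    then obtain N where N: "\<forall>m\<ge>N. \<forall>n. h1t (\<lambda>x. \<Sum>k\<in>{m..<n}. f k x) \<le> e" using C by blast
    show "\<exists>N. \<forall>m\<ge>N. \<forall>n\<ge>N. n2 (\<lambda>x. pd i (F m) x - pd i (F n) x) \<le> e"
    proof (intro exI[of _ N] allI impI)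
      fix m n assume mn: "N \<le> m" "N \<le> n"
      have "n2 (pd i (\<lambda>x. F m x - F n x)) \<le> e" using n2_pd_le_h1t diffF[OF N mn] order_trans by blast
      then show "n2 (\<lambda>x. pd i (F m) x - pd i (F n) x) \<le> e"
        unfolding pd_diff[OF test_smooth[OF tF(2)] test_smooth[OF tF(2)]] .
    qed
  qed
  from choice[OF this] obtain g where g: "\<And>i. L2 (g i)" "\<And>i. (\<lambda>n. n2 (\<lambda>x. g i x - pd i (F n) x)) \<longlonglongrightarrow> 0" by blast
  have w: "weak_pd i ?u (g i)" for i
    unfolding weak_pd_def
  proof (intro allI impI)
    fix \<phi> assume \<phi>: "test \<phi>"
    have 1: "(\<lambda>n. fdist (F n) (pd i \<phi>)) \<longlonglongrightarrow> fdist ?u (pd i \<phi>)" by (rule fdist_lim[OF uL FL u0 test_pd[OF \<phi>]])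
    have "(\<lambda>n. fdist (pd i (F n)) \<phi>) \<longlonglongrightarrow> fdist (g i) \<phi>"
      by (rule fdist_lim[OF g(1) test_L2[OF test_pd[OF tF(2)]] g(2) \<phi>])
    then have 2: "(\<lambda>n. - fdist (pd i (F n)) \<phi>) \<longlonglongrightarrow> - fdist (g i) \<phi>" by (rule tendsto_minus)
    have "fdist (F n) (pd i \<phi>) = - fdist (pd i (F n)) \<phi>" for n
      unfolding fdist_def by (rule integral_by_parts[OF tF(2) test_smooth[OF \<phi>]])
    then show "(\<integral>x. ?u x * pd i \<phi> x \<partial>lborel) = - (\<integral>x. g i x * \<phi> x \<partial>lborel)"
      using LIMSEQ_unique[OF 1] 2 unfolding fdist_def by simp
  qed
  have H: "H1 ?u" by (rule h1norm_eq(1)[OF uL g(1) w])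
  have lim: "(\<lambda>n. h1norm (\<lambda>x. ?u x - F n x)) \<longlonglongrightarrow> 0"
  proof -
    have "h1norm (\<lambda>x. ?u x - F n x) = norm (n2 (\<lambda>x. ?u x - F n x), (\<chi> i. n2 (\<lambda>x. g i x - pd i (F n) x)) :: real^3)" for n
    proof (rule h1norm_eq(2)[where g="\<lambda>i x. g i x - pd i (F n) x"])
      show "L2 (\<lambda>x. ?u x - F n x)" by (rule L2_diff[OF uL FL])
      show "L2 (\<lambda>x. g i x - pd i (F n) x)" for i by (rule L2_diff[OF g(1) test_L2[OF test_pd[OF tF(2)]]])
      show "weak_pd i (\<lambda>x. ?u x - F n x) (\<lambda>x. g i x - pd i (F n) x)" for i
        using weak_pd_lincomb[OF uL FL[of n] g(1)[of i] test_L2[OF test_pd[OF tF(2)[of n]]] w weak_pd_test[OF tF(2)[of n]], where a=1 and b="-1"] by simp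
    qed
    moreover have "(\<lambda>n. norm (n2 (\<lambda>x. ?u x - F n x), (\<chi> i. n2 (\<lambda>x. g i x - pd i (F n) x)) :: real^3)) \<longlonglongrightarrow> norm (0 :: real, (\<chi> i. 0) :: real^3)"
      by (intro tendsto_norm tendsto_Pair tendsto_vec_lambda u0 g(2))
    moreover have "norm (0 :: real, (\<chi> i. 0) :: real^3) = 0" by (simp add: norm_Pair zero_vec_def[symmetric])
    ultimately show ?thesis by simp
  qed
  show "H01 \<Omega> ?u" unfolding H01_def using H tF(1) lim by blast
  show "h1norm ?u \<le> M"
  proof (rule LIMSEQ_le_const)
    show "(\<lambda>n. h1norm (\<lambda>x. ?u x - F n x) + M) \<longlonglongrightarrow> M" using tendsto_add[OF lim tendsto_const, of M] by simp
    show "\<exists>N. \<forall>n\<ge>N. h1norm ?u \<le> h1norm (\<lambda>x. ?u x - F n x) + M"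
    proof (intro exI allI impI)
      fix n
      have d: "H1 (\<lambda>x. ?u x - F n x)"
        using H1_lincomb(1)[OF H H1_test[OF tF(2)[of n]], of 1 "-1"] by simp
      have "h1norm (\<lambda>x. 1 * (?u x - F n x) + 1 * F n x) \<le> \<bar>1\<bar> * h1norm (\<lambda>x. ?u x - F n x) + \<bar>1\<bar> * h1norm (F n)"
        by (rule H1_lincomb(2)[OF d H1_test[OF tF(2)]])
      also have "h1norm (F n) \<le> M" using M[of n] h1norm_test[OF tF(2)[of n]] by (simp add: F_def atLeast0LessThan)
      finally show "h1norm ?u \<le> h1norm (\<lambda>x. ?u x - F n x) + M" by simp
    qed
  qed
qed

section \<open>Telescoping of mollifiers\<close>

text \<open>The derivative in direction \<open>v\<close>; the name has nothing to do with the double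
  divergence of \<open>dd_norm\<close>.\<close>

definition dd :: "pt \<Rightarrow> fn \<Rightarrow> fn" where "dd v f = (\<lambda>x. \<Sum>i\<in>UNIV. v $ i * pd i f x)"

lemma test_dd: "test f \<Longrightarrow> test (dd v f)"
  unfolding dd_def by (rule test_sum[OF finite test_cmult[OF test_pd]])

lemma dd_cmult: "smooth_fn f \<Longrightarrow> dd v (\<lambda>x. c * f x) = (\<lambda>x. c * dd v f x)"
  by (simp add: dd_def pd_cmult sum_distrib_left mult.left_commute)

lemma integral_dd: "test f \<Longrightarrow> (\<integral>x. dd v f x \<partial>lborel) = 0"
  by (simp add: dd_def integral_pd test_integrable test_pd)

lemma conv_sum_right:
  assumes "finite A" "test f" "\<And>a. a \<in> A \<Longrightarrow> test (g a)"
  shows "conv f (\<lambda>x. \<Sum>a\<in>A. g a x) = (\<lambda>x. \<Sum>a\<in>A. conv f (g a) x)"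
proof
  fix x
  have "conv f (\<lambda>x. \<Sum>a\<in>A. g a x) x = (\<integral>y. (\<Sum>a\<in>A. f y * g a (x - y)) \<partial>lborel)" by (simp add: conv_eq sum_distrib_left)
  also have "\<dots> = (\<Sum>a\<in>A. conv f (g a) x)"
    unfolding conv_eq using conv_integrable[OF assms(2,3)] by (intro Bochner_Integration.integral_sum)
  finally show "conv f (\<lambda>x. \<Sum>a\<in>A. g a x) x = (\<Sum>a\<in>A. conv f (g a) x)" .
qed

lemma conv_dd_right: assumes "test f" "test g" shows "conv f (dd v g) = dd v (conv f g)"
proof -
  have "conv f (dd v g) = (\<lambda>x. \<Sum>i\<in>UNIV. conv f (\<lambda>x. v $ i * pd i g x) x)"
    unfolding dd_def by (rule conv_sum_right[OF finite assms(1) test_cmult[OF test_pd[OF assms(2)]]])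
  then show ?thesis unfolding conv_cmult_right pd_conv[OF assms, symmetric] dd_def .
qed

lemma conv_dd_left: assumes "test f" "test g" shows "conv (dd v f) g = dd v (conv f g)"
  using conv_dd_right[OF assms(2,1), of v] by (simp only: conv_commute[OF assms(2,1)] conv_commute[OF assms(2) test_dd[OF assms(1)]])

lemma dd_rfl: assumes "test g" shows "dd v (rfl g) = (\<lambda>x. - rfl (dd v g) x)"
  unfolding dd_def pd_rfl[OF assms] by (simp add: rfl_def sum_negf)

lemma dd_dd_rfl: assumes "test g" shows "dd v (dd v (rfl g)) = rfl (dd v (dd v g))"
proof -
  have "dd v (dd v (rfl g)) = dd v (\<lambda>x. (-1) * rfl (dd v g) x)" unfolding dd_rfl[OF assms] by simp
  also have "\<dots> = (\<lambda>x. (-1) * dd v (rfl (dd v g)) x)" by (rule dd_cmult[OF test_smooth[OF test_rfl[OF test_dd[OF assms]]]])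
  also have "\<dots> = rfl (dd v (dd v g))" unfolding dd_rfl[OF test_dd[OF assms]] by simp
  finally show ?thesis .
qed

lemma dd_dil: assumes "test g" shows "dd v (dil k g) = (\<lambda>x. 2 ^ k * dil k (dd v g) x)"
  unfolding dd_def pd_dil[OF assms] by (simp add: dil_def sum_distrib_left mult_ac)

lemma dd_dd_dil: assumes "test g" shows "dd v (dd v (dil k g)) = (\<lambda>x. 4 ^ k * dil k (dd v (dd v g)) x)"
proof -
  have "dd v (dd v (dil k g)) = (\<lambda>x. 2 ^ k * (2 ^ k * dil k (dd v (dd v g)) x))"
    unfolding dd_dil[OF assms] dd_cmult[OF test_smooth[OF test_dil[OF test_dd[OF assms]]]] dd_dil[OF test_dd[OF assms]] ..
  moreover have "(4::real) ^ k = 2 ^ k * 2 ^ k" by (simp flip: power_mult_distrib)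
  ultimately show ?thesis by (simp only: mult.assoc)
qed

lemma dil_dil_1: "dil k (dil 1 g) = dil (Suc k) g"
  by (simp add: dil_def fun_eq_iff mult_ac)

definition Jn :: "fn \<Rightarrow> nat \<Rightarrow> fn \<Rightarrow> fn" where
  "Jn \<theta> N \<phi> = conv (conv \<phi> (rfl (dil N \<theta>))) (rfl (dil N \<theta>))"

lemma test_Jn: "test \<phi> \<Longrightarrow> test \<theta> \<Longrightarrow> test (Jn \<theta> N \<phi>)"
  unfolding Jn_def by (rule test_conv[OF test_conv[OF _ test_rfl[OF test_dil]] test_rfl[OF test_dil]])

lemma pd_Jn: assumes "test \<phi>" "test \<theta>" shows "pd i (Jn \<theta> N \<phi>) = Jn \<theta> N (pd i \<phi>)"
proof -
  have t: "test (rfl (dil N \<theta>))" using assms by (simp add: test_rfl test_dil)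
  show ?thesis unfolding Jn_def pd_conv'[OF test_conv[OF assms(1) t] t] pd_conv'[OF assms(1) t] ..
qed

text \<open>\<open>Jn \<theta> N\<close> is the transpose of \<open>u \<mapsto> u * \<theta>\<^sub>N * \<theta>\<^sub>N\<close>, and in the convolution algebra
  \<open>q\<^sup>2 - p\<^sup>2 = (q + p) (q - p)\<close>.\<close>
lemma Jn_diff:
  assumes \<phi>: "test \<phi>" and \<theta>: "test \<theta>" and \<eta>: "\<And>a. test (\<eta> a)"
    and eq: "\<And>x. dil 1 \<theta> x - \<theta> x = (\<Sum>a\<in>UNIV. dd (d a) (dd (d a) (\<eta> a)) x)"
  shows "Jn \<theta> (Suc k) \<phi> x - Jn \<theta> k \<phi> x = (\<Sum>a\<in>(UNIV::3 set). dd (d a) (dd (d a) (Gk (\<lambda>x. \<theta> x + dil 1 \<theta> x) (\<eta> a) k \<phi>)) x)"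
proof -
  let ?\<Theta> = "\<lambda>x. \<theta> x + dil 1 \<theta> x"
  define p q where "p = rfl (dil k \<theta>)" and "q = rfl (dil (Suc k) \<theta>)"
  define \<zeta> where "\<zeta> a = rfl (dil k (\<eta> a))" for a
  have t: "test p" "test q" "test (\<zeta> a)" for a by (simp_all add: p_def q_def \<zeta>_def test_rfl test_dil \<theta> \<eta>)
  \<comment> \<open>The kernel identity \<open>eq\<close>, dilated and reflected: second derivatives
    survive the reflection without a sign (\<open>dd_dd_rfl\<close>), and the dilation accounts for
    \<open>(1/4) ^ k\<close>.\<close>
  have qp: "(\<lambda>x. q x - p x) = (\<lambda>x. (1/4) ^ k * (\<Sum>a\<in>UNIV. dd (d a) (dd (d a) (\<zeta> a)) x))"
  proof
    fix x
    have "q x - p x = dil k (\<lambda>x. dil 1 \<theta> x - \<theta> x) (- x)"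
      unfolding p_def q_def dil_dil_1[symmetric] by (simp add: rfl_def dil_def algebra_simps)
    also have "\<dots> = (\<Sum>a\<in>UNIV. dil k (dd (d a) (dd (d a) (\<eta> a))) (- x))"
      unfolding eq by (simp add: dil_def sum_distrib_left)
    also have "\<dots> = (\<Sum>a\<in>UNIV. (1/4) ^ k * dd (d a) (dd (d a) (\<zeta> a)) x)"
    proof (rule sum.cong[OF refl])
      fix a
      have "dd (d a) (dd (d a) (\<zeta> a)) x = 4 ^ k * dil k (dd (d a) (dd (d a) (\<eta> a))) (- x)"
        unfolding \<zeta>_def dd_dd_rfl[OF test_dil[OF \<eta>]] dd_dd_dil[OF \<eta>] by (simp add: rfl_def)
      then show "dil k (dd (d a) (dd (d a) (\<eta> a))) (- x) = (1/4) ^ k * dd (d a) (dd (d a) (\<zeta> a)) x"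
        by (simp add: power_one_over)
    qed
    finally show "q x - p x = (1/4) ^ k * (\<Sum>a\<in>UNIV. dd (d a) (dd (d a) (\<zeta> a)) x)" by (simp add: sum_distrib_left)
  qed
  \<comment> \<open>\<open>q + p\<close> is the other factor of the difference of squares; this is
    the origin of the kernel \<open>\<Theta>\<close> of \<open>cone_kernel\<close>.\<close>
  have \<Theta>: "rfl (dil k ?\<Theta>) = (\<lambda>x. q x + p x)"
    unfolding p_def q_def dil_dil_1[symmetric] by (simp add: rfl_def dil_def fun_eq_iff distrib_left)
  have tqp: "test (\<lambda>x. q x + p x)" by (rule test_add[OF t(2,1)])
  have cq: "conv (conv \<phi> q) p = conv (conv \<phi> p) q"
    unfolding conv_assoc[OF \<phi> t(2) t(1)] conv_assoc[OF \<phi> t(1) t(2)] conv_commute[OF t(1,2)] ..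
  have c: "test (conv \<phi> q)" "test (conv \<phi> p)" "test (conv \<phi> (\<zeta> a))" for a by (simp_all add: test_conv \<phi> t)
  have "Jn \<theta> (Suc k) \<phi> x - Jn \<theta> k \<phi> x = conv (conv \<phi> q) q x - conv (conv \<phi> p) p x"
    by (simp add: Jn_def p_def q_def)
  also have "\<dots> = conv (\<lambda>x. conv \<phi> q x - conv \<phi> p x) (\<lambda>x. q x + p x) x"
    unfolding conv_diff_left[OF tqp c(1,2)] conv_add_right[OF c(1) t(2,1)] conv_add_right[OF c(2) t(2,1)] cq by simp
  also have "(\<lambda>x. conv \<phi> q x - conv \<phi> p x) = conv \<phi> (\<lambda>x. q x - p x)"
    unfolding conv_diff_right[OF \<phi> t(2,1)] ..
  also have "\<dots> = (\<lambda>x. (1/4) ^ k * (\<Sum>a\<in>UNIV. dd (d a) (dd (d a) (conv \<phi> (\<zeta> a))) x))"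
  proof -
    have "conv \<phi> (dd (d a) (dd (d a) (\<zeta> a))) = dd (d a) (dd (d a) (conv \<phi> (\<zeta> a)))" for a
      unfolding conv_dd_right[OF \<phi> test_dd[OF t(3)]] conv_dd_right[OF \<phi> t(3)] ..
    then show ?thesis
      unfolding qp conv_cmult_right conv_sum_right[OF finite \<phi> test_dd[OF test_dd[OF t(3)]]] by simp
  qed
  also have "conv \<dots> (\<lambda>x. q x + p x) x = (\<Sum>a\<in>UNIV. (1/4) ^ k * dd (d a) (dd (d a) (conv (conv \<phi> (\<zeta> a)) (\<lambda>x. q x + p x))) x)"
  proof -
    have s: "test (\<lambda>x. \<Sum>a\<in>UNIV. dd (d a) (dd (d a) (conv \<phi> (\<zeta> a))) x)"
      by (rule test_sum[OF finite test_dd[OF test_dd[OF c(3)]]])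
    have "conv (\<lambda>x. \<Sum>a\<in>UNIV. dd (d a) (dd (d a) (conv \<phi> (\<zeta> a))) x) (\<lambda>x. q x + p x) x
      = (\<Sum>a\<in>UNIV. conv (\<lambda>x. q x + p x) (dd (d a) (dd (d a) (conv \<phi> (\<zeta> a)))) x)"
      unfolding conv_commute[OF s tqp] conv_sum_right[OF finite tqp test_dd[OF test_dd[OF c(3)]]] ..
    also have "\<dots> = (\<Sum>a\<in>UNIV. dd (d a) (dd (d a) (conv (conv \<phi> (\<zeta> a)) (\<lambda>x. q x + p x))) x)"
      unfolding conv_dd_right[OF tqp test_dd[OF c(3)]] conv_dd_right[OF tqp c(3)] conv_commute[OF tqp c(3)] ..
    finally show ?thesis unfolding conv_cmult_left by (simp add: sum_distrib_left)
  qed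
  also have "\<dots> = (\<Sum>a\<in>UNIV. dd (d a) (dd (d a) (Gk ?\<Theta> (\<eta> a) k \<phi>)) x)"
  proof (rule sum.cong[OF refl])
    fix a
    have tc: "test (conv (conv \<phi> (\<zeta> a)) (\<lambda>x. q x + p x))" by (rule test_conv[OF c(3) tqp])
    show "(1/4) ^ k * dd (d a) (dd (d a) (conv (conv \<phi> (\<zeta> a)) (\<lambda>x. q x + p x))) x = dd (d a) (dd (d a) (Gk ?\<Theta> (\<eta> a) k \<phi>)) x"
      unfolding Gk_def \<Theta> \<zeta>_def[symmetric] dd_cmult[OF test_smooth[OF tc]] dd_cmult[OF test_smooth[OF test_dd[OF tc]]] ..
  qed
  finally show ?thesis .
qed

section \<open>Convergence of the mollifiers\<close>

lemma h1t_conv: assumes f: "test f" and g: "test g" shows "h1t (conv f g) \<le> n1 g * h1t f"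
proof (rule power2_le_imp_le)
  have "(n2 (conv f g))\<^sup>2 \<le> (n1 g)\<^sup>2 * (n2 f)\<^sup>2"
    using power_mono[OF young[OF f g] n2_nonneg, where n=2] by (simp add: power_mult_distrib)
  moreover have "(n2 (pd i (conv f g)))\<^sup>2 \<le> (n1 g)\<^sup>2 * (n2 (pd i f))\<^sup>2" for i
    using power_mono[OF young[OF test_pd[OF f, of i] g] n2_nonneg, where n=2] by (simp add: power_mult_distrib pd_conv'[OF f g])
  ultimately show "(h1t (conv f g))\<^sup>2 \<le> (n1 g * h1t f)\<^sup>2"
    by (simp add: power_mult_distrib h1t_sq distrib_left sum_distrib_left add_mono sum_mono)
qed (simp add: n1_nonneg h1t_nonneg)

lemma dil_nonzero: "dil k g x \<noteq> 0 \<Longrightarrow> 2 ^ k *\<^sub>R x \<in> tsupp g"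
  using tsupp_nonzero[of g "2 ^ k *\<^sub>R x"] by (auto simp: dil_def)

lemma integral_dil: assumes "test g" shows "(\<integral>x. dil k g x \<partial>lborel) = (\<integral>x. g x \<partial>lborel)"
proof -
  have "(\<integral>x. g (2 ^ k *\<^sub>R x + 0) \<partial>lborel) = (\<integral>x. g x \<partial>lborel) / \<bar>2 ^ k\<bar> ^ 3"
    by (rule lborel_integral_affine[OF test_borel[OF assms]]) simp
  moreover have "((2::real) ^ k) ^ 3 = (2 ^ 3) ^ k" by (simp only: power_mult[symmetric] mult.commute)
  then have "(8::real) ^ k = (2 ^ k) ^ 3" by simp
  ultimately show ?thesis by (simp add: dil_def)
qed

text \<open>Because \<open>dil N g\<close> has integral 1, \<open>\<phi> x\<close> can be subtracted
  under the convolution integral. The kernel only sees points at distance at most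
  \<open>R * (1/2) ^ N\<close>, where \<open>\<phi>\<close> varies by at most its Lipschitz constant
  times that distance.\<close>

lemma conv_dil_approx_n2:
  assumes \<phi>: "test \<phi>" and g: "test g" and i1: "(\<integral>x. g x \<partial>lborel) = 1"
  shows "\<exists>C\<ge>0. \<forall>N. n2 (\<lambda>x. conv \<phi> (dil N g) x - \<phi> x) \<le> C * (1/2) ^ N"
proof -
  obtain L where L: "L \<ge> 0" "\<And>x y. \<bar>\<phi> x - \<phi> y\<bar> \<le> L * norm (x - y)" using test_Lipschitz[OF \<phi>] by metis
  obtain R where R: "R > 0" "\<And>x. x \<in> tsupp g \<Longrightarrow> norm x \<le> R"
    using compact_imp_bounded[OF test_compact[OF g]] by (auto simp: bounded_pos)
  let ?K = "{a + b | a b. a \<in> tsupp \<phi> \<and> b \<in> cball 0 R}"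
  have K: "compact ?K" by (intro compact_sums test_compact \<phi> compact_cball)
  show ?thesis
  proof (intro exI[of _ "L * R * n1 g * sqrt (measure lborel ?K)"] conjI allI)
    show "0 \<le> L * R * n1 g * sqrt (measure lborel ?K)" using L R n1_nonneg[of g] by simp
    fix N
    let ?g = "dil N g" and ?E = "\<lambda>x. conv \<phi> (dil N g) x - \<phi> x"
    have tg: "test ?g" by (rule test_dil[OF g])
    have tE: "test ?E" by (rule test_diff[OF test_conv[OF \<phi> tg] \<phi>])
    have zR: "norm z \<le> R * (1/2) ^ N" if "?g z \<noteq> 0" for z
    proof -
      have "norm (2 ^ N *\<^sub>R z) \<le> R" by (rule R(2)[OF dil_nonzero[OF that]])
      then show ?thesis by (simp add: field_simps power_one_over)
    qed
    have zR1: "norm z \<le> R" if "?g z \<noteq> 0" for z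
    proof -
      have "R * (1/2) ^ N \<le> R" using R(1) by (intro mult_left_le power_le_one) auto
      then show ?thesis using zR[OF that] by linarith
    qed
    have bound: "\<bar>?E x\<bar> \<le> L * R * n1 g * (1/2) ^ N" for x
    proof -
      have i: "integrable lborel (\<lambda>z. ?g z * \<phi> (x - z))" "integrable lborel ?g"
        by (rule conv_integrable[OF tg \<phi>], rule test_integrable[OF tg])
      have "?E x = conv ?g \<phi> x - (\<integral>z. ?g z * \<phi> x \<partial>lborel)"
        using integral_dil[OF g, of N] by (simp add: conv_commute[OF \<phi> tg] i1)
      also have "\<dots> = (\<integral>z. ?g z * (\<phi> (x - z) - \<phi> x) \<partial>lborel)"
        unfolding conv_eq using i by (simp add: right_diff_distrib)
      finally have "\<bar>?E x\<bar> = \<bar>\<dots>\<bar>" by simp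
      also have "\<dots> \<le> (\<integral>z. (L * R * (1/2) ^ N) * \<bar>?g z\<bar> \<partial>lborel)"
      proof (rule order_trans[OF integral_abs_bound], rule integral_mono)
        show "integrable lborel (\<lambda>z. \<bar>?g z * (\<phi> (x - z) - \<phi> x)\<bar>)" using i by (simp add: right_diff_distrib)
        show "integrable lborel (\<lambda>z. (L * R * (1/2) ^ N) * \<bar>?g z\<bar>)" using i by simp
        show "\<bar>?g z * (\<phi> (x - z) - \<phi> x)\<bar> \<le> (L * R * (1/2) ^ N) * \<bar>?g z\<bar>" for z
        proof (cases "?g z = 0")
          case False
          have "\<bar>\<phi> (x - z) - \<phi> x\<bar> \<le> L * norm z" using L(2)[of "x - z" x] by simp
          also have "\<dots> \<le> L * (R * (1/2) ^ N)" by (rule mult_left_mono[OF zR[OF False] L(1)])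
          finally have "\<bar>?g z\<bar> * \<bar>\<phi> (x - z) - \<phi> x\<bar> \<le> \<bar>?g z\<bar> * (L * (R * (1/2) ^ N))" by (rule mult_left_mono) simp
          then show ?thesis by (simp only: abs_mult mult_ac)
        qed simp
      qed
      also have "\<dots> = L * R * (1/2) ^ N * n1 g" using n1_dil[OF g, of N] by (simp add: n1_def)
      finally show ?thesis by (simp only: mult_ac)
    qed
    have nz: "x \<in> ?K" if "?E x \<noteq> 0" for x
    proof (cases "\<phi> x = 0")
      case False
      then show ?thesis using tsupp_nonzero[of \<phi> x] R(1) by (intro CollectI exI[of _ x] exI[of _ 0]) auto
    next
      case True
      then have "conv \<phi> ?g x \<noteq> 0" using that by simp
      then have "x \<in> {a + b | a b. a \<in> tsupp \<phi> \<and> b \<in> tsupp ?g}" using tsupp_conv[OF \<phi> tg] tsupp_nonzero[of "conv \<phi> ?g" x] by blast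
      moreover have "tsupp ?g \<subseteq> cball 0 R" by (rule tsupp_subset[OF closed_cball]) (use zR1 in simp)
      ultimately show ?thesis by blast
    qed
    have "n2 ?E \<le> (L * R * n1 g * (1/2) ^ N) * sqrt (measure lborel ?K)"
      by (rule n2_le_bound[OF test_L2[OF tE] bound nz K]) (use L R n1_nonneg[of g] in simp_all)
    then show "n2 ?E \<le> L * R * n1 g * sqrt (measure lborel ?K) * (1/2) ^ N" by (simp only: mult_ac)
  qed
qed

lemma conv_dil_approx_h1t:
  assumes \<phi>: "test \<phi>" and g: "test g" and i1: "(\<integral>x. g x \<partial>lborel) = 1"
  shows "\<exists>C\<ge>0. \<forall>N. h1t (\<lambda>x. conv \<phi> (dil N g) x - \<phi> x) \<le> C * (1/2) ^ N"
proof -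
  obtain C where C: "C \<ge> 0" "\<And>N. n2 (\<lambda>x. conv \<phi> (dil N g) x - \<phi> x) \<le> C * (1/2) ^ N"
    using conv_dil_approx_n2[OF assms] by blast
  have "\<forall>i. \<exists>D\<ge>0. \<forall>N. n2 (\<lambda>x. conv (pd i \<phi>) (dil N g) x - pd i \<phi> x) \<le> D * (1/2) ^ N"
    by (rule allI, rule conv_dil_approx_n2[OF test_pd[OF \<phi>] g i1])
  from choice[OF this] obtain D where D: "\<And>i. D i \<ge> 0" "\<And>i N. n2 (\<lambda>x. conv (pd i \<phi>) (dil N g) x - pd i \<phi> x) \<le> D i * (1/2) ^ N" by blast
  show ?thesis
  proof (intro exI[of _ "C + (\<Sum>i\<in>UNIV. D i)"] conjI allI)
    show "0 \<le> C + (\<Sum>i\<in>UNIV. D i)" by (simp add: C D sum_nonneg)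
    fix N
    have t: "test (dil N g)" by (rule test_dil[OF g])
    have "pd i (\<lambda>x. conv \<phi> (dil N g) x - \<phi> x) = (\<lambda>x. conv (pd i \<phi>) (dil N g) x - pd i \<phi> x)" for i
      unfolding pd_diff[OF test_smooth[OF test_conv[OF \<phi> t]] test_smooth[OF \<phi>]] pd_conv'[OF \<phi> t] ..
    then have "h1t (\<lambda>x. conv \<phi> (dil N g) x - \<phi> x) \<le> C * (1/2) ^ N + (\<Sum>i\<in>UNIV. D i * (1/2) ^ N)"
      by (intro order_trans[OF h1t_le_sum] add_mono sum_mono) (simp_all only: C D)
    then show "h1t (\<lambda>x. conv \<phi> (dil N g) x - \<phi> x) \<le> (C + (\<Sum>i\<in>UNIV. D i)) * (1/2) ^ N"
      by (simp only: distrib_right sum_distrib_right)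
  qed
qed

lemma Jn_tendsto:
  assumes \<phi>: "test \<phi>" and g: "test \<theta>" and i1: "(\<integral>x. \<theta> x \<partial>lborel) = 1"
  shows "(\<lambda>N. h1t (\<lambda>x. Jn \<theta> N \<phi> x - \<phi> x)) \<longlonglongrightarrow> 0"
proof -
  let ?g = "rfl \<theta>"
  have tg: "test ?g" by (rule test_rfl[OF g])
  have "(\<integral>x. ?g x \<partial>lborel) = 1" using lborel_integral_refl[OF test_borel[OF g], of 0] i1 by (simp add: rfl_def)
  from conv_dil_approx_h1t[OF \<phi> tg this] obtain C where C: "C \<ge> 0" "\<And>N. h1t (\<lambda>x. conv \<phi> (dil N ?g) x - \<phi> x) \<le> C * (1/2) ^ N" by blast
  have b: "h1t (\<lambda>x. Jn \<theta> N \<phi> x - \<phi> x) \<le> (n1 ?g + 1) * C * (1/2) ^ N" for N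
  proof -
    let ?gN = "dil N ?g"
    let ?E = "\<lambda>x. conv \<phi> ?gN x - \<phi> x"
    have tN: "test ?gN" by (rule test_dil[OF tg])
    have tE: "test ?E" by (rule test_diff[OF test_conv[OF \<phi> tN] \<phi>])
    \<comment> \<open>If \<open>?E\<close> is the error of one mollification, the error of two is
      \<open>?E\<close> mollified plus \<open>?E\<close>.\<close>
    have e: "(\<lambda>x. Jn \<theta> N \<phi> x - \<phi> x) = (\<lambda>x. conv ?E ?gN x + ?E x)"
      unfolding Jn_def rfl_dil conv_diff_left[OF tN test_conv[OF \<phi> tN] \<phi>] by simp
    have "h1t (\<lambda>x. Jn \<theta> N \<phi> x - \<phi> x) \<le> h1t (conv ?E ?gN) + h1t ?E"
      unfolding e by (rule h1t_triangle[OF test_conv[OF tE tN] tE])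
    also have "\<dots> \<le> n1 ?g * h1t ?E + h1t ?E" using h1t_conv[OF tE tN] by (simp add: n1_dil[OF tg])
    also have "\<dots> = (n1 ?g + 1) * h1t ?E" by (simp add: distrib_right)
    also have "\<dots> \<le> (n1 ?g + 1) * (C * (1/2) ^ N)" by (rule mult_left_mono[OF C(2)]) (simp add: n1_nonneg)
    finally show ?thesis by (simp only: mult.assoc)
  qed
  show ?thesis
  proof (rule Lim_null_comparison)
    show "(\<lambda>N. (n1 ?g + 1) * C * (1/2) ^ N) \<longlonglongrightarrow> 0"
      by (rule tendsto_mult_right_zero) (rule LIMSEQ_power_zero, simp)
    show "\<forall>\<^sub>F N in sequentially. norm (h1t (\<lambda>x. Jn \<theta> N \<phi> x - \<phi> x)) \<le> (n1 ?g + 1) * C * (1/2) ^ N"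
      by (rule always_eventually, rule allI) (use b h1t_nonneg in simp)
  qed
qed

section \<open>Kernels supported in a cone\<close>

text \<open>\<open>d\<close> is a basis of R^3 and \<open>L a\<close> reads off the coordinate of
  index \<open>a\<close> (\<open>dual_frame_expand\<close>). All supports are described by these
  coordinates: the cone is where they are all positive.\<close>

definition dual_frame :: "(3 \<Rightarrow> pt) \<Rightarrow> (3 \<Rightarrow> pt) \<Rightarrow> bool" where
  "dual_frame L d \<longleftrightarrow> (\<forall>a b. L a \<bullet> d b = (if a = b then 1 else 0))"

text \<open>Duality makes one matrix a one-sided inverse of the other; for square matrices it is
  then a two-sided one.\<close>

lemma dual_frame_expand: assumes "dual_frame L d" shows "(\<Sum>a\<in>UNIV. (L a \<bullet> x) *\<^sub>R d a) = x"
proof -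
  define A D :: "real^3^3" where "A = (\<chi> i j. L i $ j)" and "D = (\<chi> i j. d j $ i)"
  have "A ** D = mat 1"
    using assms by (simp add: vec_eq_iff matrix_matrix_mult_def mat_def A_def D_def dual_frame_def inner_vec_def)
  then have "D ** A = mat 1" using matrix_left_right_inverse by blast
  then have "D *v (A *v x) = x" by (simp add: matrix_vector_mul_assoc)
  moreover have "D *v (A *v x) = (\<Sum>a\<in>UNIV. (L a \<bullet> x) *\<^sub>R d a)"
    by (simp add: vec_eq_iff matrix_vector_mult_def A_def D_def inner_vec_def mult.commute)
  ultimately show ?thesis by simp
qed

definition parallelepiped :: "(3 \<Rightarrow> pt) \<Rightarrow> real \<Rightarrow> real \<Rightarrow> pt set" where
  "parallelepiped L s t = {x. \<forall>a. s \<le> L a \<bullet> x \<and> L a \<bullet> x \<le> t}"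

lemma compact_parallelepiped: assumes "dual_frame L d" shows "compact (parallelepiped L s t)"
proof -
  let ?S = "(\<lambda>y. \<Sum>a\<in>UNIV. (y $ a) *\<^sub>R d a) ` cbox (\<chi> a. s) (\<chi> a. t)"
  have sub: "parallelepiped L s t \<subseteq> ?S"
  proof
    fix x assume "x \<in> parallelepiped L s t"
    then have "(\<chi> a. L a \<bullet> x) \<in> cbox (\<chi> a. s) (\<chi> a. t)" by (simp add: parallelepiped_def mem_box_cart)
    moreover have "x = (\<Sum>a\<in>UNIV. ((\<chi> a. L a \<bullet> x) $ a) *\<^sub>R d a)" using dual_frame_expand[OF assms, of x] by simp
    ultimately show "x \<in> (\<lambda>y. \<Sum>a\<in>UNIV. (y $ a) *\<^sub>R d a) ` cbox (\<chi> a. s) (\<chi> a. t)" by blast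
  qed
  have "compact ?S"
    by (intro compact_continuous_image compact_cbox continuous_intros)
  moreover have "closed (parallelepiped L s t)"
    unfolding parallelepiped_def by (intro closed_Collect_all closed_Collect_conj closed_Collect_le continuous_intros)
  ultimately have "compact (?S \<inter> parallelepiped L s t)" by (rule compact_Int_closed)
  then show ?thesis using sub by (simp only: Int_absorb1)
qed

definition tensor3 :: "(3 \<Rightarrow> pt) \<Rightarrow> (real \<Rightarrow> real) \<Rightarrow> (real \<Rightarrow> real) \<Rightarrow> (real \<Rightarrow> real) \<Rightarrow> fn" where
  "tensor3 L f g h = (\<lambda>x. f (L 1 \<bullet> x) * g (L 2 \<bullet> x) * h (L 3 \<bullet> x))"

lemma smooth_tensor3: "smooth1 f \<Longrightarrow> smooth1 g \<Longrightarrow> smooth1 h \<Longrightarrow> smooth_fn (tensor3 L f g h)"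
  unfolding tensor3_def by (rule smooth_fn_mult[OF smooth_fn_mult[OF smooth_fn_ridge1 smooth_fn_ridge1] smooth_fn_ridge1])

lemma dd_tensor3:
  assumes s: "smooth1 f" "smooth1 g" "smooth1 h"
    and d: "\<And>x. (f has_real_derivative f' x) (at x)" "\<And>x. (g has_real_derivative g' x) (at x)" "\<And>x. (h has_real_derivative h' x) (at x)"
  shows "dd v (tensor3 L f g h) = (\<lambda>x. (L 1 \<bullet> v) * tensor3 L f' g h x + (L 2 \<bullet> v) * tensor3 L f g' h x + (L 3 \<bullet> v) * tensor3 L f g h' x)"
proof -
  have "pd i (tensor3 L f g h) = (\<lambda>x. L 1 $ i * tensor3 L f' g h x + L 2 $ i * tensor3 L f g' h x + L 3 $ i * tensor3 L f g h' x)" for i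
    unfolding tensor3_def
      pd_mult[OF smooth_fn_mult[OF smooth_fn_ridge1[OF s(1), of "L 1"] smooth_fn_ridge1[OF s(2), of "L 2"]] smooth_fn_ridge1[OF s(3), of "L 3"]]
      pd_mult[OF smooth_fn_ridge1[OF s(1), of "L 1"] smooth_fn_ridge1[OF s(2), of "L 2"]]
      pd_ridge1[OF s(1) d(1)] pd_ridge1[OF s(2) d(2)] pd_ridge1[OF s(3) d(3)]
    by (simp add: algebra_simps)
  then show ?thesis
    by (simp add: dd_def inner_vec_def fun_eq_iff sum_3 algebra_simps)
qed

definition supp_interval :: "(real \<Rightarrow> real) \<Rightarrow> real \<Rightarrow> real \<Rightarrow> bool" where
  "supp_interval f s t \<longleftrightarrow> (\<forall>x. f x \<noteq> 0 \<longrightarrow> s \<le> x \<and> x \<le> t)"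

lemma test_tensor3:
  assumes D: "dual_frame L d" and s: "smooth1 f" "smooth1 g" "smooth1 h"
    and c: "supp_interval f s t" "supp_interval g s t" "supp_interval h s t"
  shows "test (tensor3 L f g h)" "tsupp (tensor3 L f g h) \<subseteq> parallelepiped L s t"
proof -
  have nz: "x \<in> parallelepiped L s t" if "tensor3 L f g h x \<noteq> 0" for x
    using that c unfolding tensor3_def parallelepiped_def supp_interval_def by (auto simp: forall_3)
  show "test (tensor3 L f g h)" by (rule testI[OF smooth_tensor3[OF s] compact_parallelepiped[OF D] nz])
  show "tsupp (tensor3 L f g h) \<subseteq> parallelepiped L s t" by (rule tsupp_subset[OF compact_imp_closed[OF compact_parallelepiped[OF D]] nz])
qed

text \<open>A nonnegative function with zero integral vanishes almost everywhere; by continuity the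
  zero set is closed, and a closed set of full measure is everything.\<close>

lemma test_integral_pos:
  assumes f: "test f" "\<And>x. 0 \<le> f x" "f x0 > 0" shows "(\<integral>x. f x \<partial>lborel) > 0"
proof -
  have "(\<integral>x. f x \<partial>lborel) \<noteq> 0"
  proof
    assume "(\<integral>x. f x \<partial>lborel) = 0"
    then have "AE x in lborel. f x = 0"
      using integral_nonneg_eq_0_iff_AE[OF test_integrable[OF f(1)]] f(2) by simp
    then have "AE x in lebesgue. x \<in> {x. f x = 0}" by (simp add: AE_completion)
    moreover have "closed {x. f x = 0}" by (intro closed_Collect_eq test_continuous f(1) continuous_on_const)
    ultimately have "x0 \<in> {x. f x = 0}" by (intro mem_closed_if_AE_lebesgue)
    then show False using f(3) by simp
  qed
  moreover have "(\<integral>x. f x \<partial>lborel) \<ge> 0" by (rule integral_nonneg_AE) (simp add: f)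
  ultimately show ?thesis by simp
qed

lemma deriv_zero_open:
  assumes "(f has_real_derivative y) (at x)" "open S" "x \<in> S" "\<And>z. z \<in> S \<Longrightarrow> f z = c"
  shows "y = (0::real)"
proof -
  have "((\<lambda>z. c) has_real_derivative 0) (at x)" by simp
  then have "(f has_real_derivative 0) (at x)"
    by (rule has_field_derivative_transform_within_open[OF _ assms(2,3)]) (simp add: assms(4))
  then show ?thesis using DERIV_unique assms(1) by blast
qed

text \<open>One-dimensional model: with a smooth step \<open>P\<close>, \<open>A = (x P(x))''\<close> and \<open>e = x (P(2 x) - P(x))\<close> satisfy
  \<open>2 A(2 x) - A(x) = e''(x)\<close>, and \<open>e\<close> has compact support because \<open>P\<close> is eventually constant. The kernel
  is the tensor product of three copies of \<open>A\<close>; the difference of two such products telescopes.\<close>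
lemma kernel_exists:
  assumes D: "dual_frame L d" and r: "0 < r"
  shows "\<exists>\<theta> \<eta> s. 0 < s \<and> test \<theta> \<and> (\<forall>a. test (\<eta> a)) \<and> (\<integral>x. \<theta> x \<partial>lborel) = 1 \<and> tsupp \<theta> \<subseteq> parallelepiped L s r \<and>
    (\<forall>a. tsupp (\<eta> a) \<subseteq> parallelepiped L s r) \<and> (\<forall>x. dil 1 \<theta> x - \<theta> x = (\<Sum>a\<in>UNIV. dd (d a) (dd (d a) (\<eta> a)) x))"
proof -
  have "r/2 < r" using r by simp
  then obtain P where P: "smooth1 P" "\<And>x. x \<le> r/2 \<Longrightarrow> P x = 0" "\<And>x. x \<ge> r \<Longrightarrow> P x = 1" "mono P"
    using smooth_step_exists by blast
  obtain P' where P': "\<And>x. (P has_real_derivative P' x) (at x)" "smooth1 P'" using smooth1_derivE[OF P(1)] by blast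
  obtain P'' where P'': "\<And>x. (P' has_real_derivative P'' x) (at x)" "smooth1 P''" using smooth1_derivE[OF P'(2)] by blast
  have P'0: "P' x = 0" if "x < r/2 \<or> r < x" for x
    using that deriv_zero_open[OF P'(1)[of x], of "{..<r/2}" 0] deriv_zero_open[OF P'(1)[of x], of "{r<..}" 1] P(2,3) by auto
  have P''0: "P'' x = 0" if "x < r/2 \<or> r < x" for x
    using that deriv_zero_open[OF P''(1)[of x], of "{..<r/2}" 0] deriv_zero_open[OF P''(1)[of x], of "{r<..}" 0] P'0 by auto
  have P'pos: "0 \<le> P' x" for x
  proof (rule ccontr)
    assume "\<not> 0 \<le> P' x"
    then obtain e where e: "e > 0" "\<And>h. 0 < h \<Longrightarrow> h < e \<Longrightarrow> P (x + h) < P x" using DERIV_neg_dec_right[OF P'(1)[of x]] by auto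
    have "P (x + e/2) < P x" by (rule e(2)) (use e(1) in simp_all)
    moreover have "P x \<le> P (x + e/2)" by (rule monoD[OF P(4)]) (use e(1) in simp)
    ultimately show False by linarith
  qed
  have chain: "((\<lambda>x. f (2 * x)) has_real_derivative 2 * f' (2 * x)) (at x)"
    if "\<And>x. (f has_real_derivative f' x) (at x)" for f f' x
  proof -
    have "((\<lambda>x. 2 * x) has_real_derivative 2) (at x)" by (auto intro!: derivative_eq_intros)
    from DERIV_chain'[OF this that]
    have "((\<lambda>x. f (2 * x)) has_real_derivative f' (2 * x) * 2) (at x)" by simp
    moreover have "f' (2 * x) * 2 = 2 * f' (2 * x)" by simp
    ultimately show ?thesis by metis
  qed
  have two: "smooth1 (\<lambda>x. f (2 * x))" if "smooth1 f" for f using smooth1_affine[OF that, of 0 2] by simp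
  define A where "A = (\<lambda>x. P' x + (P' x + x * P'' x))"
  \<comment> \<open>\<open>A - P'\<close> is the derivative of the compactly supported
    \<open>C\<close>, so replacing \<open>A\<close> by the nonnegative \<open>P'\<close> leaves
    integrals unchanged. This is how the integral of the kernel is seen to be positive.\<close>
  define C where "C = (\<lambda>x. x * P' x)"
  define A1 where "A1 = (\<lambda>x. 2 * A (2 * x))"
  define e where "e = (\<lambda>x. x * (P (2 * x) + (-1) * P x))"
  define e' where "e' = (\<lambda>x. (P (2 * x) + (-1) * P x) + x * (2 * P' (2 * x) + (-1) * P' x))"
  define e'' where "e'' = (\<lambda>x. A1 x + (-1) * A x)"
  have sC: "smooth1 C" unfolding C_def by (rule smooth1_mult[OF smooth1_id P'(2)])
  have sA: "smooth1 A" unfolding A_def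
    by (rule smooth1_add[OF P'(2) smooth1_add[OF P'(2) smooth1_mult[OF smooth1_id P''(2)]]])
  have sA1: "smooth1 A1" unfolding A1_def by (rule smooth1_mult[OF smooth1_const two[OF sA]])
  have se: "smooth1 e" unfolding e_def
    by (rule smooth1_mult[OF smooth1_id smooth1_add[OF two[OF P(1)] smooth1_mult[OF smooth1_const P(1)]]])
  have se': "smooth1 e'" unfolding e'_def
    by (rule smooth1_add[OF smooth1_add[OF two[OF P(1)] smooth1_mult[OF smooth1_const P(1)]]
          smooth1_mult[OF smooth1_id smooth1_add[OF smooth1_mult[OF smooth1_const two[OF P'(2)]] smooth1_mult[OF smooth1_const P'(2)]]]])
  have dC: "(C has_real_derivative (A x - P' x)) (at x)" for x
    unfolding C_def A_def by (auto intro!: derivative_eq_intros P''(1))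
  have de: "(e has_real_derivative e' x) (at x)" for x
    unfolding e_def e'_def by (auto intro!: derivative_eq_intros P'(1) chain[OF P'(1)])
  have de': "(e' has_real_derivative e'' x) (at x)" for x
    unfolding e'_def e''_def A1_def A_def
    by (rule DERIV_cong[OF DERIV_add[OF DERIV_add[OF chain[OF P'(1)] DERIV_cmult[OF P'(1)]]
          DERIV_mult[OF DERIV_ident DERIV_add[OF DERIV_cmult[OF chain[OF P''(1)]] DERIV_cmult[OF P''(1)]]]]])
       (simp add: algebra_simps)
  have suA: "supp_interval A (r/2) r" "supp_interval P' (r/2) r" "supp_interval C (r/2) r"
    unfolding supp_interval_def A_def C_def using P'0 P''0 by (metis add.right_neutral linorder_not_le mult_zero_right)+
  have suA1: "supp_interval A1 (r/4) r"
  proof (unfold supp_interval_def, intro allI impI)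
    fix x assume "A1 x \<noteq> 0"
    then have "r/2 \<le> 2 * x \<and> 2 * x \<le> r" using suA(1) unfolding supp_interval_def A1_def by (metis mult_zero_right)
    then show "r/4 \<le> x \<and> x \<le> r" using r by auto
  qed
  \<comment> \<open>\<open>P (2 * x) - P x\<close> vanishes for \<open>x < r/4\<close>, where both
    steps are 0, and for \<open>x > r\<close>, where both are 1.\<close>
  have sue: "supp_interval e (r/4) r"
  proof (unfold supp_interval_def, intro allI impI, rule ccontr)
    fix x assume "e x \<noteq> 0" "\<not> (r/4 \<le> x \<and> x \<le> r)"
    then show False using r P(2)[of "2 * x"] P(2)[of x] P(3)[of "2 * x"] P(3)[of x] unfolding e_def by (cases "x < r/4") auto
  qed
  have suA': "supp_interval A (r/4) r" using suA(1) r unfolding supp_interval_def by force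
  define \<theta>0 where "\<theta>0 = tensor3 L A A A"
  have t0: "test \<theta>0" "tsupp \<theta>0 \<subseteq> parallelepiped L (r/4) r" unfolding \<theta>0_def by (rule test_tensor3[OF D sA sA sA suA' suA' suA'])+
  have LD: "L a \<bullet> d b = (if a = b then 1 else 0)" for a b using D by (simp add: dual_frame_def)
  define I where "I f g h = (\<integral>x. tensor3 L f g h x \<partial>lborel)" for f g h
  \<comment> \<open>Swaps one factor \<open>A\<close> for \<open>P'\<close> in the integral over
    R^3: by duality of the frame a derivative along \<open>d a\<close> hits only the factor in the
    coordinate \<open>L a\<close>, and integrals of derivatives vanish.\<close>
  have red: "I A g h = I P' g h" "I g A h = I g P' h" "I g h A = I g h P'"
    if g: "smooth1 g" "supp_interval g (r/2) r" and h: "smooth1 h" "supp_interval h (r/2) r" for g h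
  proof -
    obtain g' where g': "\<And>x. (g has_real_derivative g' x) (at x)" using smooth1_derivE[OF g(1)] by blast
    obtain h' where h': "\<And>x. (h has_real_derivative h' x) (at x)" using smooth1_derivE[OF h(1)] by blast
    note tt = test_tensor3(1)[OF D]
    have i: "integrable lborel (tensor3 L P' g h)" "integrable lborel (tensor3 L g P' h)" "integrable lborel (tensor3 L g h P')"
      by (auto intro!: test_integrable tt P'(2) g h suA)
    have t: "test (tensor3 L C g h)" "test (tensor3 L g C h)" "test (tensor3 L g h C)" by (auto intro!: tt sC g h suA)
    have "tensor3 L A g h = (\<lambda>x. dd (d 1) (tensor3 L C g h) x + tensor3 L P' g h x)"
      unfolding dd_tensor3[OF sC g(1) h(1) dC g' h'] by (simp add: LD tensor3_def fun_eq_iff algebra_simps)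
    then show "I A g h = I P' g h" unfolding I_def using integral_dd[OF t(1)] i test_integrable[OF test_dd[OF t(1)]] by simp
    have "tensor3 L g A h = (\<lambda>x. dd (d 2) (tensor3 L g C h) x + tensor3 L g P' h x)"
      unfolding dd_tensor3[OF g(1) sC h(1) g' dC h'] by (simp add: LD tensor3_def fun_eq_iff algebra_simps)
    then show "I g A h = I g P' h" unfolding I_def using integral_dd[OF t(2)] i test_integrable[OF test_dd[OF t(2)]] by simp
    have "tensor3 L g h A = (\<lambda>x. dd (d 3) (tensor3 L g h C) x + tensor3 L g h P' x)"
      unfolding dd_tensor3[OF g(1) h(1) sC g' h' dC] by (simp add: LD tensor3_def fun_eq_iff algebra_simps)
    then show "I g h A = I g h P'" unfolding I_def using integral_dd[OF t(3)] i test_integrable[OF test_dd[OF t(3)]] by simp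
  qed
  have "I A A A = I P' P' P'"
    using red(1)[OF sA suA(1) sA suA(1)] red(2)[OF P'(2) suA(2) sA suA(1)] red(3)[OF P'(2) suA(2) P'(2) suA(2)] by simp
  also have "\<dots> > 0"
    unfolding I_def
  proof -
    \<comment> \<open>The mean value theorem provides a point with nonzero \<open>P'\<close>; the
      point of R^3 whose three frame coordinates all equal \<open>z\<close> makes the tensor product
      positive.\<close>
    obtain z where z: "P r - P (r/2) = (r - r/2) * P' z" using MVT2[of "r/2" r P P'] r P'(1) by auto
    then have "P' z \<noteq> 0" using P(2)[of "r/2"] P(3)[of r] by auto
    then have pz: "0 < P' z" using P'pos[of z] by simp
    have "L a \<bullet> (\<Sum>b\<in>UNIV. z *\<^sub>R d b) = z" for a by (simp add: inner_sum_right LD if_distrib cong: if_cong)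
    then have "tensor3 L P' P' P' (\<Sum>b\<in>UNIV. z *\<^sub>R d b) > 0" using pz by (simp add: tensor3_def)
    moreover have "0 \<le> tensor3 L P' P' P' x" for x using P'pos by (simp add: tensor3_def)
    ultimately show "(\<integral>x. tensor3 L P' P' P' x \<partial>lborel) > 0"
      using test_integral_pos[OF test_tensor3(1)[OF D P'(2) P'(2) P'(2) suA(2) suA(2) suA(2)]] by blast
  qed
  finally have pos: "(\<integral>x. \<theta>0 x \<partial>lborel) > 0" by (simp add: I_def \<theta>0_def)
  define c where "c = 1 / (\<integral>x. \<theta>0 x \<partial>lborel)"
  \<comment> \<open>Telescoping \<open>A1 A1 A1 - A A A\<close> changes one factor at a time:
    coordinates before the changed one carry \<open>A\<close>, those after it
    \<open>A1\<close>.\<close>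
  define \<eta>0 where "\<eta>0 a = (if a = 1 then tensor3 L e A1 A1 else if a = 2 then tensor3 L A e A1 else tensor3 L A A e)" for a :: 3
  have te: "test (\<eta>0 a)" "tsupp (\<eta>0 a) \<subseteq> parallelepiped L (r/4) r" for a
    unfolding \<eta>0_def using test_tensor3[OF D] se sA sA1 sue suA' suA1 by presburger+
  obtain A' where A': "\<And>x. (A has_real_derivative A' x) (at x)" using smooth1_derivE[OF sA] by blast
  obtain A1' where A1': "\<And>x. (A1 has_real_derivative A1' x) (at x)" using smooth1_derivE[OF sA1] by blast
  have d1: "dd (d 1) (dd (d 1) (tensor3 L e A1 A1)) = tensor3 L e'' A1 A1"
    unfolding dd_tensor3[OF se sA1 sA1 de A1' A1'] by (simp add: LD dd_tensor3[OF se' sA1 sA1 de' A1' A1'])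
  have d2: "dd (d 2) (dd (d 2) (tensor3 L A e A1)) = tensor3 L A e'' A1"
    unfolding dd_tensor3[OF sA se sA1 A' de A1'] by (simp add: LD dd_tensor3[OF sA se' sA1 A' de' A1'])
  have d3: "dd (d 3) (dd (d 3) (tensor3 L A A e)) = tensor3 L A A e''"
    unfolding dd_tensor3[OF sA sA se A' A' de] by (simp add: LD dd_tensor3[OF sA sA se' A' A' de'])
  have ident: "dil 1 \<theta>0 x - \<theta>0 x = (\<Sum>a\<in>UNIV. dd (d a) (dd (d a) (\<eta>0 a)) x)" for x
  proof -
    have "dil 1 \<theta>0 x = tensor3 L A1 A1 A1 x" by (simp add: dil_def \<theta>0_def tensor3_def A1_def)
    moreover have "(\<Sum>a\<in>UNIV. dd (d a) (dd (d a) (\<eta>0 a)) x) = tensor3 L e'' A1 A1 x + tensor3 L A e'' A1 x + tensor3 L A A e'' x"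
      unfolding sum_3 by (simp add: \<eta>0_def d1 d2 d3)
    ultimately show ?thesis by (simp add: \<theta>0_def tensor3_def e''_def algebra_simps)
  qed
  have tsc: "tsupp (\<lambda>x. c * f x) \<subseteq> tsupp f" for f
    by (rule tsupp_subset[OF closed_tsupp]) (use tsupp_nonzero[of f] in auto)
  show ?thesis
  proof (intro exI[of _ "\<lambda>x. c * \<theta>0 x"] exI[of _ "\<lambda>a x. c * \<eta>0 a x"] exI[of _ "r/4"] conjI allI)
    show "test (\<lambda>x. c * \<theta>0 x)" by (rule test_cmult[OF t0(1)])
    show "test (\<lambda>x. c * \<eta>0 a x)" for a by (rule test_cmult[OF te(1)])
    show "(\<integral>x. c * \<theta>0 x \<partial>lborel) = 1" using pos by (simp add: c_def)
    show "tsupp (\<lambda>x. c * \<theta>0 x) \<subseteq> parallelepiped L (r/4) r" using tsc t0(2) by blast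
    show "tsupp (\<lambda>x. c * \<eta>0 a x) \<subseteq> parallelepiped L (r/4) r" for a using tsc te(2) by blast
    show "dil 1 (\<lambda>x. c * \<theta>0 x) x - c * \<theta>0 x = (\<Sum>a\<in>UNIV. dd (d a) (dd (d a) (\<lambda>x. c * \<eta>0 a x)) x)" for x
    proof -
      have "dd (d a) (dd (d a) (\<lambda>x. c * \<eta>0 a x)) = (\<lambda>x. c * dd (d a) (dd (d a) (\<eta>0 a)) x)" for a
        unfolding dd_cmult[OF test_smooth[OF te(1)]] dd_cmult[OF test_smooth[OF test_dd[OF te(1)]]] ..
      then have "(\<Sum>a\<in>UNIV. dd (d a) (dd (d a) (\<lambda>x. c * \<eta>0 a x)) x) = c * (dil 1 \<theta>0 x - \<theta>0 x)"
        unfolding ident by (simp add: sum_distrib_left)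
      then show ?thesis by (simp add: dil_def right_diff_distrib)
    qed
  qed (use r in simp)
qed

section \<open>Operators attached to one cone\<close>

lemma n2_dd_le: assumes "test f" shows "n2 (dd v f) \<le> (\<Sum>i\<in>UNIV. \<bar>v $ i\<bar>) * h1t f"
proof -
  have "n2 (dd v f) \<le> (\<Sum>i\<in>UNIV. n2 (\<lambda>x. v $ i * pd i f x))"
    unfolding dd_def by (rule n2_sum[OF finite test_L2[OF test_cmult[OF test_pd[OF assms]]]])
  also have "\<dots> \<le> (\<Sum>i\<in>UNIV. \<bar>v $ i\<bar> * h1t f)"
    unfolding n2_cmult by (intro sum_mono mult_left_mono n2_pd_le_h1t) simp
  finally show ?thesis by (simp only: sum_distrib_right)
qed

lemma integral_by_parts_dd:
  assumes "test f" "test g"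
  shows "(\<integral>x. f x * dd v g x \<partial>lborel) = - (\<integral>x. dd v f x * g x \<partial>lborel)"
proof -
  have i: "integrable lborel (\<lambda>x. f x * pd i g x)" "integrable lborel (\<lambda>x. pd i f x * g x)" for i
    by (rule test_integrable[OF test_mult[OF test_smooth[OF assms(1)] test_pd[OF assms(2)]]],
        rule test_integrable[OF test_mult[OF test_smooth[OF test_pd[OF assms(1)]] assms(2)]])
  have "(\<integral>x. f x * dd v g x \<partial>lborel) = (\<integral>x. (\<Sum>i\<in>UNIV. v $ i * (f x * pd i g x)) \<partial>lborel)"
    by (simp add: dd_def sum_distrib_left mult.left_commute)
  also have "\<dots> = (\<Sum>i\<in>UNIV. v $ i * (\<integral>x. f x * pd i g x \<partial>lborel))" using i by simp
  also have "\<dots> = (\<Sum>i\<in>UNIV. - (v $ i * (\<integral>x. pd i f x * g x \<partial>lborel)))"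
    by (simp add: integral_by_parts[OF assms(1) test_smooth[OF assms(2)]])
  also have "\<dots> = - (\<integral>x. (\<Sum>i\<in>UNIV. v $ i * (pd i f x * g x)) \<partial>lborel)" using i by (simp add: sum_negf)
  also have "\<dots> = - (\<integral>x. dd v f x * g x \<partial>lborel)" by (simp add: dd_def sum_distrib_right mult.assoc)
  finally show ?thesis .
qed

lemma dd_Gk:
  assumes "test \<phi>" "test \<Theta>" "test \<eta>" shows "dd v (Gk \<Theta> \<eta> k \<phi>) = Gk \<Theta> \<eta> k (dd v \<phi>)"
proof -
  have t: "test (rfl (dil k \<eta>))" "test (rfl (dil k \<Theta>))" using assms by (simp_all add: test_rfl test_dil)
  show ?thesis unfolding Gk_def dd_cmult[OF test_smooth[OF test_conv[OF test_conv[OF assms(1) t(1)] t(2)]]]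
    conv_dd_left[OF test_conv[OF assms(1) t(1)] t(2), symmetric] conv_dd_left[OF assms(1) t(1), symmetric] ..
qed

lemma fdist_sum:
  assumes "finite A" "\<And>a. a \<in> A \<Longrightarrow> L2 (f a)" "test \<phi>"
  shows "fdist (\<lambda>x. \<Sum>a\<in>A. f a x) \<phi> = (\<Sum>a\<in>A. fdist (f a) \<phi>)"
  unfolding fdist_def sum_distrib_right
  by (rule Bochner_Integration.integral_sum) (rule L2_mult_integrable[OF assms(2) test_L2[OF assms(3)]])

lemma conv_lincomb_left:
  assumes "test f" "test g" "test h"
  shows "conv (\<lambda>x. a * f x + b * g x) h = (\<lambda>x. a * conv f h x + b * conv g h x)"
  by (simp add: fun_eq_iff conv_eq distrib_right mult.assoc conv_integrable assms)

text \<open>Each kernel shifts a frame coordinate by a positive amount of at most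
  \<open>r/3\<close>. Two kernels are applied in a row, so the total shift is at most
  \<open>2 * r / 3\<close>, less than \<open>r\<close>, and \<open>cone\<close> applies. The set
  \<open>K\<close> will be the part of \<open>closure \<Omega>\<close> inside the support of a
  cutoff.\<close>

locale cone_kernel =
  fixes \<Omega> K :: "pt set" and L d :: "3 \<Rightarrow> pt" and r s :: real and \<theta> :: fn and \<eta> :: "3 \<Rightarrow> fn"
  assumes K: "compact K" and D: "dual_frame L d" and s: "0 < s"
    and cone: "\<And>y t. y \<in> K \<Longrightarrow> (\<And>a. 0 < t a \<and> t a < r) \<Longrightarrow> y + (\<Sum>a\<in>UNIV. t a *\<^sub>R d a) \<in> \<Omega>"
    and \<theta>: "test \<theta>" "(\<integral>x. \<theta> x \<partial>lborel) = 1" "tsupp \<theta> \<subseteq> parallelepiped L s (r/3)"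
    and \<eta>: "\<And>a. test (\<eta> a)" "\<And>a. tsupp (\<eta> a) \<subseteq> parallelepiped L s (r/3)"
    and ident: "\<And>x. dil 1 \<theta> x - \<theta> x = (\<Sum>a\<in>UNIV. dd (d a) (dd (d a) (\<eta> a)) x)"
begin

definition \<Theta> :: fn where "\<Theta> = (\<lambda>x. \<theta> x + dil 1 \<theta> x)"
definition T :: "3 \<Rightarrow> distr \<Rightarrow> fn" where "T a u = (\<lambda>x. \<Sum>k. Tk \<Theta> (\<eta> a) k u x)"
definition R :: "nat \<Rightarrow> distr \<Rightarrow> fn" where "R N u = conv (cv u (dil N \<theta>)) (dil N \<theta>)"
text \<open>Unlike \<open>parallelepiped L s (r/3)\<close>, this set is stable under contraction by
  \<open>2 ^ k\<close>, so it holds all dilated kernels at once although their lower bounds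
  \<open>s / 2 ^ k\<close> tend to 0.\<close>

definition cone_piece :: "pt set" where "cone_piece = {x. \<forall>a. 0 < L a \<bullet> x \<and> L a \<bullet> x \<le> r/3}"

lemma test_\<Theta>: "test \<Theta>" unfolding \<Theta>_def by (rule test_add[OF \<theta>(1) test_dil[OF \<theta>(1)]])

lemma dil_cone_piece:
  assumes "tsupp g \<subseteq> parallelepiped L q (r/3)" "0 < q" shows "tsupp (dil k g) \<subseteq> cone_piece"
proof -
  have r3: "r/3 \<ge> 0" if "dil k g x \<noteq> 0" for x
    using dil_nonzero[OF that] assms unfolding parallelepiped_def by (smt (verit) mem_Collect_eq subsetD)
  have "tsupp (dil k g) \<subseteq> parallelepiped L (q / 2 ^ k) (r/3)"
  proof (rule tsupp_subset[OF compact_imp_closed[OF compact_parallelepiped[OF D]]])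
    fix x assume x: "dil k g x \<noteq> 0"
    have p: "2 ^ k *\<^sub>R x \<in> parallelepiped L q (r/3)" using dil_nonzero[OF x] assms by blast
    show "x \<in> parallelepiped L (q / 2 ^ k) (r/3)"
      unfolding parallelepiped_def
    proof (intro CollectI allI)
      fix a
      have q: "q \<le> 2 ^ k * (L a \<bullet> x)" "2 ^ k * (L a \<bullet> x) \<le> r/3" using p by (simp_all add: parallelepiped_def)
      have "0 < 2 ^ k * (L a \<bullet> x)" using q(1) assms(2) by linarith
      then have "0 < L a \<bullet> x" by (simp add: zero_less_mult_iff)
      then have "1 * (L a \<bullet> x) \<le> 2 ^ k * (L a \<bullet> x)" by (intro mult_right_mono) auto
      then show "q / 2 ^ k \<le> L a \<bullet> x \<and> L a \<bullet> x \<le> r/3" using q by (simp add: field_simps)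
    qed
  qed
  moreover have "parallelepiped L (q / 2 ^ k) (r/3) \<subseteq> cone_piece" unfolding parallelepiped_def cone_piece_def using assms(2) by (auto intro: less_le_trans[of 0 "q / 2 ^ k"])
  ultimately show ?thesis by blast
qed

lemma tsupp_\<Theta>: "tsupp \<Theta> \<subseteq> parallelepiped L (s/2) (r/3)"
proof (rule tsupp_subset[OF compact_imp_closed[OF compact_parallelepiped[OF D]]])
  fix x assume "\<Theta> x \<noteq> 0"
  then consider "\<theta> x \<noteq> 0" | "dil 1 \<theta> x \<noteq> 0" unfolding \<Theta>_def by fastforce
  then show "x \<in> parallelepiped L (s/2) (r/3)"
  proof cases
    case 1
    then have "x \<in> parallelepiped L s (r/3)" using tsupp_nonzero[of \<theta> x] \<theta>(3) by blast
    then have b: "s \<le> L a \<bullet> x \<and> L a \<bullet> x \<le> r/3" for a by (simp add: parallelepiped_def)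
    show ?thesis unfolding parallelepiped_def
    proof (intro CollectI allI)
      fix a show "s/2 \<le> L a \<bullet> x \<and> L a \<bullet> x \<le> r/3" using b[of a] s by linarith
    qed
  next
    case 2
    then have "2 ^ 1 *\<^sub>R x \<in> parallelepiped L s (r/3)" using dil_nonzero[OF 2] \<theta>(3) by blast
    then have b: "s \<le> 2 * (L a \<bullet> x) \<and> 2 * (L a \<bullet> x) \<le> r/3" for a by (simp add: parallelepiped_def)
    show ?thesis unfolding parallelepiped_def
    proof (intro CollectI allI)
      fix a show "s/2 \<le> L a \<bullet> x \<and> L a \<bullet> x \<le> r/3" using b[of a] s by linarith
    qed
  qed
qed

lemma in_\<Omega>: assumes "y \<in> K" "b \<in> cone_piece" "c \<in> cone_piece" shows "y + b + c \<in> \<Omega>"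
proof -
  have "y + (\<Sum>a\<in>UNIV. (L a \<bullet> (b + c)) *\<^sub>R d a) \<in> \<Omega>"
  proof (rule cone[OF assms(1)])
    fix a
    have "0 < L a \<bullet> b \<and> L a \<bullet> b \<le> r/3" "0 < L a \<bullet> c \<and> L a \<bullet> c \<le> r/3" using assms by (auto simp: cone_piece_def)
    then show "0 < L a \<bullet> (b + c) \<and> L a \<bullet> (b + c) < r" by (simp add: inner_add_right)
  qed
  then show ?thesis unfolding dual_frame_expand[OF D] by (simp add: add.assoc)
qed

lemma conv_test_on:
  assumes u: "Hm1 u" "supp_in u K" and g: "test g" "tsupp g \<subseteq> cone_piece" and h: "test h" "tsupp h \<subseteq> cone_piece"
  shows "test_on \<Omega> (conv (cv u g) h)"
proof -
  note v = test_cv[OF u K g(1)]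
  have "tsupp (conv (cv u g) h) \<subseteq> \<Omega>"
  proof
    fix x assume "x \<in> tsupp (conv (cv u g) h)"
    then obtain p c where p: "x = p + c" "p \<in> tsupp (cv u g)" "c \<in> tsupp h" using tsupp_conv[OF v(1) h(1)] by blast
    then obtain y b where "p = y + b" "y \<in> K" "b \<in> tsupp g" using v(2) by blast
    then show "x \<in> \<Omega>" using p in_\<Omega>[of y b c] g h by blast
  qed
  then show ?thesis unfolding test_on_def using test_conv[OF v(1) h(1)] by blast
qed

lemma R_test_on: "Hm1 u \<Longrightarrow> supp_in u K \<Longrightarrow> test_on \<Omega> (R N u)"
  unfolding R_def using conv_test_on[OF _ _ test_dil[OF \<theta>(1)] dil_cone_piece[OF \<theta>(3) s] test_dil[OF \<theta>(1)] dil_cone_piece[OF \<theta>(3) s]] .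

lemma Tk_test_on: assumes "Hm1 u" "supp_in u K" shows "test_on \<Omega> (Tk \<Theta> (\<eta> a) k u)"
proof -
  have "test_on \<Omega> (conv (cv u (dil k \<Theta>)) (dil k (\<eta> a)))"
    by (rule conv_test_on[OF assms test_dil[OF test_\<Theta>] dil_cone_piece[OF tsupp_\<Theta>] test_dil[OF \<eta>(1)] dil_cone_piece[OF \<eta>(2) s]]) (use s in simp)
  from test_on_lincomb[OF this this, of "(1/4) ^ k" 0] show ?thesis by (simp only: Tk_def mult_zero_left add_0_right)
qed

lemma fdist_R:
  assumes u: "Hm1 u" "supp_in u K" and \<phi>: "test \<phi>" shows "fdist (R N u) \<phi> = u (Jn \<theta> N \<phi>)"
proof -
  have t: "test (dil N \<theta>)" by (rule test_dil[OF \<theta>(1)])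
  show ?thesis
    unfolding R_def Jn_def conv_adjoint[OF test_cv(1)[OF u K t] t \<phi>] fdist_cv[OF u(1) t test_conv[OF \<phi> test_rfl[OF t]]] ..
qed

definition tail_bound :: "3 \<Rightarrow> real \<Rightarrow> distr \<Rightarrow> bool" where
  "tail_bound a B u \<longleftrightarrow> (\<forall>m n. h1t (\<lambda>x. \<Sum>k\<in>{m..<n}. Tk \<Theta> (\<eta> a) k u x) \<le> B) \<and>
     (\<forall>k. n2 (Tk \<Theta> (\<eta> a) k u) \<le> B * (1/2) ^ k) \<and>
     (\<forall>e>0. \<exists>N. \<forall>m\<ge>N. \<forall>n. h1t (\<lambda>x. \<Sum>k\<in>{m..<n}. Tk \<Theta> (\<eta> a) k u x) \<le> e)"

lemma tail_bound_mono: assumes "tail_bound a B u" "B \<le> B'" shows "tail_bound a B' u"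
proof -
  have "B * (1/2) ^ k \<le> B' * (1/2) ^ k" for k by (rule mult_right_mono[OF assms(2)]) simp
  then show ?thesis using assms unfolding tail_bound_def by (meson order_trans)
qed

lemma T_bounds:
  "\<exists>M\<ge>0. \<forall>a u c. Hm1 u \<longrightarrow> supp_in u K \<longrightarrow> 0 \<le> c \<longrightarrow> hm1_le u c \<longrightarrow> tail_bound a (M * c) u"
proof -
  have "\<forall>a. \<exists>M\<ge>0. \<forall>u c. Hm1 u \<longrightarrow> supp_in u K \<longrightarrow> 0 \<le> c \<longrightarrow> hm1_le u c \<longrightarrow> tail_bound a (M * c) u"
  proof
    fix a
    show "\<exists>M\<ge>0. \<forall>u c. Hm1 u \<longrightarrow> supp_in u K \<longrightarrow> 0 \<le> c \<longrightarrow> hm1_le u c \<longrightarrow> tail_bound a (M * c) u"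
      using Tk_bounds[OF test_\<Theta> \<eta>(1)[of a], folded tail_bound_def] K by blast
  qed
  from choice[OF this] obtain M
    where M: "\<forall>a. 0 \<le> M a \<and> (\<forall>u c. Hm1 u \<longrightarrow> supp_in u K \<longrightarrow> 0 \<le> c \<longrightarrow> hm1_le u c \<longrightarrow> tail_bound a (M a * c) u)" ..
  have M0: "0 \<le> (\<Sum>a\<in>UNIV. M a)" using M by (simp add: sum_nonneg)
  have "tail_bound a ((\<Sum>a\<in>UNIV. M a) * c) u" if u: "Hm1 u" "supp_in u K" "0 \<le> c" "hm1_le u c" for a u c
  proof -
    have "M a \<le> (\<Sum>a\<in>UNIV. M a)" by (rule member_le_sum) (use M in simp_all)
    then have le: "M a * c \<le> (\<Sum>a\<in>UNIV. M a) * c" using u(3) by (rule mult_right_mono)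
    have "tail_bound a (M a * c) u" using M u by blast
    then show ?thesis by (rule tail_bound_mono[OF _ le])
  qed
  then show ?thesis using M0 by blast
qed

lemma T_props:
  "\<exists>M\<ge>0. \<forall>a u c. Hm1 u \<longrightarrow> supp_in u K \<longrightarrow> 0 \<le> c \<longrightarrow> hm1_le u c \<longrightarrow>
     H01 \<Omega> (T a u) \<and> h1norm (T a u) \<le> M * c \<and> (AE x in lborel. summable (\<lambda>k. Tk \<Theta> (\<eta> a) k u x)) \<and>
     (\<forall>\<phi>. test \<phi> \<longrightarrow> (\<lambda>k. u (Gk \<Theta> (\<eta> a) k \<phi>)) sums fdist (T a u) \<phi>)"
proof -
  obtain M where M: "M \<ge> 0" "\<And>a u c. Hm1 u \<Longrightarrow> supp_in u K \<Longrightarrow> 0 \<le> c \<Longrightarrow> hm1_le u c \<Longrightarrow> tail_bound a (M * c) u"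
    using T_bounds by blast
  have main: "H01 \<Omega> (T a u) \<and> h1norm (T a u) \<le> M * c \<and> (AE x in lborel. summable (\<lambda>k. Tk \<Theta> (\<eta> a) k u x)) \<and>
     (\<forall>\<phi>. test \<phi> \<longrightarrow> (\<lambda>k. u (Gk \<Theta> (\<eta> a) k \<phi>)) sums fdist (T a u) \<phi>)"
    if u: "Hm1 u" "supp_in u K" "0 \<le> c" "hm1_le u c" for a u c
  proof -
    note B = M(2)[OF u, of a]
    have b1: "\<And>k. n2 (Tk \<Theta> (\<eta> a) k u) \<le> M * c * (1/2) ^ k"
      and b2: "\<And>n. h1t (\<lambda>x. \<Sum>k\<in>{0..<n}. Tk \<Theta> (\<eta> a) k u x) \<le> M * c"
      and b3: "\<And>e. e > 0 \<Longrightarrow> \<exists>N. \<forall>m\<ge>N. \<forall>n. h1t (\<lambda>x. \<Sum>k\<in>{m..<n}. Tk \<Theta> (\<eta> a) k u x) \<le> e"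
      using B unfolding tail_bound_def by blast+
    note S = H01_series[OF Tk_test_on[OF u(1,2)] b1 b2 b3]
    have "(\<lambda>k. u (Gk \<Theta> (\<eta> a) k \<phi>)) sums fdist (T a u) \<phi>" if \<phi>: "test \<phi>" for \<phi>
    proof -
      have "(\<lambda>k. fdist (Tk \<Theta> (\<eta> a) k u) \<phi>) sums fdist (T a u) \<phi>" unfolding T_def by (rule S(4)[OF _ \<phi>])
      then show ?thesis unfolding Tk_adjoint[OF u(1,2) K test_\<Theta> \<eta>(1) \<phi>] .
    qed
    moreover have "H01 \<Omega> (T a u)" unfolding T_def by (rule S(1))
    moreover have "h1norm (T a u) \<le> M * c" unfolding T_def by (rule S(2))
    moreover have "AE x in lborel. summable (\<lambda>k. Tk \<Theta> (\<eta> a) k u x)" by (rule S(3))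
    ultimately show ?thesis by blast
  qed
  show ?thesis by (rule exI[of _ M]) (use M(1) main in blast)
qed

text \<open>Term by term the operators are linear everywhere; the sums are split where both series
  converge, hence almost everywhere.\<close>

lemma T_linear:
  assumes u: "Hm1 u" "supp_in u K" and v: "Hm1 v" "supp_in v K"
  shows "AE x in lborel. T a (\<lambda>\<phi>. \<alpha> * u \<phi> + \<beta> * v \<phi>) x = \<alpha> * T a u x + \<beta> * T a v x"
proof -
  obtain M where M: "\<And>a u c. Hm1 u \<Longrightarrow> supp_in u K \<Longrightarrow> 0 \<le> c \<Longrightarrow> hm1_le u c \<Longrightarrow>
     AE x in lborel. summable (\<lambda>k. Tk \<Theta> (\<eta> a) k u x)" using T_props by blast
  have l: "Tk \<Theta> (\<eta> a) k (\<lambda>\<phi>. \<alpha> * u \<phi> + \<beta> * v \<phi>) x = \<alpha> * Tk \<Theta> (\<eta> a) k u x + \<beta> * Tk \<Theta> (\<eta> a) k v x" for k x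
  proof -
    let ?cu = "cv u (dil k \<Theta>)" and ?cw = "cv v (dil k \<Theta>)"
    have t: "test ?cu" "test ?cw" "test (dil k (\<eta> a))" using test_cv(1)[OF u K test_dil[OF test_\<Theta>]] test_cv(1)[OF v K test_dil[OF test_\<Theta>]] test_dil[OF \<eta>(1)] by blast+
    have "cv (\<lambda>\<phi>. \<alpha> * u \<phi> + \<beta> * v \<phi>) (dil k \<Theta>) = (\<lambda>x. \<alpha> * ?cu x + \<beta> * ?cw x)" by (simp add: cv_def fun_eq_iff)
    then show ?thesis unfolding Tk_def
      by (simp only: conv_lincomb_left[OF t]) (simp add: algebra_simps)
  qed
  obtain c where c: "c \<ge> 0" "hm1_le u c" using Hm1_bound[OF u(1)] .
  obtain e where e: "e \<ge> 0" "hm1_le v e" using Hm1_bound[OF v(1)] .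
  from M[OF u c, of a] M[OF v e, of a] show ?thesis
  proof eventually_elim
    fix x assume s: "summable (\<lambda>k. Tk \<Theta> (\<eta> a) k u x)" "summable (\<lambda>k. Tk \<Theta> (\<eta> a) k v x)"
    show "T a (\<lambda>\<phi>. \<alpha> * u \<phi> + \<beta> * v \<phi>) x = \<alpha> * T a u x + \<beta> * T a v x"
      unfolding T_def l using suminf_add[OF summable_mult[OF s(1), of \<alpha>] summable_mult[OF s(2), of \<beta>]] suminf_mult[OF s(1), of \<alpha>] suminf_mult[OF s(2), of \<beta>] by simp
  qed
qed

lemma Jn_telescope:
  assumes u: "Hm1 u" and \<phi>: "test \<phi>"
  shows "u (Jn \<theta> (Suc k) \<phi>) - u (Jn \<theta> k \<phi>) = (\<Sum>a\<in>UNIV. u (Gk \<Theta> (\<eta> a) k (dd (d a) (dd (d a) \<phi>))))"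
proof -
  have t: "test (Gk \<Theta> (\<eta> a) k (dd (d a) (dd (d a) \<phi>)))" for a
    by (rule test_Gk[OF test_dd[OF test_dd[OF \<phi>]] test_\<Theta> \<eta>(1)])
  have "(\<lambda>x. Jn \<theta> (Suc k) \<phi> x - Jn \<theta> k \<phi> x) = (\<lambda>x. \<Sum>a\<in>UNIV. Gk \<Theta> (\<eta> a) k (dd (d a) (dd (d a) \<phi>)) x)"
    unfolding Jn_diff[OF \<phi> \<theta>(1) \<eta>(1) ident] \<Theta>_def[symmetric]
      dd_Gk[OF \<phi> test_\<Theta> \<eta>(1)] dd_Gk[OF test_dd[OF \<phi>] test_\<Theta> \<eta>(1)] ..
  moreover have "u (\<lambda>x. \<Sum>a\<in>UNIV. Gk \<Theta> (\<eta> a) k (dd (d a) (dd (d a) \<phi>)) x) = (\<Sum>a\<in>UNIV. u (Gk \<Theta> (\<eta> a) k (dd (d a) (dd (d a) \<phi>))))"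
    by (rule Hm1_sum[OF finite u t])
  ultimately show ?thesis
    using Hm1_diff[OF u test_Jn[OF \<phi> \<theta>(1)] test_Jn[OF \<phi> \<theta>(1)], of "Suc k" k] by simp
qed

lemma Jn_lim: assumes u: "Hm1 u" and \<phi>: "test \<phi>" shows "(\<lambda>N. u (Jn \<theta> N \<phi>)) \<longlonglongrightarrow> u \<phi>"
proof -
  obtain c where c: "c \<ge> 0" "hm1_le u c" using Hm1_bound[OF u] .
  have "(\<lambda>N. u (Jn \<theta> N \<phi>) - u \<phi>) \<longlonglongrightarrow> 0"
  proof (rule Lim_null_comparison)
    show "(\<lambda>N. c * h1t (\<lambda>x. Jn \<theta> N \<phi> x - \<phi> x)) \<longlonglongrightarrow> 0"
      by (rule tendsto_mult_right_zero[OF Jn_tendsto[OF \<phi> \<theta>(1,2)]])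
    have "norm (u (Jn \<theta> N \<phi>) - u \<phi>) \<le> c * h1t (\<lambda>x. Jn \<theta> N \<phi> x - \<phi> x)" for N
      using hm1_leD[OF c(2) test_diff[OF test_Jn[OF \<phi> \<theta>(1)] \<phi>], of N] Hm1_diff[OF u test_Jn[OF \<phi> \<theta>(1)] \<phi>, of N] by simp
    then show "\<forall>\<^sub>F N in sequentially. norm (u (Jn \<theta> N \<phi>) - u \<phi>) \<le> c * h1t (\<lambda>x. Jn \<theta> N \<phi> x - \<phi> x)" by simp
  qed
  then show ?thesis by (simp add: LIM_zero_iff)
qed

text \<open>The telescoping sum of \<open>u (Jn \<theta> k \<phi>)\<close> starts at
  \<open>R 0 u\<close> and has limit \<open>u \<phi>\<close>, because
  \<open>Jn \<theta> N \<phi>\<close> tends to \<open>\<phi>\<close> in \<open>h1t\<close>. Both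
  derivatives sit on \<open>\<phi>\<close>, so no sign appears.\<close>

lemma potential_identity:
  assumes u: "Hm1 u" "supp_in u K" and \<phi>: "test \<phi>"
  shows "u \<phi> = fdist (R 0 u) \<phi> + (\<Sum>a\<in>UNIV. fdist (T a u) (dd (d a) (dd (d a) \<phi>)))"
proof -
  obtain c where c: "c \<ge> 0" "hm1_le u c" using Hm1_bound[OF u(1)] .
  have "(\<lambda>k. u (Gk \<Theta> (\<eta> a) k \<psi>)) sums fdist (T a u) \<psi>" if "test \<psi>" for a \<psi>
    using T_props u c that by blast
  then have "(\<lambda>k. \<Sum>a\<in>UNIV. u (Gk \<Theta> (\<eta> a) k (dd (d a) (dd (d a) \<phi>)))) sums (\<Sum>a\<in>UNIV. fdist (T a u) (dd (d a) (dd (d a) \<phi>)))"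
    by (intro sums_sum) (simp add: test_dd \<phi>)
  then have "(\<lambda>N. \<Sum>k<N. u (Jn \<theta> (Suc k) \<phi>) - u (Jn \<theta> k \<phi>)) \<longlonglongrightarrow> (\<Sum>a\<in>UNIV. fdist (T a u) (dd (d a) (dd (d a) \<phi>)))"
    unfolding sums_def Jn_telescope[OF u(1) \<phi>] .
  then have "(\<lambda>N. u (Jn \<theta> N \<phi>) - u (Jn \<theta> 0 \<phi>)) \<longlonglongrightarrow> (\<Sum>a\<in>UNIV. fdist (T a u) (dd (d a) (dd (d a) \<phi>)))"
    unfolding sum_lessThan_telescope[of "\<lambda>n. u (Jn \<theta> n \<phi>)"] .
  moreover have "(\<lambda>N. u (Jn \<theta> N \<phi>) - u (Jn \<theta> 0 \<phi>)) \<longlonglongrightarrow> u \<phi> - u (Jn \<theta> 0 \<phi>)"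
    by (intro tendsto_diff tendsto_const Jn_lim u \<phi>)
  ultimately show ?thesis using LIMSEQ_unique fdist_R[OF u \<phi>, where N=0] by force
qed

text \<open>Density needs convergence in norm, not just for each \<open>\<phi>\<close>. The
  difference between the scales \<open>m\<close> and \<open>n\<close> is the pairing of a block of
  \<open>Tk\<close> with second derivatives of \<open>\<phi>\<close>. One derivative goes back onto
  the block, which is small in H^1 for large \<open>m\<close>, uniformly in \<open>n\<close>; then
  \<open>n\<close> tends to infinity.\<close>

lemma R_approx:
  assumes u: "Hm1 u" "supp_in u K" and e: "0 < e"
  shows "\<exists>N0. \<forall>N\<ge>N0. hm1_le (\<lambda>\<phi>. u \<phi> - fdist (R N u) \<phi>) e"
proof -
  obtain c where c: "c \<ge> 0" "hm1_le u c" using Hm1_bound[OF u(1)] .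
  define w where "w a = (\<Sum>i\<in>UNIV. \<bar>d a $ i\<bar>)" for a
  \<comment> \<open>The factor lost in bounding directional derivatives by \<open>h1t\<close>;
    adding 1 keeps it positive.\<close>
  define W where "W = (\<Sum>a\<in>UNIV. w a * w a) + 1"
  have w0: "0 \<le> w a" for a unfolding w_def by (simp add: sum_nonneg)
  have W: "0 < W" unfolding W_def using w0 by (simp add: add_nonneg_pos sum_nonneg)
  have "\<forall>a. \<exists>N. \<forall>m\<ge>N. \<forall>n. h1t (\<lambda>x. \<Sum>k\<in>{m..<n}. Tk \<Theta> (\<eta> a) k u x) \<le> e / W"
  proof
    fix a
    obtain M where "tail_bound a (M * c) u" using T_bounds u c by blast
    then show "\<exists>N. \<forall>m\<ge>N. \<forall>n. h1t (\<lambda>x. \<Sum>k\<in>{m..<n}. Tk \<Theta> (\<eta> a) k u x) \<le> e / W"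
      using divide_pos_pos[OF e W] unfolding tail_bound_def by blast
  qed
  from choice[OF this] obtain N where N: "\<And>a m n. m \<ge> N a \<Longrightarrow> h1t (\<lambda>x. \<Sum>k\<in>{m..<n}. Tk \<Theta> (\<eta> a) k u x) \<le> e / W" by blast
  have Nle: "N a \<le> (\<Sum>a\<in>UNIV. N a)" for a by (rule member_le_sum) simp_all
  show ?thesis
  proof (intro exI[of _ "\<Sum>a\<in>UNIV. N a"] allI impI)
    fix m assume m: "(\<Sum>a\<in>UNIV. N a) \<le> m"
    show "hm1_le (\<lambda>\<phi>. u \<phi> - fdist (R m u) \<phi>) e"
      unfolding hm1_le_def
    proof (intro allI impI)
      fix \<phi> assume \<phi>: "test \<phi>"
      have b: "\<bar>u (Jn \<theta> n \<phi>) - u (Jn \<theta> m \<phi>)\<bar> \<le> e * h1t \<phi>" if mn: "m \<le> n" for n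
      proof -
        define S where "S a = (\<lambda>x. \<Sum>k\<in>{m..<n}. Tk \<Theta> (\<eta> a) k u x)" for a
        have tT: "test (Tk \<Theta> (\<eta> a) k u)" for a k by (rule test_Tk[OF u K test_\<Theta> \<eta>(1)])
        have tS: "test (S a)" for a unfolding S_def by (rule test_sum[OF _ tT]) simp
        have "u (Jn \<theta> n \<phi>) - u (Jn \<theta> m \<phi>) = (\<Sum>k\<in>{m..<n}. u (Jn \<theta> (Suc k) \<phi>) - u (Jn \<theta> k \<phi>))"
          by (rule sum_Suc_diff'[OF mn, symmetric])
        also have "\<dots> = (\<Sum>a\<in>UNIV. \<Sum>k\<in>{m..<n}. u (Gk \<Theta> (\<eta> a) k (dd (d a) (dd (d a) \<phi>))))"
          unfolding Jn_telescope[OF u(1) \<phi>] by (rule sum.swap)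
        also have "\<dots> = (\<Sum>a\<in>UNIV. fdist (S a) (dd (d a) (dd (d a) \<phi>)))"
          unfolding S_def fdist_sum[OF finite_atLeastLessThan test_L2[OF tT] test_dd[OF test_dd[OF \<phi>]]]
            Tk_adjoint[OF u K test_\<Theta> \<eta>(1) test_dd[OF test_dd[OF \<phi>]]] ..
        finally have "\<bar>u (Jn \<theta> n \<phi>) - u (Jn \<theta> m \<phi>)\<bar> \<le> (\<Sum>a\<in>UNIV. \<bar>fdist (S a) (dd (d a) (dd (d a) \<phi>))\<bar>)" by (simp only: sum_abs)
        also have "\<dots> \<le> (\<Sum>a\<in>UNIV. (w a * w a) * (e / W * h1t \<phi>))"
        proof (rule sum_mono)
          fix a
          have "\<bar>fdist (S a) (dd (d a) (dd (d a) \<phi>))\<bar> = \<bar>\<integral>x. dd (d a) (S a) x * dd (d a) \<phi> x \<partial>lborel\<bar>"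
            unfolding fdist_def integral_by_parts_dd[OF tS test_dd[OF \<phi>]] by simp
          also have "\<dots> \<le> n2 (dd (d a) (S a)) * n2 (dd (d a) \<phi>)"
            by (rule L2_Cauchy_Schwarz[OF test_L2[OF test_dd[OF tS]] test_L2[OF test_dd[OF \<phi>]]])
          also have "\<dots> \<le> (w a * h1t (S a)) * (w a * h1t \<phi>)"
            using w0[of a] by (intro mult_mono n2_dd_le[OF tS, of "d a" a, folded w_def] n2_dd_le[OF \<phi>, of "d a", folded w_def]) (auto simp: n2_nonneg h1t_nonneg)
          also have "\<dots> = (w a * w a) * (h1t (S a) * h1t \<phi>)" by simp
          also have "\<dots> \<le> (w a * w a) * (e / W * h1t \<phi>)"
            using N[of a m n] Nle[of a] m w0[of a] unfolding S_def
            by (intro mult_left_mono mult_right_mono) (auto simp: h1t_nonneg)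
          finally show "\<bar>fdist (S a) (dd (d a) (dd (d a) \<phi>))\<bar> \<le> (w a * w a) * (e / W * h1t \<phi>)" .
        qed
        also have "\<dots> = (W - 1) * (e / W * h1t \<phi>)" by (simp only: W_def sum_distrib_right add_diff_cancel_right')
        also have "\<dots> \<le> W * (e / W * h1t \<phi>)"
          using e W h1t_nonneg[of \<phi>] by (intro mult_right_mono) auto
        also have "\<dots> = e * h1t \<phi>" using W by simp
        finally show ?thesis .
      qed
      have "(\<lambda>n. \<bar>u (Jn \<theta> n \<phi>) - u (Jn \<theta> m \<phi>)\<bar>) \<longlonglongrightarrow> \<bar>u \<phi> - u (Jn \<theta> m \<phi>)\<bar>"
        by (intro tendsto_rabs tendsto_diff tendsto_const Jn_lim u \<phi>)
      then have "\<bar>u \<phi> - u (Jn \<theta> m \<phi>)\<bar> \<le> e * h1t \<phi>"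
        by (rule LIMSEQ_le_const2) (use b in blast)
      then show "\<bar>u \<phi> - fdist (R m u) \<phi>\<bar> \<le> e * h1t \<phi>" unfolding fdist_R[OF u \<phi>] .
    qed
  qed
qed

text \<open>\<open>square_function\<close> at the single scale 0 bounds
  \<open>cv u (dil 0 \<theta>)\<close> in L2; derivatives then fall on the second kernel and cost a
  constant by Young's inequality.\<close>

lemma R_bound: "\<exists>M\<ge>0. \<forall>u c. Hm1 u \<longrightarrow> supp_in u K \<longrightarrow> 0 \<le> c \<longrightarrow> hm1_le u c \<longrightarrow> h1t (R 0 u) \<le> M * c"
proof -
  obtain B where B: "B \<ge> 0" "\<And>u K c m n. Hm1 u \<Longrightarrow> supp_in u K \<Longrightarrow> compact K \<Longrightarrow> 0 \<le> c \<Longrightarrow> hm1_le u c \<Longrightarrow>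
       sqrt (\<Sum>k\<in>{m..<n}. (n2 (\<lambda>x. (1/2) ^ k * cv u (dil k \<theta>) x))\<^sup>2) \<le> B * c"
    using square_function[OF \<theta>(1)] by blast
  define Q where "Q = n1 (dil 0 \<theta>) + (\<Sum>i\<in>UNIV. n1 (pd i (dil 0 \<theta>)))"
  have Q: "0 \<le> Q" unfolding Q_def by (intro add_nonneg_nonneg n1_nonneg sum_nonneg)
  have t: "test (dil 0 \<theta>)" by (rule test_dil[OF \<theta>(1)])
  show ?thesis
  proof (intro exI[of _ "Q * B"] conjI allI impI)
    show "0 \<le> Q * B" using Q B(1) by simp
    fix u c assume u: "Hm1 u" "supp_in u K" "0 \<le> c" "hm1_le u c"
    let ?v = "cv u (dil 0 \<theta>)"
    have v: "test ?v" by (rule test_cv(1)[OF u(1,2) K t])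
    have nv: "n2 ?v \<le> B * c" using B(2)[OF u(1,2) K u(3,4), of 0 1] by (simp add: n2_nonneg)
    have "h1t (R 0 u) \<le> n2 (R 0 u) + (\<Sum>i\<in>UNIV. n2 (pd i (R 0 u)))" by (rule h1t_le_sum)
    also have "\<dots> \<le> n1 (dil 0 \<theta>) * n2 ?v + (\<Sum>i\<in>UNIV. n1 (pd i (dil 0 \<theta>)) * n2 ?v)"
      unfolding R_def pd_conv[OF v t] by (intro add_mono sum_mono young v t test_pd)
    also have "\<dots> = Q * n2 ?v" unfolding Q_def by (simp add: distrib_right sum_distrib_right)
    also have "\<dots> \<le> Q * (B * c)" by (rule mult_left_mono[OF nv Q])
    finally show "h1t (R 0 u) \<le> Q * B * c" by simp
  qed
qed

end

section \<open>Lipschitz charts and cutoff functions\<close>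

lemma dual_frame_axis: "dual_frame (\<lambda>a. axis a 1) (\<lambda>a. axis a 1)"
  by (simp add: dual_frame_def inner_axis_axis)

lemma norm_sum_scale_le:
  assumes "\<And>a. 0 < t a \<and> t a < r" "\<And>a. norm (d a :: pt) \<le> B"
  shows "norm (\<Sum>a\<in>(UNIV::3 set). t a *\<^sub>R d a) \<le> 3 * (r * B)"
proof -
  have B: "0 \<le> B" using order_trans[OF norm_ge_zero assms(2)] .
  have "norm (\<Sum>a\<in>(UNIV::3 set). t a *\<^sub>R d a) \<le> (\<Sum>a\<in>(UNIV::3 set). r * B)"
  proof (rule sum_norm_le)
    fix a
    have "\<bar>t a\<bar> * norm (d a) \<le> r * B" using assms(1)[of a] assms(2)[of a] by (intro mult_mono) auto
    then show "norm (t a *\<^sub>R d a) \<le> r * B" by simp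
  qed
  then show ?thesis by simp
qed

lemma interior_chart:
  fixes \<Omega> :: "pt set"
  assumes "open \<Omega>" "x \<in> \<Omega>"
  shows "\<exists>\<rho>>0. \<exists>L d r. 0 < r \<and> dual_frame L d \<and>
    (\<forall>y\<in>closure \<Omega> \<inter> ball x \<rho>. \<forall>t. (\<forall>a. 0 < t a \<and> t a < r) \<longrightarrow> y + (\<Sum>a\<in>UNIV. t a *\<^sub>R d a) \<in> \<Omega>)"
proof -
  obtain e where e: "0 < e" "ball x e \<subseteq> \<Omega>" using assms openE by blast
  show ?thesis
  \<comment> \<open>With radius and steps below \<open>e/6\<close> the distance from
    \<open>x\<close> stays below \<open>e/6 + 3 * (e/6)\<close>, less than \<open>e\<close>.\<close>
  proof (intro exI[of _ "e/6"] conjI exI[of _ "\<lambda>a. axis a 1"] dual_frame_axis ballI allI impI)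
    fix y and t :: "3 \<Rightarrow> real" assume y: "y \<in> closure \<Omega> \<inter> ball x (e/6)" and t: "\<forall>a. 0 < t a \<and> t a < e/6"
    have "norm (\<Sum>a\<in>UNIV. t a *\<^sub>R (axis a 1 :: pt)) \<le> 3 * (e/6 * 1)" by (rule norm_sum_scale_le) (use t in auto)
    moreover have "dist x (y + (\<Sum>a\<in>UNIV. t a *\<^sub>R axis a 1)) \<le> dist x y + norm (\<Sum>a\<in>UNIV. t a *\<^sub>R (axis a 1 :: pt))"
      using dist_triangle[of x "y + (\<Sum>a\<in>UNIV. t a *\<^sub>R axis a 1)" y] by (simp add: dist_norm)
    ultimately have "dist x (y + (\<Sum>a\<in>UNIV. t a *\<^sub>R axis a 1)) < e" using y e(1) by auto
    then show "y + (\<Sum>a\<in>UNIV. t a *\<^sub>R axis a 1) \<in> \<Omega>" using e(2) by auto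
  qed (use e in auto)
qed

text \<open>The frame \<open>d0\<close> spans a cone that lies below every graph with Lipschitz constant \<open>l\<close>.\<close>
lemma boundary_chart:
  fixes \<Omega> :: "pt set"
  assumes "lipschitz_boundary \<Omega>" "x \<in> frontier \<Omega>"
  shows "\<exists>\<rho>>0. \<exists>L d r. 0 < r \<and> dual_frame L d \<and>
    (\<forall>y\<in>closure \<Omega> \<inter> ball x \<rho>. \<forall>t. (\<forall>a. 0 < t a \<and> t a < r) \<longrightarrow> y + (\<Sum>a\<in>UNIV. t a *\<^sub>R d a) \<in> \<Omega>)"
proof -
  obtain r Q \<gamma> l where r: "0 < r" and Q: "orthogonal_matrix (Q :: real^3^3)" and \<gamma>: "l-lipschitz_on UNIV (\<gamma> :: real \<times> real \<Rightarrow> real)"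
    and gr: "\<And>y. y \<in> ball x r \<Longrightarrow> y \<in> \<Omega> \<longleftrightarrow> (Q *v y) $ 3 < \<gamma> ((Q *v y) $ 1, (Q *v y) $ 2)"
    using assms unfolding lipschitz_boundary_def by blast
  have l: "0 \<le> l" using \<gamma> lipschitz_on_nonneg by blast
  \<comment> \<open>Chosen so that \<open>l * \<epsilon> \<le> 1\<close>: a horizontal move of size
    \<open>\<epsilon> * t\<close> changes the height of the graph by at most
    \<open>t\<close>.\<close>
  define \<epsilon> where "\<epsilon> = 1 / (l + 1)"
  have \<epsilon>: "0 < \<epsilon>" "\<epsilon> \<le> 1" "l * \<epsilon> \<le> 1" using l by (simp_all add: \<epsilon>_def field_simps)
  define d0 :: "3 \<Rightarrow> pt" where "d0 a = (if a = 1 then vector [\<epsilon>, 0, -1] else if a = 2 then vector [0, \<epsilon>, -1] else vector [0, 0, -1])" for a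
  \<comment> \<open>The rows of the inverse of the matrix whose columns are the
    \<open>d0 a\<close>.\<close>
  define L0 :: "3 \<Rightarrow> pt" where "L0 a = (if a = 1 then vector [1/\<epsilon>, 0, 0] else if a = 2 then vector [0, 1/\<epsilon>, 0] else vector [-1/\<epsilon>, -1/\<epsilon>, -1])" for a
  have df0: "L0 a \<bullet> d0 b = (if a = b then 1 else 0)" for a b
    using exhaust_3[of a] exhaust_3[of b] \<epsilon>(1) by (auto simp: L0_def d0_def inner_vec_def sum_3)
  define L d where "L a = transpose Q *v L0 a" and "d a = transpose Q *v d0 a" for a
  have QQ: "Q ** transpose Q = mat 1" using Q by (simp add: orthogonal_matrix_def)
  have Qd: "Q *v d a = d0 a" for a by (simp only: d_def matrix_vector_mul_assoc QQ matrix_vector_mul_lid)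
  have nd: "norm (d a) \<le> 2" for a
  proof -
    have ot: "orthogonal_transformation ((*v) (transpose Q))"
      unfolding orthogonal_transformation_matrix using Q by (simp add: orthogonal_matrix_transpose)
    have "norm (d a) = norm (d0 a)" unfolding d_def by (rule orthogonal_transformation_norm[OF ot])
    also have "\<dots> \<le> (\<Sum>i\<in>UNIV. \<bar>d0 a $ i\<bar>)" by (rule norm_le_l1_cart)
    also have "\<dots> \<le> 2" using \<epsilon> exhaust_3[of a] by (auto simp: sum_3 d0_def)
    finally show ?thesis .
  qed
  have df: "dual_frame L d"
  proof -
    have "L a \<bullet> d b = L0 a \<bullet> (Q *v d b)" for a b
      unfolding L_def by (metis dot_lmul_matrix transpose_matrix_vector)
    then show ?thesis by (simp add: dual_frame_def Qd df0)
  qed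
  have c\<gamma>: "continuous_on UNIV \<gamma>" using \<gamma> lipschitz_on_continuous_on by blast
  have cQ: "continuous_on UNIV (\<lambda>y. (Q *v y) $ i)" for i
    by (intro continuous_on_component matrix_vector_mult_linear_continuous_on)
  show ?thesis
  \<comment> \<open>Each \<open>d a\<close> has norm at most 2, so three steps below
    \<open>r/12\<close> displace by at most \<open>r/2\<close>, which leaves the point inside
    \<open>ball x r\<close>.\<close>
  proof (rule exI[of _ "r/12"], rule conjI[rotated], rule exI[of _ L], rule exI[of _ d], rule exI[of _ "r/12"], intro conjI df ballI allI impI)
    fix y and t :: "3 \<Rightarrow> real" assume y: "y \<in> closure \<Omega> \<inter> ball x (r/12)" and t: "\<forall>a. 0 < t a \<and> t a < r/12"
    let ?w = "y + (\<Sum>a\<in>UNIV. t a *\<^sub>R d a)"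
    have tp: "0 \<le> t a" for a using t[rule_format, of a] by linarith
    have yr: "y \<in> ball x r" using y r by auto
    \<comment> \<open>Points of the closure lie on or below the graph: the open set strictly above
      it, inside the ball, misses \<open>\<Omega>\<close>.\<close>
    have yle: "(Q *v y) $ 3 \<le> \<gamma> ((Q *v y) $ 1, (Q *v y) $ 2)"
    proof (rule ccontr)
      assume n: "\<not> (Q *v y) $ 3 \<le> \<gamma> ((Q *v y) $ 1, (Q *v y) $ 2)"
      let ?U = "{z. \<gamma> ((Q *v z) $ 1, (Q *v z) $ 2) < (Q *v z) $ 3} \<inter> ball x r"
      have "open {z. \<gamma> ((Q *v z) $ 1, (Q *v z) $ 2) < (Q *v z) $ 3}"
        by (intro open_Collect_less continuous_on_compose2[OF c\<gamma>] continuous_on_Pair cQ) auto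
      then have "open ?U" by blast
      moreover have "y \<in> ?U" using n yr by auto
      ultimately obtain z where "z \<in> \<Omega>" "z \<in> ?U" using y closure_iff_nhds_not_empty by blast
      then show False using gr[of z] by auto
    qed
    have "norm (\<Sum>a\<in>UNIV. t a *\<^sub>R d a) \<le> 3 * (r/12 * 2)" by (rule norm_sum_scale_le) (use t nd in auto)
    moreover have "dist x ?w \<le> dist x y + norm (\<Sum>a\<in>UNIV. t a *\<^sub>R d a)"
      using dist_triangle[of x ?w y] by (simp add: dist_norm)
    ultimately have wr: "?w \<in> ball x r" using y r by auto
    have "Q *v ?w = Q *v y + (\<Sum>a\<in>UNIV. t a *\<^sub>R d0 a)"
      by (simp add: matrix_vector_right_distrib linear_sum[OF matrix_vector_mul_linear] o_def matrix_vector_mult_scaleR Qd)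
    then have w: "(Q *v ?w) $ 1 = (Q *v y) $ 1 + \<epsilon> * t 1" "(Q *v ?w) $ 2 = (Q *v y) $ 2 + \<epsilon> * t 2"
      "(Q *v ?w) $ 3 = (Q *v y) $ 3 - (t 1 + t 2 + t 3)"
      by (simp_all add: sum_3 d0_def)
    \<comment> \<open>The height drops by \<open>t 1 + t 2 + t 3\<close> while the graph falls by at
      most \<open>t 1 + t 2\<close>; the surplus \<open>t 3\<close> makes the inequality
      strict.\<close>
    have "dist (\<gamma> ((Q *v ?w) $ 1, (Q *v ?w) $ 2)) (\<gamma> ((Q *v y) $ 1, (Q *v y) $ 2))
      \<le> l * dist ((Q *v ?w) $ 1, (Q *v ?w) $ 2) ((Q *v y) $ 1, (Q *v y) $ 2)"
      by (rule lipschitz_onD[OF \<gamma>]) auto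
    also have "\<dots> \<le> l * (\<epsilon> * t 1 + \<epsilon> * t 2)"
    proof (rule mult_left_mono[OF _ l])
      have "dist ((Q *v ?w) $ 1, (Q *v ?w) $ 2) ((Q *v y) $ 1, (Q *v y) $ 2) = norm (\<epsilon> * t 1, \<epsilon> * t 2)"
        by (simp add: w dist_norm)
      also have "\<dots> \<le> norm (\<epsilon> * t 1) + norm (\<epsilon> * t 2)" by (rule norm_Pair_le)
      finally show "dist ((Q *v ?w) $ 1, (Q *v ?w) $ 2) ((Q *v y) $ 1, (Q *v y) $ 2) \<le> \<epsilon> * t 1 + \<epsilon> * t 2"
        using \<epsilon>(1) tp[of 1] tp[of 2] by (simp add: abs_mult)
    qed
    also have "\<dots> = (l * \<epsilon>) * (t 1 + t 2)" by (simp add: algebra_simps)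
    also have "\<dots> \<le> 1 * (t 1 + t 2)"
    proof (rule mult_right_mono[OF \<epsilon>(3)])
      show "0 \<le> t 1 + t 2" using tp[of 1] tp[of 2] by simp
    qed
    finally have "\<gamma> ((Q *v y) $ 1, (Q *v y) $ 2) - \<gamma> ((Q *v ?w) $ 1, (Q *v ?w) $ 2) \<le> t 1 + t 2" by (simp add: dist_norm)
    then have "(Q *v ?w) $ 3 < \<gamma> ((Q *v ?w) $ 1, (Q *v ?w) $ 2)" using yle w(3) t[rule_format, of 3] by linarith
    then show "?w \<in> \<Omega>" using gr[OF wr] by simp
  qed (use r in auto)
qed

lemma chart_exists:
  fixes \<Omega> :: "pt set"
  assumes "open \<Omega>" "lipschitz_boundary \<Omega>" "x \<in> closure \<Omega>"
  shows "\<exists>\<rho>>0. \<exists>L d r. 0 < r \<and> dual_frame L d \<and>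
    (\<forall>y\<in>closure \<Omega> \<inter> ball x \<rho>. \<forall>t. (\<forall>a. 0 < t a \<and> t a < r) \<longrightarrow> y + (\<Sum>a\<in>UNIV. t a *\<^sub>R d a) \<in> \<Omega>)"
proof (cases "x \<in> \<Omega>")
  case True
  then show ?thesis by (rule interior_chart[OF assms(1)])
next
  case False
  then have "x \<in> frontier \<Omega>" using assms(1,3) by (simp add: frontier_def interior_open)
  then show ?thesis by (rule boundary_chart[OF assms(2)])
qed

lemma cutoff_exists:
  fixes x :: pt assumes \<rho>: "0 < \<rho>"
  shows "\<exists>\<zeta> \<delta>. test \<zeta> \<and> tsupp \<zeta> \<subseteq> ball x \<rho> \<and> 0 < \<delta> \<and> (\<forall>y\<in>ball x \<delta>. \<zeta> y = 1)"
proof -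
  obtain P where P: "smooth1 P" "\<And>x. x \<le> (1::real) \<Longrightarrow> P x = 0" "\<And>x. x \<ge> 2 \<Longrightarrow> P x = 1" "mono P"
    using smooth_step_exists[of 1 2] by auto
  \<comment> \<open>The cutoff will live in the cube of half width \<open>2 * h\<close> around
    \<open>x\<close>, whose points are within \<open>6 * h < \<rho>\<close> of
    \<open>x\<close>.\<close>
  define h where "h = \<rho> / 7"
  have h: "0 < h" using \<rho> by (simp add: h_def)
  define G where "G i y = P ((3 + x $ i / h) + (- 1 / h) * (axis i 1 \<bullet> y)) * P ((3 - x $ i / h) + (1 / h) * (axis i 1 \<bullet> y))" for i and y :: pt
  have G: "G i y = P (3 - (y $ i - x $ i) / h) * P (3 + (y $ i - x $ i) / h)" for i y
    unfolding G_def inner_axis' by (simp add: diff_divide_distrib algebra_simps)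
  have sG: "smooth_fn (G i)" for i
    unfolding G_def by (rule smooth_fn_mult[OF smooth_fn_ridge1[OF smooth1_affine[OF P(1)]] smooth_fn_ridge1[OF smooth1_affine[OF P(1)]]])
  have Gnz: "\<bar>y $ i - x $ i\<bar> \<le> 2 * h" if "G i y \<noteq> 0" for i y
  proof -
    have "\<not> 3 - (y $ i - x $ i) / h \<le> 1" "\<not> 3 + (y $ i - x $ i) / h \<le> 1"
      using that P(2) unfolding G by (metis mult_zero_left mult_zero_right)+
    then have "(y $ i - x $ i) / h < 2" "- 2 < (y $ i - x $ i) / h" by linarith+
    then show ?thesis using h by (simp add: field_simps abs_le_iff)
  qed
  define \<zeta> where "\<zeta> = (\<lambda>y. \<Prod>i\<in>UNIV. G i y)"
  let ?C = "cbox (\<chi> i. x $ i - 2 * h) (\<chi> i. x $ i + 2 * h)"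
  have nz: "y \<in> ?C" if "\<zeta> y \<noteq> 0" for y
  proof -
    have "G i y \<noteq> 0" for i using that unfolding \<zeta>_def by (metis finite iso_tuple_UNIV_I prod_zero)
    then have "\<bar>y $ i - x $ i\<bar> \<le> 2 * h" for i using Gnz by blast
    then show ?thesis by (simp add: mem_box_cart abs_le_iff algebra_simps)
  qed
  have Cb: "?C \<subseteq> ball x \<rho>"
  proof
    fix y assume "y \<in> ?C"
    then have "\<bar>(x - y) $ i\<bar> \<le> 2 * h" for i by (simp add: mem_box_cart abs_le_iff algebra_simps)
    then have "(\<Sum>i\<in>UNIV. \<bar>(x - y) $ i\<bar>) \<le> (\<Sum>i\<in>(UNIV::3 set). 2 * h)" by (rule sum_mono)
    then have "norm (x - y) \<le> 6 * h" using norm_le_l1_cart[of "x - y"] by simp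
    then show "y \<in> ball x \<rho>" using \<rho> by (simp add: dist_norm h_def)
  qed
  show ?thesis
  proof (intro exI[of _ \<zeta>] exI[of _ h] conjI ballI)
    show "test \<zeta>" by (rule testI[OF _ compact_cbox nz]) (unfold \<zeta>_def, rule smooth_fn_prod[OF finite sG])
    show "tsupp \<zeta> \<subseteq> ball x \<rho>" using tsupp_subset[OF closed_cbox nz] Cb by blast
    show "\<zeta> y = 1" if y: "y \<in> ball x h" for y
    proof -
      have "G i y = 1" for i
      proof -
        have "\<bar>y $ i - x $ i\<bar> \<le> h" using component_le_norm_cart[of "y - x" i] y by (simp add: dist_norm norm_minus_commute)
        then have "(y $ i - x $ i) / h \<le> 1" "- 1 \<le> (y $ i - x $ i) / h" using h by (simp_all add: field_simps abs_le_iff)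
        then show ?thesis unfolding G by (simp add: P(3))
      qed
      then show ?thesis by (simp add: \<zeta>_def)
    qed
  qed (rule h)
qed

text \<open>The Leibniz rule with sup norms of \<open>\<zeta>\<close> and its gradient; by
  transposition it lets cutoffs act on H^-1.\<close>

lemma h1t_mult:
  assumes \<zeta>: "test \<zeta>" shows "\<exists>C\<ge>0. \<forall>\<phi>. test \<phi> \<longrightarrow> h1t (\<lambda>x. \<zeta> x * \<phi> x) \<le> C * h1t \<phi>"
proof -
  have b: "n2 (\<lambda>x. f x * g x) \<le> B * n2 g" if "test f" "test g" "\<And>x. \<bar>f x\<bar> \<le> B" "0 \<le> B" for f g B
  proof -
    have "l2sq (\<lambda>x. f x * g x) \<le> (\<integral>x. B\<^sup>2 * (g x)\<^sup>2 \<partial>lborel)"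
      unfolding l2sq_def
    proof (rule integral_mono)
      show "integrable lborel (\<lambda>x. (f x * g x)\<^sup>2)" by (rule L2_sq[OF test_L2[OF test_mult[OF test_smooth[OF that(1)] that(2)]]])
      show "integrable lborel (\<lambda>x. B\<^sup>2 * (g x)\<^sup>2)" using L2_sq[OF test_L2[OF that(2)]] by simp
      show "(f x * g x)\<^sup>2 \<le> B\<^sup>2 * (g x)\<^sup>2" for x
        using power_mono[OF that(3)[of x] abs_ge_zero, where n=2] by (simp add: power_mult_distrib mult_right_mono)
    qed
    also have "\<dots> = (B * n2 g)\<^sup>2" by (simp add: power_mult_distrib n2_sq l2sq_def)
    finally have "(n2 (\<lambda>x. f x * g x))\<^sup>2 \<le> (B * n2 g)\<^sup>2" by (simp only: n2_sq)
    then show ?thesis by (rule power2_le_imp_le) (simp add: that n2_nonneg)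
  qed
  obtain B where B: "B \<ge> 0" "\<And>x. \<bar>\<zeta> x\<bar> \<le> B" using test_bounded[OF \<zeta>] by blast
  have "\<forall>i. \<exists>B. B \<ge> 0 \<and> (\<forall>x. \<bar>pd i \<zeta> x\<bar> \<le> B)" using test_bounded[OF test_pd[OF \<zeta>]] by metis
  from choice[OF this] obtain E where E: "\<And>i. E i \<ge> 0" "\<And>i x. \<bar>pd i \<zeta> x\<bar> \<le> E i" by blast
  show ?thesis
  proof (intro exI[of _ "B + (\<Sum>i\<in>UNIV. E i + B)"] conjI allI impI)
    show "0 \<le> B + (\<Sum>i\<in>UNIV. E i + B)" by (simp add: B E sum_nonneg)
    fix \<phi> assume \<phi>: "test \<phi>"
    have p: "pd i (\<lambda>x. \<zeta> x * \<phi> x) = (\<lambda>x. pd i \<zeta> x * \<phi> x + \<zeta> x * pd i \<phi> x)" for i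
      by (rule pd_mult[OF test_smooth[OF \<zeta>] test_smooth[OF \<phi>]])
    have t: "test (\<lambda>x. pd i \<zeta> x * \<phi> x)" "test (\<lambda>x. \<zeta> x * pd i \<phi> x)" for i
      by (rule test_mult[OF test_smooth[OF test_pd[OF \<zeta>]] \<phi>], rule test_mult[OF test_smooth[OF \<zeta>] test_pd[OF \<phi>]])
    have "h1t (\<lambda>x. \<zeta> x * \<phi> x) \<le> B * h1t \<phi> + (\<Sum>i\<in>UNIV. E i * h1t \<phi> + B * h1t \<phi>)"
    proof (intro order_trans[OF h1t_le_sum] add_mono sum_mono)
      show "n2 (\<lambda>x. \<zeta> x * \<phi> x) \<le> B * h1t \<phi>"
        by (rule order_trans[OF b[OF \<zeta> \<phi> B(2,1)] mult_left_mono[OF n2_le_h1t B(1)]])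
      fix i
      have "n2 (pd i (\<lambda>x. \<zeta> x * \<phi> x)) \<le> n2 (\<lambda>x. pd i \<zeta> x * \<phi> x) + n2 (\<lambda>x. \<zeta> x * pd i \<phi> x)"
        unfolding p by (rule n2_triangle[OF test_L2[OF t(1)] test_L2[OF t(2)]])
      also have "\<dots> \<le> E i * h1t \<phi> + B * h1t \<phi>"
        by (intro add_mono order_trans[OF b[OF test_pd[OF \<zeta>] \<phi> E(2,1)] mult_left_mono[OF n2_le_h1t E(1)]]
             order_trans[OF b[OF \<zeta> test_pd[OF \<phi>] B(2,1)] mult_left_mono[OF n2_pd_le_h1t B(1)]])
      finally show "n2 (pd i (\<lambda>x. \<zeta> x * \<phi> x)) \<le> E i * h1t \<phi> + B * h1t \<phi>" .
    qed
    then show "h1t (\<lambda>x. \<zeta> x * \<phi> x) \<le> (B + (\<Sum>i\<in>UNIV. E i + B)) * h1t \<phi>"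
      by (simp only: distrib_right sum_distrib_right)
  qed
qed

text \<open>The infimum in \<open>hm1norm\<close> is attained: if \<open>h1t \<phi>\<close> is
  positive, divide by it; if it is 0, any admissible constant already gives
  \<open>u \<phi> = 0\<close>.\<close>

lemma Hm1_hm1norm:
  assumes u: "Hm1 u" shows "hm1_le u (hm1norm u)" "0 \<le> hm1norm u"
proof -
  let ?S = "{C. 0 \<le> C \<and> hm1_le u C}"
  have ne: "?S \<noteq> {}" using Hm1_bound[OF u] by blast
  show "0 \<le> hm1norm u" unfolding hm1norm_def by (rule cInf_greatest[OF ne]) simp
  show "hm1_le u (hm1norm u)" unfolding hm1_le_def
  proof (intro allI impI)
    fix \<phi> assume \<phi>: "test \<phi>"
    show "\<bar>u \<phi>\<bar> \<le> hm1norm u * h1t \<phi>"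
    proof (cases "h1t \<phi> = 0")
      case True
      obtain C where "hm1_le u C" using ne by blast
      then show ?thesis using hm1_leD[OF _ \<phi>] True by fastforce
    next
      case False
      then have p: "0 < h1t \<phi>" using h1t_nonneg[of \<phi>] by simp
      have "\<bar>u \<phi>\<bar> / h1t \<phi> \<le> hm1norm u" unfolding hm1norm_def
        by (rule cInf_greatest[OF ne]) (use hm1_leD[OF _ \<phi>] p in \<open>auto simp: divide_le_eq\<close>)
      then show ?thesis using p by (simp add: divide_le_eq)
    qed
  qed
qed

text \<open>Absolute values are taken because outside H^-1 the infimum may run over the empty set,
  and its sign is then unknown.\<close>

lemma dd_norm_ge:
  "\<bar>hm1norm (\<sigma> i j)\<bar> \<le> dd_norm \<sigma>" "\<bar>hm1norm (ddiv \<sigma> i)\<bar> \<le> dd_norm \<sigma>" "\<bar>hm1norm (ddivdiv \<sigma>)\<bar> \<le> dd_norm \<sigma>"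
proof -
  have 1: "(hm1norm (\<sigma> i j))\<^sup>2 \<le> (\<Sum>i\<in>UNIV. \<Sum>j\<in>UNIV. (hm1norm (\<sigma> i j))\<^sup>2)"
    by (rule order_trans[OF member_le_sum[of j UNIV] member_le_sum[of i UNIV]]) (auto intro: sum_nonneg)
  have 2: "(hm1norm (ddiv \<sigma> i))\<^sup>2 \<le> (\<Sum>i\<in>UNIV. (hm1norm (ddiv \<sigma> i))\<^sup>2)" by (rule member_le_sum) auto
  have p: "0 \<le> (\<Sum>i\<in>UNIV. \<Sum>j\<in>UNIV. (hm1norm (\<sigma> i j))\<^sup>2)" "0 \<le> (\<Sum>i\<in>UNIV. (hm1norm (ddiv \<sigma> i))\<^sup>2)" "0 \<le> (hm1norm (ddivdiv \<sigma>))\<^sup>2"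
    by (simp_all add: sum_nonneg)
  show "\<bar>hm1norm (\<sigma> i j)\<bar> \<le> dd_norm \<sigma>" unfolding dd_norm_def by (rule real_le_rsqrt) (use 1 p in \<open>unfold power2_abs, linarith\<close>)
  show "\<bar>hm1norm (ddiv \<sigma> i)\<bar> \<le> dd_norm \<sigma>" unfolding dd_norm_def by (rule real_le_rsqrt) (use 2 p in \<open>unfold power2_abs, linarith\<close>)
  show "\<bar>hm1norm (ddivdiv \<sigma>)\<bar> \<le> dd_norm \<sigma>" unfolding dd_norm_def by (rule real_le_rsqrt) (use p in \<open>unfold power2_abs, linarith\<close>)
qed

lemma dd_norm_nonneg: "0 \<le> dd_norm \<sigma>"
  using dd_norm_ge(3)[of \<sigma>] by linarith

lemma Hhat_bounds:
  assumes "Hhat_dd \<Omega> \<sigma>"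
  shows "hm1_le (\<sigma> i j) (dd_norm \<sigma>)" "hm1_le (ddiv \<sigma> i) (dd_norm \<sigma>)" "hm1_le (ddivdiv \<sigma>) (dd_norm \<sigma>)"
proof -
  have H: "Hm1 (\<sigma> i j)" "Hm1 (ddiv \<sigma> i)" "Hm1 (ddivdiv \<sigma>)" using assms by (auto simp: Hhat_dd_def Htm1_def)
  show "hm1_le (\<sigma> i j) (dd_norm \<sigma>)" by (rule hm1_le_mono[OF Hm1_hm1norm(1)[OF H(1)]]) (use dd_norm_ge(1)[of \<sigma> i j] in linarith)
  show "hm1_le (ddiv \<sigma> i) (dd_norm \<sigma>)" by (rule hm1_le_mono[OF Hm1_hm1norm(1)[OF H(2)]]) (use dd_norm_ge(2)[of \<sigma> i] in linarith)
  show "hm1_le (ddivdiv \<sigma>) (dd_norm \<sigma>)" by (rule hm1_le_mono[OF Hm1_hm1norm(1)[OF H(3)]]) (use dd_norm_ge(3)[of \<sigma>] in linarith)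
qed

section \<open>An identity for second derivatives of symmetric matrices\<close>

lemma levi_values:
  "levi 1 2 3 = 1" "levi 2 3 1 = 1" "levi 3 1 2 = 1" "levi 1 3 2 = -1" "levi 3 2 1 = -1" "levi 2 1 3 = -1"
  "levi i i j = 0" "levi i j i = 0" "levi j i i = 0"
  by (auto simp: levi_def)

text \<open>The entries \<open>W a b p q k l\<close> stand for \<open>G\<^sub>a\<^sub>b \<tau>\<^sub>p\<^sub>q\<close> tested with \<open>\<partial>\<^sub>k \<partial>\<^sub>l \<phi>\<close>. For \<open>G = v v\<^sup>T\<close>
  the identity is \<open>\<partial>\<^sub>v\<^sup>2 \<tau> = v v\<^sup>T div div \<tau> + 2 sym curl (v (div \<tau> \<times> v)\<^sup>T) + inc (v \<times> \<tau> \<times> v)\<close>,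
  obtained by expanding both double cross products.\<close>
lemma second_derivative_decomposition:
  fixes W :: "3 \<Rightarrow> 3 \<Rightarrow> 3 \<Rightarrow> 3 \<Rightarrow> 3 \<Rightarrow> 3 \<Rightarrow> real"
  assumes s: "\<And>a b p q k l. W a b p q k l = W b a p q k l" "\<And>a b p q k l. W a b p q k l = W a b q p k l"
    "\<And>a b p q k l. W a b p q k l = W a b p q l k"
  shows "(\<Sum>a\<in>UNIV. \<Sum>b\<in>UNIV. W a b i j a b) =
     (\<Sum>p\<in>UNIV. \<Sum>q\<in>UNIV. W i j p q p q) +
     ((\<Sum>k\<in>UNIV. \<Sum>l\<in>UNIV. levi j k l * (2 * (\<Sum>b\<in>UNIV. \<Sum>m\<in>UNIV. levi l m b * (\<Sum>n\<in>UNIV. W i b m n n k)))) +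
      (\<Sum>k\<in>UNIV. \<Sum>l\<in>UNIV. levi i k l * (2 * (\<Sum>b\<in>UNIV. \<Sum>m\<in>UNIV. levi l m b * (\<Sum>n\<in>UNIV. W j b m n n k))))) / 2 +
     (\<Sum>k\<in>UNIV. \<Sum>l\<in>UNIV. levi j k l * (\<Sum>m\<in>UNIV. \<Sum>n\<in>UNIV. levi i m n *
        (\<Sum>a\<in>UNIV. \<Sum>p\<in>UNIV. \<Sum>b\<in>UNIV. \<Sum>q\<in>UNIV. levi l a p * levi n b q * W a b p q m k)))"
proof -
  \<comment> \<open>Brings every index pair into increasing order, so that equal terms become
    literally equal in the nine cases for \<open>i\<close> and \<open>j\<close>.\<close>
  have o: "W 2 1 p q k l = W 1 2 p q k l" "W 3 1 p q k l = W 1 3 p q k l" "W 3 2 p q k l = W 2 3 p q k l"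
    "W a b 2 1 k l = W a b 1 2 k l" "W a b 3 1 k l = W a b 1 3 k l" "W a b 3 2 k l = W a b 2 3 k l"
    "W a b p q 2 1 = W a b p q 1 2" "W a b p q 3 1 = W a b p q 1 3" "W a b p q 3 2 = W a b p q 2 3" for a b p q k l
    by (rule s)+
  show ?thesis
    using exhaust_3[of i] exhaust_3[of j]
    by (elim disjE; hypsubst; simp only: sum_3 levi_values mult_zero_left mult_zero_right add_0_left add_0_right mult_1_left mult_minus1 mult_minus_left mult_minus_right o minus_minus)
       (simp_all add: field_simps)
qed

section \<open>Localization\<close>

definition localized :: "fn \<Rightarrow> (3 \<Rightarrow> 3 \<Rightarrow> distr) \<Rightarrow> 3 \<Rightarrow> 3 \<Rightarrow> distr" where
  "localized \<zeta> \<sigma> i j = (\<lambda>\<phi>. \<sigma> i j (\<lambda>x. \<zeta> x * \<phi> x))"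

text \<open>Bundles membership, support and norm bound so that estimates can be added and multiplied
  by cutoffs in one piece. Functionals that agree on test functions are interchangeable
  (\<open>Hm1_on_cong\<close>); the product rules below are stated on test functions.\<close>

definition Hm1_on :: "pt set \<Rightarrow> real \<Rightarrow> distr \<Rightarrow> bool" where
  "Hm1_on K c u \<longleftrightarrow> Hm1 u \<and> supp_in u K \<and> 0 \<le> c \<and> hm1_le u c"

lemma Hm1_on_cong:
  assumes "Hm1_on K c u" "\<And>\<phi>. test \<phi> \<Longrightarrow> v \<phi> = u \<phi>" shows "Hm1_on K c v"
proof -
  have "v (\<lambda>x. a * \<phi> x + b * \<psi> x) = a * v \<phi> + b * v \<psi>" if "test \<phi>" "test \<psi>" for a b \<phi> \<psi>
    using assms Hm1_lin[of u \<phi> \<psi> a b] that test_add[OF test_cmult[OF that(1)] test_cmult[OF that(2)], of a b] by (simp add: Hm1_on_def)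
  moreover have "hm1_le v c" using assms by (simp add: Hm1_on_def hm1_le_def)
  moreover have "supp_in v K" using assms by (simp add: Hm1_on_def supp_in_def)
  ultimately show ?thesis using assms(1) unfolding Hm1_on_def Hm1_def by blast
qed

lemma Hm1_on_add: assumes "Hm1_on K c u" "Hm1_on K c' v" shows "Hm1_on K (c + c') (\<lambda>\<phi>. u \<phi> + v \<phi>)"
proof -
  have le: "hm1_le (\<lambda>\<phi>. u \<phi> + v \<phi>) (c + c')"
    unfolding hm1_le_def
  proof (intro allI impI)
    fix \<phi> assume \<phi>: "test \<phi>"
    have "\<bar>u \<phi>\<bar> \<le> c * h1t \<phi>" "\<bar>v \<phi>\<bar> \<le> c' * h1t \<phi>" using assms hm1_leD[OF _ \<phi>] by (auto simp: Hm1_on_def)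
    then show "\<bar>u \<phi> + v \<phi>\<bar> \<le> (c + c') * h1t \<phi>" by (simp add: distrib_right)
  qed
  have "(\<lambda>\<phi>. u \<phi> + v \<phi>) (\<lambda>x. a * \<phi> x + b * \<psi> x) = a * (u \<phi> + v \<phi>) + b * (u \<psi> + v \<psi>)" if "test \<phi>" "test \<psi>" for a b \<phi> \<psi>
    using assms Hm1_lin[of u \<phi> \<psi> a b] Hm1_lin[of v \<phi> \<psi> a b] that by (simp add: Hm1_on_def algebra_simps)
  then have "Hm1 (\<lambda>\<phi>. u \<phi> + v \<phi>)" unfolding Hm1_def using le by blast
  then show ?thesis using assms le by (simp add: Hm1_on_def supp_in_def)
qed

lemma Hm1_on_zero: "Hm1_on K 0 (\<lambda>\<phi>. 0)"
  by (auto simp: Hm1_on_def Hm1_def supp_in_def hm1_le_def intro!: exI[of _ 0])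

lemma Hm1_on_mono: "Hm1_on K c u \<Longrightarrow> c \<le> c' \<Longrightarrow> Hm1_on K c' u"
  unfolding Hm1_on_def using hm1_le_mono by (meson order_trans)

lemma Hm1_on_sum: "finite A \<Longrightarrow> (\<And>a. a \<in> A \<Longrightarrow> Hm1_on K (c a) (u a)) \<Longrightarrow> Hm1_on K (\<Sum>a\<in>A. c a) (\<lambda>\<phi>. \<Sum>a\<in>A. u a \<phi>)"
proof (induction A rule: finite_induct)
  case (insert a A)
  then have "Hm1_on K (c a + (\<Sum>a\<in>A. c a)) (\<lambda>\<phi>. u a \<phi> + (\<Sum>a\<in>A. u a \<phi>))" by (intro Hm1_on_add) auto
  then show ?case using insert by simp
qed (simp add: Hm1_on_zero)

lemma Hm1_on_mult:
  assumes \<zeta>: "test \<zeta>"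
  shows "\<exists>C\<ge>0. \<forall>u F c. Hm1_on F c u \<longrightarrow> Hm1_on (F \<inter> tsupp \<zeta>) (C * c) (\<lambda>\<phi>. u (\<lambda>x. \<zeta> x * \<phi> x))"
proof -
  obtain C where C: "C \<ge> 0" "\<And>\<phi>. test \<phi> \<Longrightarrow> h1t (\<lambda>x. \<zeta> x * \<phi> x) \<le> C * h1t \<phi>" using h1t_mult[OF \<zeta>] by blast
  have t: "test (\<lambda>x. \<zeta> x * \<phi> x)" if "test \<phi>" for \<phi> by (rule test_mult[OF test_smooth[OF \<zeta>] that])
  have "Hm1_on (F \<inter> tsupp \<zeta>) (C * c) (\<lambda>\<phi>. u (\<lambda>x. \<zeta> x * \<phi> x))" if p: "Hm1_on F c u" for u F c
  proof -
    have le: "hm1_le (\<lambda>\<phi>. u (\<lambda>x. \<zeta> x * \<phi> x)) (C * c)"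
      unfolding hm1_le_def
    proof (intro allI impI)
      fix \<phi> assume \<phi>: "test \<phi>"
      have "\<bar>u (\<lambda>x. \<zeta> x * \<phi> x)\<bar> \<le> c * h1t (\<lambda>x. \<zeta> x * \<phi> x)" using p hm1_leD[OF _ t[OF \<phi>]] by (simp add: Hm1_on_def)
      also have "\<dots> \<le> c * (C * h1t \<phi>)" using p by (intro mult_left_mono C(2) \<phi>) (simp add: Hm1_on_def)
      finally show "\<bar>u (\<lambda>x. \<zeta> x * \<phi> x)\<bar> \<le> C * c * h1t \<phi>" by (simp add: mult_ac)
    qed
    have "u (\<lambda>x. \<zeta> x * (a * \<phi> x + b * \<psi> x)) = a * u (\<lambda>x. \<zeta> x * \<phi> x) + b * u (\<lambda>x. \<zeta> x * \<psi> x)" if "test \<phi>" "test \<psi>" for a b \<phi> \<psi>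
    proof -
      have "(\<lambda>x. \<zeta> x * (a * \<phi> x + b * \<psi> x)) = (\<lambda>x. a * (\<zeta> x * \<phi> x) + b * (\<zeta> x * \<psi> x))" by (simp add: algebra_simps)
      then show ?thesis using p Hm1_lin[OF _ t[OF that(1)] t[OF that(2)], of u a b] by (simp add: Hm1_on_def)
    qed
    then have H: "Hm1 (\<lambda>\<phi>. u (\<lambda>x. \<zeta> x * \<phi> x))" unfolding Hm1_def using le by blast
    have "supp_in (\<lambda>\<phi>. u (\<lambda>x. \<zeta> x * \<phi> x)) (F \<inter> tsupp \<zeta>)"
      unfolding supp_in_def
    proof (intro allI impI)
      fix \<phi> assume \<phi>: "test \<phi>" "tsupp \<phi> \<inter> (F \<inter> tsupp \<zeta>) = {}"
      have "tsupp (\<lambda>x. \<zeta> x * \<phi> x) \<subseteq> tsupp \<zeta> \<inter> tsupp \<phi>"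
      proof (rule tsupp_subset)
        show "closed (tsupp \<zeta> \<inter> tsupp \<phi>)" by (intro closed_Int closed_tsupp)
        show "x \<in> tsupp \<zeta> \<inter> tsupp \<phi>" if "\<zeta> x * \<phi> x \<noteq> 0" for x
          using that tsupp_nonzero[of \<zeta> x] tsupp_nonzero[of \<phi> x] by auto
      qed
      then have "tsupp (\<lambda>x. \<zeta> x * \<phi> x) \<inter> F = {}" using \<phi>(2) by blast
      then show "u (\<lambda>x. \<zeta> x * \<phi> x) = 0" using p t[OF \<phi>(1)] by (auto simp: Hm1_on_def supp_in_def)
    qed
    then show ?thesis using H le p C(1) by (simp add: Hm1_on_def)
  qed
  then show ?thesis using C(1) by blast
qed

lemma Hhat_Hm1_on:
  assumes "Hhat_dd \<Omega> \<sigma>"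
  shows "Hm1_on (closure \<Omega>) (dd_norm \<sigma>) (\<sigma> i j)" "Hm1_on (closure \<Omega>) (dd_norm \<sigma>) (ddiv \<sigma> i)" "Hm1_on (closure \<Omega>) (dd_norm \<sigma>) (ddivdiv \<sigma>)"
  using assms Hhat_bounds[OF assms] dd_norm_nonneg[of \<sigma>] by (auto simp: Hm1_on_def Hhat_dd_def Htm1_def)

lemma ddiv_localized:
  assumes \<sigma>: "Hhat_dd \<Omega> \<sigma>" and \<zeta>: "test \<zeta>" and \<phi>: "test \<phi>"
  shows "ddiv (localized \<zeta> \<sigma>) i \<phi> = ddiv \<sigma> i (\<lambda>x. \<zeta> x * \<phi> x) + (\<Sum>j\<in>UNIV. \<sigma> i j (\<lambda>x. pd j \<zeta> x * \<phi> x))"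
proof -
  have H: "Hm1 (\<sigma> i j)" for j using Hhat_Hm1_on(1)[OF \<sigma>] by (simp add: Hm1_on_def)
  have "\<sigma> i j (pd j (\<lambda>x. \<zeta> x * \<phi> x)) = \<sigma> i j (\<lambda>x. pd j \<zeta> x * \<phi> x) + \<sigma> i j (\<lambda>x. \<zeta> x * pd j \<phi> x)" for j
    unfolding pd_mult[OF test_smooth[OF \<zeta>] test_smooth[OF \<phi>]]
    by (rule Hm1_add[OF H test_mult[OF test_smooth[OF test_pd[OF \<zeta>]] \<phi>] test_mult[OF test_smooth[OF \<zeta>] test_pd[OF \<phi>]]])
  then show ?thesis by (simp add: ddiv_def dderiv_def localized_def sum.distrib sum_negf)
qed

text \<open>The product rule: \<open>\<zeta>\<close> times div div, plus twice the gradient of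
  \<open>\<zeta>\<close> against div, plus the Hessian of \<open>\<zeta>\<close> against
  \<open>\<sigma>\<close>. Symmetry of \<open>\<sigma>\<close> merges the two cross terms into ones
  that involve \<open>ddiv \<sigma>\<close>, never a single first derivative of an entry, which need
  not lie in H^-1.\<close>

lemma ddivdiv_localized:
  assumes \<sigma>: "Hhat_dd \<Omega> \<sigma>" and \<zeta>: "test \<zeta>" and \<phi>: "test \<phi>"
  shows "ddivdiv (localized \<zeta> \<sigma>) \<phi> = ddivdiv \<sigma> (\<lambda>x. \<zeta> x * \<phi> x)
    + ((\<Sum>j\<in>UNIV. ddiv \<sigma> j (\<lambda>x. pd j \<zeta> x * \<phi> x)) + (\<Sum>j\<in>UNIV. ddiv \<sigma> j (\<lambda>x. pd j \<zeta> x * \<phi> x)))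
    + (\<Sum>i\<in>UNIV. \<Sum>j\<in>UNIV. \<sigma> i j (\<lambda>x. pd i (pd j \<zeta>) x * \<phi> x))"
proof -
  have H: "Hm1 (\<sigma> i j)" "Hm1 (ddiv \<sigma> i)" for i j using Hhat_Hm1_on[OF \<sigma>] by (auto simp: Hm1_on_def)
  have t: "test (\<lambda>x. f x * g x)" if "test f" "test g" for f g by (rule test_mult[OF test_smooth[OF that(1)] that(2)])
  have p: "u (pd i (\<lambda>x. f x * \<phi> x)) = u (\<lambda>x. pd i f x * \<phi> x) + u (\<lambda>x. f x * pd i \<phi> x)" if "Hm1 u" "test f" for u f i
    unfolding pd_mult[OF test_smooth[OF that(2)] test_smooth[OF \<phi>]]
    by (rule Hm1_add[OF that(1) t[OF test_pd[OF that(2)] \<phi>] t[OF that(2) test_pd[OF \<phi>]]])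
  have sym: "\<sigma> i j \<psi> = \<sigma> j i \<psi>" if "test \<psi>" for i j \<psi> using \<sigma> that by (simp add: Hhat_dd_def)
  \<comment> \<open>\<open>A\<close> and \<open>B\<close> expand the two double divergences with one
    derivative on the test function; the mixed terms of \<open>A\<close> are exchanged for
    divergences through \<open>C\<close>, where symmetry enters.\<close>
  have A: "ddivdiv (localized \<zeta> \<sigma>) \<phi> = - (\<Sum>i\<in>UNIV. ddiv \<sigma> i (\<lambda>x. \<zeta> x * pd i \<phi> x)) - (\<Sum>i\<in>UNIV. \<Sum>j\<in>UNIV. \<sigma> i j (\<lambda>x. pd j \<zeta> x * pd i \<phi> x))"
    by (simp add: ddivdiv_def dderiv_def ddiv_localized[OF \<sigma> \<zeta> test_pd[OF \<phi>]] sum.distrib sum_negf)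
  have B: "ddivdiv \<sigma> (\<lambda>x. \<zeta> x * \<phi> x) = - (\<Sum>i\<in>UNIV. ddiv \<sigma> i (\<lambda>x. pd i \<zeta> x * \<phi> x)) - (\<Sum>i\<in>UNIV. ddiv \<sigma> i (\<lambda>x. \<zeta> x * pd i \<phi> x))"
    by (simp add: ddivdiv_def dderiv_def p[OF H(2) \<zeta>] sum.distrib sum_negf)
  have C: "ddiv \<sigma> j (\<lambda>x. pd j \<zeta> x * \<phi> x) = - (\<Sum>i\<in>UNIV. \<sigma> i j (\<lambda>x. pd i (pd j \<zeta>) x * \<phi> x)) - (\<Sum>i\<in>UNIV. \<sigma> i j (\<lambda>x. pd j \<zeta> x * pd i \<phi> x))" for j
  proof -
    have "ddiv \<sigma> j (\<lambda>x. pd j \<zeta> x * \<phi> x) = - (\<Sum>i\<in>UNIV. \<sigma> i j (pd i (\<lambda>x. pd j \<zeta> x * \<phi> x)))"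
      unfolding ddiv_def dderiv_def using sym[OF test_pd[OF t[OF test_pd[OF \<zeta>] \<phi>]]] by (simp add: sum_negf)
    then show ?thesis by (simp add: p[OF H(1) test_pd[OF \<zeta>]] sum.distrib)
  qed
  have "(\<Sum>j\<in>UNIV. ddiv \<sigma> j (\<lambda>x. pd j \<zeta> x * \<phi> x)) =
     - (\<Sum>i\<in>UNIV. \<Sum>j\<in>UNIV. \<sigma> i j (\<lambda>x. pd i (pd j \<zeta>) x * \<phi> x)) - (\<Sum>i\<in>UNIV. \<Sum>j\<in>UNIV. \<sigma> i j (\<lambda>x. pd j \<zeta> x * pd i \<phi> x))"
    unfolding C sum_subtractf sum_negf by (rule arg_cong2[where f="\<lambda>a b. - a - b"]; rule sum.swap)
  then show ?thesis using A B by linarith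
qed

lemma Hm1_on_supp_mono: "Hm1_on F c u \<Longrightarrow> F \<subseteq> K \<Longrightarrow> Hm1_on K c u"
  unfolding Hm1_on_def supp_in_def by blast

text \<open>Every term of the two product rules is an entry of \<open>\<sigma>\<close>, of
  \<open>ddiv \<sigma>\<close> or \<open>ddivdiv \<sigma>\<close> itself, times
  \<open>\<zeta>\<close> or one of its derivatives, hence in H^-1 with support in
  \<open>tsupp \<zeta>\<close>. The constant \<open>M\<close> adds up the norms of these
  multipliers.\<close>

lemma localized_Hm1_on:
  assumes \<zeta>: "test \<zeta>"
  shows "\<exists>M\<ge>0. \<forall>\<sigma>. Hhat_dd \<Omega> \<sigma> \<longrightarrow>
     (\<forall>i j. Hm1_on (closure \<Omega> \<inter> tsupp \<zeta>) (M * dd_norm \<sigma>) (localized \<zeta> \<sigma> i j)) \<and>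
     (\<forall>i. Hm1_on (closure \<Omega> \<inter> tsupp \<zeta>) (M * dd_norm \<sigma>) (ddiv (localized \<zeta> \<sigma>) i)) \<and>
     Hm1_on (closure \<Omega> \<inter> tsupp \<zeta>) (M * dd_norm \<sigma>) (ddivdiv (localized \<zeta> \<sigma>))"
proof -
  let ?K = "closure \<Omega> \<inter> tsupp \<zeta>"
  define mb where "mb f C \<longleftrightarrow> 0 \<le> C \<and> (\<forall>u c. Hm1_on (closure \<Omega>) c u \<longrightarrow> Hm1_on ?K (C * c) (\<lambda>\<phi>. u (\<lambda>x. f x * \<phi> x)))" for f C
  have ex: "\<exists>C. mb f C" if f: "test f" "tsupp f \<subseteq> tsupp \<zeta>" for f
  proof -
    obtain C where C: "C \<ge> 0" "\<And>u F c. Hm1_on F c u \<Longrightarrow> Hm1_on (F \<inter> tsupp f) (C * c) (\<lambda>\<phi>. u (\<lambda>x. f x * \<phi> x))"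
      using Hm1_on_mult[OF f(1)] by blast
    have "closure \<Omega> \<inter> tsupp f \<subseteq> ?K" using f(2) by blast
    then have "mb f C" unfolding mb_def using C(1) Hm1_on_supp_mono[OF C(2)] by blast
    then show ?thesis by blast
  qed
  obtain C0 where C0: "mb \<zeta> C0" using ex[OF \<zeta>] by blast
  have "\<forall>j. \<exists>C. mb (pd j \<zeta>) C" using ex[OF test_pd[OF \<zeta>] tsupp_pd] by blast
  from choice[OF this] obtain C1 where C1: "\<And>j. mb (pd j \<zeta>) (C1 j)" by blast
  have "\<forall>p. \<exists>C. mb (pd (fst p) (pd (snd p) \<zeta>)) C"
    using ex[OF test_pd[OF test_pd[OF \<zeta>]] subset_trans[OF tsupp_pd tsupp_pd]] by blast
  from choice[OF this] obtain C2' where C2': "\<And>p. mb (pd (fst p) (pd (snd p) \<zeta>)) (C2' p)" by blast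
  define C2 where "C2 i j = C2' (i, j)" for i j
  have C2: "mb (pd i (pd j \<zeta>)) (C2 i j)" for i j using C2'[of "(i, j)"] by (simp add: C2_def)
  have pos: "0 \<le> C0" "0 \<le> C1 j" "0 \<le> C2 i j" for i j using C0 C1 C2 by (auto simp: mb_def)
  define M where "M = C0 + ((\<Sum>j\<in>UNIV. C1 j) + (\<Sum>j\<in>UNIV. C1 j)) + (\<Sum>i\<in>UNIV. \<Sum>j\<in>UNIV. C2 i j)"
  have s: "0 \<le> (\<Sum>j\<in>UNIV. C1 j)" "0 \<le> (\<Sum>i\<in>UNIV. \<Sum>j\<in>UNIV. C2 i j)" by (simp_all add: sum_nonneg pos)
  have main: "(\<forall>i j. Hm1_on ?K (M * dd_norm \<sigma>) (localized \<zeta> \<sigma> i j)) \<and>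
     (\<forall>i. Hm1_on ?K (M * dd_norm \<sigma>) (ddiv (localized \<zeta> \<sigma>) i)) \<and> Hm1_on ?K (M * dd_norm \<sigma>) (ddivdiv (localized \<zeta> \<sigma>))"
    if \<sigma>: "Hhat_dd \<Omega> \<sigma>" for \<sigma>
  proof -
    let ?D = "dd_norm \<sigma>"
    note H = Hhat_Hm1_on[OF \<sigma>]
    have ap: "Hm1_on ?K (C * ?D) (\<lambda>\<phi>. u (\<lambda>x. f x * \<phi> x))" if "mb f C" "Hm1_on (closure \<Omega>) ?D u" for f C u
      using that by (simp add: mb_def)
    have D0: "0 \<le> ?D" by (rule dd_norm_nonneg)
    have le0: "C0 * ?D \<le> M * ?D" unfolding M_def using s by (intro mult_right_mono D0) linarith
    have le1: "C0 * ?D + (\<Sum>j\<in>UNIV. C1 j * ?D) \<le> M * ?D"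
    proof -
      have "(C0 + (\<Sum>j\<in>UNIV. C1 j)) * ?D \<le> M * ?D" unfolding M_def using s by (intro mult_right_mono D0) linarith
      then show ?thesis by (simp only: distrib_right sum_distrib_right)
    qed
    have "Hm1_on ?K (M * ?D) (localized \<zeta> \<sigma> i j)" for i j
      unfolding localized_def by (rule Hm1_on_mono[OF ap[OF C0 H(1)] le0])
    moreover have "Hm1_on ?K (M * ?D) (ddiv (localized \<zeta> \<sigma>) i)" for i
    proof -
      have "Hm1_on ?K (C0 * ?D + (\<Sum>j\<in>UNIV. C1 j * ?D)) (\<lambda>\<phi>. ddiv \<sigma> i (\<lambda>x. \<zeta> x * \<phi> x) + (\<Sum>j\<in>UNIV. \<sigma> i j (\<lambda>x. pd j \<zeta> x * \<phi> x)))"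
        by (rule Hm1_on_add[OF ap[OF C0 H(2)] Hm1_on_sum[OF finite ap[OF C1 H(1)]]])
      from Hm1_on_cong[OF Hm1_on_mono[OF this le1]] show ?thesis using ddiv_localized[OF \<sigma> \<zeta>] by blast
    qed
    moreover have "Hm1_on ?K (M * ?D) (ddivdiv (localized \<zeta> \<sigma>))"
    proof -
      let ?u = "\<lambda>\<phi>. ddivdiv \<sigma> (\<lambda>x. \<zeta> x * \<phi> x)
        + ((\<Sum>j\<in>UNIV. ddiv \<sigma> j (\<lambda>x. pd j \<zeta> x * \<phi> x)) + (\<Sum>j\<in>UNIV. ddiv \<sigma> j (\<lambda>x. pd j \<zeta> x * \<phi> x)))
        + (\<Sum>i\<in>UNIV. \<Sum>j\<in>UNIV. \<sigma> i j (\<lambda>x. pd i (pd j \<zeta>) x * \<phi> x))"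
      have "Hm1_on ?K (C0 * ?D + ((\<Sum>j\<in>UNIV. C1 j * ?D) + (\<Sum>j\<in>UNIV. C1 j * ?D)) + (\<Sum>i\<in>UNIV. \<Sum>j\<in>UNIV. C2 i j * ?D)) ?u"
        by (rule Hm1_on_add[OF Hm1_on_add[OF ap[OF C0 H(3)] Hm1_on_add[OF Hm1_on_sum[OF finite ap[OF C1 H(2)]] Hm1_on_sum[OF finite ap[OF C1 H(2)]]]]
             Hm1_on_sum[OF finite Hm1_on_sum[OF finite ap[OF C2 H(1)]]]])
      moreover have "C0 * ?D + ((\<Sum>j\<in>UNIV. C1 j * ?D) + (\<Sum>j\<in>UNIV. C1 j * ?D)) + (\<Sum>i\<in>UNIV. \<Sum>j\<in>UNIV. C2 i j * ?D) = M * ?D"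
        unfolding M_def by (simp only: distrib_right sum_distrib_right)
      ultimately have "Hm1_on ?K (M * ?D) ?u" by (simp only:)
      from Hm1_on_cong[OF this] show ?thesis using ddivdiv_localized[OF \<sigma> \<zeta>] by blast
    qed
    ultimately show ?thesis by blast
  qed
  have "0 \<le> M" unfolding M_def using s pos by linarith
  then show ?thesis using main by blast
qed

text \<open>Linearity is an identity of functionals, since it comes from explicit formulas; in
  \<open>bdd_H01_op\<close> it holds almost everywhere, because series intervene.\<close>

definition bdd_Hm1_op :: "pt set \<Rightarrow> pt set \<Rightarrow> ((3 \<Rightarrow> 3 \<Rightarrow> distr) \<Rightarrow> distr) \<Rightarrow> bool" where
  "bdd_Hm1_op \<Omega> K E \<longleftrightarrow> (\<exists>M\<ge>0. \<forall>\<sigma>. Hhat_dd \<Omega> \<sigma> \<longrightarrow> Hm1_on K (M * dd_norm \<sigma>) (E \<sigma>)) \<and>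
     (\<forall>\<sigma> \<tau> a b. E (mlin a \<sigma> b \<tau>) = (\<lambda>\<phi>. a * E \<sigma> \<phi> + b * E \<tau> \<phi>))"

lemma bdd_Hm1_op_Hm1_on: "bdd_Hm1_op \<Omega> K E \<Longrightarrow> Hhat_dd \<Omega> \<sigma> \<Longrightarrow> Hm1 (E \<sigma>) \<and> supp_in (E \<sigma>) K"
  unfolding bdd_Hm1_op_def Hm1_on_def by blast

lemma bdd_Hm1_op_localized:
  assumes "test \<zeta>"
  shows "bdd_Hm1_op \<Omega> (closure \<Omega> \<inter> tsupp \<zeta>) (\<lambda>\<sigma>. localized \<zeta> \<sigma> i j)" "bdd_Hm1_op \<Omega> (closure \<Omega> \<inter> tsupp \<zeta>) (\<lambda>\<sigma>. ddiv (localized \<zeta> \<sigma>) i)"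
    "bdd_Hm1_op \<Omega> (closure \<Omega> \<inter> tsupp \<zeta>) (\<lambda>\<sigma>. ddivdiv (localized \<zeta> \<sigma>))"
proof -
  have 1: "localized \<zeta> (mlin a \<sigma> b \<tau>) i j = (\<lambda>\<phi>. a * localized \<zeta> \<sigma> i j \<phi> + b * localized \<zeta> \<tau> i j \<phi>)" for a b \<sigma> \<tau> i j
    by (simp add: localized_def mlin_def)
  have 2: "ddiv (localized \<zeta> (mlin a \<sigma> b \<tau>)) i = (\<lambda>\<phi>. a * ddiv (localized \<zeta> \<sigma>) i \<phi> + b * ddiv (localized \<zeta> \<tau>) i \<phi>)" for a b \<sigma> \<tau> i
    by (simp add: ddiv_def dderiv_def 1 fun_eq_iff sum_distrib_left sum.distrib sum_subtractf sum_negf)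
  have 3: "ddivdiv (localized \<zeta> (mlin a \<sigma> b \<tau>)) = (\<lambda>\<phi>. a * ddivdiv (localized \<zeta> \<sigma>) \<phi> + b * ddivdiv (localized \<zeta> \<tau>) \<phi>)" for a b \<sigma> \<tau>
    by (simp add: ddivdiv_def dderiv_def 2 fun_eq_iff sum_distrib_left sum.distrib sum_subtractf sum_negf)
  obtain M where M: "M \<ge> 0" "\<forall>\<sigma>. Hhat_dd \<Omega> \<sigma> \<longrightarrow>
     (\<forall>i j. Hm1_on (closure \<Omega> \<inter> tsupp \<zeta>) (M * dd_norm \<sigma>) (localized \<zeta> \<sigma> i j)) \<and>
     (\<forall>i. Hm1_on (closure \<Omega> \<inter> tsupp \<zeta>) (M * dd_norm \<sigma>) (ddiv (localized \<zeta> \<sigma>) i)) \<and>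
     Hm1_on (closure \<Omega> \<inter> tsupp \<zeta>) (M * dd_norm \<sigma>) (ddivdiv (localized \<zeta> \<sigma>))" using localized_Hm1_on[OF assms] by blast
  show "bdd_Hm1_op \<Omega> (closure \<Omega> \<inter> tsupp \<zeta>) (\<lambda>\<sigma>. localized \<zeta> \<sigma> i j)" unfolding bdd_Hm1_op_def using 1 M by blast
  show "bdd_Hm1_op \<Omega> (closure \<Omega> \<inter> tsupp \<zeta>) (\<lambda>\<sigma>. ddiv (localized \<zeta> \<sigma>) i)" unfolding bdd_Hm1_op_def using 2 M by blast
  show "bdd_Hm1_op \<Omega> (closure \<Omega> \<inter> tsupp \<zeta>) (\<lambda>\<sigma>. ddivdiv (localized \<zeta> \<sigma>))" unfolding bdd_Hm1_op_def using 3 M by blast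
qed

definition bdd_H01_op :: "pt set \<Rightarrow> ((3 \<Rightarrow> 3 \<Rightarrow> distr) \<Rightarrow> fn) \<Rightarrow> bool" where
  "bdd_H01_op \<Omega> S \<longleftrightarrow> (\<forall>\<sigma>. Hhat_dd \<Omega> \<sigma> \<longrightarrow> H01 \<Omega> (S \<sigma>)) \<and>
     (\<forall>\<sigma> \<tau> a b. Hhat_dd \<Omega> \<sigma> \<longrightarrow> Hhat_dd \<Omega> \<tau> \<longrightarrow> (AE x in lborel. S (mlin a \<sigma> b \<tau>) x = a * S \<sigma> x + b * S \<tau> x)) \<and>
     (\<exists>C. \<forall>\<sigma>. Hhat_dd \<Omega> \<sigma> \<longrightarrow> h1norm (S \<sigma>) \<le> C * dd_norm \<sigma>)"

lemma bdd_H01_op_zero: "bdd_H01_op \<Omega> (\<lambda>\<sigma> x. 0)"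
  unfolding bdd_H01_op_def using H01_test_on[OF test_on_zero] h1norm_test[OF test_zero] h1t_zero
  by (auto intro!: exI[of _ 0])

lemma bdd_H01_op_lincomb:
  assumes S: "bdd_H01_op \<Omega> S" and T: "bdd_H01_op \<Omega> T" shows "bdd_H01_op \<Omega> (\<lambda>\<sigma> x. c * S \<sigma> x + e * T \<sigma> x)"
proof -
  obtain A where A: "\<And>\<sigma>. Hhat_dd \<Omega> \<sigma> \<Longrightarrow> h1norm (S \<sigma>) \<le> A * dd_norm \<sigma>" using S unfolding bdd_H01_op_def by blast
  obtain B where B: "\<And>\<sigma>. Hhat_dd \<Omega> \<sigma> \<Longrightarrow> h1norm (T \<sigma>) \<le> B * dd_norm \<sigma>" using T unfolding bdd_H01_op_def by blast
  have H: "H01 \<Omega> (S \<sigma>)" "H01 \<Omega> (T \<sigma>)" if "Hhat_dd \<Omega> \<sigma>" for \<sigma> using S T that unfolding bdd_H01_op_def by blast+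
  have h: "h1norm (\<lambda>x. c * S \<sigma> x + e * T \<sigma> x) \<le> (\<bar>c\<bar> * A + \<bar>e\<bar> * B) * dd_norm \<sigma>" if \<sigma>: "Hhat_dd \<Omega> \<sigma>" for \<sigma>
  proof -
    have "h1norm (\<lambda>x. c * S \<sigma> x + e * T \<sigma> x) \<le> \<bar>c\<bar> * h1norm (S \<sigma>) + \<bar>e\<bar> * h1norm (T \<sigma>)"
      using H[OF \<sigma>] by (intro H1_lincomb(2)) (auto simp: H01_def)
    also have "\<dots> \<le> \<bar>c\<bar> * (A * dd_norm \<sigma>) + \<bar>e\<bar> * (B * dd_norm \<sigma>)"
      by (intro add_mono mult_left_mono A B \<sigma>) auto
    finally show ?thesis by (simp add: algebra_simps)
  qed
  have l: "AE x in lborel. c * S (mlin a \<sigma> b \<tau>) x + e * T (mlin a \<sigma> b \<tau>) x = a * (c * S \<sigma> x + e * T \<sigma> x) + b * (c * S \<tau> x + e * T \<tau> x)"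
    if "Hhat_dd \<Omega> \<sigma>" "Hhat_dd \<Omega> \<tau>" for a b \<sigma> \<tau>
  proof -
    have "AE x in lborel. S (mlin a \<sigma> b \<tau>) x = a * S \<sigma> x + b * S \<tau> x" "AE x in lborel. T (mlin a \<sigma> b \<tau>) x = a * T \<sigma> x + b * T \<tau> x"
      using S T that unfolding bdd_H01_op_def by blast+
    then show ?thesis by eventually_elim (simp add: algebra_simps)
  qed
  have H': "H01 \<Omega> (\<lambda>x. c * S \<sigma> x + e * T \<sigma> x)" if "Hhat_dd \<Omega> \<sigma>" for \<sigma> by (rule H01_lincomb[OF H[OF that]])
  show ?thesis unfolding bdd_H01_op_def using H' l h by blast
qed

lemma bdd_H01_op_add: "bdd_H01_op \<Omega> S \<Longrightarrow> bdd_H01_op \<Omega> T \<Longrightarrow> bdd_H01_op \<Omega> (\<lambda>\<sigma> x. S \<sigma> x + T \<sigma> x)"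
  using bdd_H01_op_lincomb[of \<Omega> S T 1 1] by simp

lemma bdd_H01_op_cmult: "bdd_H01_op \<Omega> S \<Longrightarrow> bdd_H01_op \<Omega> (\<lambda>\<sigma> x. c * S \<sigma> x)"
  using bdd_H01_op_lincomb[of \<Omega> S S c 0] by simp

lemma bdd_H01_op_sum: "finite A \<Longrightarrow> (\<And>a. a \<in> A \<Longrightarrow> bdd_H01_op \<Omega> (S a)) \<Longrightarrow> bdd_H01_op \<Omega> (\<lambda>\<sigma> x. \<Sum>a\<in>A. S a \<sigma> x)"
proof (induction A rule: finite_induct)
  case (insert a A)
  then have "bdd_H01_op \<Omega> (\<lambda>\<sigma> x. S a \<sigma> x + (\<Sum>a\<in>A. S a \<sigma> x))" by (intro bdd_H01_op_add) auto
  then show ?case using insert by simp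
qed (simp add: bdd_H01_op_zero)

lemma cv_cong: "(\<And>\<phi>. test \<phi> \<Longrightarrow> u \<phi> = v \<phi>) \<Longrightarrow> test g \<Longrightarrow> cv u g = cv v g"
  by (simp add: cv_def fun_eq_iff test_refl)

context cone_kernel
begin

lemma T_cong: assumes "\<And>\<phi>. test \<phi> \<Longrightarrow> u \<phi> = v \<phi>" shows "T a u = T a v"
proof -
  have "cv u (dil k \<Theta>) = cv v (dil k \<Theta>)" for k by (rule cv_cong[OF assms test_dil[OF test_\<Theta>]])
  then show ?thesis by (simp add: T_def Tk_def)
qed

lemma R_cong: assumes "\<And>\<phi>. test \<phi> \<Longrightarrow> u \<phi> = v \<phi>" shows "R N u = R N v"
proof -
  have "cv u (dil N \<theta>) = cv v (dil N \<theta>)" by (rule cv_cong[OF assms test_dil[OF \<theta>(1)]])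
  then show ?thesis by (simp add: R_def)
qed

lemma T_bdd_H01_op: assumes E: "bdd_Hm1_op \<Omega> K E" shows "bdd_H01_op \<Omega> (\<lambda>\<sigma>. T a (E \<sigma>))"
proof -
  obtain A where A: "A \<ge> 0" "\<And>\<sigma>. Hhat_dd \<Omega> \<sigma> \<Longrightarrow> Hm1_on K (A * dd_norm \<sigma>) (E \<sigma>)" using E unfolding bdd_Hm1_op_def by blast
  obtain M where M: "\<And>a u c. Hm1 u \<Longrightarrow> supp_in u K \<Longrightarrow> 0 \<le> c \<Longrightarrow> hm1_le u c \<Longrightarrow> H01 \<Omega> (T a u) \<and> h1norm (T a u) \<le> M * c"
    using T_props by blast
  have "H01 \<Omega> (T a (E \<sigma>)) \<and> h1norm (T a (E \<sigma>)) \<le> (M * A) * dd_norm \<sigma>" if "Hhat_dd \<Omega> \<sigma>" for \<sigma>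
  proof -
    have p: "Hm1 (E \<sigma>)" "supp_in (E \<sigma>) K" "0 \<le> A * dd_norm \<sigma>" "hm1_le (E \<sigma>) (A * dd_norm \<sigma>)"
      using A(2)[OF that] by (auto simp: Hm1_on_def)
    show ?thesis using M[OF p, of a] by (simp add: mult.assoc)
  qed
  moreover have "AE x in lborel. T a (E (mlin p \<sigma> q \<tau>)) x = p * T a (E \<sigma>) x + q * T a (E \<tau>) x"
    if "Hhat_dd \<Omega> \<sigma>" "Hhat_dd \<Omega> \<tau>" for p q \<sigma> \<tau>
  proof -
    have e: "E (mlin p \<sigma> q \<tau>) = (\<lambda>\<phi>. p * E \<sigma> \<phi> + q * E \<tau> \<phi>)" using E unfolding bdd_Hm1_op_def by blast
    show ?thesis unfolding e using bdd_Hm1_op_Hm1_on[OF E that(1)] bdd_Hm1_op_Hm1_on[OF E that(2)] by (intro T_linear) auto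
  qed
  ultimately show ?thesis unfolding bdd_H01_op_def by blast
qed

lemma R_bdd_H01_op: assumes E: "bdd_Hm1_op \<Omega> K E" shows "bdd_H01_op \<Omega> (\<lambda>\<sigma>. R 0 (E \<sigma>))"
proof -
  obtain A where A: "A \<ge> 0" "\<And>\<sigma>. Hhat_dd \<Omega> \<sigma> \<Longrightarrow> Hm1_on K (A * dd_norm \<sigma>) (E \<sigma>)" using E unfolding bdd_Hm1_op_def by blast
  obtain M where M: "\<And>u c. Hm1 u \<Longrightarrow> supp_in u K \<Longrightarrow> 0 \<le> c \<Longrightarrow> hm1_le u c \<Longrightarrow> h1t (R 0 u) \<le> M * c"
    using R_bound by blast
  have t: "test (dil 0 \<theta>)" by (rule test_dil[OF \<theta>(1)])
  have "H01 \<Omega> (R 0 (E \<sigma>)) \<and> h1norm (R 0 (E \<sigma>)) \<le> (M * A) * dd_norm \<sigma>" if \<sigma>: "Hhat_dd \<Omega> \<sigma>" for \<sigma>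
  proof -
    have p: "Hm1 (E \<sigma>)" "supp_in (E \<sigma>) K" "0 \<le> A * dd_norm \<sigma>" "hm1_le (E \<sigma>) (A * dd_norm \<sigma>)"
      using A(2)[OF \<sigma>] by (auto simp: Hm1_on_def)
    have to: "test_on \<Omega> (R 0 (E \<sigma>))" by (rule R_test_on[OF p(1,2)])
    have "h1norm (R 0 (E \<sigma>)) \<le> M * (A * dd_norm \<sigma>)"
      unfolding h1norm_test[OF test_on_test[OF to]] by (rule M[OF p])
    then show ?thesis using H01_test_on[OF to] by (simp only: mult.assoc)
  qed
  moreover have "AE x in lborel. R 0 (E (mlin p \<sigma> q \<tau>)) x = p * R 0 (E \<sigma>) x + q * R 0 (E \<tau>) x"
    if "Hhat_dd \<Omega> \<sigma>" "Hhat_dd \<Omega> \<tau>" for p q \<sigma> \<tau>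
  proof -
    have e: "E (mlin p \<sigma> q \<tau>) = (\<lambda>\<phi>. p * E \<sigma> \<phi> + q * E \<tau> \<phi>)" using E unfolding bdd_Hm1_op_def by blast
    have v: "test (cv (E \<sigma>) (dil 0 \<theta>))" "test (cv (E \<tau>) (dil 0 \<theta>))"
      using bdd_Hm1_op_Hm1_on[OF E that(1)] bdd_Hm1_op_Hm1_on[OF E that(2)] test_cv(1)[OF _ _ K t] by blast+
    have "cv (E (mlin p \<sigma> q \<tau>)) (dil 0 \<theta>) = (\<lambda>x. p * cv (E \<sigma>) (dil 0 \<theta>) x + q * cv (E \<tau>) (dil 0 \<theta>) x)"
      unfolding e by (simp add: cv_def fun_eq_iff)
    then have "R 0 (E (mlin p \<sigma> q \<tau>)) = (\<lambda>x. p * R 0 (E \<sigma>) x + q * R 0 (E \<tau>) x)"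
      unfolding R_def by (simp only: conv_lincomb_left[OF v t])
    then show ?thesis by simp
  qed
  ultimately show ?thesis unfolding bdd_H01_op_def by blast
qed

end

lemma fdist_add: "L2 f \<Longrightarrow> L2 g \<Longrightarrow> test \<phi> \<Longrightarrow> fdist (\<lambda>x. f x + g x) \<phi> = fdist f \<phi> + fdist g \<phi>"
  by (simp add: fdist_def distrib_right L2_mult_integrable test_L2)

section \<open>Decompositions near a boundary point\<close>

definition decomp :: "(3 \<Rightarrow> 3 \<Rightarrow> fn) \<Rightarrow> (3 \<Rightarrow> 3 \<Rightarrow> fn) \<Rightarrow> (3 \<Rightarrow> 3 \<Rightarrow> fn) \<Rightarrow> 3 \<Rightarrow> 3 \<Rightarrow> distr" where
  "decomp F G H i j \<phi> = matdist F i j \<phi> + dsym (dcurl (matdist G)) i j \<phi> + dinc (matdist H) i j \<phi>"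

lemma dcurl_eq: "dcurl T i j \<phi> = (\<Sum>k\<in>UNIV. \<Sum>l\<in>UNIV. levi j k l * - T i l (pd k \<phi>))"
  by (simp add: dcurl_def dderiv_def)

lemma dinc_eq: "dinc g i j \<phi> = (\<Sum>k\<in>UNIV. \<Sum>l\<in>UNIV. levi j k l * (\<Sum>m\<in>UNIV. \<Sum>n\<in>UNIV. levi i m n * g l n (pd m (pd k \<phi>))))"
  by (simp add: dinc_def dcurl_eq dtrans_def sum_negf)

lemma decomp_add:
  assumes L: "\<And>i j. L2 (F i j)" "\<And>i j. L2 (F' i j)" "\<And>i j. L2 (G i j)" "\<And>i j. L2 (G' i j)" "\<And>i j. L2 (H i j)" "\<And>i j. L2 (H' i j)"
    and \<phi>: "test \<phi>"
  shows "decomp (\<lambda>i j x. F i j x + F' i j x) (\<lambda>i j x. G i j x + G' i j x) (\<lambda>i j x. H i j x + H' i j x) i j \<phi>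
    = decomp F G H i j \<phi> + decomp F' G' H' i j \<phi>"
proof -
  have a: "matdist (\<lambda>i j x. A i j x + B i j x) i j \<psi> = matdist A i j \<psi> + matdist B i j \<psi>"
    if "\<And>i j. L2 (A i j)" "\<And>i j. L2 (B i j)" "test \<psi>" for A B i j \<psi>
    unfolding matdist_def by (rule fdist_add[OF that])
  have g: "matdist (\<lambda>i j x. G i j x + G' i j x) i l (pd k \<phi>) = matdist G i l (pd k \<phi>) + matdist G' i l (pd k \<phi>)" for i l k
    by (rule a[OF L(3,4) test_pd[OF \<phi>]])
  have h: "matdist (\<lambda>i j x. H i j x + H' i j x) i l (pd m (pd k \<phi>)) = matdist H i l (pd m (pd k \<phi>)) + matdist H' i l (pd m (pd k \<phi>))" for i l k m
    by (rule a[OF L(5,6) test_pd[OF test_pd[OF \<phi>]]])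
  have 1: "dcurl (matdist (\<lambda>i j x. G i j x + G' i j x)) i j \<phi> = dcurl (matdist G) i j \<phi> + dcurl (matdist G') i j \<phi>" for i j
    unfolding dcurl_eq g by (simp add: algebra_simps sum.distrib sum_subtractf sum_negf)
  have 2: "dinc (matdist (\<lambda>i j x. H i j x + H' i j x)) i j \<phi> = dinc (matdist H) i j \<phi> + dinc (matdist H') i j \<phi>" for i j
    unfolding dinc_eq h by (simp add: distrib_left sum.distrib)
  show ?thesis unfolding decomp_def dsym_def 1 2 a[OF L(1,2) \<phi>] by (simp add: add_divide_distrib)
qed

text \<open>Componentwise closeness with one bound, which adds up more easily than the Euclidean
  \<open>dd_within\<close>; \<open>dd_within_near\<close> and \<open>near_dd_within\<close> compare
  the two.\<close>

definition near :: "(3 \<Rightarrow> 3 \<Rightarrow> distr) \<Rightarrow> (3 \<Rightarrow> 3 \<Rightarrow> fn) \<Rightarrow> real \<Rightarrow> bool" where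
  "near \<sigma> \<Phi> e \<longleftrightarrow> (\<forall>i j. hm1_le (\<lambda>\<phi>. \<sigma> i j \<phi> - matdist \<Phi> i j \<phi>) e) \<and>
     (\<forall>i. hm1_le (\<lambda>\<phi>. ddiv \<sigma> i \<phi> - ddiv (matdist \<Phi>) i \<phi>) e) \<and>
     hm1_le (\<lambda>\<phi>. ddivdiv \<sigma> \<phi> - ddivdiv (matdist \<Phi>) \<phi>) e"

lemma ddiv_eq: "ddiv \<sigma> i \<phi> = - (\<Sum>j\<in>UNIV. \<sigma> i j (pd j \<phi>))"
  by (simp add: ddiv_def dderiv_def sum_negf)

lemma ddivdiv_eq: "ddivdiv \<sigma> \<phi> = (\<Sum>i\<in>UNIV. \<Sum>j\<in>UNIV. \<sigma> i j (pd j (pd i \<phi>)))"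
  by (simp add: ddivdiv_def dderiv_def ddiv_eq)

lemma hm1_le_sum2:
  assumes "hm1_le u a" "hm1_le v b" "\<And>\<phi>. test \<phi> \<Longrightarrow> w \<phi> = u \<phi> + v \<phi>" shows "hm1_le w (a + b)"
  unfolding hm1_le_def
proof (intro allI impI)
  fix \<phi> assume \<phi>: "test \<phi>"
  show "\<bar>w \<phi>\<bar> \<le> (a + b) * h1t \<phi>"
    using hm1_leD[OF assms(1) \<phi>] hm1_leD[OF assms(2) \<phi>] assms(3)[OF \<phi>] by (simp add: distrib_right)
qed

lemma near_add:
  assumes "near \<sigma> \<Phi> a" "near \<tau> \<Psi> b" and \<rho>: "\<And>i j \<phi>. test \<phi> \<Longrightarrow> \<rho> i j \<phi> = \<sigma> i j \<phi> + \<tau> i j \<phi>"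
    and t: "\<And>i j. test (\<Phi> i j)" "\<And>i j. test (\<Psi> i j)"
  shows "near \<rho> (\<lambda>i j x. \<Phi> i j x + \<Psi> i j x) (a + b)"
proof -
  have m: "matdist (\<lambda>i j x. \<Phi> i j x + \<Psi> i j x) i j \<phi> = matdist \<Phi> i j \<phi> + matdist \<Psi> i j \<phi>" if "test \<phi>" for i j \<phi>
    unfolding matdist_def by (rule fdist_add[OF test_L2[OF t(1)] test_L2[OF t(2)] that])
  show ?thesis unfolding near_def
  proof (intro conjI allI)
    fix i j
    show "hm1_le (\<lambda>\<phi>. \<rho> i j \<phi> - matdist (\<lambda>i j x. \<Phi> i j x + \<Psi> i j x) i j \<phi>) (a + b)"
      by (rule hm1_le_sum2[of "\<lambda>\<phi>. \<sigma> i j \<phi> - matdist \<Phi> i j \<phi>" _ "\<lambda>\<phi>. \<tau> i j \<phi> - matdist \<Psi> i j \<phi>"])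
         (use assms(1,2) in \<open>simp_all add: near_def \<rho> m\<close>)
  next
    fix i
    show "hm1_le (\<lambda>\<phi>. ddiv \<rho> i \<phi> - ddiv (matdist (\<lambda>i j x. \<Phi> i j x + \<Psi> i j x)) i \<phi>) (a + b)"
      by (rule hm1_le_sum2[of "\<lambda>\<phi>. ddiv \<sigma> i \<phi> - ddiv (matdist \<Phi>) i \<phi>" _ "\<lambda>\<phi>. ddiv \<tau> i \<phi> - ddiv (matdist \<Psi>) i \<phi>"])
         (use assms(1,2) in \<open>simp_all add: near_def\<close>, simp add: ddiv_eq \<rho> m test_pd sum.distrib)
  next
    show "hm1_le (\<lambda>\<phi>. ddivdiv \<rho> \<phi> - ddivdiv (matdist (\<lambda>i j x. \<Phi> i j x + \<Psi> i j x)) \<phi>) (a + b)"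
      by (rule hm1_le_sum2[of "\<lambda>\<phi>. ddivdiv \<sigma> \<phi> - ddivdiv (matdist \<Phi>) \<phi>" _ "\<lambda>\<phi>. ddivdiv \<tau> \<phi> - ddivdiv (matdist \<Psi>) \<phi>"])
         (use assms(1,2) in \<open>simp_all add: near_def\<close>, simp add: ddivdiv_eq \<rho> m test_pd sum.distrib)
  qed
qed

text \<open>A property of the cutoff, quantified over all \<open>\<sigma>\<close>, so that
  decompositions belonging to several cutoffs can be added by finite induction. The algebraic
  constraints hold at every point.\<close>

definition decomposable :: "pt set \<Rightarrow> fn \<Rightarrow> bool" where
  "decomposable \<Omega> \<zeta> \<longleftrightarrow> (\<exists>S0 S1 S2. (\<forall>i j. bdd_H01_op \<Omega> (\<lambda>\<sigma>. S0 \<sigma> i j)) \<and> (\<forall>i j. bdd_H01_op \<Omega> (\<lambda>\<sigma>. S1 \<sigma> i j)) \<and> (\<forall>i j. bdd_H01_op \<Omega> (\<lambda>\<sigma>. S2 \<sigma> i j)) \<and>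
     (\<forall>\<sigma> x. Hhat_dd \<Omega> \<sigma> \<longrightarrow> is_sym (\<lambda>i j. S0 \<sigma> i j x) \<and> is_tracefree (\<lambda>i j. S1 \<sigma> i j x) \<and> is_sym (\<lambda>i j. S2 \<sigma> i j x)) \<and>
     (\<forall>\<sigma> i j \<phi>. Hhat_dd \<Omega> \<sigma> \<longrightarrow> test \<phi> \<longrightarrow> localized \<zeta> \<sigma> i j \<phi> = decomp (S0 \<sigma>) (S1 \<sigma>) (S2 \<sigma>) i j \<phi>))"

definition approximable :: "pt set \<Rightarrow> fn \<Rightarrow> bool" where
  "approximable \<Omega> \<zeta> \<longleftrightarrow> (\<forall>\<sigma> e. Hhat_dd \<Omega> \<sigma> \<longrightarrow> 0 < e \<longrightarrow> (\<exists>\<Phi>. test_sym_on \<Omega> \<Phi> \<and> near (localized \<zeta> \<sigma>) \<Phi> e))"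

lemma localized_add:
  assumes "Hhat_dd \<Omega> \<sigma>" "smooth_fn f" "smooth_fn g" "test \<phi>"
  shows "localized (\<lambda>x. f x + g x) \<sigma> i j \<phi> = localized f \<sigma> i j \<phi> + localized g \<sigma> i j \<phi>"
proof -
  have H: "Hm1 (\<sigma> i j)" using Hhat_Hm1_on(1)[OF assms(1)] by (simp add: Hm1_on_def)
  show ?thesis unfolding localized_def distrib_right
    by (rule Hm1_add[OF H test_mult[OF assms(2,4)] test_mult[OF assms(3,4)]])
qed

lemma bdd_H01_op_L2: "bdd_H01_op \<Omega> S \<Longrightarrow> Hhat_dd \<Omega> \<sigma> \<Longrightarrow> L2 (S \<sigma>)"
  unfolding bdd_H01_op_def H01_def using H1_L2 by blast

lemma decomposable_add:
  assumes f: "decomposable \<Omega> f" "smooth_fn f" and g: "decomposable \<Omega> g" "smooth_fn g"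
  shows "decomposable \<Omega> (\<lambda>x. f x + g x)"
proof -
  obtain S0 S1 S2 where S: "\<And>i j. bdd_H01_op \<Omega> (\<lambda>\<sigma>. S0 \<sigma> i j)" "\<And>i j. bdd_H01_op \<Omega> (\<lambda>\<sigma>. S1 \<sigma> i j)" "\<And>i j. bdd_H01_op \<Omega> (\<lambda>\<sigma>. S2 \<sigma> i j)"
     "\<And>\<sigma> x. Hhat_dd \<Omega> \<sigma> \<Longrightarrow> is_sym (\<lambda>i j. S0 \<sigma> i j x) \<and> is_tracefree (\<lambda>i j. S1 \<sigma> i j x) \<and> is_sym (\<lambda>i j. S2 \<sigma> i j x)"
     "\<And>\<sigma> i j \<phi>. Hhat_dd \<Omega> \<sigma> \<Longrightarrow> test \<phi> \<Longrightarrow> localized f \<sigma> i j \<phi> = decomp (S0 \<sigma>) (S1 \<sigma>) (S2 \<sigma>) i j \<phi>"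
    using f(1) unfolding decomposable_def by blast
  obtain U0 U1 U2 where U: "\<And>i j. bdd_H01_op \<Omega> (\<lambda>\<sigma>. U0 \<sigma> i j)" "\<And>i j. bdd_H01_op \<Omega> (\<lambda>\<sigma>. U1 \<sigma> i j)" "\<And>i j. bdd_H01_op \<Omega> (\<lambda>\<sigma>. U2 \<sigma> i j)"
     "\<And>\<sigma> x. Hhat_dd \<Omega> \<sigma> \<Longrightarrow> is_sym (\<lambda>i j. U0 \<sigma> i j x) \<and> is_tracefree (\<lambda>i j. U1 \<sigma> i j x) \<and> is_sym (\<lambda>i j. U2 \<sigma> i j x)"
     "\<And>\<sigma> i j \<phi>. Hhat_dd \<Omega> \<sigma> \<Longrightarrow> test \<phi> \<Longrightarrow> localized g \<sigma> i j \<phi> = decomp (U0 \<sigma>) (U1 \<sigma>) (U2 \<sigma>) i j \<phi>"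
    using g(1) unfolding decomposable_def by blast
  show ?thesis unfolding decomposable_def
  proof (rule exI[of _ "\<lambda>\<sigma> i j x. S0 \<sigma> i j x + U0 \<sigma> i j x"], rule exI[of _ "\<lambda>\<sigma> i j x. S1 \<sigma> i j x + U1 \<sigma> i j x"],
      rule exI[of _ "\<lambda>\<sigma> i j x. S2 \<sigma> i j x + U2 \<sigma> i j x"], intro conjI allI impI)
    fix i j
    show "bdd_H01_op \<Omega> (\<lambda>\<sigma> x. S0 \<sigma> i j x + U0 \<sigma> i j x)" by (rule bdd_H01_op_add[OF S(1) U(1)])
    show "bdd_H01_op \<Omega> (\<lambda>\<sigma> x. S1 \<sigma> i j x + U1 \<sigma> i j x)" by (rule bdd_H01_op_add[OF S(2) U(2)])
    show "bdd_H01_op \<Omega> (\<lambda>\<sigma> x. S2 \<sigma> i j x + U2 \<sigma> i j x)" by (rule bdd_H01_op_add[OF S(3) U(3)])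
  next
    fix \<sigma> x assume \<sigma>: "Hhat_dd \<Omega> \<sigma>"
    show "is_sym (\<lambda>i j. S0 \<sigma> i j x + U0 \<sigma> i j x)" "is_sym (\<lambda>i j. S2 \<sigma> i j x + U2 \<sigma> i j x)"
      using S(4)[OF \<sigma>, of x] U(4)[OF \<sigma>, of x] unfolding is_sym_def by metis+
    show "is_tracefree (\<lambda>i j. S1 \<sigma> i j x + U1 \<sigma> i j x)"
      using S(4)[OF \<sigma>, of x] U(4)[OF \<sigma>, of x] unfolding is_tracefree_def by (simp add: sum.distrib)
  next
    fix \<sigma> i j \<phi> assume \<sigma>: "Hhat_dd \<Omega> \<sigma>" and \<phi>: "test \<phi>"
    show "localized (\<lambda>x. f x + g x) \<sigma> i j \<phi> = decomp (\<lambda>i j x. S0 \<sigma> i j x + U0 \<sigma> i j x) (\<lambda>i j x. S1 \<sigma> i j x + U1 \<sigma> i j x) (\<lambda>i j x. S2 \<sigma> i j x + U2 \<sigma> i j x) i j \<phi>"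
      unfolding localized_add[OF \<sigma> f(2) g(2) \<phi>] S(5)[OF \<sigma> \<phi>] U(5)[OF \<sigma> \<phi>]
      by (rule decomp_add[symmetric]; (rule bdd_H01_op_L2[OF _ \<sigma>] | rule \<phi>); rule S U)
  qed
qed

lemma approximable_add:
  assumes f: "approximable \<Omega> f" "smooth_fn f" and g: "approximable \<Omega> g" "smooth_fn g"
  shows "approximable \<Omega> (\<lambda>x. f x + g x)"
  unfolding approximable_def
proof (intro allI impI)
  fix \<sigma> and e :: real assume \<sigma>: "Hhat_dd \<Omega> \<sigma>" and e: "0 < e"
  have e2: "0 < e/2" using e by simp
  obtain \<Phi> where \<Phi>: "test_sym_on \<Omega> \<Phi>" "near (localized f \<sigma>) \<Phi> (e/2)" using f(1) \<sigma> e2 unfolding approximable_def by blast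
  obtain \<Psi> where \<Psi>: "test_sym_on \<Omega> \<Psi>" "near (localized g \<sigma>) \<Psi> (e/2)" using g(1) \<sigma> e2 unfolding approximable_def by blast
  have t: "test_on \<Omega> (\<Phi> i j)" "test_on \<Omega> (\<Psi> i j)" "\<Phi> i j = \<Phi> j i" "\<Psi> i j = \<Psi> j i" for i j
    using \<Phi>(1) \<Psi>(1) unfolding test_sym_on_def by blast+
  have "near (localized (\<lambda>x. f x + g x) \<sigma>) (\<lambda>i j x. \<Phi> i j x + \<Psi> i j x) (e/2 + e/2)"
    by (rule near_add[OF \<Phi>(2) \<Psi>(2) localized_add[OF \<sigma> f(2) g(2)] test_on_test[OF t(1)] test_on_test[OF t(2)]])
  moreover have "test_sym_on \<Omega> (\<lambda>i j x. \<Phi> i j x + \<Psi> i j x)"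
    unfolding test_sym_on_def
  proof (intro allI conjI)
    fix i j
    show "test_on \<Omega> (\<lambda>x. \<Phi> i j x + \<Psi> i j x)" using test_on_lincomb[OF t(1,2), where a=1 and b=1, of i j i j] by simp
    show "(\<lambda>x. \<Phi> i j x + \<Psi> i j x) = (\<lambda>x. \<Phi> j i x + \<Psi> j i x)" using t(3)[of i j] t(4)[of i j] by simp
  qed
  ultimately show "\<exists>\<Phi>. test_sym_on \<Omega> \<Phi> \<and> near (localized (\<lambda>x. f x + g x) \<sigma>) \<Phi> e" by auto
qed

lemma decomposable_zero: "decomposable \<Omega> (\<lambda>x. 0)"
  unfolding decomposable_def
proof (rule exI[of _ "\<lambda>\<sigma> i j x. 0"], rule exI[of _ "\<lambda>\<sigma> i j x. 0"], rule exI[of _ "\<lambda>\<sigma> i j x. 0"], intro conjI allI impI)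
  show "bdd_H01_op \<Omega> (\<lambda>\<sigma> x. 0)" by (rule bdd_H01_op_zero)
  fix \<sigma> i j \<phi> assume \<sigma>: "Hhat_dd \<Omega> \<sigma>" and "test \<phi>"
  have "Hm1 (\<sigma> i j)" using Hhat_Hm1_on(1)[OF \<sigma>] by (simp add: Hm1_on_def)
  then have "localized (\<lambda>x. 0) \<sigma> i j \<phi> = 0" by (simp add: localized_def Hm1_zero)
  then show "localized (\<lambda>x. 0) \<sigma> i j \<phi> = decomp (\<lambda>i j x. 0) (\<lambda>i j x. 0) (\<lambda>i j x. 0) i j \<phi>"
    by (simp add: decomp_def dsym_def dcurl_eq dinc_eq matdist_def fdist_def)
qed (auto simp: is_sym_def is_tracefree_def bdd_H01_op_zero)

lemma approximable_zero: "approximable \<Omega> (\<lambda>x. 0)"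
  unfolding approximable_def
proof (intro allI impI)
  fix \<sigma> and e :: real assume \<sigma>: "Hhat_dd \<Omega> \<sigma>" and e: "0 < e"
  have "Hm1 (\<sigma> i j)" for i j using Hhat_Hm1_on(1)[OF \<sigma>] by (simp add: Hm1_on_def)
  then have "near (localized (\<lambda>x. 0) \<sigma>) (\<lambda>i j x. 0) e"
    using e by (simp add: near_def localized_def Hm1_zero ddiv_eq ddivdiv_eq matdist_def fdist_def hm1_le_def h1t_nonneg)
  moreover have "test_sym_on \<Omega> (\<lambda>i j x. 0)" by (simp add: test_sym_on_def test_on_zero)
  ultimately show "\<exists>\<Phi>. test_sym_on \<Omega> \<Phi> \<and> near (localized (\<lambda>x. 0) \<sigma>) \<Phi> e" by blast
qed

lemma dd_dd: assumes "test \<phi>" shows "dd v (dd v \<phi>) = (\<lambda>x. \<Sum>a\<in>UNIV. \<Sum>b\<in>UNIV. (v $ a * v $ b) * pd a (pd b \<phi>) x)"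
proof -
  have "pd a (dd v \<phi>) = (\<lambda>x. \<Sum>b\<in>UNIV. v $ b * pd a (pd b \<phi>) x)" for a
    unfolding dd_def pd_sum[OF finite test_smooth[OF test_cmult[OF test_pd[OF assms]]]]
    by (simp add: pd_cmult test_smooth test_pd assms)
  then show ?thesis unfolding dd_def[of v "dd v \<phi>"] by (simp add: sum_distrib_left mult.assoc)
qed

lemma sum4_swap:
  fixes f :: "'a \<Rightarrow> 'b \<Rightarrow> 'c \<Rightarrow> 'd \<Rightarrow> real"
  shows "(\<Sum>a\<in>A. \<Sum>p\<in>B. \<Sum>b\<in>C. \<Sum>q\<in>D. f a p b q) = (\<Sum>b\<in>C. \<Sum>q\<in>D. \<Sum>a\<in>A. \<Sum>p\<in>B. f a p b q)"
proof -
  have 1: "(\<Sum>p\<in>B. \<Sum>b\<in>C. \<Sum>q\<in>D. f a p b q) = (\<Sum>b\<in>C. \<Sum>q\<in>D. \<Sum>p\<in>B. f a p b q)" for a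
    by (rule trans[OF sum.swap sum.cong[OF refl sum.swap]])
  show ?thesis unfolding 1 by (rule trans[OF sum.swap sum.cong[OF refl sum.swap]])
qed

section \<open>Decomposition and approximation in one cone\<close>

context cone_kernel
begin

text \<open>The three potentials, each carried by the matrix product of \<open>d e\<close> with its
  transpose. The algebraic identity is linear in this matrix, so the sum over the directions is
  treated at once through its symmetry in \<open>i\<close> and \<open>j\<close>.\<close>

definition V :: "3 \<Rightarrow> 3 \<Rightarrow> distr \<Rightarrow> fn" where
  "V i j u = (\<lambda>x. \<Sum>e\<in>UNIV. (d e $ i * d e $ j) * T e u x)"

lemma V_sym: "V i j u = V j i u" by (simp add: V_def mult.commute)

lemma V_cong: "(\<And>\<phi>. test \<phi> \<Longrightarrow> u \<phi> = v \<phi>) \<Longrightarrow> V i j u = V i j v"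
  unfolding V_def by (simp only: T_cong[of u v])

lemma V_bdd_H01_op: "bdd_Hm1_op \<Omega> K E \<Longrightarrow> bdd_H01_op \<Omega> (\<lambda>\<sigma>. V i j (E \<sigma>))"
  unfolding V_def by (rule bdd_H01_op_sum[OF finite bdd_H01_op_cmult[OF T_bdd_H01_op]])

lemma T_sums: assumes "Hm1 u" "supp_in u K" "test \<phi>" shows "(\<lambda>k. u (Gk \<Theta> (\<eta> a) k \<phi>)) sums fdist (T a u) \<phi>"
proof -
  obtain c where "c \<ge> 0" "hm1_le u c" using Hm1_bound[OF assms(1)] .
  then show ?thesis using T_props assms by blast
qed

lemma T_L2: assumes "Hm1 u" "supp_in u K" shows "L2 (T a u)"
proof -
  obtain c where "c \<ge> 0" "hm1_le u c" using Hm1_bound[OF assms(1)] .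
  then have "H01 \<Omega> (T a u)" using T_props assms by blast
  then show ?thesis using H1_L2 by (simp add: H01_def)
qed

lemma V_L2: "Hm1 u \<Longrightarrow> supp_in u K \<Longrightarrow> L2 (V i j u)"
  unfolding V_def by (rule L2_sum[OF finite L2_cmult[OF T_L2]])

lemma fdist_V:
  assumes "Hm1 u" "supp_in u K" "test \<phi>"
  shows "fdist (V i j u) \<phi> = (\<Sum>e\<in>UNIV. (d e $ i * d e $ j) * fdist (T e u) \<phi>)"
proof -
  have "fdist (V i j u) \<phi> = (\<Sum>e\<in>UNIV. fdist (\<lambda>x. (d e $ i * d e $ j) * T e u x) \<phi>)"
    unfolding V_def by (rule fdist_sum[OF finite L2_cmult[OF T_L2[OF assms(1,2)]] assms(3)])
  also have "\<dots> = (\<Sum>e\<in>UNIV. (d e $ i * d e $ j) * fdist (T e u) \<phi>)" by (simp add: fdist_def mult.assoc)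
  finally show ?thesis .
qed

text \<open>\<open>T\<close> commutes with the divergence: scale by scale its transpose
  \<open>Gk\<close> commutes with \<open>pd\<close>, and both sides are sums of the same series.
  Hence the assumption on div yields a potential in H^1, where differentiating
  \<open>T a (\<tau> m n)\<close> would yield L2.\<close>

lemma fdist_V_ddiv:
  assumes \<tau>: "\<And>i j. Hm1 (\<tau> i j)" "\<And>i j. supp_in (\<tau> i j) K" and w: "Hm1 (ddiv \<tau> m)" "supp_in (ddiv \<tau> m) K" and \<phi>: "test \<phi>"
  shows "fdist (V i j (ddiv \<tau> m)) \<phi> = - (\<Sum>n\<in>UNIV. fdist (V i j (\<tau> m n)) (pd n \<phi>))"
proof -
  have "fdist (T a (ddiv \<tau> m)) \<phi> = - (\<Sum>n\<in>UNIV. fdist (T a (\<tau> m n)) (pd n \<phi>))" for a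
  proof (rule sums_unique2[OF T_sums[OF w \<phi>]])
    have "(\<lambda>k. - (\<Sum>n\<in>UNIV. \<tau> m n (Gk \<Theta> (\<eta> a) k (pd n \<phi>)))) sums - (\<Sum>n\<in>UNIV. fdist (T a (\<tau> m n)) (pd n \<phi>))"
      by (intro sums_minus sums_sum T_sums \<tau> test_pd \<phi>)
    then show "(\<lambda>k. ddiv \<tau> m (Gk \<Theta> (\<eta> a) k \<phi>)) sums - (\<Sum>n\<in>UNIV. fdist (T a (\<tau> m n)) (pd n \<phi>))"
      unfolding ddiv_eq pd_Gk[OF \<phi> test_\<Theta> \<eta>(1)] .
  qed
  then show ?thesis
    unfolding fdist_V[OF w \<phi>] fdist_V[OF \<tau> test_pd[OF \<phi>]]
    by (simp only: sum_distrib_left mult_minus_right sum_negf) (subst sum.swap, rule refl)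
qed

lemma fdist_V_ddivdiv:
  assumes \<tau>: "\<And>i j. Hm1 (\<tau> i j)" "\<And>i j. supp_in (\<tau> i j) K" and w: "Hm1 (ddivdiv \<tau>)" "supp_in (ddivdiv \<tau>) K" and \<phi>: "test \<phi>"
  shows "fdist (V i j (ddivdiv \<tau>)) \<phi> = (\<Sum>p\<in>UNIV. \<Sum>q\<in>UNIV. fdist (V i j (\<tau> p q)) (pd q (pd p \<phi>)))"
proof -
  have "fdist (T a (ddivdiv \<tau>)) \<phi> = (\<Sum>p\<in>UNIV. \<Sum>q\<in>UNIV. fdist (T a (\<tau> p q)) (pd q (pd p \<phi>)))" for a
  proof (rule sums_unique2[OF T_sums[OF w \<phi>]])
    have "(\<lambda>k. \<Sum>p\<in>UNIV. \<Sum>q\<in>UNIV. \<tau> p q (Gk \<Theta> (\<eta> a) k (pd q (pd p \<phi>)))) sums (\<Sum>p\<in>UNIV. \<Sum>q\<in>UNIV. fdist (T a (\<tau> p q)) (pd q (pd p \<phi>)))"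
      by (intro sums_sum T_sums \<tau> test_pd \<phi>)
    then show "(\<lambda>k. ddivdiv \<tau> (Gk \<Theta> (\<eta> a) k \<phi>)) sums (\<Sum>p\<in>UNIV. \<Sum>q\<in>UNIV. fdist (T a (\<tau> p q)) (pd q (pd p \<phi>)))"
      unfolding ddivdiv_eq pd_Gk[OF \<phi> test_\<Theta> \<eta>(1)] pd_Gk[OF test_pd[OF \<phi>] test_\<Theta> \<eta>(1)] .
  qed
  then have "fdist (V i j (ddivdiv \<tau>)) \<phi> = (\<Sum>e\<in>UNIV. \<Sum>p\<in>UNIV. \<Sum>q\<in>UNIV. (d e $ i * d e $ j) * fdist (T e (\<tau> p q)) (pd q (pd p \<phi>)))"
    unfolding fdist_V[OF w \<phi>] by (simp only: sum_distrib_left)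
  also have "\<dots> = (\<Sum>p\<in>UNIV. \<Sum>e\<in>UNIV. \<Sum>q\<in>UNIV. (d e $ i * d e $ j) * fdist (T e (\<tau> p q)) (pd q (pd p \<phi>)))" by (rule sum.swap)
  also have "\<dots> = (\<Sum>p\<in>UNIV. \<Sum>q\<in>UNIV. \<Sum>e\<in>UNIV. (d e $ i * d e $ j) * fdist (T e (\<tau> p q)) (pd q (pd p \<phi>)))" by (rule sum.cong[OF refl sum.swap])
  finally show ?thesis unfolding fdist_V[OF \<tau> test_pd[OF test_pd[OF \<phi>]]] .
qed

text \<open>In entries and summed over the directions, \<open>S0\<close>, \<open>S1\<close> and
  \<open>S2\<close> are the arguments of the three terms of the algebraic identity:
  \<open>levi\<close> with one \<open>V\<close> encodes the cross product of div with
  \<open>v\<close>, and the two factors \<open>levi\<close> in \<open>S2\<close> encode the double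
  cross product. \<open>S0\<close> also takes up the smooth part \<open>R 0\<close>.\<close>

definition S0 :: "(3 \<Rightarrow> 3 \<Rightarrow> distr) \<Rightarrow> 3 \<Rightarrow> 3 \<Rightarrow> fn" where
  "S0 \<tau> i j = (\<lambda>x. R 0 (\<tau> i j) x + V i j (ddivdiv \<tau>) x)"
definition S1 :: "(3 \<Rightarrow> 3 \<Rightarrow> distr) \<Rightarrow> 3 \<Rightarrow> 3 \<Rightarrow> fn" where
  "S1 \<tau> i j = (\<lambda>x. 2 * (\<Sum>b\<in>UNIV. \<Sum>m\<in>UNIV. levi j m b * V i b (ddiv \<tau> m) x))"
definition S2 :: "(3 \<Rightarrow> 3 \<Rightarrow> distr) \<Rightarrow> 3 \<Rightarrow> 3 \<Rightarrow> fn" where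
  "S2 \<tau> i j = (\<lambda>x. \<Sum>a\<in>UNIV. \<Sum>p\<in>UNIV. \<Sum>b\<in>UNIV. \<Sum>q\<in>UNIV. (levi i a p * levi j b q) * V a b (\<tau> p q) x)"

text \<open>The trace pairs \<open>V\<close>, symmetric in its indices, with an antisymmetric
  symbol: a cross product with \<open>v\<close> is orthogonal to \<open>v\<close>.\<close>

lemma S1_tracefree: "is_tracefree (\<lambda>i j. S1 \<tau> i j x)"
proof -
  have v: "V 2 1 u = V 1 2 u" "V 3 1 u = V 1 3 u" "V 3 2 u = V 2 3 u" for u by (rule V_sym)+
  show ?thesis unfolding is_tracefree_def S1_def sum_3 by (simp add: levi_values v)
qed

text \<open>Exchanging the pair \<open>a\<close>, \<open>p\<close> with \<open>b\<close>,
  \<open>q\<close> swaps the two factors \<open>levi\<close> and transposes both \<open>V\<close>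
  and \<open>\<tau>\<close>.\<close>

lemma S2_sym: assumes "\<And>i j \<phi>. test \<phi> \<Longrightarrow> \<tau> i j \<phi> = \<tau> j i \<phi>" shows "S2 \<tau> i j = S2 \<tau> j i"
proof
  fix x
  have v: "V a b (\<tau> p q) x = V b a (\<tau> q p) x" for a b p q
    using V_cong[of "\<tau> p q" "\<tau> q p" a b] assms V_sym[of a b] by metis
  let ?f = "\<lambda>i j a p b q. (levi i a p * levi j b q) * V a b (\<tau> p q) x"
  have "S2 \<tau> i j x = (\<Sum>b\<in>UNIV. \<Sum>q\<in>UNIV. \<Sum>a\<in>UNIV. \<Sum>p\<in>UNIV. ?f i j a p b q)"
    unfolding S2_def by (rule sum4_swap)
  also have "\<dots> = S2 \<tau> j i x"
    unfolding S2_def by (intro sum.cong refl) (simp add: v[symmetric] mult.commute)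
  finally show "S2 \<tau> i j x = S2 \<tau> j i x" .
qed

lemma S0_sym: assumes "\<And>i j \<phi>. test \<phi> \<Longrightarrow> \<tau> i j \<phi> = \<tau> j i \<phi>" shows "S0 \<tau> i j = S0 \<tau> j i"
proof -
  have "R 0 (\<tau> i j) = R 0 (\<tau> j i)" by (rule R_cong[OF assms])
  then show ?thesis by (simp add: S0_def V_sym[of i j])
qed

text \<open>Once everything is written with \<open>W\<close>, an array with the symmetries of
  \<open>V\<close>, \<open>\<tau>\<close> and second derivatives, the left side is
  \<open>potential_identity\<close> and the rest is the finite identity
  \<open>second_derivative_decomposition\<close>.\<close>

lemma cone_decomposition:
  assumes sym: "\<And>i j \<phi>. test \<phi> \<Longrightarrow> \<tau> i j \<phi> = \<tau> j i \<phi>"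
    and \<tau>: "\<And>i j. Hm1 (\<tau> i j)" "\<And>i j. supp_in (\<tau> i j) K"
    and dv: "\<And>m. Hm1 (ddiv \<tau> m)" "\<And>m. supp_in (ddiv \<tau> m) K"
    and dvv: "Hm1 (ddivdiv \<tau>)" "supp_in (ddivdiv \<tau>) K" and \<phi>: "test \<phi>"
  shows "\<tau> i j \<phi> = decomp (S0 \<tau>) (S1 \<tau>) (S2 \<tau>) i j \<phi>"
proof -
  define W where "W a b p q k l = fdist (V a b (\<tau> p q)) (pd k (pd l \<phi>))" for a b p q k l
  have W1: "W a b p q k l = W b a p q k l" for a b p q k l unfolding W_def V_sym[of a b] ..
  have W2: "W a b p q k l = W a b q p k l" for a b p q k l
  proof -
    have "V a b (\<tau> p q) = V a b (\<tau> q p)" by (rule V_cong[OF sym])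
    then show ?thesis by (simp add: W_def)
  qed
  have W3: "W a b p q k l = W a b p q l k" for a b p q k l unfolding W_def pd_commute[OF test_smooth[OF \<phi>], of k l] ..
  have RL: "L2 (R 0 (\<tau> i j))" for i j by (rule test_L2[OF test_on_test[OF R_test_on[OF \<tau>]]])
  have "(\<Sum>e\<in>UNIV. fdist (T e (\<tau> i j)) (dd (d e) (dd (d e) \<phi>))) = (\<Sum>a\<in>UNIV. \<Sum>b\<in>UNIV. W a b i j a b)"
  proof -
    have "fdist (T e (\<tau> i j)) (dd (d e) (dd (d e) \<phi>)) = (\<Sum>a\<in>UNIV. \<Sum>b\<in>UNIV. (d e $ a * d e $ b) * fdist (T e (\<tau> i j)) (pd a (pd b \<phi>)))" for e
    proof -
      have H: "Hm1 (fdist (T e (\<tau> i j)))" by (rule Hm1_fdist[OF T_L2[OF \<tau>]])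
      have t: "test (\<lambda>x. (d e $ a * d e $ b) * pd a (pd b \<phi>) x)" for a b by (rule test_cmult[OF test_pd[OF test_pd[OF \<phi>]]])
      show ?thesis unfolding dd_dd[OF \<phi>] Hm1_sum[OF finite H test_sum[OF finite t]] Hm1_sum[OF finite H t]
        Hm1_cmult[OF H test_pd[OF test_pd[OF \<phi>]]] ..
    qed
    then have "(\<Sum>e\<in>UNIV. fdist (T e (\<tau> i j)) (dd (d e) (dd (d e) \<phi>))) =
       (\<Sum>e\<in>UNIV. \<Sum>a\<in>UNIV. \<Sum>b\<in>UNIV. (d e $ a * d e $ b) * fdist (T e (\<tau> i j)) (pd a (pd b \<phi>)))" by simp
    also have "\<dots> = (\<Sum>a\<in>UNIV. \<Sum>e\<in>UNIV. \<Sum>b\<in>UNIV. (d e $ a * d e $ b) * fdist (T e (\<tau> i j)) (pd a (pd b \<phi>)))" by (rule sum.swap)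
    also have "\<dots> = (\<Sum>a\<in>UNIV. \<Sum>b\<in>UNIV. \<Sum>e\<in>UNIV. (d e $ a * d e $ b) * fdist (T e (\<tau> i j)) (pd a (pd b \<phi>)))" by (rule sum.cong[OF refl sum.swap])
    finally show ?thesis unfolding W_def fdist_V[OF \<tau> test_pd[OF test_pd[OF \<phi>]]] .
  qed
  then have lhs: "\<tau> i j \<phi> = fdist (R 0 (\<tau> i j)) \<phi> + (\<Sum>a\<in>UNIV. \<Sum>b\<in>UNIV. W a b i j a b)"
    using potential_identity[OF \<tau> \<phi>, of i j] by simp
  have m0: "matdist (S0 \<tau>) i j \<phi> = fdist (R 0 (\<tau> i j)) \<phi> + (\<Sum>p\<in>UNIV. \<Sum>q\<in>UNIV. W i j p q p q)"
  proof -
    have "matdist (S0 \<tau>) i j \<phi> = fdist (R 0 (\<tau> i j)) \<phi> + fdist (V i j (ddivdiv \<tau>)) \<phi>"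
      unfolding matdist_def S0_def by (rule fdist_add[OF RL V_L2[OF dvv] \<phi>])
    also have "fdist (V i j (ddivdiv \<tau>)) \<phi> = (\<Sum>p\<in>UNIV. \<Sum>q\<in>UNIV. W i j p q q p)"
      unfolding W_def by (rule fdist_V_ddivdiv[OF \<tau> dvv \<phi>])
    finally show ?thesis by (simp only: W3)
  qed
  have c1: "dcurl (matdist (S1 \<tau>)) i j \<phi> = (\<Sum>k\<in>UNIV. \<Sum>l\<in>UNIV. levi j k l * (2 * (\<Sum>b\<in>UNIV. \<Sum>m\<in>UNIV. levi l m b * (\<Sum>n\<in>UNIV. W i b m n n k))))" for i j
  proof -
    \<comment> \<open>The minus sign of the outer derivative cancels the one in
      \<open>fdist_V_ddiv\<close>.\<close>
    have "- matdist (S1 \<tau>) i l (pd k \<phi>) = 2 * (\<Sum>b\<in>UNIV. \<Sum>m\<in>UNIV. levi l m b * (\<Sum>n\<in>UNIV. W i b m n n k))" for l k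
    proof -
      have int: "integrable lborel (\<lambda>x. V i b (ddiv \<tau> m) x * pd k \<phi> x)" for b m
        by (rule L2_mult_integrable[OF V_L2[OF dv] test_L2[OF test_pd[OF \<phi>]]])
      have "matdist (S1 \<tau>) i l (pd k \<phi>) = (\<integral>x. 2 * (\<Sum>b\<in>UNIV. \<Sum>m\<in>UNIV. levi l m b * (V i b (ddiv \<tau> m) x * pd k \<phi> x)) \<partial>lborel)"
        by (simp add: matdist_def fdist_def S1_def sum_distrib_right mult.assoc)
      also have "\<dots> = 2 * (\<Sum>b\<in>UNIV. \<Sum>m\<in>UNIV. levi l m b * fdist (V i b (ddiv \<tau> m)) (pd k \<phi>))"
        using int by (simp add: fdist_def)
      finally show ?thesis unfolding fdist_V_ddiv[OF \<tau> dv test_pd[OF \<phi>]] W_def by (simp add: sum_negf)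
    qed
    then show ?thesis unfolding dcurl_eq by simp
  qed
  have c2: "dinc (matdist (S2 \<tau>)) i j \<phi> = (\<Sum>k\<in>UNIV. \<Sum>l\<in>UNIV. levi j k l * (\<Sum>m\<in>UNIV. \<Sum>n\<in>UNIV. levi i m n *
        (\<Sum>a\<in>UNIV. \<Sum>p\<in>UNIV. \<Sum>b\<in>UNIV. \<Sum>q\<in>UNIV. levi l a p * levi n b q * W a b p q m k)))"
  proof -
    have "matdist (S2 \<tau>) l n (pd m (pd k \<phi>)) = (\<Sum>a\<in>UNIV. \<Sum>p\<in>UNIV. \<Sum>b\<in>UNIV. \<Sum>q\<in>UNIV. levi l a p * levi n b q * W a b p q m k)" for l n m k
    proof -
      have int: "integrable lborel (\<lambda>x. V a b (\<tau> p q) x * pd m (pd k \<phi>) x)" for a b p q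
        by (rule L2_mult_integrable[OF V_L2[OF \<tau>] test_L2[OF test_pd[OF test_pd[OF \<phi>]]]])
      have "matdist (S2 \<tau>) l n (pd m (pd k \<phi>)) = (\<integral>x. (\<Sum>a\<in>UNIV. \<Sum>p\<in>UNIV. \<Sum>b\<in>UNIV. \<Sum>q\<in>UNIV. (levi l a p * levi n b q) * (V a b (\<tau> p q) x * pd m (pd k \<phi>) x)) \<partial>lborel)"
        by (simp add: matdist_def fdist_def S2_def sum_distrib_right mult.assoc)
      also have "\<dots> = (\<Sum>a\<in>UNIV. \<Sum>p\<in>UNIV. \<Sum>b\<in>UNIV. \<Sum>q\<in>UNIV. (levi l a p * levi n b q) * fdist (V a b (\<tau> p q)) (pd m (pd k \<phi>)))"
        using int by (simp add: fdist_def)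
      finally show ?thesis unfolding W_def .
    qed
    then show ?thesis unfolding dinc_eq by simp
  qed
  show ?thesis
    unfolding lhs decomp_def dsym_def m0 c1 c2 using second_derivative_decomposition[of W i j, OF W1 W2 W3] by linarith
qed

text \<open>Since \<open>Jn\<close> commutes with \<open>pd\<close>, mollifying the entries also
  mollifies \<open>ddiv\<close> and \<open>ddivdiv\<close>. \<open>R_approx\<close> applies to each
  of the finitely many components, and a common \<open>N\<close> exists.\<close>

lemma cone_near:
  assumes \<tau>: "\<And>i j. Hm1 (\<tau> i j)" "\<And>i j. supp_in (\<tau> i j) K"
    and dv: "\<And>m. Hm1 (ddiv \<tau> m)" "\<And>m. supp_in (ddiv \<tau> m) K"
    and dvv: "Hm1 (ddivdiv \<tau>)" "supp_in (ddivdiv \<tau>) K" and e: "0 < e"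
  shows "\<exists>N. near \<tau> (\<lambda>i j. R N (\<tau> i j)) e"
proof -
  have ev: "\<forall>\<^sub>F N in sequentially. hm1_le (\<lambda>\<phi>. u \<phi> - fdist (R N u) \<phi>) e" if "Hm1 u" "supp_in u K" for u
    unfolding eventually_sequentially by (rule R_approx[OF that e])
  have "\<forall>\<^sub>F N in sequentially. (\<forall>i j. hm1_le (\<lambda>\<phi>. \<tau> i j \<phi> - fdist (R N (\<tau> i j)) \<phi>) e) \<and>
    (\<forall>i. hm1_le (\<lambda>\<phi>. ddiv \<tau> i \<phi> - fdist (R N (ddiv \<tau> i)) \<phi>) e) \<and> hm1_le (\<lambda>\<phi>. ddivdiv \<tau> \<phi> - fdist (R N (ddivdiv \<tau>)) \<phi>) e"
    by (intro eventually_conj eventually_all_finite ev \<tau> dv dvv)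
  then obtain N where N: "\<And>i j. hm1_le (\<lambda>\<phi>. \<tau> i j \<phi> - fdist (R N (\<tau> i j)) \<phi>) e"
    "\<And>i. hm1_le (\<lambda>\<phi>. ddiv \<tau> i \<phi> - fdist (R N (ddiv \<tau> i)) \<phi>) e" "hm1_le (\<lambda>\<phi>. ddivdiv \<tau> \<phi> - fdist (R N (ddivdiv \<tau>)) \<phi>) e"
    unfolding eventually_sequentially by blast
  let ?\<Phi> = "\<lambda>i j. R N (\<tau> i j)"
  have m: "matdist ?\<Phi> i j \<phi> = \<tau> i j (Jn \<theta> N \<phi>)" if "test \<phi>" for i j \<phi>
    unfolding matdist_def by (rule fdist_R[OF \<tau> that])
  have d1: "ddiv (matdist ?\<Phi>) i \<phi> = fdist (R N (ddiv \<tau> i)) \<phi>" if \<phi>: "test \<phi>" for i \<phi>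
    unfolding fdist_R[OF dv \<phi>] ddiv_eq m[OF test_pd[OF \<phi>]] pd_Jn[OF \<phi> \<theta>(1)] ..
  have d2: "ddivdiv (matdist ?\<Phi>) \<phi> = fdist (R N (ddivdiv \<tau>)) \<phi>" if \<phi>: "test \<phi>" for \<phi>
    unfolding fdist_R[OF dvv \<phi>] ddivdiv_eq m[OF test_pd[OF test_pd[OF \<phi>]]] pd_Jn[OF \<phi> \<theta>(1)] pd_Jn[OF test_pd[OF \<phi>] \<theta>(1)] ..
  have "near \<tau> ?\<Phi> e"
    using N unfolding near_def hm1_le_def by (simp add: d1 d2) (simp add: matdist_def)
  then show ?thesis by blast
qed

lemma cone_cutoff:
  assumes \<zeta>: "test \<zeta>" and KK: "K = closure \<Omega> \<inter> tsupp \<zeta>"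
  shows "decomposable \<Omega> \<zeta>" "approximable \<Omega> \<zeta>"
proof -
  note A = bdd_Hm1_op_localized[OF \<zeta>, of \<Omega>, folded KK]
  have sym: "localized \<zeta> \<sigma> i j \<phi> = localized \<zeta> \<sigma> j i \<phi>" if "Hhat_dd \<Omega> \<sigma>" "test \<phi>" for \<sigma> i j \<phi>
    using that test_mult[OF test_smooth[OF \<zeta>] that(2)] by (simp add: localized_def Hhat_dd_def)
  have P: "\<And>i j. Hm1 (localized \<zeta> \<sigma> i j)" "\<And>i j. supp_in (localized \<zeta> \<sigma> i j) K" "\<And>m. Hm1 (ddiv (localized \<zeta> \<sigma>) m)" "\<And>m. supp_in (ddiv (localized \<zeta> \<sigma>) m) K"
    "Hm1 (ddivdiv (localized \<zeta> \<sigma>))" "supp_in (ddivdiv (localized \<zeta> \<sigma>)) K" if "Hhat_dd \<Omega> \<sigma>" for \<sigma>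
    using bdd_Hm1_op_Hm1_on[OF A(1) that] bdd_Hm1_op_Hm1_on[OF A(2) that] bdd_Hm1_op_Hm1_on[OF A(3) that] by blast+
  show "decomposable \<Omega> \<zeta>" unfolding decomposable_def
  proof (rule exI[of _ "\<lambda>\<sigma>. S0 (localized \<zeta> \<sigma>)"], rule exI[of _ "\<lambda>\<sigma>. S1 (localized \<zeta> \<sigma>)"], rule exI[of _ "\<lambda>\<sigma>. S2 (localized \<zeta> \<sigma>)"], intro conjI allI impI)
    fix i j
    show "bdd_H01_op \<Omega> (\<lambda>\<sigma>. S0 (localized \<zeta> \<sigma>) i j)" unfolding S0_def by (rule bdd_H01_op_add[OF R_bdd_H01_op[OF A(1)] V_bdd_H01_op[OF A(3)]])
    show "bdd_H01_op \<Omega> (\<lambda>\<sigma>. S1 (localized \<zeta> \<sigma>) i j)" unfolding S1_def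
      by (rule bdd_H01_op_cmult[OF bdd_H01_op_sum[OF finite bdd_H01_op_sum[OF finite bdd_H01_op_cmult[OF V_bdd_H01_op[OF A(2)]]]]])
    show "bdd_H01_op \<Omega> (\<lambda>\<sigma>. S2 (localized \<zeta> \<sigma>) i j)" unfolding S2_def
      by (rule bdd_H01_op_sum[OF finite bdd_H01_op_sum[OF finite bdd_H01_op_sum[OF finite bdd_H01_op_sum[OF finite bdd_H01_op_cmult[OF V_bdd_H01_op[OF A(1)]]]]]])
  next
    fix \<sigma> x assume \<sigma>: "Hhat_dd \<Omega> \<sigma>"
    show "is_sym (\<lambda>i j. S0 (localized \<zeta> \<sigma>) i j x)" unfolding is_sym_def using S0_sym[of "localized \<zeta> \<sigma>", OF sym[OF \<sigma>]] by metis
    show "is_sym (\<lambda>i j. S2 (localized \<zeta> \<sigma>) i j x)" unfolding is_sym_def using S2_sym[of "localized \<zeta> \<sigma>", OF sym[OF \<sigma>]] by metis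
    show "is_tracefree (\<lambda>i j. S1 (localized \<zeta> \<sigma>) i j x)" by (rule S1_tracefree)
  next
    fix \<sigma> i j \<phi> assume \<sigma>: "Hhat_dd \<Omega> \<sigma>" and \<phi>: "test \<phi>"
    show "localized \<zeta> \<sigma> i j \<phi> = decomp (S0 (localized \<zeta> \<sigma>)) (S1 (localized \<zeta> \<sigma>)) (S2 (localized \<zeta> \<sigma>)) i j \<phi>"
      by (rule cone_decomposition[OF sym[OF \<sigma>] P[OF \<sigma>] \<phi>])
  qed
  show "approximable \<Omega> \<zeta>" unfolding approximable_def
  proof (intro allI impI)
    fix \<sigma> and e :: real assume \<sigma>: "Hhat_dd \<Omega> \<sigma>" and e: "0 < e"
    obtain N where N: "near (localized \<zeta> \<sigma>) (\<lambda>i j. R N (localized \<zeta> \<sigma> i j)) e" using cone_near[OF P[OF \<sigma>] e] by blast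
    have "R N (localized \<zeta> \<sigma> i j) = R N (localized \<zeta> \<sigma> j i)" for i j by (rule R_cong[OF sym[OF \<sigma>]])
    then have "test_sym_on \<Omega> (\<lambda>i j. R N (localized \<zeta> \<sigma> i j))"
      unfolding test_sym_on_def using R_test_on[OF P(1,2)[OF \<sigma>]] by blast
    then show "\<exists>\<Phi>. test_sym_on \<Omega> \<Phi> \<and> near (localized \<zeta> \<sigma>) \<Phi> e" using N by blast
  qed
qed

end

section \<open>Globalization\<close>

lemma cutoff_decomposable:
  assumes "dual_frame L d" "0 < r" and \<zeta>: "test \<zeta>"
    and cone: "\<And>y t. y \<in> closure \<Omega> \<inter> tsupp \<zeta> \<Longrightarrow> (\<And>a. 0 < t a \<and> t a < r) \<Longrightarrow> y + (\<Sum>a\<in>UNIV. t a *\<^sub>R d a) \<in> \<Omega>"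
  shows "decomposable \<Omega> \<zeta>" "approximable \<Omega> \<zeta>"
proof -
  have r3: "0 < r/3" using assms(2) by simp
  from kernel_exists[OF assms(1) r3] obtain \<theta> \<eta> s where k: "0 < s" "test \<theta>" "\<forall>a. test (\<eta> a)" "(\<integral>x. \<theta> x \<partial>lborel) = 1" "tsupp \<theta> \<subseteq> parallelepiped L s (r/3)"
    "\<forall>a. tsupp (\<eta> a) \<subseteq> parallelepiped L s (r/3)" "\<forall>x. dil 1 \<theta> x - \<theta> x = (\<Sum>a\<in>UNIV. dd (d a) (dd (d a) (\<eta> a)) x)" by blast
  have "compact (closure \<Omega> \<inter> tsupp \<zeta>)"
    using compact_Int_closed[OF test_compact[OF \<zeta>] closed_closure, of \<Omega>] by (simp only: Int_commute)
  then interpret cone_kernel \<Omega> "closure \<Omega> \<inter> tsupp \<zeta>" L d r s \<theta> \<eta>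
    by unfold_locales (use assms(1) k cone in blast)+
  show "decomposable \<Omega> \<zeta>" "approximable \<Omega> \<zeta>" by (rule cone_cutoff[OF \<zeta> refl])+
qed

text \<open>The cutoff grows ball by ball as \<open>\<psi> + (1 - \<psi>) * \<zeta>\<close>, which
  is 1 wherever \<open>\<psi>\<close> or the new \<open>\<zeta>\<close> is, so no division by a sum
  of cutoffs occurs.\<close>

lemma global_cutoff:
  fixes \<Omega> :: "pt set"
  assumes \<Omega>: "open \<Omega>" "bounded \<Omega>" "lipschitz_boundary \<Omega>"
  shows "\<exists>\<psi> U. smooth_fn \<psi> \<and> decomposable \<Omega> \<psi> \<and> approximable \<Omega> \<psi> \<and> open U \<and> closure \<Omega> \<subseteq> U \<and> (\<forall>y\<in>U. \<psi> y = 1)"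
proof -
  \<comment> \<open>The multiplier \<open>\<xi>\<close> provides for the factor
    \<open>1 - \<psi>\<close> of the induction step; it does not enlarge the support of
    \<open>\<zeta>\<close>, so the same chart serves.\<close>
  define ok where "ok \<zeta> \<delta> x \<longleftrightarrow> test \<zeta> \<and> 0 < \<delta> \<and> (\<forall>y\<in>ball x \<delta>. \<zeta> y = 1) \<and>
     (\<forall>\<xi>. smooth_fn \<xi> \<longrightarrow> decomposable \<Omega> (\<lambda>x. \<xi> x * \<zeta> x) \<and> approximable \<Omega> (\<lambda>x. \<xi> x * \<zeta> x))" for \<zeta> \<delta> and x :: pt
  have "\<exists>\<zeta> \<delta>. ok \<zeta> \<delta> x" if x: "x \<in> closure \<Omega>" for x
  proof -
    from chart_exists[OF \<Omega>(1,3) x] obtain \<rho> L d r where c: "0 < \<rho>" "0 < r" "dual_frame L d"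
      "\<forall>y\<in>closure \<Omega> \<inter> ball x \<rho>. \<forall>t. (\<forall>a. 0 < t a \<and> t a < r) \<longrightarrow> y + (\<Sum>a\<in>UNIV. t a *\<^sub>R d a) \<in> \<Omega>" by blast
    from cutoff_exists[OF c(1), of x] obtain \<zeta> \<delta> where z: "test \<zeta>" "tsupp \<zeta> \<subseteq> ball x \<rho>" "0 < \<delta>" "\<forall>y\<in>ball x \<delta>. \<zeta> y = 1" by blast
    have "decomposable \<Omega> (\<lambda>x. \<xi> x * \<zeta> x) \<and> approximable \<Omega> (\<lambda>x. \<xi> x * \<zeta> x)" if \<xi>: "smooth_fn \<xi>" for \<xi>
    proof -
      have t: "test (\<lambda>x. \<xi> x * \<zeta> x)" by (rule test_mult[OF \<xi> z(1)])
      have "tsupp (\<lambda>x. \<xi> x * \<zeta> x) \<subseteq> tsupp \<zeta>"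
        by (rule tsupp_subset[OF closed_tsupp]) (use tsupp_nonzero[of \<zeta>] in auto)
      then have "y + (\<Sum>a\<in>UNIV. t a *\<^sub>R d a) \<in> \<Omega>"
        if "y \<in> closure \<Omega> \<inter> tsupp (\<lambda>x. \<xi> x * \<zeta> x)" "\<And>a. 0 < t a \<and> t a < r" for y t
        using c(4) z(2) that by blast
      then show ?thesis using cutoff_decomposable[OF c(3,2) t] by blast
    qed
    then show ?thesis unfolding ok_def using z by blast
  qed
  then have "\<forall>x\<in>closure \<Omega>. \<exists>p. ok (fst p) (snd p) x" by simp
  from bchoice[OF this] obtain p where p: "\<forall>x\<in>closure \<Omega>. ok (fst (p x)) (snd (p x)) x" ..
  define \<zeta> \<delta> where "\<zeta> x = fst (p x)" and "\<delta> x = snd (p x)" for x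
  have z: "test (\<zeta> x)" "0 < \<delta> x" "\<And>y. y \<in> ball x (\<delta> x) \<Longrightarrow> \<zeta> x y = 1"
    "\<And>\<xi>. smooth_fn \<xi> \<Longrightarrow> decomposable \<Omega> (\<lambda>y. \<xi> y * \<zeta> x y)" "\<And>\<xi>. smooth_fn \<xi> \<Longrightarrow> approximable \<Omega> (\<lambda>y. \<xi> y * \<zeta> x y)"
    if "x \<in> closure \<Omega>" for x using p that unfolding ok_def \<zeta>_def \<delta>_def by blast+
  have "compact (closure \<Omega>)" using \<Omega>(2) by (simp add: compact_closure)
  then obtain Z where Z: "Z \<subseteq> closure \<Omega>" "finite Z" "closure \<Omega> \<subseteq> (\<Union>x\<in>Z. ball x (\<delta> x))"
  proof (rule compactE_image)
    show "closure \<Omega> \<subseteq> (\<Union>x\<in>closure \<Omega>. ball x (\<delta> x))" using z(2) by force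
  qed auto
  have "\<exists>\<psi>. smooth_fn \<psi> \<and> decomposable \<Omega> \<psi> \<and> approximable \<Omega> \<psi> \<and> (\<forall>y\<in>(\<Union>x\<in>Z. ball x (\<delta> x)). \<psi> y = 1)"
    using Z(2,1)
  proof (induction Z rule: finite_induct)
    case empty
    show ?case by (intro exI[of _ "\<lambda>x. 0"]) (simp add: smooth_fn_const decomposable_zero approximable_zero)
  next
    case (insert x Z)
    then obtain \<psi> where \<psi>: "smooth_fn \<psi>" "decomposable \<Omega> \<psi>" "approximable \<Omega> \<psi>" "\<forall>y\<in>(\<Union>x\<in>Z. ball x (\<delta> x)). \<psi> y = 1" by blast
    have x: "x \<in> closure \<Omega>" using insert by blast
    let ?g = "\<lambda>y. (1 - \<psi> y) * \<zeta> x y"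
    have s1: "smooth_fn (\<lambda>y. 1 - \<psi> y)" by (rule smooth_fn_diff[OF smooth_fn_const \<psi>(1)])
    have g: "smooth_fn ?g" by (rule smooth_fn_mult[OF s1 test_smooth[OF z(1)[OF x]]])
    note zg = z(4)[OF x s1] z(5)[OF x s1]
    show ?case
    proof (rule exI[of _ "\<lambda>y. \<psi> y + ?g y"], intro conjI ballI)
      show "smooth_fn (\<lambda>y. \<psi> y + ?g y)" by (rule smooth_fn_add[OF \<psi>(1) g])
      show "decomposable \<Omega> (\<lambda>y. \<psi> y + ?g y)" by (rule decomposable_add[OF \<psi>(2,1) zg(1) g])
      show "approximable \<Omega> (\<lambda>y. \<psi> y + ?g y)" by (rule approximable_add[OF \<psi>(3,1) zg(2) g])
      fix y assume "y \<in> (\<Union>x\<in>insert x Z. ball x (\<delta> x))"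
      then consider "y \<in> ball x (\<delta> x)" | "y \<in> (\<Union>x\<in>Z. ball x (\<delta> x))" by blast
      then show "\<psi> y + (1 - \<psi> y) * \<zeta> x y = 1"
      proof cases
        case 1 then show ?thesis using z(3)[OF x 1] by simp
      next
        case 2 then have "\<psi> y = 1" using \<psi>(4) by blast
        then show ?thesis by simp
      qed
    qed
  qed
  then obtain \<psi> where "smooth_fn \<psi>" "decomposable \<Omega> \<psi>" "approximable \<Omega> \<psi>" "\<forall>y\<in>(\<Union>x\<in>Z. ball x (\<delta> x)). \<psi> y = 1" by blast
  moreover have "open (\<Union>x\<in>Z. ball x (\<delta> x))" by blast
  ultimately show ?thesis using Z(3) by blast
qed

text \<open>The function \<open>\<psi> * \<phi> - \<phi>\<close> has its closed support off
  \<open>U\<close>. A neighbourhood of \<open>closure \<Omega>\<close> is asked for because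
  \<open>supp_in\<close> tests closed supports.\<close>

lemma localized_one:
  assumes \<sigma>: "Hhat_dd \<Omega> \<sigma>" and \<psi>: "smooth_fn \<psi>" and U: "open U" "closure \<Omega> \<subseteq> U" "\<forall>y\<in>U. \<psi> y = 1" and \<phi>: "test \<phi>"
  shows "localized \<psi> \<sigma> i j \<phi> = \<sigma> i j \<phi>"
proof -
  have H: "Hm1 (\<sigma> i j)" "supp_in (\<sigma> i j) (closure \<Omega>)" using Hhat_Hm1_on(1)[OF \<sigma>] by (auto simp: Hm1_on_def)
  have t: "test (\<lambda>x. \<psi> x * \<phi> x)" by (rule test_mult[OF \<psi> \<phi>])
  have td: "test (\<lambda>x. \<psi> x * \<phi> x - \<phi> x)" by (rule test_diff[OF t \<phi>])
  have "tsupp (\<lambda>x. \<psi> x * \<phi> x - \<phi> x) \<subseteq> - U"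
    by (rule tsupp_subset) (use U(1,3) in auto)
  then have "\<sigma> i j (\<lambda>x. \<psi> x * \<phi> x - \<phi> x) = 0" using H(2) td U(2) unfolding supp_in_def by blast
  then show ?thesis using Hm1_diff[OF H(1) t \<phi>] by (simp add: localized_def)
qed

section \<open>Limits of test fields belong to the space\<close>

lemma Hm1_on_fdist_test_on: assumes "test_on \<Omega> f" shows "Hm1_on (closure \<Omega>) (n2 f) (fdist f)"
proof -
  have t: "test f" "tsupp f \<subseteq> closure \<Omega>" using assms closure_subset[of \<Omega>] by (auto simp: test_on_def)
  show ?thesis
    unfolding Hm1_on_def using Hm1_fdist[OF test_L2[OF t(1)]] hm1_le_fdist[OF test_L2[OF t(1)]] n2_nonneg supp_in_fdist[of f] t(2)
    unfolding supp_in_def by blast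
qed

lemma test_on_pd: "test_on \<Omega> f \<Longrightarrow> test_on \<Omega> (pd i f)"
  unfolding test_on_def using test_pd tsupp_pd[of i f] by blast

lemma fdist_pd: "test f \<Longrightarrow> test \<phi> \<Longrightarrow> fdist f (pd i \<phi>) = - fdist (pd i f) \<phi>"
  unfolding fdist_def by (rule integral_by_parts[OF _ test_smooth])

lemma Hm1_on_matdist:
  assumes "test_sym_on \<Omega> \<Phi>"
  shows "\<exists>c. Hm1_on (closure \<Omega>) c (matdist \<Phi> i j)" "\<exists>c. Hm1_on (closure \<Omega>) c (ddiv (matdist \<Phi>) i)" "\<exists>c. Hm1_on (closure \<Omega>) c (ddivdiv (matdist \<Phi>))"
proof -
  have t: "test_on \<Omega> (\<Phi> i j)" for i j using assms by (simp add: test_sym_on_def)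
  note tt = test_on_test[OF t]
  show "\<exists>c. Hm1_on (closure \<Omega>) c (matdist \<Phi> i j)" unfolding matdist_def using Hm1_on_fdist_test_on[OF t] by blast
  have "Hm1_on (closure \<Omega>) (\<Sum>j\<in>UNIV. n2 (pd j (\<Phi> i j))) (\<lambda>\<phi>. \<Sum>j\<in>UNIV. fdist (pd j (\<Phi> i j)) \<phi>)"
    by (rule Hm1_on_sum[OF finite Hm1_on_fdist_test_on[OF test_on_pd[OF t]]])
  moreover have "ddiv (matdist \<Phi>) i \<phi> = (\<Sum>j\<in>UNIV. fdist (pd j (\<Phi> i j)) \<phi>)" if "test \<phi>" for \<phi>
    by (simp add: ddiv_eq matdist_def fdist_pd[OF tt that] sum_negf)
  ultimately show "\<exists>c. Hm1_on (closure \<Omega>) c (ddiv (matdist \<Phi>) i)" using Hm1_on_cong by blast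
  have "Hm1_on (closure \<Omega>) (\<Sum>i\<in>UNIV. \<Sum>j\<in>UNIV. n2 (pd i (pd j (\<Phi> i j)))) (\<lambda>\<phi>. \<Sum>i\<in>UNIV. \<Sum>j\<in>UNIV. fdist (pd i (pd j (\<Phi> i j))) \<phi>)"
    by (rule Hm1_on_sum[OF finite Hm1_on_sum[OF finite Hm1_on_fdist_test_on[OF test_on_pd[OF test_on_pd[OF t]]]]])
  moreover have "ddivdiv (matdist \<Phi>) \<phi> = (\<Sum>i\<in>UNIV. \<Sum>j\<in>UNIV. fdist (pd i (pd j (\<Phi> i j))) \<phi>)" if \<phi>: "test \<phi>" for \<phi>
    by (simp add: ddivdiv_eq matdist_def fdist_pd[OF tt test_pd[OF \<phi>]] fdist_pd[OF test_pd[OF tt] \<phi>])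
  ultimately show "\<exists>c. Hm1_on (closure \<Omega>) c (ddivdiv (matdist \<Phi>))" using Hm1_on_cong by blast
qed

lemma real_zero_if_small: "(\<And>e. 0 < e \<Longrightarrow> \<bar>x\<bar> \<le> C * e) \<Longrightarrow> x = (0::real)"
  using eq_if_abs_diff_le[of x 0 C] by simp

text \<open>\<open>Htilde_dd\<close> constrains an arbitrary functional only through its distance to
  test fields, so linearity, boundedness and support all have to be recovered from the
  approximants.\<close>

lemma Htm1_limit:
  assumes "\<And>e. 0 < e \<Longrightarrow> \<exists>v c. Hm1_on (closure \<Omega>) c v \<and> hm1_le (\<lambda>\<phi>. u \<phi> - v \<phi>) e"
  shows "Htm1 \<Omega> u"
proof -
  have lin: "u (\<lambda>x. a * \<phi> x + b * \<psi> x) = a * u \<phi> + b * u \<psi>" if t: "test \<phi>" "test \<psi>" for a b \<phi> \<psi>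
  proof -
    let ?\<xi> = "\<lambda>x. a * \<phi> x + b * \<psi> x"
    have tx: "test ?\<xi>" by (rule test_add[OF test_cmult[OF t(1)] test_cmult[OF t(2)]])
    have "u ?\<xi> - (a * u \<phi> + b * u \<psi>) = 0"
    proof (rule real_zero_if_small)
      fix e :: real assume "0 < e"
      then obtain v c where v: "Hm1_on (closure \<Omega>) c v" "hm1_le (\<lambda>\<phi>. u \<phi> - v \<phi>) e" using assms by blast
      have vl: "v ?\<xi> = a * v \<phi> + b * v \<psi>" using v(1) Hm1_lin[OF _ t, of v a b] by (simp add: Hm1_on_def)
      have b: "\<bar>u ?\<xi> - v ?\<xi>\<bar> \<le> e * h1t ?\<xi>" "\<bar>u \<phi> - v \<phi>\<bar> \<le> e * h1t \<phi>" "\<bar>u \<psi> - v \<psi>\<bar> \<le> e * h1t \<psi>"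
        by (rule hm1_leD[OF v(2) tx], rule hm1_leD[OF v(2) t(1)], rule hm1_leD[OF v(2) t(2)])
      have "\<bar>u ?\<xi> - (a * u \<phi> + b * u \<psi>)\<bar> = \<bar>(u ?\<xi> - v ?\<xi>) - a * (u \<phi> - v \<phi>) - b * (u \<psi> - v \<psi>)\<bar>"
        unfolding vl by (simp add: algebra_simps)
      also have "\<dots> \<le> \<bar>u ?\<xi> - v ?\<xi>\<bar> + \<bar>a\<bar> * \<bar>u \<phi> - v \<phi>\<bar> + \<bar>b\<bar> * \<bar>u \<psi> - v \<psi>\<bar>"
        unfolding abs_mult[symmetric] by linarith
      also have "\<dots> \<le> e * h1t ?\<xi> + \<bar>a\<bar> * (e * h1t \<phi>) + \<bar>b\<bar> * (e * h1t \<psi>)"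
        by (intro add_mono mult_left_mono b) auto
      finally show "\<bar>u ?\<xi> - (a * u \<phi> + b * u \<psi>)\<bar> \<le> (h1t ?\<xi> + \<bar>a\<bar> * h1t \<phi> + \<bar>b\<bar> * h1t \<psi>) * e"
        by (simp add: algebra_simps)
    qed
    then show ?thesis by simp
  qed
  obtain v c where v: "Hm1_on (closure \<Omega>) c v" "hm1_le (\<lambda>\<phi>. u \<phi> - v \<phi>) 1" using assms[of 1] by auto
  have "hm1_le u (c + 1)"
    by (rule hm1_le_sum2[OF _ v(2)]) (use v(1) in \<open>auto simp: Hm1_on_def\<close>)
  then have "Hm1 u" unfolding Hm1_def using lin by blast
  moreover have "supp_in u (closure \<Omega>)" unfolding supp_in_def
  proof (intro allI impI)
    fix \<phi> assume \<phi>: "test \<phi>" "tsupp \<phi> \<inter> closure \<Omega> = {}"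
    show "u \<phi> = 0"
    proof (rule real_zero_if_small)
      fix e :: real assume "0 < e"
      then obtain v c where v: "Hm1_on (closure \<Omega>) c v" "hm1_le (\<lambda>\<phi>. u \<phi> - v \<phi>) e" using assms by blast
      have "v \<phi> = 0" using v(1) \<phi> by (auto simp: Hm1_on_def supp_in_def)
      then show "\<bar>u \<phi>\<bar> \<le> h1t \<phi> * e" using hm1_leD[OF v(2) \<phi>(1)] by (simp add: mult.commute)
    qed
  qed
  ultimately show ?thesis by (simp add: Htm1_def)
qed

lemma ddiv_diff: "ddiv (\<lambda>i j \<phi>. \<sigma> i j \<phi> - \<tau> i j \<phi>) i = (\<lambda>\<phi>. ddiv \<sigma> i \<phi> - ddiv \<tau> i \<phi>)"
  by (simp add: fun_eq_iff ddiv_eq sum_subtractf)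

lemma ddivdiv_diff: "ddivdiv (\<lambda>i j \<phi>. \<sigma> i j \<phi> - \<tau> i j \<phi>) = (\<lambda>\<phi>. ddivdiv \<sigma> \<phi> - ddivdiv \<tau> \<phi>)"
  by (simp add: fun_eq_iff ddivdiv_eq sum_subtractf)

lemma dd_within_near:
  assumes "dd_within (\<lambda>i j \<phi>. \<sigma> i j \<phi> - matdist \<Phi> i j \<phi>) e" "0 < e" shows "near \<sigma> \<Phi> e"
proof -
  obtain a b c where a: "\<And>i j. 0 \<le> a i j \<and> hm1_le (\<lambda>\<phi>. \<sigma> i j \<phi> - matdist \<Phi> i j \<phi>) (a i j)"
    and b: "\<And>i. 0 \<le> b i \<and> hm1_le (\<lambda>\<phi>. ddiv \<sigma> i \<phi> - ddiv (matdist \<Phi>) i \<phi>) (b i)"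
    and c: "0 \<le> c" "hm1_le (\<lambda>\<phi>. ddivdiv \<sigma> \<phi> - ddivdiv (matdist \<Phi>) \<phi>) c"
    and le: "(\<Sum>i\<in>UNIV. \<Sum>j\<in>UNIV. (a i j)\<^sup>2) + (\<Sum>i\<in>UNIV. (b i)\<^sup>2) + c\<^sup>2 \<le> e\<^sup>2"
    using assms(1) unfolding dd_within_def ddiv_diff ddivdiv_diff by blast
  have p: "0 \<le> (\<Sum>i\<in>UNIV. \<Sum>j\<in>UNIV. (a i j)\<^sup>2)" "0 \<le> (\<Sum>i\<in>UNIV. (b i)\<^sup>2)" "0 \<le> c\<^sup>2" by (simp_all add: sum_nonneg)
  have "(a i j)\<^sup>2 \<le> (\<Sum>i\<in>UNIV. \<Sum>j\<in>UNIV. (a i j)\<^sup>2)" for i j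
    by (rule order_trans[OF member_le_sum[of j UNIV] member_le_sum[of i UNIV]]) (auto intro: sum_nonneg)
  then have "(a i j)\<^sup>2 \<le> e\<^sup>2" for i j using p le by (smt (verit))
  then have "a i j \<le> e" for i j using power2_le_imp_le assms(2) by (metis less_imp_le)
  moreover have "(b i)\<^sup>2 \<le> (\<Sum>i\<in>UNIV. (b i)\<^sup>2)" for i by (rule member_le_sum) auto
  then have "(b i)\<^sup>2 \<le> e\<^sup>2" for i using p le by (smt (verit))
  then have "b i \<le> e" for i using power2_le_imp_le assms(2) by (metis less_imp_le)
  moreover have "c \<le> e" using power2_le_imp_le[of c e] p le assms(2) by linarith
  ultimately show ?thesis unfolding near_def using a b c hm1_le_mono by blast
qed

lemma near_dd_within:
  assumes "near \<sigma> \<Phi> (e/4)" "0 < e" shows "dd_within (\<lambda>i j \<phi>. \<sigma> i j \<phi> - matdist \<Phi> i j \<phi>) e"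
  unfolding dd_within_def ddiv_diff ddivdiv_diff
  \<comment> \<open>Nine entries, three divergences and one double divergence:
    \<open>13 * (e/4)^2 \<le> e^2\<close>.\<close>
  by (rule exI[of _ "\<lambda>i j. e/4"], rule exI[of _ "\<lambda>i. e/4"], rule exI[of _ "e/4"])
     (use assms in \<open>simp add: near_def power2_eq_square\<close>)

lemma Htilde_imp_Hhat:
  assumes "Htilde_dd \<Omega> \<sigma>" shows "Hhat_dd \<Omega> \<sigma>"
proof -
  have ex: "\<exists>\<Phi>. test_sym_on \<Omega> \<Phi> \<and> near \<sigma> \<Phi> e" if "0 < e" for e
    using assms dd_within_near that unfolding Htilde_dd_def by blast
  show ?thesis unfolding Hhat_dd_def
  proof (intro conjI allI impI)
    fix i j
    show "Htm1 \<Omega> (\<sigma> i j)"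
      by (rule Htm1_limit) (use ex Hm1_on_matdist(1) near_def in metis)
    show "Htm1 \<Omega> (ddiv \<sigma> i)"
      by (rule Htm1_limit) (use ex Hm1_on_matdist(2) near_def in metis)
  next
    show "Htm1 \<Omega> (ddivdiv \<sigma>)"
      by (rule Htm1_limit) (use ex Hm1_on_matdist(3) near_def in metis)
  next
    fix i j \<phi> assume \<phi>: "test \<phi>"
    have "\<sigma> i j \<phi> - \<sigma> j i \<phi> = 0"
    proof (rule real_zero_if_small)
      fix e :: real assume "0 < e"
      then obtain \<Phi> where \<Phi>: "test_sym_on \<Omega> \<Phi>" "near \<sigma> \<Phi> e" using ex by blast
      have "matdist \<Phi> i j \<phi> = matdist \<Phi> j i \<phi>" using \<Phi>(1) unfolding test_sym_on_def matdist_def by metis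
      moreover have "\<bar>\<sigma> i j \<phi> - matdist \<Phi> i j \<phi>\<bar> \<le> e * h1t \<phi>" "\<bar>\<sigma> j i \<phi> - matdist \<Phi> j i \<phi>\<bar> \<le> e * h1t \<phi>"
        using \<Phi>(2) \<phi> unfolding near_def hm1_le_def by blast+
      ultimately show "\<bar>\<sigma> i j \<phi> - \<sigma> j i \<phi>\<bar> \<le> (2 * h1t \<phi>) * e" by (simp add: mult.commute)
    qed
    then show "\<sigma> i j \<phi> = \<sigma> j i \<phi>" by simp
  qed
qed

lemma bdd_lin_opI:
  assumes S: "\<And>i j. bdd_H01_op \<Omega> (\<lambda>\<sigma>. S \<sigma> i j)" and P: "\<And>\<sigma> x. Hhat_dd \<Omega> \<sigma> \<Longrightarrow> P (\<lambda>i j. S \<sigma> i j x)"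
  shows "bdd_lin_op \<Omega> P S"
proof -
  have "\<forall>p. \<exists>C. \<forall>\<sigma>. Hhat_dd \<Omega> \<sigma> \<longrightarrow> h1norm (S \<sigma> (fst p) (snd p)) \<le> C * dd_norm \<sigma>"
    using S unfolding bdd_H01_op_def by blast
  from choice[OF this] obtain C where C: "\<And>i j \<sigma>. Hhat_dd \<Omega> \<sigma> \<Longrightarrow> h1norm (S \<sigma> i j) \<le> C (i, j) * dd_norm \<sigma>" by force
  have "h1norm (S \<sigma> i j) \<le> (\<Sum>p\<in>UNIV. \<bar>C p\<bar>) * dd_norm \<sigma>" if "Hhat_dd \<Omega> \<sigma>" for \<sigma> i j
  proof -
    have "\<bar>C (i, j)\<bar> \<le> (\<Sum>p\<in>UNIV. \<bar>C p\<bar>)" by (rule member_le_sum) auto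
    then have "C (i, j) \<le> (\<Sum>p\<in>UNIV. \<bar>C p\<bar>)" by linarith
    then show ?thesis using C[OF that, of i j] mult_right_mono[OF _ dd_norm_nonneg[of \<sigma>]] order_trans by blast
  qed
  moreover have "H01 \<Omega> (S \<sigma> i j)" if "Hhat_dd \<Omega> \<sigma>" for \<sigma> i j using S[of i j] that unfolding bdd_H01_op_def by blast
  moreover have "AE x in lborel. S (mlin a \<sigma> b \<tau>) i j x = a * S \<sigma> i j x + b * S \<tau> i j x"
    if "Hhat_dd \<Omega> \<sigma>" "Hhat_dd \<Omega> \<tau>" for \<sigma> \<tau> a b i j using S[of i j] that unfolding bdd_H01_op_def by blast
  moreover have "AE x in lborel. P (\<lambda>i j. S \<sigma> i j x)" if "Hhat_dd \<Omega> \<sigma>" for \<sigma> using P[OF that] by simp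
  ultimately show ?thesis unfolding bdd_lin_op_def by blast
qed

theorem mainTheorem13:
  fixes \<Omega> :: "(real^3) set"
  assumes "open \<Omega>" and "bounded \<Omega>" and "connected \<Omega>" and "simply_connected \<Omega>"
    and "lipschitz_boundary \<Omega>" and "connected (frontier \<Omega>)"
  shows "(\<exists>S0 S1 S2.
            bdd_lin_op \<Omega> is_sym S0 \<and> bdd_lin_op \<Omega> is_tracefree S1 \<and> bdd_lin_op \<Omega> is_sym S2 \<and>
            (\<forall>\<sigma>. Hhat_dd \<Omega> \<sigma> \<longrightarrow> (\<forall>i j \<phi>. test \<phi> \<longrightarrow>
               \<sigma> i j \<phi> = matdist (S0 \<sigma>) i j \<phi> + dsym (dcurl (matdist (S1 \<sigma>))) i j \<phi>
                          + dinc (matdist (S2 \<sigma>)) i j \<phi>)))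
         \<and> (\<forall>\<sigma>. Hhat_dd \<Omega> \<sigma> \<longleftrightarrow> Htilde_dd \<Omega> \<sigma>)"
proof -
  obtain \<psi> U where \<psi>: "smooth_fn \<psi>" "decomposable \<Omega> \<psi>" "approximable \<Omega> \<psi>" and U: "open U" "closure \<Omega> \<subseteq> U" "\<forall>y\<in>U. \<psi> y = 1"
    using global_cutoff[OF assms(1,2,5)] by blast
  \<comment> \<open>On test functions the localization by \<open>\<psi>\<close> is the identity,
    which turns the statements about \<open>localized \<psi> \<sigma>\<close> into statements about
    \<open>\<sigma>\<close>.\<close>
  note one = localized_one[OF _ \<psi>(1) U]
  obtain S0 S1 S2 where S: "\<And>i j. bdd_H01_op \<Omega> (\<lambda>\<sigma>. S0 \<sigma> i j)" "\<And>i j. bdd_H01_op \<Omega> (\<lambda>\<sigma>. S1 \<sigma> i j)" "\<And>i j. bdd_H01_op \<Omega> (\<lambda>\<sigma>. S2 \<sigma> i j)"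
     "\<And>\<sigma> x. Hhat_dd \<Omega> \<sigma> \<Longrightarrow> is_sym (\<lambda>i j. S0 \<sigma> i j x) \<and> is_tracefree (\<lambda>i j. S1 \<sigma> i j x) \<and> is_sym (\<lambda>i j. S2 \<sigma> i j x)"
     "\<And>\<sigma> i j \<phi>. Hhat_dd \<Omega> \<sigma> \<Longrightarrow> test \<phi> \<Longrightarrow> localized \<psi> \<sigma> i j \<phi> = decomp (S0 \<sigma>) (S1 \<sigma>) (S2 \<sigma>) i j \<phi>"
    using \<psi>(2) unfolding decomposable_def by blast
  have "bdd_lin_op \<Omega> is_sym S0" by (rule bdd_lin_opI[OF S(1)]) (use S(4) in blast)
  moreover have "bdd_lin_op \<Omega> is_tracefree S1" by (rule bdd_lin_opI[OF S(2)]) (use S(4) in blast)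
  moreover have "bdd_lin_op \<Omega> is_sym S2" by (rule bdd_lin_opI[OF S(3)]) (use S(4) in blast)
  moreover have "\<sigma> i j \<phi> = matdist (S0 \<sigma>) i j \<phi> + dsym (dcurl (matdist (S1 \<sigma>))) i j \<phi> + dinc (matdist (S2 \<sigma>)) i j \<phi>"
    if "Hhat_dd \<Omega> \<sigma>" "test \<phi>" for \<sigma> i j \<phi>
    using S(5)[OF that] one[OF that] unfolding decomp_def by simp
  moreover have "Htilde_dd \<Omega> \<sigma>" if \<sigma>: "Hhat_dd \<Omega> \<sigma>" for \<sigma>
    unfolding Htilde_dd_def
  proof (intro allI impI)
    fix e :: real assume e: "0 < e"
    then have "0 < e/4" by simp
    then obtain \<Phi> where \<Phi>: "test_sym_on \<Omega> \<Phi>" "near (localized \<psi> \<sigma>) \<Phi> (e/4)" using \<psi>(3) \<sigma> unfolding approximable_def by blast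
    have "near \<sigma> \<Phi> (e/4)"
      using \<Phi>(2) unfolding near_def hm1_le_def ddiv_eq ddivdiv_eq by (simp add: one[OF \<sigma>] test_pd)
    then show "\<exists>\<Phi>. test_sym_on \<Omega> \<Phi> \<and> dd_within (\<lambda>i j \<phi>. \<sigma> i j \<phi> - matdist \<Phi> i j \<phi>) e"
      using \<Phi>(1) near_dd_within[OF _ e] by blast
  qed
  ultimately show ?thesis using Htilde_imp_Hhat by blast
qed

end
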